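(* Suppose $\theta_0=(\alpha_0,\beta_0,d_0)\in I$ for some compact interval $I\subset\mathbb R^3$. Assume that the density $f_X$ of $X$ is continuous and strictly positive at $d_0$. Let $$\hat\theta^{\ell_2}=(\hat\alpha^{\ell_2},\hat\beta^{\ell_2},\hat d^{\ell_2})=\arg\min_{(\alpha,\beta,d)\in I}\frac1n\sum_{i=1}^n\big(Y_i-\alpha\mathbf 1_{X_i\le d}-\beta\mathbf 1_{X_i>d}\big)^2$$ (mid-argmin in the $d$-coordinate). Then, as $n\to\infty$, in distribution, $$\sqrt n(\hat\alpha^{\ell_2}-\alpha_0)\Rightarrow\mathcal N\Big(0,\frac{\sigma_\xi^2}{F_X(d_0)}\Big),\qquad \sqrt n(\hat\beta^{\ell_2}-\beta_0)\Rightarrow\mathcal N\Big(0,\frac{\sigma_\xi^2}{\bar F_X(d_0)}\Big),$$ $$n(\hat d^{\ell_2}-d_0)\Rightarrow\operatorname{mid\,argmin}_{t\in\mathbb R}\ \mathrm{CPP}\Big(\xi+\frac{|\alpha_0-\beta_0|}{2},\ f_X(d_0)\Big)(t),$$ and the estimates of the parameters are asymptotically independent.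
   Context: Model: $(X_i,\xi_i)_{i\ge1}$ are i.i.d. copies of $(X,\xi)$, with $X$ real-valued having distribution function $F_X$ and density $f_X$, $\bar F_X=1-F_X$, and $\xi$ independent of $X$, symmetric about $0$, with finite variance $\sigma_\xi^2=\mathbb E[\xi^2]<\infty$. One observes $(X_i,Y_i)_{1\le i\le n}$ with $Y_i=\alpha_0\mathbf 1_{X_i\le d_0}+\beta_0\mathbf 1_{X_i>d_0}+\xi_i$, where $\alpha_0\ne\beta_0$. Mid argmin: the criterion is piecewise constant in $d$ (and the limit process is piecewise constant in $t$), so its minimizer in that coordinate is an interval; $\operatorname{mid\,argmin}$ denotes the midpoint of the minimizing interval. Two-sided compound Poisson process: for a real random variable $Z$ and $\lambda>0$, $\mathrm{CPP}(Z,\lambda)$ is the process on $\mathbb R$ equal to $\sum_{i=1}^{N_1(t)}Z_i$ for $t\ge0$ and $\sum_{i=1}^{N_2(-t)}Z_i'$ for $t<0$, where $N_1,N_2$ are independent homogeneous Poisson processes on $[0,\infty)$ with intensity $\lambda$, and $Z_i,Z_i'$ are i.i.d. copies of $Z$ independent of $N_1,N_2$.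
   Formalization: θ₀ is taken in the interior of I, since on the boundary the limits are one-sided; the limit of d̂ and the asymptotic independence assume that the CPP almost surely has a single minimizing interval between consecutive jump times, since ties make them false. *)

theory Defs
  imports "HOL-Probability.Probability"
begin

section \<open>Minimizers and mid-argmin\<close>

definition argmin_set :: "('t \<Rightarrow> real) \<Rightarrow> 't set \<Rightarrow> 't set" where
  "argmin_set g S = {t. is_arg_min g (\<lambda>s. s \<in> S) t}"

text \<open>
  When the set is a bounded interval, with or without its endpoints, this is its midpoint.
\<close>

definition interval_midpoint :: "real set \<Rightarrow> real" where
  "interval_midpoint A = midpoint (Inf A) (Sup A)"

definition mid_argmin :: "(real \<Rightarrow> real) \<Rightarrow> real" where
  "mid_argmin g = interval_midpoint (argmin_set g UNIV)"


section \<open>The change-point model and the least squares criterion\<close>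

definition change_point_fun :: "real \<times> real \<times> real \<Rightarrow> real \<Rightarrow> real" where
  "change_point_fun = (\<lambda>(\<alpha>, \<beta>, d) x. \<alpha> * of_bool (x \<le> d) + \<beta> * of_bool (x > d))"

text \<open>
  The pair \<open>(X, \<xi>)\<close> is the generic pair and \<open>(Xs i, \<xi>s i)\<close> is the sequence of its
  i.i.d. copies, numbered from \<open>0\<close>; a sample of size \<open>n\<close> consists of the indices \<open>i < n\<close>.
\<close>

locale change_point_model = prob_space M
  for M :: "'a measure" +
  fixes X \<xi> :: "'a \<Rightarrow> real"
    and Xs \<xi>s Ys :: "nat \<Rightarrow> 'a \<Rightarrow> real"
    and f_X :: "real \<Rightarrow> real"
    and \<alpha>\<^sub>0 \<beta>\<^sub>0 d\<^sub>0 :: real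
  assumes X_\<xi>_indep: "indep_var borel X borel \<xi>"
    and X_density: "distributed M lborel X (\<lambda>x. ennreal (f_X x))"
    and f_X_nonneg: "\<And>x. 0 \<le> f_X x"
    and \<xi>_symmetric: "distr M borel (\<lambda>\<omega>. - \<xi> \<omega>) = distr M borel \<xi>"
    and \<xi>_square_integrable: "integrable M (\<lambda>\<omega>. (\<xi> \<omega>)\<^sup>2)"
    and sample_indep:
      "indep_vars (\<lambda>_. borel \<Otimes>\<^sub>M borel) (\<lambda>i \<omega>. (Xs i \<omega>, \<xi>s i \<omega>)) UNIV"
    and sample_copies:
      "\<And>i. distr M (borel \<Otimes>\<^sub>M borel) (\<lambda>\<omega>. (Xs i \<omega>, \<xi>s i \<omega>)) =
           distr M (borel \<Otimes>\<^sub>M borel) (\<lambda>\<omega>. (X \<omega>, \<xi> \<omega>))"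
    and response:
      "\<And>i \<omega>. \<omega> \<in> space M \<Longrightarrow> Ys i \<omega> = change_point_fun (\<alpha>\<^sub>0, \<beta>\<^sub>0, d\<^sub>0) (Xs i \<omega>) + \<xi>s i \<omega>"
    and \<alpha>\<^sub>0_neq_\<beta>\<^sub>0: "\<alpha>\<^sub>0 \<noteq> \<beta>\<^sub>0"

definition ls_criterion ::
    "nat \<Rightarrow> (nat \<Rightarrow> real) \<Rightarrow> (nat \<Rightarrow> real) \<Rightarrow> real \<times> real \<times> real \<Rightarrow> real" where
  "ls_criterion n x y \<theta> = 1 / real n * (\<Sum>i<n. (y i - change_point_fun \<theta> (x i))\<^sup>2)"

text \<open>
  Minimizers of \<open>L\<close> over \<open>I\<close> with the mid-argmin convention in the last coordinate: the first two
  coordinates are those of some global minimizer, and the last one is the midpoint of the set of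
  all \<open>d'\<close> completing them to a global minimizer.
\<close>

definition argmin_mid_last ::
    "(real \<times> real \<times> real \<Rightarrow> real) \<Rightarrow> (real \<times> real \<times> real) set \<Rightarrow> (real \<times> real \<times> real) set" where
  "argmin_mid_last L I =
     {(\<alpha>, \<beta>, d). (\<exists>d'. (\<alpha>, \<beta>, d') \<in> argmin_set L I) \<and>
                 d = interval_midpoint {d'. (\<alpha>, \<beta>, d') \<in> argmin_set L I}}"


section \<open>Two-sided compound Poisson processes\<close>

locale poisson_process = prob_space M
  for M :: "'b measure" +
  fixes N :: "real \<Rightarrow> 'b \<Rightarrow> nat" and rate :: real
  assumes rate_pos: "0 < rate"
    and N_measurable: "\<And>t. 0 \<le> t \<Longrightarrow> N t \<in> measurable M (count_space UNIV)"
    and N_0: "\<And>\<omega>. \<omega> \<in> space M \<Longrightarrow> N 0 \<omega> = 0"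
    and N_mono: "\<And>\<omega>. \<omega> \<in> space M \<Longrightarrow> mono_on {0..} (\<lambda>t. N t \<omega>)"
    and N_right_cont:
      "\<And>\<omega> t. \<omega> \<in> space M \<Longrightarrow> 0 \<le> t \<Longrightarrow> continuous (at_right t) (\<lambda>s. N s \<omega>)"
    and N_increments_poisson:
      "\<And>s t. 0 \<le> s \<Longrightarrow> s < t \<Longrightarrow>
         distr M (count_space UNIV) (\<lambda>\<omega>. N t \<omega> - N s \<omega>) = measure_pmf (poisson_pmf (rate * (t - s)))"
    and N_increments_indep:
      "\<And>\<tau> :: nat \<Rightarrow> real. 0 \<le> \<tau> 0 \<Longrightarrow> mono \<tau> \<Longrightarrow>
         indep_vars (\<lambda>_. count_space UNIV) (\<lambda>i \<omega>. N (\<tau> (Suc i)) \<omega> - N (\<tau> i) \<omega>) UNIV"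

text \<open>
  The ingredients of \<open>CPP(Z, rate)\<close>, where \<open>\<mu>\<close> is the law of \<open>Z\<close>. The jump sequences \<open>Z1\<close>, \<open>Z2\<close>
  are numbered from \<open>0\<close>. The last assumption says that the \<open>\<sigma>\<close>-algebra generated by all jumps is
  independent of the one generated by the two Poisson processes.
\<close>

locale two_sided_cpp =
  right: poisson_process M N1 rate + left: poisson_process M N2 rate
  for M :: "'b measure" and N1 N2 :: "real \<Rightarrow> 'b \<Rightarrow> nat" and rate :: real +
  fixes Z1 Z2 :: "nat \<Rightarrow> 'b \<Rightarrow> real" and \<mu> :: "real measure"
  assumes N1_N2_indep:
      "right.indep_var (\<Pi>\<^sub>M t\<in>{0..}. count_space UNIV) (\<lambda>\<omega>. \<lambda>t\<in>{0..}. N1 t \<omega>)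
                 (\<Pi>\<^sub>M t\<in>{0..}. count_space UNIV) (\<lambda>\<omega>. \<lambda>t\<in>{0..}. N2 t \<omega>)"
    and jumps_indep: "right.indep_vars (\<lambda>_. borel) (case_sum Z1 Z2) UNIV"
    and Z1_law: "\<And>i. distr M borel (Z1 i) = \<mu>"
    and Z2_law: "\<And>i. distr M borel (Z2 i) = \<mu>"
    and jumps_N_indep:
      "right.indep_set
         (sets (vimage_algebra (space M) (\<lambda>\<omega> k. case_sum Z1 Z2 k \<omega>) (\<Pi>\<^sub>M k\<in>UNIV. borel)))
         (sets (vimage_algebra (space M) (\<lambda>\<omega>. (\<lambda>t\<in>{0..}. N1 t \<omega>, \<lambda>t\<in>{0..}. N2 t \<omega>))
            ((\<Pi>\<^sub>M t\<in>{0..}. count_space UNIV) \<Otimes>\<^sub>M (\<Pi>\<^sub>M t\<in>{0..}. count_space UNIV))))"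

definition cpp_path ::
    "(real \<Rightarrow> 'b \<Rightarrow> nat) \<Rightarrow> (real \<Rightarrow> 'b \<Rightarrow> nat) \<Rightarrow> (nat \<Rightarrow> 'b \<Rightarrow> real) \<Rightarrow> (nat \<Rightarrow> 'b \<Rightarrow> real) \<Rightarrow>
     'b \<Rightarrow> real \<Rightarrow> real" where
  "cpp_path N1 N2 Z1 Z2 \<omega> t =
     (if 0 \<le> t then (\<Sum>i<N1 t \<omega>. Z1 i \<omega>) else (\<Sum>i<N2 (- t) \<omega>. Z2 i \<omega>))"

text \<open>
  The sets on which \<open>cpp_piece N1 N2 \<omega>\<close> is constant are exactly the intervals between consecutive
  jump epochs of the two-sided Poisson process, the one around \<open>0\<close> having number \<open>0\<close>.
\<close>

definition cpp_piece ::
    "(real \<Rightarrow> 'b \<Rightarrow> nat) \<Rightarrow> (real \<Rightarrow> 'b \<Rightarrow> nat) \<Rightarrow> 'b \<Rightarrow> real \<Rightarrow> int" where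
  "cpp_piece N1 N2 \<omega> t = (if 0 \<le> t then int (N1 t \<omega>) else - int (N2 (- t) \<omega>))"

text \<open>
  Almost surely all minimizers of the process lie between the same two consecutive epochs, so that
  there is only one minimizing interval. This is automatic if the law of the jumps has no atoms.
  It may fail for laws with atoms: for \<open>\<xi> = \<plusminus>\<bar>\<alpha>\<^sub>0 - \<beta>\<^sub>0\<bar>\<close> with probability \<open>1/2\<close> each, different
  partial sums of \<open>\<xi> + \<bar>\<alpha>\<^sub>0 - \<beta>\<^sub>0\<bar> / 2\<close> are tied with positive probability.
\<close>

definition unique_minimizing_interval ::
    "'b measure \<Rightarrow> (real \<Rightarrow> 'b \<Rightarrow> nat) \<Rightarrow> (real \<Rightarrow> 'b \<Rightarrow> nat) \<Rightarrow>
     (nat \<Rightarrow> 'b \<Rightarrow> real) \<Rightarrow> (nat \<Rightarrow> 'b \<Rightarrow> real) \<Rightarrow> bool" where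
  "unique_minimizing_interval M N1 N2 Z1 Z2 \<longleftrightarrow>
     (AE \<omega> in M. \<forall>s \<in> argmin_set (cpp_path N1 N2 Z1 Z2 \<omega>) UNIV.
                 \<forall>t \<in> argmin_set (cpp_path N1 N2 Z1 Z2 \<omega>) UNIV.
                   cpp_piece N1 N2 \<omega> s = cpp_piece N1 N2 \<omega> t)"


section \<open>Limit laws\<close>

text \<open>
  Indexed by the variance \<open>v \<ge> 0\<close>; the case \<open>v = 0\<close> is the point mass, which
  \<open>normal_density\<close> does not cover.
\<close>

definition normal_law :: "real \<Rightarrow> real \<Rightarrow> real measure" where
  "normal_law m v =
     (if v = 0 then return borel m
      else density lborel (\<lambda>x. ennreal (normal_density m (sqrt v) x)))"

text \<open>
  The library has \<open>weak_conv_m\<close> for measures on the real line only; this version serves for random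
  vectors.
\<close>

definition weak_conv_borel ::
    "(nat \<Rightarrow> 'c::topological_space measure) \<Rightarrow> 'c measure \<Rightarrow> bool" where
  "weak_conv_borel \<mu>s \<mu> \<longleftrightarrow>
     (\<forall>f :: 'c \<Rightarrow> real. continuous_on UNIV f \<longrightarrow> bounded (range f) \<longrightarrow>
        (\<lambda>n. integral\<^sup>L (\<mu>s n) f) \<longlonglongrightarrow> integral\<^sup>L \<mu> f)"

end

theory Submission imports Defs begin

text \<open>
  The estimators of the coefficients are consistent and the estimator of the change point has rate \<open>1 / n\<close>, because
  the noise sums over all half-lines are \<open>O(sqrt n)\<close> (a chain of index sets, so Kolmogorov's inequality applies) and the
  drift of the criterion is linear in the number of misclassified design points. Hence
  \<open>sqrt n (\<alpha>_hat - \<alpha>)\<close> and \<open>sqrt n (\<beta>_hat - \<beta>)\<close> are, up to a negligible error, sums of the noise over the design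
  points outside a window of width \<open>O(1 / n)\<close> around the change point, while the change point estimator depends only on
  the finitely many observations inside that window.

  Cut the window into small cells. For a given set of occupied cells (with one observation each), the joint law of the
  jumps in the cells and of the sum outside the window factors exactly over the i.i.d. sample, up to the choice of the
  indices that fall into the window; passing to the limit gives a Gaussian characteristic function times the probability
  of the same event for the compound Poisson process on the grid. If the minimizing interval is unique, the minimum over
  the grid is strict with large probability and stable under the small perturbation caused by the estimated coefficients,
  and the midpoint of the minimizing interval is known up to the mesh. So the joint characteristic function converges to
  a product, and a weak convergence criterion for product laws finishes the proof.
\<close>

section \<open>Maximal inequalities along chains of index sets\<close>

text \<open>No functional limit theorem and no continuity of an argmin functional is invoked.
  Characteristic functions are compared directly, each replaced by a finite sum over grid patterns
  with the exponential of the outer sum as a weight. Asymptotic independence comes from a single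
  number: each of the n - k observations outside the window contributes the same factor E[1(X
  outside the window) exp(i \<xi> w(X) / sqrt n)], and its power tends to a Gaussian factor times
  the Poisson void probability of the window, whatever happens inside. The obstacle is that the
  place of the minimum does not depend continuously on the path. The gap \<open>\<eta>\<close> in
  \<open>strict_grid_min\<close> deals with this: it absorbs the error of the coefficients, and it
  exists because the other grid points lie strictly higher. Hence the order of choices: width of the
  window, mesh, gap, sample size. Sets of minimizers are handled through inner probability, while
  the patterns are genuine events. The limit of the coefficients alone uses the empty grid, so ties
  among minimizers do not affect it.\<close>

lemma (in prob_space) indep_vars_sum_zero_mult:
 fixes Y :: "'i \<Rightarrow> 'a \<Rightarrow> real"
 assumes ind: "indep_vars (\<lambda>_. borel) Y J" and fin: "finite J"
  and mean: "\<And>i. i \<in> J \<Longrightarrow> expectation (Y i) = 0"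
  and int: "\<And>i. i \<in> J \<Longrightarrow> integrable M (Y i)"
  and S: "S \<subseteq> J" and h: "h \<in> borel_measurable (PiM S (\<lambda>_. borel))"
  and inth: "integrable M (\<lambda>w. h (\<lambda>i\<in>S. Y i w))"
 shows "integrable M (\<lambda>w. h (\<lambda>i\<in>S. Y i w) * (\<Sum>i\<in>J-S. Y i w))"
  and "expectation (\<lambda>w. h (\<lambda>i\<in>S. Y i w) * (\<Sum>i\<in>J-S. Y i w)) = (0::real)"
proof -
 have iv: "indep_var borel (\<lambda>w. h (\<lambda>i\<in>S. Y i w)) borel (Y i)" if "i \<in> J - S" for i
 proof -
  have "indep_var (PiM S (\<lambda>_. borel)) (\<lambda>w. \<lambda>i\<in>S. Y i w) (PiM {i} (\<lambda>_. borel)) (\<lambda>w. \<lambda>i\<in>{i}. Y i w)"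
   using that S by (intro indep_var_restrict[OF ind]) auto
  from indep_var_compose[OF this h measurable_component_singleton[of i "{i}"]]
  show ?thesis by (simp add: comp_def)
 qed
 have eq: "h (\<lambda>i\<in>S. Y i w) * (\<Sum>i\<in>J-S. Y i w) = (\<Sum>i\<in>J-S. h (\<lambda>i\<in>S. Y i w) * Y i w)" for w
  by (simp add: sum_distrib_left)
 have I: "integrable M (\<lambda>w. h (\<lambda>i\<in>S. Y i w) * Y i w)" if "i \<in> J - S" for i
  using indep_var_integrable[OF iv[OF that] inth] int that by auto
 have E: "expectation (\<lambda>w. h (\<lambda>i\<in>S. Y i w) * Y i w) = 0" if "i \<in> J - S" for i
  using indep_var_lebesgue_integral[OF iv[OF that] inth] int mean that by auto
 show "integrable M (\<lambda>w. h (\<lambda>i\<in>S. Y i w) * (\<Sum>i\<in>J-S. Y i w))"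
  unfolding eq using I by auto
 show "expectation (\<lambda>w. h (\<lambda>i\<in>S. Y i w) * (\<Sum>i\<in>J-S. Y i w)) = 0"
  unfolding eq by (subst Bochner_Integration.integral_sum) (use I E in auto)
qed

lemma (in prob_space) expectation_sum_square:
 fixes Y :: "'i \<Rightarrow> 'a \<Rightarrow> real"
 assumes ind: "indep_vars (\<lambda>_. borel) Y J" and fin: "finite J"
  and mean: "\<And>i. i \<in> J \<Longrightarrow> expectation (Y i) = 0"
  and sq: "\<And>i. i \<in> J \<Longrightarrow> integrable M (\<lambda>w. (Y i w)\<^sup>2)"
 shows "integrable M (\<lambda>w. (\<Sum>i\<in>J. Y i w)\<^sup>2) \<and>
  expectation (\<lambda>w. (\<Sum>i\<in>J. Y i w)\<^sup>2) = (\<Sum>i\<in>J. expectation (\<lambda>w. (Y i w)\<^sup>2))"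
 using fin ind mean sq
proof (induction J)
 case (insert j J)
 have rv: "\<And>i. i \<in> insert j J \<Longrightarrow> random_variable borel (Y i)"
  using insert.prems(1) by (auto simp: indep_vars_def)
 have intY: "integrable M (Y i)" if "i \<in> insert j J" for i
  by (rule square_integrable_imp_integrable[OF rv[OF that] insert.prems(3)[OF that]])
 have indJ: "indep_vars (\<lambda>_. borel) Y J" using insert.prems(1) by (rule indep_vars_subset) auto
 have IH: "integrable M (\<lambda>w. (\<Sum>i\<in>J. Y i w)\<^sup>2)"
  "expectation (\<lambda>w. (\<Sum>i\<in>J. Y i w)\<^sup>2) = (\<Sum>i\<in>J. expectation (\<lambda>w. (Y i w)\<^sup>2))"
  using insert.IH[OF indJ] insert.prems by auto
 have diff: "insert j J - {j} = J" using insert.hyps by auto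
 have c: "integrable M (\<lambda>w. Y j w * (\<Sum>i\<in>J. Y i w))"
  "expectation (\<lambda>w. Y j w * (\<Sum>i\<in>J. Y i w)) = 0"
  using indep_vars_sum_zero_mult[OF insert.prems(1), of "{j}" "\<lambda>f. f j"] insert.prems(2) intY insert.hyps
  by (auto simp: diff)
 have eq: "(\<Sum>i\<in>insert j J. Y i w)\<^sup>2 = (Y j w)\<^sup>2 + 2 * (Y j w * (\<Sum>i\<in>J. Y i w)) + (\<Sum>i\<in>J. Y i w)\<^sup>2" for w
  using insert.hyps by (simp add: power2_eq_square algebra_simps)
 show ?case unfolding eq using c IH insert.prems(3)[of j] insert.hyps by simp
qed simp

text \<open>Kolmogorov's argument: stop at the first member of the chain at which the level is exceeded.\<close>

lemma (in prob_space) kolmogorov_chain: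
 fixes Y :: "'i \<Rightarrow> 'a \<Rightarrow> real"
 assumes ind: "indep_vars (\<lambda>_. borel) Y J" and fin: "finite J"
  and mean: "\<And>i. i \<in> J \<Longrightarrow> expectation (Y i) = 0"
  and sq: "\<And>i. i \<in> J \<Longrightarrow> integrable M (\<lambda>w. (Y i w)\<^sup>2)"
  and var: "\<And>i. i \<in> J \<Longrightarrow> expectation (\<lambda>w. (Y i w)\<^sup>2) \<le> s2"
  and C: "C \<subseteq> Pow J" "\<And>S T. S \<in> C \<Longrightarrow> T \<in> C \<Longrightarrow> S \<subseteq> T \<or> T \<subseteq> S"
  and l: "0 < l"
 shows "prob {w\<in>space M. \<exists>S\<in>C. l \<le> \<bar>\<Sum>i\<in>S. Y i w\<bar>} \<le> real (card J) * s2 / l\<^sup>2"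
proof -
 have rv[measurable]: "\<And>i. i \<in> J \<Longrightarrow> random_variable borel (Y i)"
  using ind by (auto simp: indep_vars_def)
 have intY: "integrable M (Y i)" if "i \<in> J" for i
  by (rule square_integrable_imp_integrable[OF rv[OF that] sq[OF that]])
 have finC: "finite C" using C(1) fin by (simp add: finite_subset)
 define A where "A S = {w\<in>space M. l \<le> \<bar>\<Sum>i\<in>S. Y i w\<bar> \<and> (\<forall>T\<in>{T\<in>C. T \<subset> S}. \<not> l \<le> \<bar>\<Sum>i\<in>T. Y i w\<bar>)}" for S
 have meas_sum: "(\<lambda>w. \<Sum>i\<in>S. Y i w) \<in> borel_measurable M" if "S \<in> C" for S
  using that C(1) by (intro borel_measurable_sum rv) auto
 have A_ev[measurable]: "A S \<in> events" if "S \<in> C" for S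
 proof -
  note [measurable] = meas_sum[OF that]
  have [measurable]: "Measurable.pred M (\<lambda>w. \<forall>T\<in>{T\<in>C. T \<subset> S}. \<not> l \<le> \<bar>\<Sum>i\<in>T. Y i w\<bar>)"
  proof (rule pred_intros_finite(3))
   show "finite {T\<in>C. T \<subset> S}" using finC by simp
   fix T assume "T \<in> {T\<in>C. T \<subset> S}"
   then have [measurable]: "(\<lambda>w. \<Sum>i\<in>T. Y i w) \<in> borel_measurable M" using meas_sum by auto
   show "Measurable.pred M (\<lambda>w. \<not> l \<le> \<bar>\<Sum>i\<in>T. Y i w\<bar>)" by measurable
  qed
  show ?thesis unfolding A_def by measurable
 qed
 have UN: "{w\<in>space M. \<exists>S\<in>C. l \<le> \<bar>\<Sum>i\<in>S. Y i w\<bar>} = (\<Union>S\<in>C. A S)"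
 proof -
  have "\<exists>S\<in>C. w \<in> A S" if w: "w \<in> space M" and ex: "\<exists>S\<in>C. l \<le> \<bar>\<Sum>i\<in>S. Y i w\<bar>" for w
  proof -
   define B where "B = {S\<in>C. l \<le> \<bar>\<Sum>i\<in>S. Y i w\<bar>}"
   have "finite B" "B \<noteq> {}" using finC ex by (auto simp: B_def)
   then obtain S where S: "S \<in> B" "\<forall>T\<in>B. T \<subseteq> S \<longrightarrow> S = T"
    using finite_has_minimal[of B] by auto
   then have "w \<in> A S" using w unfolding A_def B_def by auto
   then show ?thesis using S(1) by (auto simp: B_def)
  qed
  then show ?thesis by (auto simp: A_def)
 qed
 have disj: "disjoint_family_on A C"
 proof (unfold disjoint_family_on_def, intro ballI impI)
  fix S T assume "S \<in> C" "T \<in> C" "S \<noteq> T"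
  then have "S \<subset> T \<or> T \<subset> S" using C(2) by blast
  then show "A S \<inter> A T = {}" using \<open>S \<in> C\<close> \<open>T \<in> C\<close> by (auto simp: A_def)
 qed
 define Z where "Z w = (\<Sum>i\<in>J. Y i w)" for w
 have Z2: "integrable M (\<lambda>w. (Z w)\<^sup>2)" "expectation (\<lambda>w. (Z w)\<^sup>2) \<le> card J * s2"
 proof -
  note * = expectation_sum_square[OF ind fin mean sq]
  show "integrable M (\<lambda>w. (Z w)\<^sup>2)" using * by (simp add: Z_def)
  have "expectation (\<lambda>w. (Z w)\<^sup>2) = (\<Sum>i\<in>J. expectation (\<lambda>w. (Y i w)\<^sup>2))" using * by (simp add: Z_def)
  also have "\<dots> \<le> card J * s2" using var by (intro sum_bounded_above) auto
  finally show "expectation (\<lambda>w. (Z w)\<^sup>2) \<le> card J * s2" .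
 qed
 have key: "l\<^sup>2 * prob (A S) \<le> expectation (\<lambda>w. indicator (A S) w * (Z w)\<^sup>2)" if S: "S \<in> C" for S
 proof -
  have SJ: "S \<subseteq> J" using S C(1) by auto
  have finS: "finite S" using SJ fin by (rule finite_subset)
  \<comment> \<open>Every set compared in \<open>A S\<close> lies inside \<open>S\<close>, so
    \<open>h\<close> depends only on the coordinates in \<open>S\<close>. This plays the role of a
    stopping time being adapted.\<close>
  define h where "h f = (if l \<le> \<bar>\<Sum>i\<in>S. f i\<bar> \<and> (\<forall>T\<in>{T\<in>C. T \<subset> S}. \<not> l \<le> \<bar>\<Sum>i\<in>T. f i\<bar>) then (\<Sum>i\<in>S. f i) else (0::real))" for f :: "'i \<Rightarrow> real"
  have hm: "h \<in> borel_measurable (PiM S (\<lambda>_. borel))"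
  proof -
   have [measurable]: "(\<lambda>f. \<Sum>i\<in>T. f i) \<in> borel_measurable (PiM S (\<lambda>_. borel::real measure))" if "T \<subseteq> S" for T
    using that by (intro borel_measurable_sum measurable_component_singleton) auto
   have [measurable]: "Measurable.pred (PiM S (\<lambda>_. borel::real measure)) (\<lambda>f. \<forall>T\<in>{T\<in>C. T \<subset> S}. \<not> l \<le> \<bar>\<Sum>i\<in>T. f i\<bar>)"
   proof (rule pred_intros_finite(3))
    show "finite {T\<in>C. T \<subset> S}" using finC by simp
    fix T assume "T \<in> {T\<in>C. T \<subset> S}"
    then have "T \<subseteq> S" by auto
    then show "Measurable.pred (PiM S (\<lambda>_. borel::real measure)) (\<lambda>f. \<not> l \<le> \<bar>\<Sum>i\<in>T. f i\<bar>)" by measurable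
   qed
   show ?thesis unfolding h_def by measurable
  qed
  have hY: "h (\<lambda>i\<in>S. Y i w) = indicator (A S) w * (\<Sum>i\<in>S. Y i w)" if "w \<in> space M" for w
  proof -
   have "(\<Sum>i\<in>T. (\<lambda>i\<in>S. Y i w) i) = (\<Sum>i\<in>T. Y i w)" if "T \<subseteq> S" for T
    using that by (intro sum.cong) auto
   then show ?thesis using that by (auto simp: h_def A_def indicator_def)
  qed
  have intS: "integrable M (\<lambda>w. \<Sum>i\<in>S. Y i w)" using intY SJ by (intro Bochner_Integration.integrable_sum) auto
  have inth: "integrable M (\<lambda>w. h (\<lambda>i\<in>S. Y i w))"
  proof -
   have "integrable M (\<lambda>w. indicator (A S) w * (\<Sum>i\<in>S. Y i w))"
    using integrable_mult_indicator[OF A_ev[OF S] intS] by simp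
   then show ?thesis by (subst Bochner_Integration.integrable_cong[OF refl hY]) auto
  qed
  have cross: "integrable M (\<lambda>w. h (\<lambda>i\<in>S. Y i w) * (\<Sum>i\<in>J-S. Y i w))"
   "expectation (\<lambda>w. h (\<lambda>i\<in>S. Y i w) * (\<Sum>i\<in>J-S. Y i w)) = 0"
   using indep_vars_sum_zero_mult[OF ind fin mean intY SJ hm inth] by -
  have S2: "integrable M (\<lambda>w. indicator (A S) w * (\<Sum>i\<in>S. Y i w)\<^sup>2)"
  proof -
   have "indep_vars (\<lambda>_. borel) Y S" using ind SJ by (rule indep_vars_subset)
   then have "integrable M (\<lambda>w. (\<Sum>i\<in>S. Y i w)\<^sup>2)"
    using expectation_sum_square[of Y S] finS mean sq SJ by auto
   from integrable_mult_indicator[OF A_ev[OF S] this] show ?thesis by simp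
  qed
  have R: "integrable M (\<lambda>w. indicator (A S) w * (Z w)\<^sup>2)"
   using integrable_mult_indicator[OF A_ev[OF S] Z2(1)] by simp
  have "l\<^sup>2 * prob (A S) = expectation (\<lambda>w. l\<^sup>2 * indicator (A S) w)"
   using A_ev[OF S] by simp
  also have "\<dots> \<le> expectation (\<lambda>w. indicator (A S) w * (\<Sum>i\<in>S. Y i w)\<^sup>2)"
  proof (rule integral_mono)
   show "integrable M (\<lambda>w. l\<^sup>2 * indicator (A S) w)"
    using A_ev[OF S] by (auto intro!: integrable_mult_right integrable_real_indicator simp: emeasure_eq_measure)
   fix w show "l\<^sup>2 * indicator (A S) w \<le> indicator (A S) w * (\<Sum>i\<in>S. Y i w)\<^sup>2"
    using l by (auto simp: A_def indicator_def abs_le_square_iff[symmetric])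
  qed (rule S2)
  also have "\<dots> = expectation (\<lambda>w. indicator (A S) w * (\<Sum>i\<in>S. Y i w)\<^sup>2) +
    2 * expectation (\<lambda>w. h (\<lambda>i\<in>S. Y i w) * (\<Sum>i\<in>J-S. Y i w))"
   unfolding cross(2) by simp
  also have "\<dots> = expectation (\<lambda>w. indicator (A S) w * (\<Sum>i\<in>S. Y i w)\<^sup>2 + 2 * (h (\<lambda>i\<in>S. Y i w) * (\<Sum>i\<in>J-S. Y i w)))"
   unfolding Bochner_Integration.integral_add[OF S2 integrable_mult_right[OF cross(1)]] by (simp only: integral_mult_right_zero)
  \<comment> \<open>The square of the sum over \<open>J - S\<close> is dropped; the cross term has
    mean 0.\<close>
  also have "\<dots> \<le> expectation (\<lambda>w. indicator (A S) w * (Z w)\<^sup>2)"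
  proof (rule integral_mono)
   show "integrable M (\<lambda>w. indicator (A S) w * (\<Sum>i\<in>S. Y i w)\<^sup>2 + 2 * (h (\<lambda>i\<in>S. Y i w) * (\<Sum>i\<in>J-S. Y i w)))"
    by (intro Bochner_Integration.integrable_add S2 integrable_mult_right cross(1))
   fix w assume "w \<in> space M"
   have "Z w = (\<Sum>i\<in>S. Y i w) + (\<Sum>i\<in>J-S. Y i w)"
    unfolding Z_def using SJ fin by (simp add: sum.subset_diff[of S J])
   then show "indicator (A S) w * (\<Sum>i\<in>S. Y i w)\<^sup>2 + 2 * (h (\<lambda>i\<in>S. Y i w) * (\<Sum>i\<in>J-S. Y i w))
     \<le> indicator (A S) w * (Z w)\<^sup>2"
    unfolding hY[OF \<open>w \<in> space M\<close>] by (auto simp: indicator_def power2_sum)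
  qed (rule R)
  finally show ?thesis .
 qed
 have AC: "A ` C \<subseteq> events" using A_ev by blast
 have "l\<^sup>2 * prob (\<Union>S\<in>C. A S) = (\<Sum>S\<in>C. l\<^sup>2 * prob (A S))"
  unfolding finite_measure_finite_Union[OF finC AC disj] by (simp add: sum_distrib_left)
 also have "\<dots> \<le> (\<Sum>S\<in>C. expectation (\<lambda>w. indicator (A S) w * (Z w)\<^sup>2))"
  by (intro sum_mono key)
 also have "\<dots> = expectation (\<lambda>w. \<Sum>S\<in>C. indicator (A S) w * (Z w)\<^sup>2)"
  using integrable_mult_indicator[OF A_ev Z2(1)] by (subst Bochner_Integration.integral_sum) auto
 also have "\<dots> \<le> expectation (\<lambda>w. (Z w)\<^sup>2)"
 proof (rule integral_mono)
  show "integrable M (\<lambda>w. \<Sum>S\<in>C. indicator (A S) w * (Z w)\<^sup>2)"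
   using integrable_mult_indicator[OF A_ev Z2(1)] by (intro Bochner_Integration.integrable_sum) auto
  fix w
  have "(\<Sum>S\<in>C. indicator (A S) w) = (indicator (\<Union>S\<in>C. A S) w :: real)"
   by (rule indicator_UN_disjoint[OF finC disj, symmetric])
  then have "(\<Sum>S\<in>C. indicator (A S) w * (Z w)\<^sup>2) = indicator (\<Union>S\<in>C. A S) w * (Z w)\<^sup>2"
   by (simp add: sum_distrib_right[symmetric])
  then show "(\<Sum>S\<in>C. indicator (A S) w * (Z w)\<^sup>2) \<le> (Z w)\<^sup>2"
   by (simp add: indicator_def)
 qed (rule Z2(1))
 also note Z2(2)
 finally show ?thesis unfolding UN using l by (simp add: field_simps)
qed

text \<open>Peeling into dyadic blocks of cardinality. In block \<open>j\<close> the level is at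
  least \<open>c * 2^j * k0\<close> while the variance is at most \<open>2^Suc j * k0 * s2\<close>,
  so Kolmogorov's bound is geometric in \<open>j\<close> and the total is governed by
  \<open>k0\<close>.\<close>

lemma (in prob_space) chain_strong_law:
 fixes Y :: "'i \<Rightarrow> 'a \<Rightarrow> real"
 assumes ind: "indep_vars (\<lambda>_. borel) Y J" and fin: "finite J"
  and mean: "\<And>i. i \<in> J \<Longrightarrow> expectation (Y i) = 0"
  and sq: "\<And>i. i \<in> J \<Longrightarrow> integrable M (\<lambda>w. (Y i w)\<^sup>2)"
  and var: "\<And>i. i \<in> J \<Longrightarrow> expectation (\<lambda>w. (Y i w)\<^sup>2) \<le> s2"
  and C: "C \<subseteq> Pow J" "\<And>S T. S \<in> C \<Longrightarrow> T \<in> C \<Longrightarrow> S \<subseteq> T \<or> T \<subseteq> S"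
  and c: "0 < (c::real)" and k0: "0 < k0" and s2: "0 \<le> s2"
 shows "prob {w\<in>space M. \<exists>S\<in>C. k0 \<le> card S \<and> c * card S \<le> \<bar>\<Sum>i\<in>S. Y i w\<bar>} \<le> 4 * s2 / (c\<^sup>2 * k0)"
proof -
 have rv: "\<And>i. i \<in> J \<Longrightarrow> random_variable borel (Y i)"
  using ind by (auto simp: indep_vars_def)
 define D where "D j = {S\<in>C. 2^j * k0 \<le> card S \<and> card S < 2^Suc j * k0}" for j :: nat
 define E where "E j = {w\<in>space M. \<exists>S\<in>D j. c * 2^j * k0 \<le> \<bar>\<Sum>i\<in>S. Y i w\<bar>}" for j
 have finC: "finite C" using C(1) fin by (simp add: finite_subset)
 have E_ev: "E j \<in> events" for j
 proof -
  have "(\<lambda>w. \<Sum>i\<in>S. Y i w) \<in> borel_measurable M" if "S \<in> D j" for S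
   using that C(1) by (intro borel_measurable_sum rv) (auto simp: D_def)
  then have "E j = (\<Union>S\<in>D j. {w\<in>space M. c * 2^j * k0 \<le> \<bar>\<Sum>i\<in>S. Y i w\<bar>})" "\<forall>S\<in>D j. {w\<in>space M. c * 2^j * k0 \<le> \<bar>\<Sum>i\<in>S. Y i w\<bar>} \<in> events"
   by (auto simp: E_def)
  moreover have "finite (D j)" using finC by (auto simp: D_def)
  ultimately show ?thesis by (simp add: sets.finite_UN)
 qed
 have PE: "prob (E j) \<le> 2 * s2 / (c\<^sup>2 * k0) * (1/2)^j" for j
 proof (cases "D j = {}")
  case True then show ?thesis using c k0 s2 by (simp add: E_def)
 next
  case False
  have "finite (D j)" using finC by (auto simp: D_def)
  \<comment> \<open>The largest member of the block replaces \<open>J\<close>, so that the variance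
    is proportional to the size of the block and not to \<open>card J\<close>.\<close>
  then obtain T where T: "T \<in> D j" "\<forall>S\<in>D j. T \<subseteq> S \<longrightarrow> T = S"
   using finite_has_maximal[of "D j"] False by auto
  then have sub: "D j \<subseteq> Pow T" using C(2) by (auto simp: D_def)
  have TJ: "T \<subseteq> J" using T(1) C(1) by (auto simp: D_def)
  have l: "0 < c * 2^j * k0" using c k0 by simp
  have "prob (E j) \<le> card T * s2 / (c * 2^j * k0)\<^sup>2"
   unfolding E_def
   using TJ finite_subset[OF TJ fin] indep_vars_subset[OF ind TJ] mean sq var sub C(2) l
   by (intro kolmogorov_chain) (auto simp: D_def)
  also have "\<dots> \<le> (2^Suc j * k0) * s2 / (c * 2^j * k0)\<^sup>2"
   using T(1) l s2 by (intro divide_right_mono mult_right_mono) (auto simp: D_def of_nat_less_iff[symmetric, where 'a=real] simp del: of_nat_less_iff)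
  also have "\<dots> = 2 * s2 / (c\<^sup>2 * k0) * (1/2)^j"
   using c k0 by (simp add: field_simps power2_eq_square)
  finally show ?thesis .
 qed
 have sub: "{w\<in>space M. \<exists>S\<in>C. k0 \<le> card S \<and> c * card S \<le> \<bar>\<Sum>i\<in>S. Y i w\<bar>} \<subseteq> (\<Union>j\<in>{..card J}. E j)"
 proof safe
  fix w S assume w: "w \<in> space M" and S: "S \<in> C" "k0 \<le> card S" "c * card S \<le> \<bar>\<Sum>i\<in>S. Y i w\<bar>"
  have cardS: "card S \<le> card J" using S(1) C(1) fin by (intro card_mono) auto
  define j where "j = (LEAST j. card S < 2^Suc j * k0)"
  have ex: "card S < 2^Suc (card S) * k0"
  proof -
   have "card S < 2^Suc (card S)" by (meson less_exp lessI less_trans power_strict_increasing_iff one_less_numeral_iff semiring_norm(76))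
   also have "\<dots> \<le> 2^Suc (card S) * k0" using k0 by simp
   finally show ?thesis .
  qed
  have up: "card S < 2^Suc j * k0" unfolding j_def by (rule LeastI[of _ "card S"]) (rule ex)
  have jle: "j \<le> card S" unfolding j_def by (rule Least_le) (rule ex)
  have lo: "2^j * k0 \<le> card S"
  proof (cases j)
   case (Suc i)
   then have "\<not> card S < 2^Suc i * k0" using not_less_Least[of i "\<lambda>j. card S < 2^Suc j * k0"] by (simp add: j_def)
   then show ?thesis using Suc by simp
  qed (use S in simp)
  have "c * 2^j * k0 \<le> c * card S"
  proof -
   have "real (2^j * k0) \<le> card S" using lo by (simp only: of_nat_le_iff)
   then have "c * real (2^j * k0) \<le> c * card S" using c by (intro mult_left_mono) auto
   then show ?thesis by (simp add: mult.assoc)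
  qed
  then have "w \<in> E j" using w S up lo by (auto simp: E_def D_def intro!: bexI[of _ S])
  then show "w \<in> (\<Union>j\<in>{..card J}. E j)" using jle cardS by auto
 qed
 have "prob {w\<in>space M. \<exists>S\<in>C. k0 \<le> card S \<and> c * card S \<le> \<bar>\<Sum>i\<in>S. Y i w\<bar>} \<le> prob (\<Union>j\<in>{..card J}. E j)"
  using E_ev by (intro finite_measure_mono sub) auto
 also have "\<dots> \<le> (\<Sum>j\<in>{..card J}. prob (E j))" using E_ev by (intro measure_UNION_le) auto
 also have "\<dots> \<le> (\<Sum>j\<in>{..card J}. 2 * s2 / (c\<^sup>2 * k0) * (1/2)^j)" by (intro sum_mono PE)
 also have "\<dots> = 2 * s2 / (c\<^sup>2 * k0) * (\<Sum>j\<in>{..card J}. (1/2)^j)" by (simp add: sum_distrib_left)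
 also have "\<dots> \<le> 2 * s2 / (c\<^sup>2 * k0) * 2"
 proof (intro mult_left_mono)
  have "(\<Sum>j\<in>{..card J}. (1/2::real)^j) \<le> (\<Sum>j. (1/2)^j)" by (intro sum_le_suminf) (auto simp: summable_geometric)
  also have "\<dots> = 2" by (subst suminf_geometric) auto
  finally show "(\<Sum>j\<in>{..card J}. (1/2::real)^j) \<le> 2" .
 qed (use c k0 s2 in simp)
 finally show ?thesis by simp
qed

section \<open>Weak convergence to a product law\<close>

text \<open>Reweighting: under the probability with density \<open>g n / e n\<close> the variable
  has transforms converging to \<open>char \<mu>\<close>, since \<gamma> is the limit of
  \<open>e n\<close> and cancels; Levy's theorem applies there. The lower bound 1 keeps
  \<open>e n\<close> and \<gamma> away from 0.\<close>

lemma (in prob_space) levy_weight_ge_1: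
 fixes X g :: "nat \<Rightarrow> 'a \<Rightarrow> real" and f :: "real \<Rightarrow> real"
 assumes X[measurable]: "\<And>n. X n \<in> borel_measurable M" and g[measurable]: "\<And>n. g n \<in> borel_measurable M"
  and gB: "\<And>n w. 1 \<le> g n w" "\<And>n w. g n w \<le> B"
  and \<mu>: "real_distribution \<mu>"
  and conv: "\<And>u. (\<lambda>n. expectation (\<lambda>w. complex_of_real (g n w) * iexp (u * X n w))) \<longlonglongrightarrow> complex_of_real \<gamma> * char \<mu> u"
  and f: "continuous_on UNIV f" "\<And>x. \<bar>f x\<bar> \<le> K"
 shows "(\<lambda>n. expectation (\<lambda>w. g n w * f (X n w))) \<longlonglongrightarrow> \<gamma> * integral\<^sup>L \<mu> f"
proof -
 interpret \<mu>: real_distribution \<mu> by fact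
 have [measurable]: "f \<in> borel_measurable borel" using f(1) by (rule borel_measurable_continuous_onI)
 have int_g: "integrable M (g n)" for n
 proof (rule integrable_const_bound[of _ B])
  have "\<bar>g n w\<bar> \<le> B" for w using gB(1)[of n w] gB(2)[of n w] by linarith
  then show "AE w in M. norm (g n w) \<le> B" by simp
 qed simp
 define e where "e n = expectation (g n)" for n
 have e1: "1 \<le> e n" for n
 proof -
  have "expectation (\<lambda>_. 1::real) \<le> expectation (g n)" by (rule integral_mono) (use int_g gB in auto)
  then show ?thesis by (simp add: e_def prob_space)
 qed
 have e_lim: "e \<longlonglongrightarrow> \<gamma>"
 proof -
  have "(\<lambda>n. complex_of_real (e n)) \<longlonglongrightarrow> complex_of_real \<gamma>"
   using conv[of 0] \<mu>.char_zero by (simp add: e_def)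
  then show ?thesis by (simp add: tendsto_of_real_iff)
 qed
 define N where "N n = density M (\<lambda>w. ennreal (g n w / e n))" for n
 have [simp]: "space (N n) = space M" "sets (N n) = sets M" for n by (auto simp: N_def)
 have ge0: "0 \<le> g n w / e n" for n w using gB(1)[of n w] e1[of n] by (intro divide_nonneg_nonneg) auto
 have intN: "integral\<^sup>L (N n) h = expectation (\<lambda>w. (g n w / e n) *\<^sub>R h w)"
  if [measurable]: "h \<in> borel_measurable M" for h :: "'a \<Rightarrow> 'c::{banach,second_countable_topology}" and n
  unfolding N_def by (rule integral_density) (use ge0 in auto)
 have pN: "prob_space (N n)" for n
 proof
  have "emeasure (N n) (space (N n)) = (\<integral>\<^sup>+w. ennreal (g n w / e n) \<partial>M)"
   by (simp add: N_def emeasure_density cong: nn_integral_cong)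
  also have "\<dots> = ennreal (expectation (\<lambda>w. g n w / e n))"
   using int_g ge0 by (intro nn_integral_eq_integral) auto
  also have "expectation (\<lambda>w. g n w / e n) = 1" using e1[of n] by (simp add: e_def)
  finally show "emeasure (N n) (space (N n)) = 1" by simp
 qed
 have XN[measurable]: "X n \<in> borel_measurable (N n)" for n by (simp add: N_def)
 have rd: "real_distribution (distr (N n) borel (X n))" for n
  using prob_space.real_distribution_distr[OF pN XN] .
 have ch: "char (distr (N n) borel (X n)) u = expectation (\<lambda>w. complex_of_real (g n w) * iexp (u * X n w)) / complex_of_real (e n)" for n u
 proof -
  have "char (distr (N n) borel (X n)) u = integral\<^sup>L (N n) (\<lambda>w. iexp (u * X n w))"
   unfolding char_def by (subst integral_distr) auto
  also have "\<dots> = expectation (\<lambda>w. (complex_of_real (g n w) * iexp (u * X n w)) / complex_of_real (e n))"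
   by (subst intN) (auto simp: scaleR_conv_of_real)
  finally show ?thesis by simp
 qed
 have g0: "complex_of_real \<gamma> \<noteq> 0"
  using LIMSEQ_le_const[OF e_lim, of 1] e1 by fastforce
 have "weak_conv_m (\<lambda>n. distr (N n) borel (X n)) \<mu>"
 proof (rule levy_continuity[OF rd \<mu>])
  fix u
  have "(\<lambda>n. expectation (\<lambda>w. complex_of_real (g n w) * iexp (u * X n w)) / complex_of_real (e n)) \<longlonglongrightarrow> complex_of_real \<gamma> * char \<mu> u / complex_of_real \<gamma>"
   using g0 by (intro tendsto_divide conv tendsto_of_real e_lim) auto
  then show "(\<lambda>n. char (distr (N n) borel (X n)) u) \<longlonglongrightarrow> char \<mu> u"
   using g0 by (simp add: ch)
 qed
 then have "(\<lambda>n. integral\<^sup>L (distr (N n) borel (X n)) f) \<longlonglongrightarrow> integral\<^sup>L \<mu> f"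
  using f by (intro weak_conv_imp_integral_bdd_continuous_conv[OF rd \<mu>, where B=K]) (auto simp: continuous_on_eq_continuous_at)
 then have "(\<lambda>n. e n * integral\<^sup>L (distr (N n) borel (X n)) f) \<longlonglongrightarrow> \<gamma> * integral\<^sup>L \<mu> f"
  by (intro tendsto_mult e_lim)
 moreover have "e n * integral\<^sup>L (distr (N n) borel (X n)) f = expectation (\<lambda>w. g n w * f (X n w))" for n
 proof -
  have "integral\<^sup>L (distr (N n) borel (X n)) f = expectation (\<lambda>w. g n w / e n * f (X n w))"
   by (subst integral_distr) (auto simp: intN)
  also have "\<dots> = expectation (\<lambda>w. g n w * f (X n w)) / e n" by simp
  finally show ?thesis using e1[of n] by simp
 qed
 ultimately show ?thesis by simp
qed

lemma cnj_iexp: "cnj (iexp x) = iexp (- x)"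
 by (simp add: exp_cnj)

text \<open>Reduction to weights that are at least 1: adding \<open>1 + B\<close> to the real part
  of the weight makes it such, and subtracting \<open>1 + B\<close> times the unweighted limit
  undoes this. The imaginary part is the real part after multiplication by -i.\<close>

lemma (in prob_space) levy_complex_weight:
 fixes X :: "nat \<Rightarrow> 'a \<Rightarrow> real" and c :: "nat \<Rightarrow> 'a \<Rightarrow> complex" and f :: "real \<Rightarrow> real"
 assumes X[measurable]: "\<And>n. X n \<in> borel_measurable M" and c[measurable]: "\<And>n. c n \<in> borel_measurable M"
  and cB: "\<And>n w. cmod (c n w) \<le> B"
  and \<mu>: "real_distribution \<mu>"
  and conv1: "\<And>u. (\<lambda>n. expectation (\<lambda>w. iexp (u * X n w))) \<longlonglongrightarrow> char \<mu> u"
  and conv: "\<And>u. (\<lambda>n. expectation (\<lambda>w. c n w * iexp (u * X n w))) \<longlonglongrightarrow> \<gamma> * char \<mu> u"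
  and f: "continuous_on UNIV f" "\<And>x. \<bar>f x\<bar> \<le> K"
 shows "(\<lambda>n. expectation (\<lambda>w. c n w * complex_of_real (f (X n w)))) \<longlonglongrightarrow> \<gamma> * complex_of_real (integral\<^sup>L \<mu> f)"
proof -
 interpret \<mu>: real_distribution \<mu> by fact
 have [measurable]: "f \<in> borel_measurable borel" using f(1) by (rule borel_measurable_continuous_onI)
 have B0: "0 \<le> B" using cB[of 0 undefined] norm_ge_zero order_trans by blast
 have K0: "0 \<le> K" using f(2)[of 0] by simp
 have char_neg: "cnj (char \<mu> (- u)) = char \<mu> u" for u
 proof -
  have "cnj (char \<mu> (- u)) = (\<integral>x. cnj (iexp (- u * x)) \<partial>\<mu>)"
   unfolding char_def by (rule integral_bounded_linear[OF bounded_linear_cnj, symmetric]) (intro \<mu>.integrable_iexp; simp)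
  then show ?thesis unfolding char_def cnj_iexp by simp
 qed
 have ie: "integrable M (\<lambda>w. iexp (u * X n w))" for u n by (intro integrable_iexp) auto
 have real_case: "(\<lambda>n. expectation (\<lambda>w. Re (d n w) * f (X n w))) \<longlonglongrightarrow> Re \<delta> * integral\<^sup>L \<mu> f"
  if d[measurable]: "\<And>n. d n \<in> borel_measurable M" and dB: "\<And>n w. cmod (d n w) \<le> B"
  and dconv: "\<And>u. (\<lambda>n. expectation (\<lambda>w. d n w * iexp (u * X n w))) \<longlonglongrightarrow> \<delta> * char \<mu> u" for d \<delta>
 proof -
  have R: "\<bar>Re (d n w)\<bar> \<le> B" for n w using abs_Re_le_cmod[of "d n w"] dB[of n w] by simp
  have intd: "integrable M (\<lambda>w. d n w * iexp (u * X n w))" for n u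
   by (rule integrable_const_bound[of _ B]) (use dB in \<open>auto simp: norm_mult\<close>)
  \<comment> \<open>The conjugate of the weight appears as well, so the hypothesis is used at
    \<open>u\<close> and, conjugated, at \<open>- u\<close>.\<close>
  have Re_eq: "complex_of_real (Re (d n w)) * iexp (u * X n w) =
    (d n w * iexp (u * X n w) + cnj (d n w * iexp (- u * X n w))) / 2" for n w u
  proof -
   have "complex_of_real (Re (d n w)) = (d n w + cnj (d n w)) / 2" by (simp add: complex_add_cnj)
   then show ?thesis by (simp only: complex_cnj_mult cnj_iexp) (simp add: algebra_simps add_divide_distrib)
  qed
  have Ecnj: "expectation (\<lambda>w. cnj (d n w * iexp (u * X n w))) = cnj (expectation (\<lambda>w. d n w * iexp (u * X n w)))" for n u
   by (rule integral_bounded_linear[OF bounded_linear_cnj intd])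
  have icnj: "integrable M (\<lambda>w. cnj (d n w * iexp (u * X n w)))" for n u
   by (rule integrable_bounded_linear[OF bounded_linear_cnj intd])
  have conv_Re: "(\<lambda>n. expectation (\<lambda>w. complex_of_real (Re (d n w)) * iexp (u * X n w))) \<longlonglongrightarrow> complex_of_real (Re \<delta>) * char \<mu> u" for u
  proof -
   have "expectation (\<lambda>w. complex_of_real (Re (d n w)) * iexp (u * X n w)) =
    (expectation (\<lambda>w. d n w * iexp (u * X n w)) + cnj (expectation (\<lambda>w. d n w * iexp (- u * X n w)))) / 2" for n
    unfolding Re_eq using intd icnj by (simp only: Ecnj[symmetric] integral_divide_zero Bochner_Integration.integral_add)
   moreover have "(\<lambda>n. (expectation (\<lambda>w. d n w * iexp (u * X n w)) + cnj (expectation (\<lambda>w. d n w * iexp (- u * X n w)))) / 2)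
     \<longlonglongrightarrow> (\<delta> * char \<mu> u + cnj (\<delta> * char \<mu> (- u))) / 2"
    by (intro tendsto_intros dconv) simp
   moreover have "(\<delta> * char \<mu> u + cnj (\<delta> * char \<mu> (- u))) / 2 = complex_of_real (Re \<delta>) * char \<mu> u"
   proof -
    have "complex_of_real (Re \<delta>) = (\<delta> + cnj \<delta>) / 2" by (simp add: complex_add_cnj)
    then show ?thesis by (simp only: complex_cnj_mult char_neg) (simp add: algebra_simps add_divide_distrib)
   qed
   ultimately show ?thesis by (simp only:)
  qed
  have iRe: "integrable M (\<lambda>w. complex_of_real (Re (d n w)) * iexp (u * X n w))" for n u
   by (rule integrable_const_bound[of _ B]) (use R in \<open>auto simp: norm_mult\<close>)
  have 1: "(\<lambda>n. expectation (\<lambda>w. (1 + B + Re (d n w)) * f (X n w))) \<longlonglongrightarrow> (1 + B + Re \<delta>) * integral\<^sup>L \<mu> f"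
  proof (rule levy_weight_ge_1[where B="1+2*B" and K=K])
   show "1 \<le> 1 + B + Re (d n w)" "1 + B + Re (d n w) \<le> 1 + 2*B" for n w using R[of n w] by auto
   show "(\<lambda>n. expectation (\<lambda>w. complex_of_real (1 + B + Re (d n w)) * iexp (u * X n w))) \<longlonglongrightarrow> complex_of_real (1 + B + Re \<delta>) * char \<mu> u" for u
   proof -
    have "(\<lambda>n. complex_of_real (1 + B) * expectation (\<lambda>w. iexp (u * X n w)) + expectation (\<lambda>w. complex_of_real (Re (d n w)) * iexp (u * X n w)))
     \<longlonglongrightarrow> complex_of_real (1 + B) * char \<mu> u + complex_of_real (Re \<delta>) * char \<mu> u"
     by (intro tendsto_intros conv_Re conv1)
    moreover have "expectation (\<lambda>w. complex_of_real (1 + B + Re (d n w)) * iexp (u * X n w)) = complex_of_real (1 + B) * expectation (\<lambda>w. iexp (u * X n w)) + expectation (\<lambda>w. complex_of_real (Re (d n w)) * iexp (u * X n w))" for n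
     unfolding of_real_add distrib_right[of "_ + _"]
     by (subst Bochner_Integration.integral_add) (use ie iRe in \<open>auto intro!: integrable_mult_right\<close>)
    ultimately show ?thesis by (simp add: algebra_simps)
   qed
  qed (use \<mu> f in auto)
  have 2: "(\<lambda>n. expectation (\<lambda>w. 1 * f (X n w))) \<longlonglongrightarrow> 1 * integral\<^sup>L \<mu> f"
   by (rule levy_weight_ge_1[where B=1 and K=K]) (use \<mu> f conv1 in auto)
  have if1: "integrable M (\<lambda>w. f (X n w))" for n
   by (rule integrable_const_bound[of _ K]) (use f in auto)
  have if2: "integrable M (\<lambda>w. Re (d n w) * f (X n w))" for n
   by (rule integrable_const_bound[of _ "B*K"]) (use f R B0 in \<open>auto simp: abs_mult intro!: mult_mono\<close>)
  have "(\<lambda>n. expectation (\<lambda>w. (1 + B + Re (d n w)) * f (X n w)) - (1 + B) * expectation (\<lambda>w. 1 * f (X n w))) \<longlonglongrightarrow>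
    (1 + B + Re \<delta>) * integral\<^sup>L \<mu> f - (1 + B) * (1 * integral\<^sup>L \<mu> f)"
   by (intro tendsto_diff tendsto_mult tendsto_const 1 2)
  moreover have "expectation (\<lambda>w. (1 + B + Re (d n w)) * f (X n w)) - (1 + B) * expectation (\<lambda>w. 1 * f (X n w)) = expectation (\<lambda>w. Re (d n w) * f (X n w))" for n
   unfolding distrib_right[of "_ + _"] using if1 if2 by simp
  ultimately show ?thesis by (simp add: algebra_simps)
 qed
 have A: "(\<lambda>n. expectation (\<lambda>w. Re (c n w) * f (X n w))) \<longlonglongrightarrow> Re \<gamma> * integral\<^sup>L \<mu> f"
  by (rule real_case) (use cB conv in auto)
 have "(\<lambda>n. expectation (\<lambda>w. Re (- \<i> * c n w) * f (X n w))) \<longlonglongrightarrow> Re (- \<i> * \<gamma>) * integral\<^sup>L \<mu> f"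
 proof (rule real_case)
  show "(\<lambda>n. expectation (\<lambda>w. - \<i> * c n w * iexp (u * X n w))) \<longlonglongrightarrow> - \<i> * \<gamma> * char \<mu> u" for u
   using tendsto_mult[OF tendsto_const[of "-\<i>"] conv[of u]] by (simp add: mult.assoc)
 qed (use cB in \<open>auto simp: norm_mult\<close>)
 then have Bm: "(\<lambda>n. expectation (\<lambda>w. Im (c n w) * f (X n w))) \<longlonglongrightarrow> Im \<gamma> * integral\<^sup>L \<mu> f"
  by simp
 have ic: "integrable M (\<lambda>w. c n w * complex_of_real (f (X n w)))" for n
  by (rule integrable_const_bound[of _ "B*K"]) (use f cB B0 in \<open>auto simp: norm_mult intro!: mult_mono\<close>)
 show ?thesis
  unfolding tendsto_complex_iff integral_Re[OF ic, symmetric] integral_Im[OF ic, symmetric]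
  using A Bm by simp
qed

text \<open>The algebra for Stone-Weierstrass. Products with bounded factors remain admissible test
  functions on the whole space, which polynomials would not.\<close>

inductive_set product_span :: "(real \<times> real \<times> real \<Rightarrow> real) set" where
 prod: "\<lbrakk>continuous_on UNIV f1; continuous_on UNIV f2; continuous_on UNIV f3;
   bounded (range f1); bounded (range f2); bounded (range f3)\<rbrakk> \<Longrightarrow>
   (\<lambda>x. f1 (fst x) * f2 (fst (snd x)) * f3 (snd (snd x))) \<in> product_span"
| add: "\<lbrakk>f \<in> product_span; g \<in> product_span\<rbrakk> \<Longrightarrow> (\<lambda>x. f x + g x) \<in> product_span"

lemma product_span_continuous: "f \<in> product_span \<Longrightarrow> continuous_on UNIV f"
proof (induction rule: product_span.induct)
 case (prod f1 f2 f3)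
 show ?case
  by (intro continuous_on_mult continuous_on_compose2[OF prod(1)] continuous_on_compose2[OF prod(2)]
    continuous_on_compose2[OF prod(3)] continuous_on_fst continuous_on_snd continuous_on_id subset_UNIV)
qed (intro continuous_intros)

lemma bounded_range_mult:
 fixes f g :: "'b \<Rightarrow> real"
 assumes "bounded (range f)" "bounded (range g)"
 shows "bounded (range (\<lambda>x. f x * g x))"
proof -
 obtain a where a: "\<And>x. \<bar>f x\<bar> \<le> a" using assms(1) by (auto simp: bounded_iff)
 obtain b where b: "\<And>x. \<bar>g x\<bar> \<le> b" using assms(2) by (auto simp: bounded_iff)
 have "\<bar>f x * g x\<bar> \<le> a * b" for x
  unfolding abs_mult using a[of x] b[of x] by (intro mult_mono) (auto intro: order_trans[OF abs_ge_zero])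
 then show ?thesis by (auto simp: bounded_iff intro!: exI[of _ "a * b"])
qed

lemma bounded_range_compose: "bounded (range f) \<Longrightarrow> bounded (range (\<lambda>x. f (g x)))"
 by (rule bounded_subset) auto

lemma product_span_bounded: "f \<in> product_span \<Longrightarrow> bounded (range f)"
proof (induction rule: product_span.induct)
 case (prod f1 f2 f3)
 show ?case
  by (rule bounded_range_mult[OF bounded_range_mult[OF bounded_range_compose[OF prod(4)] bounded_range_compose[OF prod(5)]] bounded_range_compose[OF prod(6)]])
next
 case (add f g)
 then show ?case using bounded_plus_comp[of f UNIV g] by simp
qed

lemma product_span_mult: "f \<in> product_span \<Longrightarrow> g \<in> product_span \<Longrightarrow> (\<lambda>x. f x * g x) \<in> product_span"
proof (induction arbitrary: g rule: product_span.induct)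
 case (prod f1 f2 f3)
 from prod(7) show ?case
 proof (induction rule: product_span.induct)
  case (prod g1 g2 g3)
  have "(\<lambda>x. (\<lambda>y. f1 y * g1 y) (fst x) * (\<lambda>y. f2 y * g2 y) (fst (snd x)) * (\<lambda>y. f3 y * g3 y) (snd (snd x))) \<in> product_span"
   using prod \<open>continuous_on UNIV f1\<close> \<open>continuous_on UNIV f2\<close> \<open>continuous_on UNIV f3\<close>
    \<open>bounded (range f1)\<close> \<open>bounded (range f2)\<close> \<open>bounded (range f3)\<close>
   by (intro product_span.prod continuous_on_mult bounded_range_mult)
  then show ?case by (simp add: ac_simps)
 next
  case (add f g)
  then show ?case using product_span.add by (simp add: distrib_left)
 qed
next
 case (add f f')
 then show ?case using product_span.add by (simp add: distrib_right)
qed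

text \<open>A trapezoid equal to 1 on [-R, R] and to 0 off [-R - 1, R + 1].\<close>

definition cutoff :: "real \<Rightarrow> real \<Rightarrow> real" where
 "cutoff R x = max 0 (min 1 (R + 1 - \<bar>x\<bar>))"

definition cutoff3 :: "real \<Rightarrow> real \<times> real \<times> real \<Rightarrow> real" where
 "cutoff3 R = (\<lambda>x. cutoff R (fst x) * cutoff R (fst (snd x)) * cutoff R (snd (snd x)))"

lemma cutoff_bounds: "0 \<le> cutoff R x" "cutoff R x \<le> 1"
 by (auto simp: cutoff_def)

lemma cutoff3_span: "cutoff3 R \<in> product_span"
proof -
 have "continuous_on UNIV (cutoff R)" unfolding cutoff_def by (intro continuous_intros)
 moreover have "bounded (range (cutoff R))"
  using cutoff_bounds[of R] by (auto simp: bounded_iff intro!: exI[of _ 1])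
 ultimately show ?thesis unfolding cutoff3_def by (intro product_span.prod)
qed

lemma cutoff3_bounds: "0 \<le> cutoff3 R x" "cutoff3 R x \<le> 1"
 unfolding cutoff3_def using cutoff_bounds by (auto intro!: mult_le_one mult_nonneg_nonneg)

lemma cutoff3_limit: "(\<lambda>R. cutoff3 (real R) x) \<longlonglongrightarrow> 1"
proof -
 have "\<forall>\<^sub>F R in sequentially. cutoff (real R) y = 1" for y
  using eventually_ge_at_top[of "nat \<lceil>\<bar>y\<bar>\<rceil>"]
  by eventually_elim (auto simp: cutoff_def nat_le_iff ceiling_le_iff)
 then have "\<forall>\<^sub>F R in sequentially. cutoff (real R) (fst x) = 1 \<and> cutoff (real R) (fst (snd x)) = 1 \<and> cutoff (real R) (snd (snd x)) = 1"
  by (simp add: eventually_conj)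
 then have "\<forall>\<^sub>F R in sequentially. cutoff3 (real R) x = 1"
  by eventually_elim (simp add: cutoff3_def)
 then show ?thesis by (rule tendsto_eventually)
qed

text \<open>Stone-Weierstrass on the cube of half-width R + 1; outside it \<open>cutoff3\<close>
  vanishes, so the estimate is global.\<close>

lemma product_span_dense:
 assumes f: "continuous_on UNIV f" and e: "0 < e"
 obtains g where "g \<in> product_span" "\<And>x. \<bar>f x * cutoff3 R x - g x * cutoff3 R x\<bar> \<le> e"
proof -
 define S :: "(real \<times> real \<times> real) set" where "S = cbox (-(R+1), -(R+1), -(R+1)) (R+1, R+1, R+1)"
 have c: "(\<lambda>_. c) \<in> product_span" for c
  using product_span.prod[of "\<lambda>_. c" "\<lambda>_. 1" "\<lambda>_. 1"] by simp
 \<comment> \<open>Coordinates clipped to the cube: they separate its points and, unlike the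
   coordinates themselves, are bounded.\<close>
 define T where "T x = max (-(R+1)) (min (R+1) x)" for x :: real
 have Tc: "continuous_on UNIV T" unfolding T_def by (intro continuous_intros)
 have Tb: "bounded (range T)"
  by (auto simp: bounded_iff T_def intro!: exI[of _ "\<bar>R+1\<bar>"])
 have sp: "(\<lambda>x. T (fst x)) \<in> product_span" "(\<lambda>x. T (fst (snd x))) \<in> product_span" "(\<lambda>x. T (snd (snd x))) \<in> product_span"
  using product_span.prod[of T "\<lambda>_. 1" "\<lambda>_. 1"] product_span.prod[of "\<lambda>_. 1" T "\<lambda>_. 1"] product_span.prod[of "\<lambda>_. 1" "\<lambda>_. 1" T] Tc Tb
  by simp_all
 have mem: "x \<in> S \<longleftrightarrow> \<bar>fst x\<bar> \<le> R+1 \<and> \<bar>fst (snd x)\<bar> \<le> R+1 \<and> \<bar>snd (snd x)\<bar> \<le> R+1" for x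
  by (cases x) (auto simp: S_def cbox_Pair_eq abs_le_iff)
 have "function_ring_on product_span S"
 proof
  show "compact S" by (simp add: S_def)
  show "continuous_on S f" if "f \<in> product_span" for f
   using product_span_continuous[OF that] by (rule continuous_on_subset) auto
  show "\<exists>f\<in>product_span. f x \<noteq> f y" if "x \<in> S" "y \<in> S" "x \<noteq> y" for x y
  proof -
   have "T a = a" if "\<bar>a\<bar> \<le> R+1" for a using that by (auto simp: T_def)
   then have "T (fst x) \<noteq> T (fst y) \<or> T (fst (snd x)) \<noteq> T (fst (snd y)) \<or> T (snd (snd x)) \<noteq> T (snd (snd y))"
    using that by (auto simp: mem prod_eq_iff)
   then show ?thesis by (elim disjE) (rule bexI[OF _ sp(1)], assumption, rule bexI[OF _ sp(2)], assumption, rule bexI[OF _ sp(3)], assumption)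
  qed
 qed (auto intro: product_span.add product_span_mult c)
 from function_ring_on.Stone_Weierstrass_basic[OF this continuous_on_subset[OF f subset_UNIV] e]
 obtain g where g: "g \<in> product_span" "\<And>x. x \<in> S \<Longrightarrow> \<bar>f x - g x\<bar> < e" by auto
 have "\<bar>f x * cutoff3 R x - g x * cutoff3 R x\<bar> \<le> e" for x
 proof (cases "x \<in> S")
  case True
  have "\<bar>f x * cutoff3 R x - g x * cutoff3 R x\<bar> = \<bar>f x - g x\<bar> * cutoff3 R x"
   using cutoff3_bounds[of R x] by (simp add: left_diff_distrib[symmetric] abs_mult)
  also have "\<dots> \<le> e * 1" using g(2)[OF True] cutoff3_bounds[of R x] e by (intro mult_mono) auto
  finally show ?thesis by simp
 next
  case False
  then have "cutoff3 R x = 0" by (auto simp: mem cutoff3_def cutoff_def)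
  then show ?thesis using e by simp
 qed
 with g(1) that show ?thesis by blast
qed

text \<open>The cost of truncation is controlled by the expectation of the cutoff, which lies in the
  span and therefore converges. Tightness thus needs no separate proof; the estimate serves both the
  sample laws and the limit law.\<close>

lemma (in prob_space) cutoff3_approx:
 fixes f g :: "real \<times> real \<times> real \<Rightarrow> real"
 assumes T[measurable]: "T \<in> measurable M borel" and f: "continuous_on UNIV f" "\<And>x. \<bar>f x\<bar> \<le> K"
  and g: "g \<in> product_span" "\<And>x. \<bar>f x * cutoff3 R x - g x * cutoff3 R x\<bar> \<le> e"
 shows "\<bar>expectation (\<lambda>w. f (T w)) - expectation (\<lambda>w. g (T w) * cutoff3 R (T w))\<bar> \<le> K * (1 - expectation (\<lambda>w. cutoff3 R (T w))) + e"
proof -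
 have [measurable]: "f \<in> borel_measurable borel" "g \<in> borel_measurable borel" "cutoff3 R \<in> borel_measurable borel"
  using f(1) product_span_continuous[OF g(1)] product_span_continuous[OF cutoff3_span] by (auto intro: borel_measurable_continuous_onI)
 obtain b where b: "\<And>x. \<bar>g x\<bar> \<le> b" using product_span_bounded[OF g(1)] by (auto simp: bounded_iff)
 have i1: "integrable M (\<lambda>w. f (T w))" by (rule integrable_const_bound[of _ K]) (use f in auto)
 have i2: "integrable M (\<lambda>w. cutoff3 R (T w))" by (rule integrable_const_bound[of _ 1]) (use cutoff3_bounds in auto)
 have i3: "integrable M (\<lambda>w. g (T w) * cutoff3 R (T w))"
 proof (rule integrable_const_bound[of _ "b * 1"])
  have "\<bar>g x * cutoff3 R x\<bar> \<le> b * 1" for x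
   unfolding abs_mult using b[of x] cutoff3_bounds[of R x] by (intro mult_mono) (auto intro: order_trans[OF abs_ge_zero])
  then show "AE x in M. norm (g (T x) * cutoff3 R (T x)) \<le> b * 1" by auto
 qed simp
 have "\<bar>expectation (\<lambda>w. f (T w)) - expectation (\<lambda>w. g (T w) * cutoff3 R (T w))\<bar> = \<bar>expectation (\<lambda>w. f (T w) - g (T w) * cutoff3 R (T w))\<bar>"
  using i1 i3 by simp
 also have "\<dots> \<le> expectation (\<lambda>w. \<bar>f (T w) - g (T w) * cutoff3 R (T w)\<bar>)"
  by (rule integral_abs_bound)
 also have "\<dots> \<le> expectation (\<lambda>w. K * (1 - cutoff3 R (T w)) + e)"
 proof (rule integral_mono)
  fix w
  have "f (T w) - g (T w) * cutoff3 R (T w) = f (T w) * (1 - cutoff3 R (T w)) + (f (T w) * cutoff3 R (T w) - g (T w) * cutoff3 R (T w))"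
   by (simp add: algebra_simps)
  moreover have "\<bar>f (T w) * (1 - cutoff3 R (T w))\<bar> \<le> K * (1 - cutoff3 R (T w))"
   unfolding abs_mult using f(2) cutoff3_bounds[of R "T w"] by (intro mult_mono) (auto intro: order_trans[OF abs_ge_zero f(2)])
  ultimately show "\<bar>f (T w) - g (T w) * cutoff3 R (T w)\<bar> \<le> K * (1 - cutoff3 R (T w)) + e"
   using g(2)[of "T w"] by linarith
 qed (use i1 i2 i3 in auto)
 also have "\<dots> = K * (1 - expectation (\<lambda>w. cutoff3 R (T w))) + e" using i2 by (simp add: prob_space)
 finally show ?thesis .
qed

text \<open>Levy's theorem turns one exponential at a time into a bounded continuous test function,
  the remaining factors acting as a complex weight. This gives convergence on
  \<open>product_span\<close>, and uniform approximation under a cutoff extends it to all test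
  functions.\<close>

lemma (in prob_space) weak_conv_borel_product3:
 fixes A B D :: "nat \<Rightarrow> 'a \<Rightarrow> real"
 assumes rv[measurable]: "\<And>n. A n \<in> borel_measurable M" "\<And>n. B n \<in> borel_measurable M" "\<And>n. D n \<in> borel_measurable M"
  and rd: "real_distribution \<mu>1" "real_distribution \<mu>2" "real_distribution \<mu>3"
  and conv: "\<And>u v v'. (\<lambda>n. expectation (\<lambda>w. iexp (u * A n w + v * B n w + v' * D n w))) \<longlonglongrightarrow> char \<mu>1 u * char \<mu>2 v * char \<mu>3 v'"
 shows "weak_conv_borel (\<lambda>n. distr M borel (\<lambda>w. (A n w, B n w, D n w))) (\<mu>1 \<Otimes>\<^sub>M (\<mu>2 \<Otimes>\<^sub>M \<mu>3))"
proof -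
 interpret m1: real_distribution \<mu>1 by fact
 interpret m2: real_distribution \<mu>2 by fact
 interpret m3: real_distribution \<mu>3 by fact
 interpret m23: pair_prob_space \<mu>2 \<mu>3 ..
 interpret m123: pair_prob_space \<mu>1 "\<mu>2 \<Otimes>\<^sub>M \<mu>3" ..
 let ?\<mu> = "\<mu>1 \<Otimes>\<^sub>M (\<mu>2 \<Otimes>\<^sub>M \<mu>3)"
 have sets_\<mu>: "sets ?\<mu> = sets (borel :: (real \<times> real \<times> real) measure)"
 proof -
  have "sets ?\<mu> = sets (borel \<Otimes>\<^sub>M (borel \<Otimes>\<^sub>M borel) :: (real \<times> real \<times> real) measure)"
   by (intro sets_pair_measure_cong) auto
  then show ?thesis by (simp only: borel_prod)
 qed
 define T where "T n w = (A n w, B n w, D n w)" for n w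
 have T[measurable]: "T n \<in> measurable M borel" for n
  unfolding T_def borel_prod[symmetric] by measurable
 have z: "char \<mu>1 0 = 1" "char \<mu>2 0 = 1" "char \<mu>3 0 = 1"
  using m1.char_zero m2.char_zero m3.char_zero by auto
 have c1: "(\<lambda>n. expectation (\<lambda>w. iexp (u * A n w))) \<longlonglongrightarrow> char \<mu>1 u" for u
  using conv[of u 0 0] z by simp
 have c2: "(\<lambda>n. expectation (\<lambda>w. iexp (u * B n w))) \<longlonglongrightarrow> char \<mu>2 u" for u
  using conv[of 0 u 0] z by simp
 have c3: "(\<lambda>n. expectation (\<lambda>w. iexp (u * D n w))) \<longlonglongrightarrow> char \<mu>3 u" for u
  using conv[of 0 0 u] z by simp
 have step: "(\<lambda>n. expectation (\<lambda>w. f1 (A n w) * f2 (B n w) * f3 (D n w))) \<longlonglongrightarrow> integral\<^sup>L \<mu>1 f1 * integral\<^sup>L \<mu>2 f2 * integral\<^sup>L \<mu>3 f3"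
  if f: "continuous_on UNIV f1" "continuous_on UNIV f2" "continuous_on UNIV f3"
   "bounded (range f1)" "bounded (range f2)" "bounded (range f3)" for f1 f2 f3 :: "real \<Rightarrow> real"
 proof -
  have [measurable]: "f1 \<in> borel_measurable borel" "f2 \<in> borel_measurable borel" "f3 \<in> borel_measurable borel"
   using f by (auto intro: borel_measurable_continuous_onI)
  obtain K1 where K1: "\<And>x. \<bar>f1 x\<bar> \<le> K1" using f(4) by (auto simp: bounded_iff)
  obtain K2 where K2: "\<And>x. \<bar>f2 x\<bar> \<le> K2" using f(5) by (auto simp: bounded_iff)
  obtain K3 where K3: "\<And>x. \<bar>f3 x\<bar> \<le> K3" using f(6) by (auto simp: bounded_iff)
  have n1: "norm (iexp r) = 1" for r by simp
  \<comment> \<open>The exponentials of the other two coordinates are the weight. In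
    \<open>s2\<close> and \<open>s3\<close> the test functions already obtained join the
    weight.\<close>
  have s1: "(\<lambda>n. expectation (\<lambda>w. iexp (v * B n w + v' * D n w) * complex_of_real (f1 (A n w)))) \<longlonglongrightarrow>
    (char \<mu>2 v * char \<mu>3 v') * complex_of_real (integral\<^sup>L \<mu>1 f1)" for v v'
  proof (rule levy_complex_weight[where B=1 and K=K1])
   show "(\<lambda>n. expectation (\<lambda>w. iexp (v * B n w + v' * D n w) * iexp (u * A n w))) \<longlonglongrightarrow> char \<mu>2 v * char \<mu>3 v' * char \<mu>1 u" for u
    using conv[of u v v'] by (simp add: exp_add[symmetric] algebra_simps)
  qed (use c1 f K1 rd n1 in \<open>simp_all del: of_real_add\<close>)
  have s2: "(\<lambda>n. expectation (\<lambda>w. (iexp (v' * D n w) * complex_of_real (f1 (A n w))) * complex_of_real (f2 (B n w)))) \<longlonglongrightarrow>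
    (char \<mu>3 v' * complex_of_real (integral\<^sup>L \<mu>1 f1)) * complex_of_real (integral\<^sup>L \<mu>2 f2)" for v'
  proof (rule levy_complex_weight[where B=K1 and K=K2])
   show "(\<lambda>n. expectation (\<lambda>w. (iexp (v' * D n w) * complex_of_real (f1 (A n w))) * iexp (u * B n w))) \<longlonglongrightarrow>
    (char \<mu>3 v' * complex_of_real (integral\<^sup>L \<mu>1 f1)) * char \<mu>2 u" for u
    using s1[of u v'] by (simp add: exp_add algebra_simps)
  qed (use c2 f K1 K2 rd n1 in \<open>simp_all add: norm_mult\<close>)
  have K0: "0 \<le> K1" using K1[of 0] by simp
  have s3: "(\<lambda>n. expectation (\<lambda>w. complex_of_real (f1 (A n w) * f2 (B n w)) * complex_of_real (f3 (D n w)))) \<longlonglongrightarrow>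
    complex_of_real (integral\<^sup>L \<mu>1 f1 * integral\<^sup>L \<mu>2 f2) * complex_of_real (integral\<^sup>L \<mu>3 f3)"
  proof (rule levy_complex_weight[where B="K1*K2" and K=K3])
   show "(\<lambda>n. expectation (\<lambda>w. complex_of_real (f1 (A n w) * f2 (B n w)) * iexp (u * D n w))) \<longlonglongrightarrow>
    complex_of_real (integral\<^sup>L \<mu>1 f1 * integral\<^sup>L \<mu>2 f2) * char \<mu>3 u" for u
    using s2[of u] by (simp add: algebra_simps)
   show "norm (complex_of_real (f1 (A n w) * f2 (B n w))) \<le> K1 * K2" for n w
    using K1[of "A n w"] K2[of "B n w"] K0 by (auto simp: norm_mult abs_mult intro!: mult_mono)
  qed (use c3 f K3 rd in simp_all)
  then show ?thesis
   unfolding of_real_mult[symmetric] integral_complex_of_real tendsto_of_real_iff by simp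
 qed
 have span: "integrable ?\<mu> g \<and> (\<lambda>n. expectation (\<lambda>w. g (T n w))) \<longlonglongrightarrow> integral\<^sup>L ?\<mu> g" if "g \<in> product_span" for g
  using that
 proof (induction rule: product_span.induct)
  case (prod f1 f2 f3)
  have [measurable]: "f1 \<in> borel_measurable borel" "f2 \<in> borel_measurable borel" "f3 \<in> borel_measurable borel"
   using prod by (auto intro: borel_measurable_continuous_onI)
  obtain K1 where K1: "\<And>x. \<bar>f1 x\<bar> \<le> K1" using prod(4) by (auto simp: bounded_iff)
  obtain K2 where K2: "\<And>x. \<bar>f2 x\<bar> \<le> K2" using prod(5) by (auto simp: bounded_iff)
  obtain K3 where K3: "\<And>x. \<bar>f3 x\<bar> \<le> K3" using prod(6) by (auto simp: bounded_iff)
  have i1: "integrable \<mu>1 f1" by (rule m1.integrable_const_bound[of _ K1]) (use K1 in auto)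
  have i2: "integrable \<mu>2 f2" by (rule m2.integrable_const_bound[of _ K2]) (use K2 in auto)
  have i3: "integrable \<mu>3 f3" by (rule m3.integrable_const_bound[of _ K3]) (use K3 in auto)
  have ps: "(\<lambda>x. f1 (fst x) * f2 (fst (snd x)) * f3 (snd (snd x))) \<in> product_span" using prod by (intro product_span.prod)
  obtain K where K: "\<And>x. \<bar>f1 (fst x) * f2 (fst (snd x)) * f3 (snd (snd x))\<bar> \<le> K" using product_span_bounded[OF ps] by (auto simp: bounded_iff)
  have int: "integrable ?\<mu> (\<lambda>x. f1 (fst x) * f2 (fst (snd x)) * f3 (snd (snd x)))"
   by (rule m123.P.integrable_const_bound[of _ K]) (use K in auto)
  have int': "integrable ?\<mu> (\<lambda>(x, y). f1 x * f2 (fst y) * f3 (snd y))"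
   using int by (simp add: case_prod_beta' mult.assoc)
  have int23: "integrable (\<mu>2 \<Otimes>\<^sub>M \<mu>3) (\<lambda>(y, z). f2 y * f3 z)"
  proof (rule m23.P.integrable_const_bound[of _ "K2*K3"])
   have "\<bar>f2 y * f3 z\<bar> \<le> K2 * K3" for y z
    unfolding abs_mult using K2[of y] K3[of z] by (intro mult_mono) (auto intro: order_trans[OF abs_ge_zero])
   then show "AE x in \<mu>2 \<Otimes>\<^sub>M \<mu>3. norm (case x of (y, z) \<Rightarrow> f2 y * f3 z) \<le> K2 * K3" by auto
  qed measurable
  have "integral\<^sup>L ?\<mu> (\<lambda>x. f1 (fst x) * f2 (fst (snd x)) * f3 (snd (snd x))) = (\<integral>x. \<integral>y. f1 x * f2 (fst y) * f3 (snd y) \<partial>(\<mu>2 \<Otimes>\<^sub>M \<mu>3) \<partial>\<mu>1)"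
   using m123.integral_fst[OF int'] by (simp add: case_prod_beta')
  also have "\<dots> = (\<integral>x. f1 x * (\<integral>y. f2 (fst y) * f3 (snd y) \<partial>(\<mu>2 \<Otimes>\<^sub>M \<mu>3)) \<partial>\<mu>1)" by (simp add: mult.assoc)
  also have "(\<integral>y. f2 (fst y) * f3 (snd y) \<partial>(\<mu>2 \<Otimes>\<^sub>M \<mu>3)) = (\<integral>y. \<integral>z. f2 y * f3 z \<partial>\<mu>3 \<partial>\<mu>2)"
   using m23.integral_fst[OF int23] by (simp add: case_prod_beta')
  finally have eq: "integral\<^sup>L ?\<mu> (\<lambda>x. f1 (fst x) * f2 (fst (snd x)) * f3 (snd (snd x))) = integral\<^sup>L \<mu>1 f1 * integral\<^sup>L \<mu>2 f2 * integral\<^sup>L \<mu>3 f3"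
   by simp
  show ?case unfolding eq using step[OF prod] int by (simp add: T_def)
 next
  case (add f g)
  have m[measurable]: "f \<in> borel_measurable borel" "g \<in> borel_measurable borel"
   using product_span_continuous add by (auto intro: borel_measurable_continuous_onI)
  obtain K1 where K1: "\<And>x. \<bar>f x\<bar> \<le> K1" using product_span_bounded[OF add(1)] by (auto simp: bounded_iff)
  obtain K2 where K2: "\<And>x. \<bar>g x\<bar> \<le> K2" using product_span_bounded[OF add(2)] by (auto simp: bounded_iff)
  have i: "integrable M (\<lambda>w. f (T n w))" "integrable M (\<lambda>w. g (T n w))" for n
   by (rule integrable_const_bound[of _ K1], use K1 in auto) (rule integrable_const_bound[of _ K2], use K2 in auto)
  show ?case using add(3,4) i by (auto intro!: tendsto_add)
 qed
 show ?thesis unfolding weak_conv_borel_def T_def[symmetric]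
 proof (intro allI impI)
  fix f :: "real \<times> real \<times> real \<Rightarrow> real" assume f: "continuous_on UNIV f" "bounded (range f)"
  then obtain K where K: "\<And>x. \<bar>f x\<bar> \<le> K" by (auto simp: bounded_iff)
  have K0: "0 \<le> K" using K[of undefined] by (rule order_trans[OF abs_ge_zero])
  have fm[measurable]: "f \<in> borel_measurable borel" using f(1) by (rule borel_measurable_continuous_onI)
  have id: "(\<lambda>x. x) \<in> measurable ?\<mu> borel" by (intro measurable_ident_sets sets_\<mu>)
  have "(\<lambda>n. expectation (\<lambda>w. f (T n w))) \<longlonglongrightarrow> integral\<^sup>L ?\<mu> f"
  proof (rule LIMSEQ_I)
   fix r :: real assume r: "0 < r"
   \<comment> \<open>The errors add up to at most 3 K e + 3 e: truncation costs 2 K e + e for the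
     sample and K e + e for the limit, and the convergence on the span another e.\<close>
   define e where "e = r / (4 * K + 6)"
   have e: "0 < e" "(4 * K + 6) * e = r" using r K0 by (auto simp: e_def)
   have "(\<lambda>R. integral\<^sup>L ?\<mu> (cutoff3 (real R))) \<longlonglongrightarrow> integral\<^sup>L ?\<mu> (\<lambda>_. 1)"
    using cutoff3_limit cutoff3_bounds borel_measurable_integrable[OF span[OF cutoff3_span, THEN conjunct1]]
    by (intro integral_dominated_convergence[where w="\<lambda>_. 1"]) auto
   then have "(\<lambda>R. integral\<^sup>L ?\<mu> (cutoff3 (real R))) \<longlonglongrightarrow> 1" using m123.P.prob_space by simp
   then have "\<forall>\<^sub>F R in sequentially. 1 - e < integral\<^sup>L ?\<mu> (cutoff3 (real R))" using e by (auto dest: order_tendstoD(1)[where a="1-e"])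
   then obtain R0 where R0: "1 - e < integral\<^sup>L ?\<mu> (cutoff3 (real R0))" by (auto dest: eventually_happens)
   define R where "R = real R0"
   have R: "1 - integral\<^sup>L ?\<mu> (cutoff3 R) < e" using R0 by (simp add: R_def)
   obtain g where g: "g \<in> product_span" "\<And>x. \<bar>f x * cutoff3 R x - g x * cutoff3 R x\<bar> \<le> e"
    using product_span_dense[OF f(1) e(1), where R=R] by blast
   have gc: "(\<lambda>x. g x * cutoff3 R x) \<in> product_span" by (intro product_span_mult g cutoff3_span)
   note l1 = span[OF gc, THEN conjunct2, THEN tendstoD, OF e(1)]
   note l2 = span[OF cutoff3_span, of R, THEN conjunct2, THEN tendstoD, OF e(1)]
   have b1: "\<bar>integral\<^sup>L ?\<mu> f - integral\<^sup>L ?\<mu> (\<lambda>x. g x * cutoff3 R x)\<bar> \<le> K * (1 - integral\<^sup>L ?\<mu> (cutoff3 R)) + e"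
    using m123.P.cutoff3_approx[OF id f(1) K g] by simp
   have "\<forall>\<^sub>F n in sequentially. norm (expectation (\<lambda>w. f (T n w)) - integral\<^sup>L ?\<mu> f) < r"
    using l1 l2
   proof eventually_elim
    case (elim n)
    have b2: "\<bar>expectation (\<lambda>w. f (T n w)) - expectation (\<lambda>w. g (T n w) * cutoff3 R (T n w))\<bar> \<le> K * (1 - expectation (\<lambda>w. cutoff3 R (T n w))) + e"
     by (rule cutoff3_approx[OF T f(1) K g])
    have "K * (1 - expectation (\<lambda>w. cutoff3 R (T n w))) \<le> K * (2 * e)"
     using elim(2) R K0 by (intro mult_left_mono) (auto simp: dist_real_def abs_less_iff)
    moreover have "K * (1 - integral\<^sup>L ?\<mu> (cutoff3 R)) \<le> K * e" using R K0 by (intro mult_left_mono) auto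
    moreover have "0 \<le> K * e" using K0 e by simp
    moreover have "4 * (K * e) + 6 * e = r" using e(2) by (simp add: algebra_simps)
    ultimately show ?case using b1 b2 elim(1) e(1) by (auto simp: dist_real_def)
   qed
   then show "\<exists>n0. \<forall>n\<ge>n0. norm (expectation (\<lambda>w. f (T n w)) - integral\<^sup>L ?\<mu> f) < r"
    by (auto simp: eventually_sequentially)
  qed
  then show "(\<lambda>n. integral\<^sup>L (distr M borel (T n)) f) \<longlonglongrightarrow> integral\<^sup>L ?\<mu> f"
   by (simp add: integral_distr)
 qed
qed

section \<open>Counts and sums over a sample\<close>

definition cnt :: "nat \<Rightarrow> (nat \<Rightarrow> real) \<Rightarrow> real set \<Rightarrow> nat" where
 "cnt n x S = card {i. i < n \<and> x i \<in> S}"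

definition esum :: "nat \<Rightarrow> (nat \<Rightarrow> real) \<Rightarrow> (nat \<Rightarrow> real) \<Rightarrow> real set \<Rightarrow> real" where
 "esum n x e S = (\<Sum>i | i < n \<and> x i \<in> S. e i)"

lemma cnt_Un: "S \<inter> T = {} \<Longrightarrow> cnt n x (S \<union> T) = cnt n x S + cnt n x T"
 unfolding cnt_def by (subst card_Un_disjoint[symmetric]) (auto intro!: arg_cong[where f=card])

lemma esum_Un: "S \<inter> T = {} \<Longrightarrow> esum n x e (S \<union> T) = esum n x e S + esum n x e T"
 unfolding esum_def by (subst sum.union_disjoint[symmetric]) (auto intro!: sum.cong)

lemma cnt_mono: "S \<subseteq> T \<Longrightarrow> cnt n x S \<le> cnt n x T"
 unfolding cnt_def by (intro card_mono) auto

lemma cnt_empty [simp]: "cnt n x {} = 0"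
 by (simp add: cnt_def)

lemma esum_empty [simp]: "esum n x e {} = 0"
 by (simp add: esum_def)

lemma cnt_indicator: "real (cnt n x S) = (\<Sum>i<n. indicator S (x i))"
proof -
 have "(\<Sum>i<n. indicator S (x i)) = (\<Sum>i | i < n \<and> x i \<in> S. 1::real)"
  by (rule sum.mono_neutral_cong_right) (auto simp: indicator_def)
 then show ?thesis by (simp add: cnt_def)
qed

lemma esum_indicator: "esum n x e S = (\<Sum>i<n. indicator S (x i) * e i)"
 unfolding esum_def by (rule sum.mono_neutral_cong_left) (auto simp: indicator_def)

text \<open>Inner probability, so that no measurability of the predicates is needed.\<close>

definition (in prob_space) likely :: "real \<Rightarrow> (nat \<Rightarrow> 'a \<Rightarrow> bool) \<Rightarrow> bool" where
 "likely \<epsilon> P \<longleftrightarrow> (\<forall>\<^sub>F n in sequentially. \<exists>A\<in>events. 1 - \<epsilon> \<le> prob A \<and> (\<forall>w\<in>A. P n w))"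

lemma (in prob_space) likely_mono:
 assumes "likely \<epsilon> P" "\<forall>\<^sub>F n in sequentially. \<forall>w\<in>space M. P n w \<longrightarrow> Q n w"
 shows "likely \<epsilon> Q"
 using assms unfolding likely_def
proof eventually_elim
 case (elim n)
 then show ?case using sets.sets_into_space by blast
qed

lemma (in prob_space) likely_conj:
 assumes "likely \<epsilon>1 P" "likely \<epsilon>2 Q"
 shows "likely (\<epsilon>1 + \<epsilon>2) (\<lambda>n w. P n w \<and> Q n w)"
 using assms unfolding likely_def
proof eventually_elim
 case (elim n)
 then obtain A B where AB: "A \<in> events" "1 - \<epsilon>1 \<le> prob A" "\<forall>w\<in>A. P n w" "B \<in> events" "1 - \<epsilon>2 \<le> prob B" "\<forall>w\<in>B. Q n w"
  by blast
 have "prob (A \<union> B) = prob A + prob B - prob (A \<inter> B)"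
  using AB by (intro measure_Un3) (auto simp: fmeasurable_eq_sets)
 then have "1 - (\<epsilon>1 + \<epsilon>2) \<le> prob (A \<inter> B)" using AB prob_le_1[of "A \<union> B"] by linarith
 then show ?case using AB by (intro bexI[of _ "A \<inter> B"]) auto
qed

lemma (in prob_space) likely_AE:
 assumes "\<And>n. 1 \<le> n \<Longrightarrow> AE w in M. P n w" and \<epsilon>: "0 \<le> \<epsilon>"
 shows "likely \<epsilon> P"
 unfolding likely_def
proof (rule eventually_sequentiallyI)
 fix n :: nat assume "1 \<le> n"
 from AE_E3[OF assms(1)[OF this]] obtain N where N: "N \<in> null_sets M" "\<And>w. w \<in> space M - N \<Longrightarrow> P n w" by blast
 have "prob (space M - N) = 1" using N(1) by (subst prob_compl) (auto simp: measure_eq_0_null_sets)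
 then show "\<exists>A\<in>events. 1 - \<epsilon> \<le> prob A \<and> (\<forall>w\<in>A. P n w)"
  using N \<epsilon> by (intro bexI[of _ "space M - N"]) auto
qed

lemma (in prob_space) likely_prob:
 assumes "\<forall>\<^sub>F n in sequentially. {w\<in>space M. \<not> P n w} \<in> events \<and> prob {w\<in>space M. \<not> P n w} \<le> \<epsilon>"
 shows "likely \<epsilon> P"
 using assms unfolding likely_def
proof eventually_elim
 case (elim n)
 let ?N = "{w\<in>space M. \<not> P n w}"
 have "prob (space M - ?N) = 1 - prob ?N" using elim by (intro prob_compl) auto
 then show ?case using elim by (intro bexI[of _ "space M - ?N"]) auto
qed

section \<open>The sample\<close>

context change_point_model
begin

lemma X_rv [measurable]: "X \<in> borel_measurable M" and \<xi>_rv [measurable]: "\<xi> \<in> borel_measurable M"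
 using indep_var_rv1[OF X_\<xi>_indep] indep_var_rv2[OF X_\<xi>_indep] by auto

lemma pair_rv [measurable]: "(\<lambda>w. (Xs i w, \<xi>s i w)) \<in> measurable M (borel \<Otimes>\<^sub>M borel)"
 using sample_indep by (auto simp: indep_vars_def)

lemma Xs_rv [measurable]: "Xs i \<in> borel_measurable M"
 using measurable_compose[OF pair_rv measurable_fst, of i] by simp

lemma \<xi>s_rv [measurable]: "\<xi>s i \<in> borel_measurable M"
 using measurable_compose[OF pair_rv measurable_snd, of i] by simp

lemma pair_law: "distr M (borel \<Otimes>\<^sub>M borel) (\<lambda>w. (Xs i w, \<xi>s i w)) = distr M borel X \<Otimes>\<^sub>M distr M borel \<xi>"
 using X_\<xi>_indep unfolding sample_copies indep_var_distribution_eq by simp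

lemma Xs_law: "distr M borel (Xs i) = distr M borel X"
proof -
 have "distr M borel (Xs i) = distr (distr M (borel \<Otimes>\<^sub>M borel) (\<lambda>w. (Xs i w, \<xi>s i w))) borel fst"
  by (subst distr_distr) (auto simp: comp_def)
 also have "\<dots> = distr M borel X" unfolding sample_copies by (subst distr_distr) (auto simp: comp_def)
 finally show ?thesis .
qed

lemma \<xi>s_law: "distr M borel (\<xi>s i) = distr M borel \<xi>"
proof -
 have "distr M borel (\<xi>s i) = distr (distr M (borel \<Otimes>\<^sub>M borel) (\<lambda>w. (Xs i w, \<xi>s i w))) borel snd"
  by (subst distr_distr) (auto simp: comp_def)
 also have "\<dots> = distr M borel \<xi>" unfolding sample_copies by (subst distr_distr) (auto simp: comp_def)
 finally show ?thesis .
qed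

lemma expectation_sample:
 fixes f :: "real \<times> real \<Rightarrow> 'c::{banach, second_countable_topology}"
 assumes [measurable]: "f \<in> borel_measurable (borel \<Otimes>\<^sub>M borel)"
 shows "expectation (\<lambda>w. f (Xs i w, \<xi>s i w)) = expectation (\<lambda>w. f (X w, \<xi> w))"
proof -
 have "expectation (\<lambda>w. f (Xs i w, \<xi>s i w)) = integral\<^sup>L (distr M (borel \<Otimes>\<^sub>M borel) (\<lambda>w. (Xs i w, \<xi>s i w))) f"
  by (subst integral_distr) auto
 then show ?thesis unfolding sample_copies by (subst (asm) integral_distr) auto
qed

lemma expectation_\<xi>s:
 fixes f :: "real \<Rightarrow> 'c::{banach, second_countable_topology}"
 assumes [measurable]: "f \<in> borel_measurable borel"
 shows "expectation (\<lambda>w. f (\<xi>s i w)) = expectation (\<lambda>w. f (\<xi> w))"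
 using expectation_sample[of "\<lambda>p. f (snd p)" i] by simp

lemma integrable_\<xi>s:
 fixes f :: "real \<Rightarrow> 'c::{banach, second_countable_topology}"
 assumes [measurable]: "f \<in> borel_measurable borel" and "integrable M (\<lambda>w. f (\<xi> w))"
 shows "integrable M (\<lambda>w. f (\<xi>s i w))"
proof -
 have "integrable (distr M borel \<xi>) f" using assms by (subst integrable_distr_eq) auto
 then show ?thesis unfolding \<xi>s_law[of i, symmetric] by (subst (asm) integrable_distr_eq) auto
qed

lemma prob_Xs: "B \<in> sets borel \<Longrightarrow> prob {w\<in>space M. Xs i w \<in> B} = prob {w\<in>space M. X w \<in> B}"
 using arg_cong[OF Xs_law[of i], of "\<lambda>N. measure N B"]
 by (simp add: measure_distr vimage_def Int_def conj_commute)

lemma \<xi>_integrable: "integrable M \<xi>"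
 by (rule square_integrable_imp_integrable[OF \<xi>_rv \<xi>_square_integrable])

lemma expectation_\<xi>: "expectation \<xi> = 0"
proof -
 have "expectation \<xi> = integral\<^sup>L (distr M borel \<xi>) (\<lambda>x. x)" by (subst integral_distr) auto
 also have "\<dots> = expectation (\<lambda>w. - \<xi> w)" unfolding \<xi>_symmetric[symmetric] by (subst integral_distr) auto
 finally show ?thesis by simp
qed

definition \<sigma>2 :: real where "\<sigma>2 = expectation (\<lambda>w. (\<xi> w)\<^sup>2)"

lemma \<sigma>2_nonneg: "0 \<le> \<sigma>2" unfolding \<sigma>2_def by simp

lemma \<xi>s_moments:
 "expectation (\<xi>s i) = 0" "integrable M (\<xi>s i)" "integrable M (\<lambda>w. (\<xi>s i w)\<^sup>2)" "expectation (\<lambda>w. (\<xi>s i w)\<^sup>2) = \<sigma>2"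
 using expectation_\<xi>s[of "\<lambda>x. x" i] integrable_\<xi>s[of "\<lambda>x. x" i] integrable_\<xi>s[of "\<lambda>x. x\<^sup>2" i] expectation_\<xi>s[of "\<lambda>x. x\<^sup>2" i]
  \<xi>_integrable expectation_\<xi> \<xi>_square_integrable
 by (simp_all add: \<sigma>2_def)

text \<open>Independence of the pairs across indices and of \<open>X\<close> and
  \<open>\<xi>\<close> within a pair combine to independence of all coordinates. It is used to
  freeze the design, and to separate the noise of selected observations from everything
  else.\<close>

lemma coordinates_indep: "indep_vars (\<lambda>_. borel) (case_sum Xs \<xi>s) UNIV"
proof -
 have rv: "random_variable borel (case_sum Xs \<xi>s k)" for k by (cases k) auto
 show ?thesis unfolding indep_vars_def2
 proof (intro conjI ballI)
  show "random_variable borel (case_sum Xs \<xi>s k)" for k by (rule rv)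
  show "indep_sets (\<lambda>k. {case_sum Xs \<xi>s k -` A \<inter> space M |A. A \<in> sets borel}) UNIV"
  proof (rule indep_setsI)
   show "{case_sum Xs \<xi>s k -` A \<inter> space M |A. A \<in> sets borel} \<subseteq> events" for k
    using rv[of k] by (auto intro: measurable_sets)
   fix A and J :: "(nat + nat) set"
   assume J: "J \<noteq> {}" "J \<subseteq> UNIV" "finite J" and A: "\<forall>j\<in>J. A j \<in> {case_sum Xs \<xi>s j -` A \<inter> space M |A. A \<in> sets borel}"
   then have "\<forall>j\<in>J. \<exists>B. B \<in> sets borel \<and> A j = case_sum Xs \<xi>s j -` B \<inter> space M" by auto
   then obtain B where B: "\<And>j. j \<in> J \<Longrightarrow> B j \<in> sets borel" "\<And>j. j \<in> J \<Longrightarrow> A j = case_sum Xs \<xi>s j -` B j \<inter> space M"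
    by metis
   define I where "I = {i. Inl i \<in> J \<or> Inr i \<in> J}"
   have I_eq: "I = (Inl -` J) \<union> (Inr -` J)" by (auto simp: I_def)
   have finI: "finite I" unfolding I_eq using J(3) by (auto intro!: finite_vimageI)
   have finv: "finite (Inl -` J)" "finite (Inr -` J)" "finite {i. Inl i \<in> J}" "finite {i. Inr i \<in> J}"
    using J(3) finite_vimageI[of J Inl] finite_vimageI[of J Inr] by (auto simp: vimage_def)
   have Ine: "I \<noteq> {}"
   proof -
    obtain k where "k \<in> J" using J(1) by auto
    then show ?thesis by (cases k) (auto simp: I_def)
   qed
   \<comment> \<open>A coordinate outside \<open>J\<close> gets the whole line, so that each index
     contributes a full rectangle and the extra factor is 1.\<close>
   define L where "L k = (if k \<in> J then B k else UNIV)" for k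
   have Lb[measurable]: "L k \<in> sets borel" for k using B(1) by (auto simp: L_def)
   have eq1: "(\<Inter>j\<in>J. A j) = (\<Inter>i\<in>I. (\<lambda>w. (Xs i w, \<xi>s i w)) -` (L (Inl i) \<times> L (Inr i)) \<inter> space M)"
   proof (intro set_eqI iffI)
    fix w assume "w \<in> (\<Inter>j\<in>J. A j)"
    then have "\<And>j. j \<in> J \<Longrightarrow> w \<in> A j" by blast
    then have *: "\<And>j. j \<in> J \<Longrightarrow> w \<in> case_sum Xs \<xi>s j -` B j \<inter> space M" using B(2) by blast
    have "w \<in> space M" using J(1) * by blast
    then show "w \<in> (\<Inter>i\<in>I. (\<lambda>w. (Xs i w, \<xi>s i w)) -` (L (Inl i) \<times> L (Inr i)) \<inter> space M)"
     using *[of "Inl _"] *[of "Inr _"] by (auto simp: L_def)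
   next
    fix w assume "w \<in> (\<Inter>i\<in>I. (\<lambda>w. (Xs i w, \<xi>s i w)) -` (L (Inl i) \<times> L (Inr i)) \<inter> space M)"
    then have *: "w \<in> (\<lambda>w. (Xs i w, \<xi>s i w)) -` (L (Inl i) \<times> L (Inr i)) \<inter> space M" if "i \<in> I" for i
     using that by blast
    show "w \<in> (\<Inter>j\<in>J. A j)"
    proof
     fix j assume j: "j \<in> J"
     show "w \<in> A j"
     proof (cases j)
      case (Inl i)
      then have "i \<in> I" using j by (auto simp: I_def)
      then show ?thesis using *[of i] j Inl by (auto simp: B(2) L_def)
     next
      case (Inr i)
      then have "i \<in> I" using j by (auto simp: I_def)
      then show ?thesis using *[of i] j Inr by (auto simp: B(2) L_def)
     qed
    qed
   qed
   have "prob (\<Inter>j\<in>J. A j) = (\<Prod>i\<in>I. prob ((\<lambda>w. (Xs i w, \<xi>s i w)) -` (L (Inl i) \<times> L (Inr i)) \<inter> space M))"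
    unfolding eq1 by (rule indep_varsD[OF sample_indep Ine finI]) auto
   also have "\<dots> = (\<Prod>i\<in>I. prob (Xs i -` L (Inl i) \<inter> space M) * prob (\<xi>s i -` L (Inr i) \<inter> space M))"
   proof (rule prod.cong)
    fix i
    interpret PX: prob_space "distr M borel (Xs i)" by (intro prob_space_distr) simp
    interpret Pxi: prob_space "distr M borel (\<xi>s i)" by (intro prob_space_distr) simp
    have "prob ((\<lambda>w. (Xs i w, \<xi>s i w)) -` (L (Inl i) \<times> L (Inr i)) \<inter> space M) =
      measure (distr M borel (Xs i) \<Otimes>\<^sub>M distr M borel (\<xi>s i)) (L (Inl i) \<times> L (Inr i))"
     unfolding Xs_law \<xi>s_law pair_law[of i, symmetric] by (subst measure_distr) auto
    also have "\<dots> = measure (distr M borel (Xs i)) (L (Inl i)) * measure (distr M borel (\<xi>s i)) (L (Inr i))"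
     by (simp add: measure_def Pxi.emeasure_pair_measure_Times enn2real_mult)
    finally show "prob ((\<lambda>w. (Xs i w, \<xi>s i w)) -` (L (Inl i) \<times> L (Inr i)) \<inter> space M) =
      prob (Xs i -` L (Inl i) \<inter> space M) * prob (\<xi>s i -` L (Inr i) \<inter> space M)"
     by (simp add: measure_distr)
   qed simp
   also have "\<dots> = (\<Prod>i\<in>I. prob (Xs i -` L (Inl i) \<inter> space M)) * (\<Prod>i\<in>I. prob (\<xi>s i -` L (Inr i) \<inter> space M))"
    by (rule prod.distrib)
   also have "(\<Prod>i\<in>I. prob (Xs i -` L (Inl i) \<inter> space M)) = (\<Prod>i\<in>Inl -` J. prob (A (Inl i)))"
    by (rule prod.mono_neutral_cong_right) (auto simp: finv I_def L_def B(2) prob_space)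
   also have "(\<Prod>i\<in>I. prob (\<xi>s i -` L (Inr i) \<inter> space M)) = (\<Prod>i\<in>Inr -` J. prob (A (Inr i)))"
    by (rule prod.mono_neutral_cong_right) (auto simp: finv I_def L_def B(2) prob_space)
   also have "(\<Prod>i\<in>Inl -` J. prob (A (Inl i))) * (\<Prod>i\<in>Inr -` J. prob (A (Inr i))) = (\<Prod>j\<in>Inl ` (Inl -` J) \<union> Inr ` (Inr -` J). prob (A j))"
    using finv(1,2) by (subst prod.union_disjoint) (auto simp: prod.reindex simp del: image_vimage_eq)
   also have "Inl ` (Inl -` J) \<union> Inr ` (Inr -` J) = J"
   proof (intro set_eqI iffI)
    fix x assume "x \<in> J" then show "x \<in> Inl ` (Inl -` J) \<union> Inr ` (Inr -` J)" by (cases x) auto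
   qed auto
   finally show "prob (\<Inter>j\<in>J. A j) = (\<Prod>j\<in>J. prob (A j))" .
  qed
 qed
qed

lemma \<xi>s_indep: "indep_vars (\<lambda>_. borel) \<xi>s J"
proof -
 have "indep_vars (\<lambda>_. borel) (\<lambda>i w. snd (Xs i w, \<xi>s i w)) J"
  using indep_vars_compose2[OF indep_vars_subset[OF sample_indep subset_UNIV], of J "\<lambda>_. snd" "\<lambda>_. borel"] by auto
 then show ?thesis by simp
qed

lemma Xs_indep: "indep_vars (\<lambda>_. borel) Xs J"
proof -
 have "indep_vars (\<lambda>_. borel) (\<lambda>i w. fst (Xs i w, \<xi>s i w)) J"
  using indep_vars_compose2[OF indep_vars_subset[OF sample_indep subset_UNIV], of J "\<lambda>_. fst" "\<lambda>_. borel"] by auto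
 then show ?thesis by simp
qed

lemma designs_noise_indep:
 "indep_var (PiM {..<n::nat} (\<lambda>_. borel)) (\<lambda>w. \<lambda>i\<in>{..<n}. Xs i w) (PiM {..<n} (\<lambda>_. borel)) (\<lambda>w. \<lambda>i\<in>{..<n}. \<xi>s i w)"
proof -
 have 1: "indep_var (PiM (Inl ` {..<n}) (\<lambda>_. borel)) (\<lambda>w. restrict (\<lambda>k. case_sum Xs \<xi>s k w) (Inl ` {..<n}))
   (PiM (Inr ` {..<n}) (\<lambda>_. borel)) (\<lambda>w. restrict (\<lambda>k. case_sum Xs \<xi>s k w) (Inr ` {..<n}))"
  by (rule indep_var_restrict[OF coordinates_indep]) auto
 have m1: "(\<lambda>f. \<lambda>i\<in>{..<n}. f (Inl i)) \<in> measurable (PiM (Inl ` {..<n}) (\<lambda>_::nat+nat. borel::real measure)) (PiM {..<n} (\<lambda>_. borel))"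
  by (intro measurable_restrict measurable_component_singleton) auto
 have m2: "(\<lambda>f. \<lambda>i\<in>{..<n}. f (Inr i)) \<in> measurable (PiM (Inr ` {..<n}) (\<lambda>_::nat+nat. borel::real measure)) (PiM {..<n} (\<lambda>_. borel))"
  by (intro measurable_restrict measurable_component_singleton) auto
 have e1: "(\<lambda>f. \<lambda>i\<in>{..<n}. f (Inl i)) \<circ> (\<lambda>w. restrict (\<lambda>k. case_sum Xs \<xi>s k w) (Inl ` {..<n})) = (\<lambda>w. \<lambda>i\<in>{..<n}. Xs i w)"
  by (auto simp: fun_eq_iff restrict_def)
 have e2: "(\<lambda>f. \<lambda>i\<in>{..<n}. f (Inr i)) \<circ> (\<lambda>w. restrict (\<lambda>k. case_sum Xs \<xi>s k w) (Inr ` {..<n})) = (\<lambda>w. \<lambda>i\<in>{..<n}. \<xi>s i w)"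
  by (auto simp: fun_eq_iff restrict_def)
 show ?thesis using indep_var_compose[OF 1 m1 m2] unfolding e1 e2 .
qed

text \<open>
 Given the design points, the sets \<open>{i < n. x i \<in> B \<and> s * x i \<le> s * x j}\<close> form a deterministic chain;
 summing over the finitely many possible chains transfers bounds for the noise.
\<close>

lemma random_chain:
 fixes s :: real and n :: nat and B :: "real set"
 defines "R x j \<equiv> {i. i < n \<and> x i \<in> B \<and> s * x i \<le> s * x j}"
 assumes B[measurable]: "B \<in> sets borel"
  and bad: "\<And>S. Measurable.pred (PiM {..<n} (\<lambda>_. borel)) (bad S)"
  and bound: "\<And>C. C \<subseteq> Pow {..<n} \<Longrightarrow> (\<And>S T. S \<in> C \<Longrightarrow> T \<in> C \<Longrightarrow> S \<subseteq> T \<or> T \<subseteq> S) \<Longrightarrow>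
   prob {w\<in>space M. \<exists>S\<in>C. bad S (\<lambda>i\<in>{..<n}. \<xi>s i w)} \<le> \<epsilon>"
 shows "{w\<in>space M. \<exists>j<n. bad (R (\<lambda>i. Xs i w) j) (\<lambda>i\<in>{..<n}. \<xi>s i w)} \<in> events"
  and "prob {w\<in>space M. \<exists>j<n. bad (R (\<lambda>i. Xs i w) j) (\<lambda>i\<in>{..<n}. \<xi>s i w)} \<le> \<epsilon>"
proof -
 let ?P = "PiM {..<n} (\<lambda>_. borel :: real measure)"
 define xv where "xv w = (\<lambda>i\<in>{..<n}. Xs i w)" for w
 define ev where "ev w = (\<lambda>i\<in>{..<n}. \<xi>s i w)" for w
 have ind: "indep_var ?P xv ?P ev" unfolding xv_def ev_def by (rule designs_noise_indep)
 have xvm[measurable]: "xv \<in> measurable M ?P" and evm[measurable]: "ev \<in> measurable M ?P"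
  using indep_var_rv1[OF ind] indep_var_rv2[OF ind] by auto
 note [measurable] = bad
 define \<C> where "\<C> = {C. C \<subseteq> Pow {..<n} \<and> (\<forall>S\<in>C. \<forall>T\<in>C. S \<subseteq> T \<or> T \<subseteq> S)}"
 have fin\<C>: "finite \<C>" by (rule finite_subset[of _ "Pow (Pow {..<n})"]) (auto simp: \<C>_def)
 have Rxv: "R (xv w) j = R (\<lambda>i. Xs i w) j" if "j < n" for w j using that by (auto simp: R_def xv_def)
 have R\<C>: "R x ` {..<n} \<in> \<C>" for x
 proof -
  have "R x j \<subseteq> R x k \<or> R x k \<subseteq> R x j" for j k
   by (cases "s * x j \<le> s * x k") (auto simp: R_def)
  then show ?thesis by (auto simp: \<C>_def R_def)
 qed
 have Rm: "Measurable.pred ?P (\<lambda>x. R x j = S)" if "j < n" "S \<subseteq> {..<n}" for j S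
 proof -
  have eq: "R x j = S \<longleftrightarrow> (\<forall>i\<in>{..<n}. (x i \<in> B \<and> s * x i \<le> s * x j) = (i \<in> S))" for x
   using that by (auto simp: R_def)
  show ?thesis unfolding eq
  proof (rule pred_intros_finite(3))
   fix i assume "i \<in> {..<n}"
   then have m: "(\<lambda>x. (x i, x j)) \<in> measurable ?P (borel \<Otimes>\<^sub>M borel)"
    using \<open>j < n\<close> by (intro measurable_Pair measurable_component_singleton) auto
   have "Measurable.pred (borel \<Otimes>\<^sub>M borel) (\<lambda>p. fst p \<in> B \<and> s * fst p \<le> s * snd p)"
    by measurable
   from measurable_compose[OF m this]
   have "Measurable.pred ?P (\<lambda>x. x i \<in> B \<and> s * x i \<le> s * x j)" by simp
   then show "Measurable.pred ?P (\<lambda>x. (x i \<in> B \<and> s * x i \<le> s * x j) = (i \<in> S))"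
    by (cases "i \<in> S") (auto dest: pred_intros_logic(2))
  qed simp
 qed
 have Cm: "{x \<in> space ?P. R x ` {..<n} = C} \<in> sets ?P" if "C \<in> \<C>" for C
 proof -
  have fC: "finite C" using that by (auto simp: \<C>_def intro: finite_subset[of _ "Pow {..<n}"])
  have eq: "R x ` {..<n} = C \<longleftrightarrow> (\<forall>j\<in>{..<n}. \<exists>S\<in>C. R x j = S) \<and> (\<forall>S\<in>C. \<exists>j\<in>{..<n}. R x j = S)" for x by auto
  have "Measurable.pred ?P (\<lambda>x. (\<forall>j\<in>{..<n}. \<exists>S\<in>C. R x j = S) \<and> (\<forall>S\<in>C. \<exists>j\<in>{..<n}. R x j = S))"
   using that fC by (intro pred_intros_logic(3) pred_intros_finite(3,4) Rm) (auto simp: \<C>_def)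
  then show ?thesis unfolding eq by (rule predE)
 qed
 have Em: "{x \<in> space ?P. \<exists>S\<in>C. bad S x} \<in> sets ?P" if "C \<in> \<C>" for C
 proof -
  have fC: "finite C" using that by (auto simp: \<C>_def intro: finite_subset[of _ "Pow {..<n}"])
  show ?thesis by (intro predE pred_intros_finite(4) bad fC)
 qed
 define E where "E C = (xv -` {x \<in> space ?P. R x ` {..<n} = C} \<inter> space M) \<inter> (ev -` {x \<in> space ?P. \<exists>S\<in>C. bad S x} \<inter> space M)" for C
 define G where "G C = xv -` {x \<in> space ?P. R x ` {..<n} = C} \<inter> space M" for C
 have sp: "xv w \<in> space ?P" "ev w \<in> space ?P" for w by (auto simp: xv_def ev_def space_PiM)
 have G_ev: "G C \<in> events" if "C \<in> \<C>" for C unfolding G_def using Cm[OF that] by measurable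
 have H_ev: "ev -` {x \<in> space ?P. \<exists>S\<in>C. bad S x} \<inter> space M \<in> events" if "C \<in> \<C>" for C using Em[OF that] by measurable
 have E_ev: "E C \<in> events" if "C \<in> \<C>" for C unfolding E_def using G_ev[OF that] H_ev[OF that] by (auto simp: G_def)
 have eq: "{w\<in>space M. \<exists>j<n. bad (R (\<lambda>i. Xs i w) j) (\<lambda>i\<in>{..<n}. \<xi>s i w)} = (\<Union>C\<in>\<C>. E C)"
 proof -
  have "(\<exists>j<n. bad (R (\<lambda>i. Xs i w) j) (ev w)) \<longleftrightarrow> (\<exists>S\<in>R (xv w) ` {..<n}. bad S (ev w))" for w
   by (auto simp: Rxv)
  then show ?thesis using R\<C> sp by (auto simp: E_def ev_def[symmetric])
 qed
 show "{w\<in>space M. \<exists>j<n. bad (R (\<lambda>i. Xs i w) j) (\<lambda>i\<in>{..<n}. \<xi>s i w)} \<in> events"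
  unfolding eq using E_ev fin\<C> by auto
 \<comment> \<open>The chain is a function of the design; for a fixed chain the bad event is one of
   the noise. Independence factors the two.\<close>
 have PE: "prob (E C) \<le> prob (G C) * \<epsilon>" if "C \<in> \<C>" for C
 proof -
  have "prob (E C) = prob ((\<lambda>w. (xv w, ev w)) -` ({x \<in> space ?P. R x ` {..<n} = C} \<times> {x \<in> space ?P. \<exists>S\<in>C. bad S x}) \<inter> space M)"
   by (rule arg_cong[where f=prob]) (auto simp: E_def)
  also have "\<dots> = prob (G C) * prob (ev -` {x \<in> space ?P. \<exists>S\<in>C. bad S x} \<inter> space M)"
   unfolding G_def by (rule indep_varD[OF ind Cm[OF that] Em[OF that]])
  also have "prob (ev -` {x \<in> space ?P. \<exists>S\<in>C. bad S x} \<inter> space M) = prob {w\<in>space M. \<exists>S\<in>C. bad S (\<lambda>i\<in>{..<n}. \<xi>s i w)}"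
   using sp by (intro arg_cong[where f=prob]) (auto simp: ev_def[symmetric])
  also have "\<dots> \<le> \<epsilon>" using that by (intro bound) (auto simp: \<C>_def)
  finally show ?thesis by (simp add: mult_left_mono)
 qed
 have \<epsilon>0: "0 \<le> \<epsilon>" using bound[of "{}"] by simp
 have "prob (\<Union>C\<in>\<C>. E C) \<le> (\<Sum>C\<in>\<C>. prob (E C))" using E_ev fin\<C> by (intro measure_UNION_le) auto
 also have "\<dots> \<le> (\<Sum>C\<in>\<C>. prob (G C) * \<epsilon>)" by (intro sum_mono PE)
 also have "\<dots> = (\<Sum>C\<in>\<C>. prob (G C)) * \<epsilon>" by (simp add: sum_distrib_right)
 also have "(\<Sum>C\<in>\<C>. prob (G C)) = prob (\<Union>C\<in>\<C>. G C)"
  using G_ev by (intro finite_measure_finite_Union[symmetric] fin\<C>) (auto simp: disjoint_family_on_def G_def)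
 also have "\<dots> * \<epsilon> \<le> 1 * \<epsilon>" using \<epsilon>0 by (intro mult_right_mono) auto
 finally show "prob {w\<in>space M. \<exists>j<n. bad (R (\<lambda>i. Xs i w) j) (\<lambda>i\<in>{..<n}. \<xi>s i w)} \<le> \<epsilon>" unfolding eq by simp
qed

text \<open>The extreme sample point in the direction \<open>s\<close> determines a half-line within
  the sample. Suprema over a continuum of thresholds thus reduce to maxima over sample
  points.\<close>

lemma half_line_set:
 fixes s :: real and x :: "nat \<Rightarrow> real"
 assumes P: "\<And>y y'. P y \<Longrightarrow> s * y' \<le> s * y \<Longrightarrow> P y'" and ne: "{i. i < n \<and> x i \<in> B \<and> P (x i)} \<noteq> {}"
 obtains j where "j < n" "{i. i < n \<and> x i \<in> B \<and> P (x i)} = {i. i < n \<and> x i \<in> B \<and> s * x i \<le> s * x j}"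
proof -
 let ?S = "{i. i < n \<and> x i \<in> B \<and> P (x i)}"
 have "Max ((\<lambda>i. s * x i) ` ?S) \<in> (\<lambda>i. s * x i) ` ?S" using ne by (intro Max_in) auto
 then obtain j where j: "j \<in> ?S" "Max ((\<lambda>i. s * x i) ` ?S) = s * x j" by auto
 have "s * x i \<le> s * x j" if "i \<in> ?S" for i unfolding j(2)[symmetric] using that by (intro Max_ge) auto
 then have "?S = {i. i < n \<and> x i \<in> B \<and> s * x i \<le> s * x j}" using j(1) P[of "x j"] by auto
 then show ?thesis using j(1) that by auto
qed

lemma sum_pred: "S \<subseteq> {..<n} \<Longrightarrow> (\<lambda>f. \<Sum>i\<in>S. f i) \<in> borel_measurable (PiM {..<n::nat} (\<lambda>_. borel :: real measure))"
 by (intro borel_measurable_sum measurable_component_singleton) auto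

text \<open>Each half-line is a member of the chain determined by the design, so Kolmogorov's
  inequality bounds all \<open>d\<close> at once. \<open>B\<close> holds the end of the interval
  that does not move, \<open>s\<close> the direction of growth.\<close>

lemma noise_sup_bound:
 fixes s :: real
 assumes B: "B \<in> sets borel" and P: "\<And>d y y'. P d y \<Longrightarrow> s * y' \<le> s * y \<Longrightarrow> P d y'" and \<epsilon>: "0 < \<epsilon>"
 shows "\<exists>C>0. likely \<epsilon> (\<lambda>n w. \<forall>d. \<bar>esum n (\<lambda>i. Xs i w) (\<lambda>i. \<xi>s i w) {y\<in>B. P d y}\<bar> < C * sqrt n)"
proof -
 \<comment> \<open>The level \<open>C * sqrt n\<close> gives the error \<sigma>2 / C^2; the added 1
   keeps \<open>C\<close> positive in the absence of noise.\<close>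
 define C where "C = sqrt ((\<sigma>2 + 1) / \<epsilon>)"
 have C: "0 < C" "C\<^sup>2 = (\<sigma>2 + 1) / \<epsilon>" using \<epsilon> \<sigma>2_nonneg by (auto simp: C_def)
 show ?thesis
 proof (rule exI[of _ C], rule conjI[OF C(1)])
  define N where "N n = {w\<in>space M. \<exists>j<n. C * sqrt n \<le> \<bar>\<Sum>i | i < n \<and> Xs i w \<in> B \<and> s * Xs i w \<le> s * Xs j w. \<xi>s i w\<bar>}" for n :: nat
  have N: "N n \<in> events \<and> prob (N n) \<le> \<epsilon>" if n: "1 \<le> n" for n
  proof -
   \<comment> \<open>The clause \<open>S \<subseteq> {..<n}\<close> makes the event measurable for
     every \<open>S\<close>, as \<open>random_chain\<close> asks.\<close>
   define bad where "bad S f \<longleftrightarrow> S \<subseteq> {..<n} \<and> C * sqrt n \<le> \<bar>\<Sum>i\<in>S. f i\<bar>" for S and f :: "nat \<Rightarrow> real"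
   have meas: "Measurable.pred (PiM {..<n} (\<lambda>_. borel)) (bad S)" for S
   proof (cases "S \<subseteq> {..<n}")
    case True
    note [measurable] = sum_pred[OF True]
    show ?thesis unfolding bad_def by measurable
   next
    case False
    then have "bad S = (\<lambda>_. False)" by (auto simp: bad_def fun_eq_iff)
    then show ?thesis by simp
   qed
   have bd: "prob {w\<in>space M. \<exists>S\<in>\<C>. bad S (\<lambda>i\<in>{..<n}. \<xi>s i w)} \<le> \<epsilon>"
    if \<C>: "\<C> \<subseteq> Pow {..<n}" "\<And>S T. S \<in> \<C> \<Longrightarrow> T \<in> \<C> \<Longrightarrow> S \<subseteq> T \<or> T \<subseteq> S" for \<C>
   proof -
    have "bad S (\<lambda>i\<in>{..<n}. \<xi>s i w) \<longleftrightarrow> C * sqrt n \<le> \<bar>\<Sum>i\<in>S. \<xi>s i w\<bar>" if "S \<in> \<C>" for S w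
    proof -
     have S: "S \<subseteq> {..<n}" using that \<C> by auto
     then have "(\<Sum>i\<in>S. (\<lambda>i\<in>{..<n}. \<xi>s i w) i) = (\<Sum>i\<in>S. \<xi>s i w)" by (intro sum.cong) auto
     then show ?thesis using S by (simp add: bad_def)
    qed
    then have "{w\<in>space M. \<exists>S\<in>\<C>. bad S (\<lambda>i\<in>{..<n}. \<xi>s i w)} = {w\<in>space M. \<exists>S\<in>\<C>. C * sqrt n \<le> \<bar>\<Sum>i\<in>S. \<xi>s i w\<bar>}"
     by auto
    also have "prob \<dots> \<le> real (card {..<n}) * \<sigma>2 / (C * sqrt n)\<^sup>2"
     using \<C> C n by (intro kolmogorov_chain \<xi>s_indep) (auto simp: \<xi>s_moments)
    also have "\<dots> = \<sigma>2 / C\<^sup>2" using n C by (simp add: power_mult_distrib)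
    also have "\<dots> = \<epsilon> * (\<sigma>2 / (\<sigma>2 + 1))" using \<epsilon> C by simp
    also have "\<dots> \<le> \<epsilon> * 1" using \<epsilon> \<sigma>2_nonneg by (intro mult_left_mono) (auto simp: divide_le_eq)
    finally show ?thesis by simp
   qed
   have "(\<exists>j<n. bad {i. i < n \<and> Xs i w \<in> B \<and> s * Xs i w \<le> s * Xs j w} (\<lambda>i\<in>{..<n}. \<xi>s i w)) \<longleftrightarrow>
     (\<exists>j<n. C * sqrt n \<le> \<bar>\<Sum>i | i < n \<and> Xs i w \<in> B \<and> s * Xs i w \<le> s * Xs j w. \<xi>s i w\<bar>)" for w
   proof -
    have "(\<Sum>i | i < n \<and> Xs i w \<in> B \<and> s * Xs i w \<le> s * Xs j w. (\<lambda>i\<in>{..<n}. \<xi>s i w) i) = (\<Sum>i | i < n \<and> Xs i w \<in> B \<and> s * Xs i w \<le> s * Xs j w. \<xi>s i w)" for j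
     by (intro sum.cong) auto
    then show ?thesis unfolding bad_def by auto
   qed
   then have eq: "N n = {w\<in>space M. \<exists>j<n. bad {i. i < n \<and> Xs i w \<in> B \<and> s * Xs i w \<le> s * Xs j w} (\<lambda>i\<in>{..<n}. \<xi>s i w)}"
    unfolding N_def by (simp only:)
   show ?thesis unfolding eq by (rule conjI; rule random_chain[OF B meas bd])
  qed
  have "likely \<epsilon> (\<lambda>n w. w \<notin> N n)"
  proof (rule likely_prob, rule eventually_sequentiallyI[of 1])
   fix n :: nat assume "1 \<le> n"
   moreover have "{w\<in>space M. \<not> w \<notin> N n} = N n" by (auto simp: N_def)
   ultimately show "{w\<in>space M. \<not> w \<notin> N n} \<in> events \<and> prob {w\<in>space M. \<not> w \<notin> N n} \<le> \<epsilon>"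
    using N by simp
  qed
  then show "likely \<epsilon> (\<lambda>n w. \<forall>d. \<bar>esum n (\<lambda>i. Xs i w) (\<lambda>i. \<xi>s i w) {y\<in>B. P d y}\<bar> < C * sqrt n)"
  proof (rule likely_mono, intro eventually_sequentiallyI[of 1] ballI impI allI)
   fix n :: nat and w d assume n: "1 \<le> n" and w: "w \<in> space M" "w \<notin> N n"
   let ?S = "{i. i < n \<and> Xs i w \<in> B \<and> P d (Xs i w)}"
   show "\<bar>esum n (\<lambda>i. Xs i w) (\<lambda>i. \<xi>s i w) {y\<in>B. P d y}\<bar> < C * sqrt n"
   proof (cases "?S = {}")
    case True
    then have "{i. i < n \<and> Xs i w \<in> {y\<in>B. P d y}} = {}" by auto
    then have "esum n (\<lambda>i. Xs i w) (\<lambda>i. \<xi>s i w) {y\<in>B. P d y} = 0" unfolding esum_def by (simp only: sum.empty)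
    then show ?thesis using C n by simp
   next
    case False
    obtain j where "j < n" "?S = {i. i < n \<and> Xs i w \<in> B \<and> s * Xs i w \<le> s * Xs j w}"
     by (rule half_line_set[of "P d" s, OF P False])
    then show ?thesis using w by (auto simp: N_def esum_def not_le)
   qed
  qed
 qed
qed

text \<open>Needed for drift against noise near the change point: once an interval holds
  \<open>k0\<close> points, its noise sum is a small fraction of its count, with \<open>k0\<close>
  independent of \<open>n\<close>. It is the chain form of the strong law, applied after fixing the
  design.\<close>

lemma noise_strong_law:
 fixes s c :: real
 assumes B: "B \<in> sets borel" and P: "\<And>d y y'. P d y \<Longrightarrow> s * y' \<le> s * y \<Longrightarrow> P d y'" and \<epsilon>: "0 < \<epsilon>" and c: "0 < c"
 shows "\<exists>k0>0. likely \<epsilon> (\<lambda>n w. \<forall>d. k0 \<le> cnt n (\<lambda>i. Xs i w) {y\<in>B. P d y} \<longrightarrow>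
   \<bar>esum n (\<lambda>i. Xs i w) (\<lambda>i. \<xi>s i w) {y\<in>B. P d y}\<bar> < c * cnt n (\<lambda>i. Xs i w) {y\<in>B. P d y})"
proof -
 \<comment> \<open>Read off from the bound 4 \<sigma>2 / (c^2 k0) of
   \<open>chain_strong_law\<close>.\<close>
 obtain k0 :: nat where k: "4 * \<sigma>2 / (c\<^sup>2 * \<epsilon>) < k0" using reals_Archimedean2 by blast
 have "0 \<le> 4 * \<sigma>2 / (c\<^sup>2 * \<epsilon>)" using c \<epsilon> \<sigma>2_nonneg by simp
 then have "0 < real k0" using k by linarith
 then have k0: "0 < k0" by simp
 then have k0': "4 * \<sigma>2 / (c\<^sup>2 * k0) \<le> \<epsilon>" using k c \<epsilon> by (simp add: field_simps)
 show ?thesis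
 proof (rule exI[of _ k0], rule conjI[OF k0])
  define N where "N n = {w\<in>space M. \<exists>j<n. k0 \<le> card {i. i < n \<and> Xs i w \<in> B \<and> s * Xs i w \<le> s * Xs j w} \<and>
    c * card {i. i < n \<and> Xs i w \<in> B \<and> s * Xs i w \<le> s * Xs j w} \<le> \<bar>\<Sum>i | i < n \<and> Xs i w \<in> B \<and> s * Xs i w \<le> s * Xs j w. \<xi>s i w\<bar>}" for n :: nat
  have N: "N n \<in> events \<and> prob (N n) \<le> \<epsilon>" for n
  proof -
   define bad where "bad S f \<longleftrightarrow> S \<subseteq> {..<n} \<and> k0 \<le> card S \<and> c * card S \<le> \<bar>\<Sum>i\<in>S. f i\<bar>" for S and f :: "nat \<Rightarrow> real"
   have meas: "Measurable.pred (PiM {..<n} (\<lambda>_. borel)) (bad S)" for S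
   proof (cases "S \<subseteq> {..<n}")
    case True
    note [measurable] = sum_pred[OF True]
    show ?thesis unfolding bad_def by measurable
   next
    case False
    then have "bad S = (\<lambda>_. False)" by (auto simp: bad_def fun_eq_iff)
    then show ?thesis by simp
   qed
   have bd: "prob {w\<in>space M. \<exists>S\<in>\<C>. bad S (\<lambda>i\<in>{..<n}. \<xi>s i w)} \<le> \<epsilon>"
    if \<C>: "\<C> \<subseteq> Pow {..<n}" "\<And>S T. S \<in> \<C> \<Longrightarrow> T \<in> \<C> \<Longrightarrow> S \<subseteq> T \<or> T \<subseteq> S" for \<C>
   proof -
    have "bad S (\<lambda>i\<in>{..<n}. \<xi>s i w) \<longleftrightarrow> k0 \<le> card S \<and> c * card S \<le> \<bar>\<Sum>i\<in>S. \<xi>s i w\<bar>" if "S \<in> \<C>" for S w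
    proof -
     have S: "S \<subseteq> {..<n}" using that \<C> by auto
     then have "(\<Sum>i\<in>S. (\<lambda>i\<in>{..<n}. \<xi>s i w) i) = (\<Sum>i\<in>S. \<xi>s i w)" by (intro sum.cong) auto
     then show ?thesis using S by (simp add: bad_def)
    qed
    then have "{w\<in>space M. \<exists>S\<in>\<C>. bad S (\<lambda>i\<in>{..<n}. \<xi>s i w)} = {w\<in>space M. \<exists>S\<in>\<C>. k0 \<le> card S \<and> c * card S \<le> \<bar>\<Sum>i\<in>S. \<xi>s i w\<bar>}"
     by auto
    also have "prob \<dots> \<le> 4 * \<sigma>2 / (c\<^sup>2 * k0)"
     using \<C> c k0 \<sigma>2_nonneg by (intro chain_strong_law[where J="{..<n}"] \<xi>s_indep) (auto simp: \<xi>s_moments)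
    also have "\<dots> \<le> \<epsilon>" by (rule k0')
    finally show ?thesis .
   qed
   have "(\<exists>j<n. bad {i. i < n \<and> Xs i w \<in> B \<and> s * Xs i w \<le> s * Xs j w} (\<lambda>i\<in>{..<n}. \<xi>s i w)) \<longleftrightarrow>
     (\<exists>j<n. k0 \<le> card {i. i < n \<and> Xs i w \<in> B \<and> s * Xs i w \<le> s * Xs j w} \<and>
    c * card {i. i < n \<and> Xs i w \<in> B \<and> s * Xs i w \<le> s * Xs j w} \<le> \<bar>\<Sum>i | i < n \<and> Xs i w \<in> B \<and> s * Xs i w \<le> s * Xs j w. \<xi>s i w\<bar>)" for w
   proof -
    have "(\<Sum>i | i < n \<and> Xs i w \<in> B \<and> s * Xs i w \<le> s * Xs j w. (\<lambda>i\<in>{..<n}. \<xi>s i w) i) = (\<Sum>i | i < n \<and> Xs i w \<in> B \<and> s * Xs i w \<le> s * Xs j w. \<xi>s i w)" for j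
     by (intro sum.cong) auto
    then show ?thesis unfolding bad_def by auto
   qed
   then have eq: "N n = {w\<in>space M. \<exists>j<n. bad {i. i < n \<and> Xs i w \<in> B \<and> s * Xs i w \<le> s * Xs j w} (\<lambda>i\<in>{..<n}. \<xi>s i w)}"
    unfolding N_def by (simp only:)
   show ?thesis unfolding eq by (rule conjI; rule random_chain[OF B meas bd])
  qed
  have "likely \<epsilon> (\<lambda>n w. w \<notin> N n)"
  proof (rule likely_prob, rule always_eventually, rule allI)
   fix n :: nat
   have "{w\<in>space M. \<not> w \<notin> N n} = N n" by (auto simp: N_def)
   then show "{w\<in>space M. \<not> w \<notin> N n} \<in> events \<and> prob {w\<in>space M. \<not> w \<notin> N n} \<le> \<epsilon>"
    using N by simp
  qed
  then show "likely \<epsilon> (\<lambda>n w. \<forall>d. k0 \<le> cnt n (\<lambda>i. Xs i w) {y\<in>B. P d y} \<longrightarrow>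
   \<bar>esum n (\<lambda>i. Xs i w) (\<lambda>i. \<xi>s i w) {y\<in>B. P d y}\<bar> < c * cnt n (\<lambda>i. Xs i w) {y\<in>B. P d y})"
  proof (rule likely_mono, intro always_eventually ballI impI allI)
   fix n :: nat and w d assume w: "w \<in> space M" "w \<notin> N n"
   let ?S = "{i. i < n \<and> Xs i w \<in> B \<and> P d (Xs i w)}"
   assume le: "k0 \<le> cnt n (\<lambda>i. Xs i w) {y\<in>B. P d y}"
   have ne: "?S \<noteq> {}"
   proof
    assume "?S = {}"
    then have "cnt n (\<lambda>i. Xs i w) {y\<in>B. P d y} = 0" unfolding cnt_def mem_Collect_eq by (simp only: card.empty)
    then show False using le k0 by simp
   qed
   obtain j where "j < n" "?S = {i. i < n \<and> Xs i w \<in> B \<and> s * Xs i w \<le> s * Xs j w}"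
    by (rule half_line_set[of "P d" s, OF P ne])
   then show "\<bar>esum n (\<lambda>i. Xs i w) (\<lambda>i. \<xi>s i w) {y\<in>B. P d y}\<bar> < c * cnt n (\<lambda>i. Xs i w) {y\<in>B. P d y}"
    using w le by (auto simp: N_def esum_def cnt_def not_le)
  qed
 qed
qed

end

section \<open>Laws of large numbers for the design\<close>

context change_point_model
begin

text \<open>The variance of an indicator is bounded by \<open>p\<close> and not by a constant: the
  estimate is also applied to windows of mass O(1 / n), where \<open>n * p\<close> stays
  bounded.\<close>

lemma cnt_deviation:
 fixes n :: nat and p :: real
 assumes B[measurable]: "B \<in> sets borel" and t: "0 < t"
 defines "p \<equiv> prob {w\<in>space M. X w \<in> B}"
 shows "{w\<in>space M. t \<le> \<bar>cnt n (\<lambda>i. Xs i w) B - n * p\<bar>} \<in> events"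
  and "prob {w\<in>space M. t \<le> \<bar>cnt n (\<lambda>i. Xs i w) B - n * p\<bar>} \<le> n * p / t\<^sup>2"
proof -
 define Y where "Y i w = indicator B (Xs i w) - p" for i w
 have Ym[measurable]: "Y i \<in> borel_measurable M" for i unfolding Y_def by measurable
 have ind: "indep_vars (\<lambda>_. borel) Y {..<n}"
  unfolding Y_def by (rule indep_vars_compose2[OF Xs_indep]) measurable
 have Ei: "expectation (\<lambda>w. indicator B (Xs i w)) = p" for i
 proof -
  have "expectation (\<lambda>w. indicator B (Xs i w)) = expectation (indicator {w\<in>space M. Xs i w \<in> B})"
   by (rule Bochner_Integration.integral_cong) (auto simp: indicator_def)
  also have "\<dots> = prob {w\<in>space M. Xs i w \<in> B}" by simp
  also have "\<dots> = p" unfolding p_def by (rule prob_Xs) measurable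
  finally show ?thesis .
 qed
 have ii: "integrable M (\<lambda>w. indicator B (Xs i w) :: real)" for i
  by (rule integrable_const_bound[of _ 1]) (auto simp: indicator_def)
 have p01: "0 \<le> p" "p \<le> 1" by (auto simp: p_def)
 have sqi: "integrable M (\<lambda>w. (Y i w)\<^sup>2)" for i
 proof (rule integrable_const_bound[of _ 1])
  have "\<bar>Y i w\<bar> \<le> 1" for w using p01 by (auto simp: Y_def indicator_def)
  then have "\<bar>Y i w\<bar>\<^sup>2 \<le> 1\<^sup>2" for w by (intro power_mono) auto
  then show "AE w in M. norm ((Y i w)\<^sup>2) \<le> 1" by simp
 qed simp
 have var: "expectation (\<lambda>w. (Y i w)\<^sup>2) \<le> p" for i
 proof -
  have "(Y i w)\<^sup>2 = (1 - 2 * p) * indicator B (Xs i w) + p\<^sup>2" for w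
   by (auto simp: Y_def indicator_def power2_eq_square algebra_simps)
  then have "expectation (\<lambda>w. (Y i w)\<^sup>2) = (1 - 2 * p) * p + p\<^sup>2"
   using ii Ei by (simp add: prob_space)
  also have "\<dots> = p - p\<^sup>2" by (simp add: power2_eq_square algebra_simps)
  finally show ?thesis by simp
 qed
 have EY: "expectation (Y i) = 0" for i
 proof -
  have "expectation (\<lambda>w. indicator B (Xs i w) - p) = 0" using ii Ei by (simp add: prob_space)
  moreover have "Y i = (\<lambda>w. indicator B (Xs i w) - p)" by (simp add: Y_def fun_eq_iff)
  ultimately show ?thesis by simp
 qed
 \<comment> \<open>A chain with one member turns the maximal inequality into Chebyshev's.\<close>
 have eq: "{w\<in>space M. t \<le> \<bar>cnt n (\<lambda>i. Xs i w) B - n * p\<bar>} = {w\<in>space M. \<exists>S\<in>{{..<n}}. t \<le> \<bar>\<Sum>i\<in>S. Y i w\<bar>}"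
  by (simp add: Y_def cnt_indicator sum_subtractf)
 show "{w\<in>space M. t \<le> \<bar>cnt n (\<lambda>i. Xs i w) B - n * p\<bar>} \<in> events"
  unfolding eq by simp
 have "prob {w\<in>space M. \<exists>S\<in>{{..<n}}. t \<le> \<bar>\<Sum>i\<in>S. Y i w\<bar>} \<le> real (card {..<n}) * p / t\<^sup>2"
  by (rule kolmogorov_chain[OF ind]) (use sqi var t EY in auto)
 then show "prob {w\<in>space M. t \<le> \<bar>cnt n (\<lambda>i. Xs i w) B - n * p\<bar>} \<le> n * p / t\<^sup>2" unfolding eq by simp
qed

lemma cnt_law_of_large_numbers:
 assumes B: "B \<in> sets borel" and \<epsilon>: "0 < \<epsilon>" and \<eta>: "0 < \<eta>"
 shows "likely \<epsilon> (\<lambda>n w. \<bar>cnt n (\<lambda>i. Xs i w) B / n - prob {w\<in>space M. X w \<in> B}\<bar> < \<eta>)"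
proof (rule likely_prob)
 let ?p = "prob {w\<in>space M. X w \<in> B}"
 show "\<forall>\<^sub>F n in sequentially. {w\<in>space M. \<not> \<bar>cnt n (\<lambda>i. Xs i w) B / n - ?p\<bar> < \<eta>} \<in> events \<and>
   prob {w\<in>space M. \<not> \<bar>cnt n (\<lambda>i. Xs i w) B / n - ?p\<bar> < \<eta>} \<le> \<epsilon>"
  using eventually_ge_at_top[of "nat \<lceil>1 / (\<eta>\<^sup>2 * \<epsilon>)\<rceil>"] eventually_ge_at_top[of 1]
 proof eventually_elim
  case (elim n)
  have n: "1 \<le> n" "1 / (\<eta>\<^sup>2 * \<epsilon>) \<le> n" using elim by linarith+
  have "\<not> \<bar>c / n - ?p\<bar> < \<eta> \<longleftrightarrow> \<eta> * n \<le> \<bar>c - n * ?p\<bar>" for c :: real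
  proof -
   have "c / n - ?p = (c - n * ?p) / n" using n by (simp add: field_simps)
   then have "\<bar>c / n - ?p\<bar> = \<bar>c - n * ?p\<bar> / n" by (simp only: abs_divide abs_of_nat)
   then show ?thesis using n by (simp add: not_less field_simps)
  qed
  then have eq: "{w\<in>space M. \<not> \<bar>cnt n (\<lambda>i. Xs i w) B / n - ?p\<bar> < \<eta>} = {w\<in>space M. \<eta> * n \<le> \<bar>cnt n (\<lambda>i. Xs i w) B - n * ?p\<bar>}" by simp
  have "real n * ?p / (\<eta> * n)\<^sup>2 \<le> real n * 1 / (\<eta> * n)\<^sup>2" by (intro divide_right_mono mult_left_mono prob_le_1 of_nat_0_le_iff zero_le_power2)
  also have "\<dots> = 1 / (\<eta>\<^sup>2 * n)" using n by (simp add: power2_eq_square)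
  also have "\<dots> \<le> \<epsilon>" using n \<eta> \<epsilon> by (simp add: field_simps)
  finally show ?case unfolding eq using cnt_deviation[OF B, of "\<eta> * n" n] \<eta> n by auto
 qed
qed

text \<open>Chebyshev's inequality at half the mean q. The first lower bound on \<open>c\<close>
  puts \<open>k0\<close> below half the mean, the second makes the error 4 / q at most
  \<epsilon>.\<close>

lemma cnt_large:
 assumes B: "\<And>n. B n \<in> sets borel" and lim: "(\<lambda>n. n * prob {w\<in>space M. X w \<in> B n}) \<longlonglongrightarrow> c"
  and c: "2 * real k0 < c" "4 / \<epsilon> < c" and \<epsilon>: "0 < \<epsilon>"
 shows "likely \<epsilon> (\<lambda>n w. k0 \<le> cnt n (\<lambda>i. Xs i w) (B n))"
proof (rule likely_mono)
 let ?q = "\<lambda>n. n * prob {w\<in>space M. X w \<in> B n}"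
 have ev: "\<forall>\<^sub>F n in sequentially. 2 * real k0 < ?q n \<and> 4 / \<epsilon> < ?q n"
  using order_tendstoD(1)[OF lim c(1)] order_tendstoD(1)[OF lim c(2)] by eventually_elim auto
 show "likely \<epsilon> (\<lambda>n w. \<not> ?q n / 2 \<le> \<bar>cnt n (\<lambda>i. Xs i w) (B n) - ?q n\<bar>)"
 proof (rule likely_prob)
  show "\<forall>\<^sub>F n in sequentially. {w\<in>space M. \<not> \<not> ?q n / 2 \<le> \<bar>cnt n (\<lambda>i. Xs i w) (B n) - ?q n\<bar>} \<in> events \<and>
   prob {w\<in>space M. \<not> \<not> ?q n / 2 \<le> \<bar>cnt n (\<lambda>i. Xs i w) (B n) - ?q n\<bar>} \<le> \<epsilon>"
   using ev
  proof eventually_elim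
   case (elim n)
   have q: "0 < ?q n" using elim by linarith
   then have q2: "0 < ?q n / 2" by simp
   have "r / (r / 2)\<^sup>2 = 4 / r" if "0 < r" for r :: real using that by (simp add: power2_eq_square)
   from this[OF q] have "?q n / (?q n / 2)\<^sup>2 = 4 / ?q n" .
   also have "\<dots> \<le> \<epsilon>" using elim \<epsilon> q by (simp add: field_simps)
   finally have le: "?q n / (?q n / 2)\<^sup>2 \<le> \<epsilon>" .
   note d = cnt_deviation[OF B[of n] q2, of n]
   show ?case unfolding not_not by (intro conjI d(1) order_trans[OF d(2) le])
  qed
 qed
 show "\<forall>\<^sub>F n in sequentially. \<forall>w\<in>space M. \<not> ?q n / 2 \<le> \<bar>cnt n (\<lambda>i. Xs i w) (B n) - ?q n\<bar> \<longrightarrow> k0 \<le> cnt n (\<lambda>i. Xs i w) (B n)"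
  using ev
 proof eventually_elim
  case (elim n)
  show ?case
  proof (intro ballI impI)
   fix w assume "\<not> ?q n / 2 \<le> \<bar>cnt n (\<lambda>i. Xs i w) (B n) - ?q n\<bar>"
   then have "real k0 < cnt n (\<lambda>i. Xs i w) (B n)" using elim by linarith
   then show "k0 \<le> cnt n (\<lambda>i. Xs i w) (B n)" by simp
  qed
 qed
qed

text \<open>Markov's inequality: design and noise are independent, so the expectation is the mean
  number of points times \<open>1 + E \<bar>\<xi>\<bar>\<close>, and this converges.\<close>

lemma window_sum_bounded:
 assumes B: "\<And>n. B n \<in> sets borel" and lim: "(\<lambda>n. n * prob {w\<in>space M. X w \<in> B n}) \<longlonglongrightarrow> c"
  and \<epsilon>: "0 < \<epsilon>"
 shows "\<exists>C>0. likely \<epsilon> (\<lambda>n w. cnt n (\<lambda>i. Xs i w) (B n) + esum n (\<lambda>i. Xs i w) (\<lambda>i. \<bar>\<xi>s i w\<bar>) (B n) < C)"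
proof -
 note [measurable] = B
 let ?q = "\<lambda>n. n * prob {w\<in>space M. X w \<in> B n}"
 define m where "m = expectation (\<lambda>w. 1 + \<bar>\<xi> w\<bar>)"
 have mi: "integrable M (\<lambda>w. 1 + \<bar>\<xi> w\<bar>)" using \<xi>_integrable by auto
 have m0: "0 \<le> m" unfolding m_def by simp
 have c0: "0 \<le> c" by (rule LIMSEQ_le_const[OF lim]) auto
 define C where "C = ((c + 1) * m + 1) / \<epsilon>"
 have C: "0 < C" using \<epsilon> c0 m0 by (auto simp: C_def intro!: divide_pos_pos add_nonneg_pos)
 define u where "u n w = (\<Sum>i<n. indicator (B n) (Xs i w) * (1 + \<bar>\<xi>s i w\<bar>))" for n w
 have u: "u n w = cnt n (\<lambda>i. Xs i w) (B n) + esum n (\<lambda>i. Xs i w) (\<lambda>i. \<bar>\<xi>s i w\<bar>) (B n)" for n w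
  by (simp add: u_def cnt_indicator esum_indicator sum.distrib algebra_simps)
 have E1: "integrable M (\<lambda>w. indicator (B n) (Xs i w) * (1 + \<bar>\<xi>s i w\<bar>))"
  "expectation (\<lambda>w. indicator (B n) (Xs i w) * (1 + \<bar>\<xi>s i w\<bar>)) = prob {w\<in>space M. X w \<in> B n} * m" for n i
 proof -
  have "integrable M (\<lambda>w. 1 + \<bar>\<xi>s i w\<bar>)" using \<xi>s_moments(2) by auto
  then show "integrable M (\<lambda>w. indicator (B n) (Xs i w) * (1 + \<bar>\<xi>s i w\<bar>))"
   by (rule Bochner_Integration.integrable_bound) (auto simp: indicator_def)
  have "expectation (\<lambda>w. indicator (B n) (Xs i w) * (1 + \<bar>\<xi>s i w\<bar>)) = expectation (\<lambda>w. indicator (B n) (X w) * (1 + \<bar>\<xi> w\<bar>))"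
   using expectation_sample[of "\<lambda>p. indicator (B n) (fst p) * (1 + \<bar>snd p\<bar>)" i] by simp
  also have "\<dots> = expectation (\<lambda>w. indicator (B n) (X w)) * m"
   unfolding m_def
  proof (rule indep_var_lebesgue_integral)
   show "indep_var borel (\<lambda>w. indicator (B n) (X w) :: real) borel (\<lambda>w. 1 + \<bar>\<xi> w\<bar>)"
    using indep_var_compose[OF X_\<xi>_indep, of "indicator (B n)" borel "\<lambda>x. 1 + \<bar>x\<bar>" borel] by (simp add: comp_def)
   show "integrable M (\<lambda>w. indicator (B n) (X w) :: real)" by (rule integrable_const_bound[of _ 1]) (auto simp: indicator_def)
  qed (rule mi)
  also have "expectation (\<lambda>w. indicator (B n) (X w)) = expectation (indicator {w\<in>space M. X w \<in> B n})"
   by (rule Bochner_Integration.integral_cong) (auto simp: indicator_def)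
  also have "\<dots> = prob {w\<in>space M. X w \<in> B n}" by simp
  finally show "expectation (\<lambda>w. indicator (B n) (Xs i w) * (1 + \<bar>\<xi>s i w\<bar>)) = prob {w\<in>space M. X w \<in> B n} * m" .
 qed
 have ui: "integrable M (u n)" for n unfolding u_def using E1(1) by (intro Bochner_Integration.integrable_sum) auto
 have uE: "expectation (u n) = ?q n * m" for n
  unfolding u_def by (subst Bochner_Integration.integral_sum) (use E1 in auto)
 have um[measurable]: "u n \<in> borel_measurable M" for n using ui by auto
 show ?thesis
 proof (rule exI[of _ C], rule conjI[OF C], rule likely_prob)
  have "\<forall>\<^sub>F n in sequentially. ?q n < c + 1" by (rule order_tendstoD(2)[OF lim]) simp
  then show "\<forall>\<^sub>F n in sequentially.
    {w\<in>space M. \<not> cnt n (\<lambda>i. Xs i w) (B n) + esum n (\<lambda>i. Xs i w) (\<lambda>i. \<bar>\<xi>s i w\<bar>) (B n) < C} \<in> events \<and>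
    prob {w\<in>space M. \<not> cnt n (\<lambda>i. Xs i w) (B n) + esum n (\<lambda>i. Xs i w) (\<lambda>i. \<bar>\<xi>s i w\<bar>) (B n) < C} \<le> \<epsilon>"
  proof eventually_elim
   case (elim n)
   have "prob {w\<in>space M. C \<le> u n w} \<le> expectation (u n) / C"
    by (rule integral_Markov_inequality_measure[OF ui, of "space M"]) (use C in \<open>auto simp: u_def indicator_def intro!: sum_nonneg\<close>)
   also have "\<dots> \<le> ((c + 1) * m + 1) / C" unfolding uE using elim m0 C
    by (intro divide_right_mono) (auto intro: order_trans[OF mult_right_mono[of "?q n" "c+1" m]])
   also have "\<dots> = \<epsilon>" using C \<epsilon> by (simp add: C_def field_simps)
   finally show ?case by (simp add: u[symmetric] not_less)
  qed
 qed
qed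

end

section \<open>Mass of the design near the change point\<close>

locale regular_change_point_model = change_point_model +
 assumes density_cont: "isCont f_X d\<^sub>0" and density_pos: "0 < f_X d\<^sub>0"
begin

text \<open>The only place where continuity of the density at the change point acts: on a window of
  width O(1 / n) the density is nearly constant.\<close>

lemma local_mass:
 fixes a b :: real
 assumes ab: "a \<le> b"
 shows "(\<lambda>n::nat. real n * prob {w\<in>space M. X w \<in> {d\<^sub>0 + a / real n<..d\<^sub>0 + b / real n}}) \<longlonglongrightarrow> f_X d\<^sub>0 * (b - a)"
proof (rule LIMSEQ_I)
 fix r :: real assume r: "0 < r"
 \<comment> \<open>The added 1 avoids a division by 0 when \<open>a = b\<close>.\<close>
 define e where "e = r / (2 * (b - a + 1))"
 have e: "0 < e" "e * (b - a) < r"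
 proof -
  show "0 < e" using r ab by (auto simp: e_def)
  have "r * (b - a) < r * (2 * (b - a + 1))" using r ab by (intro mult_strict_left_mono) auto
  then show "e * (b - a) < r" using ab by (simp add: e_def divide_less_eq)
 qed
 obtain \<delta> where \<delta>: "0 < \<delta>" "\<And>x. \<bar>x - d\<^sub>0\<bar> < \<delta> \<Longrightarrow> \<bar>f_X x - f_X d\<^sub>0\<bar> < e"
  using density_cont e(1) unfolding continuous_at_eps_delta by (auto simp: dist_real_def)
 have fm[measurable]: "(\<lambda>x. ennreal (f_X x)) \<in> borel_measurable lborel"
  using X_density by (auto simp: distributed_def)
 \<comment> \<open>For \<open>n\<close> beyond this bound both ends of the window are closer than
   \<delta> to the change point.\<close>
 define N where "N = nat \<lceil>(\<bar>a\<bar> + \<bar>b\<bar>) / \<delta>\<rceil> + 1"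
 have main: "norm (n * prob {w\<in>space M. X w \<in> {d\<^sub>0 + a / n<..d\<^sub>0 + b / n}} - f_X d\<^sub>0 * (b - a)) < r" if "N \<le> n" for n :: nat
 proof -
  from that have n: "1 \<le> n" "(\<bar>a\<bar> + \<bar>b\<bar>) / \<delta> < n" unfolding N_def by linarith+
  let ?A = "{d\<^sub>0 + a / n<..d\<^sub>0 + b / n}"
  let ?L = "(b - a) / n"
  have L0: "0 \<le> ?L" using ab by simp
  have ab': "a / n \<le> b / n" using ab by (simp add: divide_right_mono)
  have A: "f_X d\<^sub>0 - e \<le> f_X x" "f_X x \<le> f_X d\<^sub>0 + e" if x: "x \<in> ?A" for x
  proof -
   have "\<bar>a\<bar> / n < \<delta>" "\<bar>b\<bar> / n < \<delta>" using n \<delta>(1) by (auto simp: field_simps intro: le_less_trans[rotated])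
   moreover have "\<bar>x - d\<^sub>0\<bar> \<le> max (\<bar>a\<bar> / n) (\<bar>b\<bar> / n)"
   proof -
    have "- (\<bar>a\<bar> / n) \<le> a / n" "b / n \<le> \<bar>b\<bar> / n" using n by (simp_all add: field_simps)
    then show ?thesis using x by auto
   qed
   ultimately have "\<bar>x - d\<^sub>0\<bar> < \<delta>" by linarith
   then show "f_X d\<^sub>0 - e \<le> f_X x" "f_X x \<le> f_X d\<^sub>0 + e" using \<delta>(2)[of x] by auto
  qed
  have LL: "0 \<le> (f_X d\<^sub>0 + e) * ?L" using density_pos e(1) L0 by (intro mult_nonneg_nonneg) auto
  have em: "emeasure lborel ?A = ennreal ?L" using ab' by (simp add: diff_divide_distrib)
  have P: "emeasure M (X -` ?A \<inter> space M) = (\<integral>\<^sup>+x. ennreal (f_X x) * indicator ?A x \<partial>lborel)"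
   by (rule distributed_emeasure[OF X_density]) simp
  have Pm: "X -` ?A \<inter> space M = {w\<in>space M. X w \<in> ?A}" by auto
  have "emeasure M (X -` ?A \<inter> space M) \<le> (\<integral>\<^sup>+x. ennreal (f_X d\<^sub>0 + e) * indicator ?A x \<partial>lborel)"
   unfolding P by (intro nn_integral_mono) (auto simp: indicator_def A intro!: ennreal_leI)
  also have "\<dots> = ennreal (f_X d\<^sub>0 + e) * ennreal ?L" by (subst nn_integral_cmult_indicator) (auto simp: em)
  also have "\<dots> = ennreal ((f_X d\<^sub>0 + e) * ?L)" using density_pos e by (intro ennreal_mult[symmetric] L0) auto
  finally have up: "prob {w\<in>space M. X w \<in> ?A} \<le> (f_X d\<^sub>0 + e) * ?L"
   unfolding Pm emeasure_eq_measure using ennreal_le_iff[OF LL] by (simp only:)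
  have lo: "(f_X d\<^sub>0 - e) * ?L \<le> prob {w\<in>space M. X w \<in> ?A}"
  proof (cases "0 \<le> f_X d\<^sub>0 - e")
   case True
   have "ennreal ((f_X d\<^sub>0 - e) * ?L) = ennreal (f_X d\<^sub>0 - e) * ennreal ?L" using True L0 by (intro ennreal_mult) auto
   also have "\<dots> = (\<integral>\<^sup>+x. ennreal (f_X d\<^sub>0 - e) * indicator ?A x \<partial>lborel)" by (subst nn_integral_cmult_indicator) (auto simp: em)
   also have "\<dots> \<le> emeasure M (X -` ?A \<inter> space M)"
    unfolding P by (intro nn_integral_mono) (auto simp: indicator_def A intro!: ennreal_leI)
   finally show ?thesis unfolding Pm emeasure_eq_measure by (subst (asm) ennreal_le_iff) auto
  next
   case False
   then have "(f_X d\<^sub>0 - e) * ?L \<le> 0" using L0 by (intro mult_nonpos_nonneg) auto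
   then show ?thesis using measure_nonneg order_trans by blast
  qed
  have "n * ((f_X d\<^sub>0 + e) * ?L) = f_X d\<^sub>0 * (b - a) + e * (b - a)" "n * ((f_X d\<^sub>0 - e) * ?L) = f_X d\<^sub>0 * (b - a) - e * (b - a)"
  proof -
   have c: "real n * (c * ?L) = c * (b - a)" for c using n by simp
   show "n * ((f_X d\<^sub>0 + e) * ?L) = f_X d\<^sub>0 * (b - a) + e * (b - a)" "n * ((f_X d\<^sub>0 - e) * ?L) = f_X d\<^sub>0 * (b - a) - e * (b - a)"
    unfolding c by (simp_all only: distrib_right left_diff_distrib)
  qed
  moreover have "n * prob {w\<in>space M. X w \<in> ?A} \<le> n * ((f_X d\<^sub>0 + e) * ?L)" "n * ((f_X d\<^sub>0 - e) * ?L) \<le> n * prob {w\<in>space M. X w \<in> ?A}"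
   using up lo by (intro mult_left_mono; simp)+
  ultimately show "norm (n * prob {w\<in>space M. X w \<in> ?A} - f_X d\<^sub>0 * (b - a)) < r"
   using e(2) by (simp add: abs_less_iff)
 qed
 then show "\<exists>N::nat. \<forall>n\<ge>N. norm (real n * prob {w\<in>space M. X w \<in> {d\<^sub>0 + a / real n<..d\<^sub>0 + b / real n}} - f_X d\<^sub>0 * (b - a)) < r"
  by blast
qed

definition p\<^sub>L :: real where "p\<^sub>L = prob {w\<in>space M. X w \<in> {..d\<^sub>0}}"
definition p\<^sub>R :: real where "p\<^sub>R = prob {w\<in>space M. X w \<in> {d\<^sub>0<..}}"

text \<open>By \<open>local_mass\<close>, short windows adjacent to the change point have positive
  mass on either side.\<close>

lemma p_pos: "0 < p\<^sub>L" "0 < p\<^sub>R"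
proof -
 have ev: "\<exists>n. 0 < prob {w\<in>space M. X w \<in> {d\<^sub>0 + a / real n<..d\<^sub>0 + b / real n}}" if "a < b" for a b :: real
 proof -
  have "0 < f_X d\<^sub>0 * (b - a)" using density_pos that by simp
  from order_tendstoD(1)[OF local_mass this] that
  have "\<forall>\<^sub>F n in sequentially. 0 < n * prob {w\<in>space M. X w \<in> {d\<^sub>0 + a / n<..d\<^sub>0 + b / n}}" by auto
  then obtain n where "0 < n * prob {w\<in>space M. X w \<in> {d\<^sub>0 + a / real n<..d\<^sub>0 + b / n}}" by (auto dest: eventually_happens)
  then show ?thesis by (auto simp: zero_less_mult_iff)
 qed
 obtain n where "0 < prob {w\<in>space M. X w \<in> {d\<^sub>0 + (-1) / real n<..d\<^sub>0 + 0 / real n}}" using ev[of "-1" 0] by auto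
 also have "\<dots> \<le> p\<^sub>L" unfolding p\<^sub>L_def by (intro finite_measure_mono) auto
 finally show "0 < p\<^sub>L" .
 obtain n where "0 < prob {w\<in>space M. X w \<in> {d\<^sub>0 + 0 / real n<..d\<^sub>0 + 1 / real n}}" using ev[of 0 1] by auto
 also have "\<dots> \<le> p\<^sub>R" unfolding p\<^sub>R_def by (intro finite_measure_mono) auto
 finally show "0 < p\<^sub>R" .
qed

lemma p\<^sub>L_cdf: "cdf (distr M borel X) d\<^sub>0 = p\<^sub>L"
 by (simp add: cdf_def measure_distr p\<^sub>L_def vimage_def Int_def conj_commute)

lemma p\<^sub>R_eq: "p\<^sub>R = 1 - p\<^sub>L"
proof -
 have "space M - {w\<in>space M. X w \<in> {..d\<^sub>0}} = {w\<in>space M. X w \<in> {d\<^sub>0<..}}" by auto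
 then show ?thesis unfolding p\<^sub>L_def p\<^sub>R_def using prob_compl[of "{w\<in>space M. X w \<in> {..d\<^sub>0}}"] by simp
qed

end

section \<open>Deterministic analysis of the least squares criterion\<close>

definition rss :: "nat \<Rightarrow> (nat \<Rightarrow> real) \<Rightarrow> (nat \<Rightarrow> real) \<Rightarrow> real \<times> real \<times> real \<Rightarrow> real" where
 "rss n x y \<theta> = (\<Sum>i<n. (y i - change_point_fun \<theta> (x i))\<^sup>2)"

lemma argmin_rss:
 assumes "\<theta> \<in> argmin_set (ls_criterion n x y) I" "1 \<le> n"
 shows "\<theta> \<in> I" "\<And>\<theta>'. \<theta>' \<in> I \<Longrightarrow> rss n x y \<theta> \<le> rss n x y \<theta>'"
 using assms unfolding argmin_set_def is_arg_min_def ls_criterion_def rss_def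
 by (auto simp: not_less divide_le_cancel)

lemma argmin_rssI:
 assumes "\<theta> \<in> I" "\<And>\<theta>'. \<theta>' \<in> I \<Longrightarrow> rss n x y \<theta> \<le> rss n x y \<theta>'"
 shows "\<theta> \<in> argmin_set (ls_criterion n x y) I"
proof -
 have "1 / real n * rss n x y \<theta> \<le> 1 / real n * rss n x y \<theta>'" if "\<theta>' \<in> I" for \<theta>'
  by (intro mult_left_mono assms(2)[OF that]) simp
 then show ?thesis using assms(1)
  by (auto simp: argmin_set_def is_arg_min_def ls_criterion_def rss_def not_less)
qed

text \<open>One fixed outcome of the sample. Everything in this locale is algebra with counts and
  noise sums; probability enters only through the bounds that are assumed for them.\<close>

locale cp_data =
 fixes n :: nat and x e y :: "nat \<Rightarrow> real" and \<alpha>\<^sub>0 \<beta>\<^sub>0 d\<^sub>0 :: real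
 assumes y: "\<And>i. i < n \<Longrightarrow> y i = change_point_fun (\<alpha>\<^sub>0, \<beta>\<^sub>0, d\<^sub>0) (x i) + e i"
  and n: "1 \<le> n" and neq: "\<alpha>\<^sub>0 \<noteq> \<beta>\<^sub>0"
begin

abbreviation C :: "real set \<Rightarrow> real" where "C S \<equiv> real (cnt n x S)"
abbreviation E :: "real set \<Rightarrow> real" where "E S \<equiv> esum n x e S"
abbreviation D :: real where "D \<equiv> \<beta>\<^sub>0 - \<alpha>\<^sub>0"
abbreviation Q :: "real \<Rightarrow> real \<Rightarrow> real \<Rightarrow> real" where "Q \<alpha> \<beta> d \<equiv> rss n x y (\<alpha>, \<beta>, d)"

text \<open>The points between \<open>d\<^sub>0\<close> and \<open>d\<close> are generated by the
  right level but fitted by \<alpha>; their residual is the noise plus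
  \<open>D - (\<alpha> - \<alpha>\<^sub>0)\<close>.\<close>

lemma Q_right:
 assumes "d\<^sub>0 \<le> d"
 shows "Q \<alpha> \<beta> d = (\<Sum>i<n. (e i)\<^sup>2) + ((\<alpha> - \<alpha>\<^sub>0)\<^sup>2 * C {..d\<^sub>0} - 2 * (\<alpha> - \<alpha>\<^sub>0) * E {..d\<^sub>0})
  + ((D - (\<alpha> - \<alpha>\<^sub>0))\<^sup>2 * C {d\<^sub>0<..d} + 2 * (D - (\<alpha> - \<alpha>\<^sub>0)) * E {d\<^sub>0<..d})
  + ((\<beta> - \<beta>\<^sub>0)\<^sup>2 * C {d<..} - 2 * (\<beta> - \<beta>\<^sub>0) * E {d<..})"
proof -
 have "Q \<alpha> \<beta> d = (\<Sum>i<n. (e i)\<^sup>2 + ((\<alpha> - \<alpha>\<^sub>0)\<^sup>2 * indicator {..d\<^sub>0} (x i) - 2 * (\<alpha> - \<alpha>\<^sub>0) * (indicator {..d\<^sub>0} (x i) * e i))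
  + ((D - (\<alpha> - \<alpha>\<^sub>0))\<^sup>2 * indicator {d\<^sub>0<..d} (x i) + 2 * (D - (\<alpha> - \<alpha>\<^sub>0)) * (indicator {d\<^sub>0<..d} (x i) * e i))
  + ((\<beta> - \<beta>\<^sub>0)\<^sup>2 * indicator {d<..} (x i) - 2 * (\<beta> - \<beta>\<^sub>0) * (indicator {d<..} (x i) * e i)))"
  unfolding rss_def
 proof (rule sum.cong)
  fix i assume "i \<in> {..<n}"
  then have yi: "y i = change_point_fun (\<alpha>\<^sub>0, \<beta>\<^sub>0, d\<^sub>0) (x i) + e i" by (simp add: y)
  consider "x i \<le> d\<^sub>0" | "d\<^sub>0 < x i" "x i \<le> d" | "d < x i" by linarith
  then show "(y i - change_point_fun (\<alpha>, \<beta>, d) (x i))\<^sup>2 = (e i)\<^sup>2 + ((\<alpha> - \<alpha>\<^sub>0)\<^sup>2 * indicator {..d\<^sub>0} (x i) - 2 * (\<alpha> - \<alpha>\<^sub>0) * (indicator {..d\<^sub>0} (x i) * e i))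
  + ((D - (\<alpha> - \<alpha>\<^sub>0))\<^sup>2 * indicator {d\<^sub>0<..d} (x i) + 2 * (D - (\<alpha> - \<alpha>\<^sub>0)) * (indicator {d\<^sub>0<..d} (x i) * e i))
  + ((\<beta> - \<beta>\<^sub>0)\<^sup>2 * indicator {d<..} (x i) - 2 * (\<beta> - \<beta>\<^sub>0) * (indicator {d<..} (x i) * e i))"
   using assms by cases (auto simp: yi change_point_fun_def indicator_def power2_eq_square algebra_simps)
 qed simp
 then show ?thesis unfolding cnt_indicator esum_indicator
  by (simp only: sum.distrib sum_subtractf sum_distrib_left)
qed

lemma Q_left:
 assumes "d \<le> d\<^sub>0"
 shows "Q \<alpha> \<beta> d = (\<Sum>i<n. (e i)\<^sup>2) + ((\<alpha> - \<alpha>\<^sub>0)\<^sup>2 * C {..d} - 2 * (\<alpha> - \<alpha>\<^sub>0) * E {..d})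
  + ((D + (\<beta> - \<beta>\<^sub>0))\<^sup>2 * C {d<..d\<^sub>0} - 2 * (D + (\<beta> - \<beta>\<^sub>0)) * E {d<..d\<^sub>0})
  + ((\<beta> - \<beta>\<^sub>0)\<^sup>2 * C {d\<^sub>0<..} - 2 * (\<beta> - \<beta>\<^sub>0) * E {d\<^sub>0<..})"
proof -
 have "Q \<alpha> \<beta> d = (\<Sum>i<n. (e i)\<^sup>2 + ((\<alpha> - \<alpha>\<^sub>0)\<^sup>2 * indicator {..d} (x i) - 2 * (\<alpha> - \<alpha>\<^sub>0) * (indicator {..d} (x i) * e i))
  + ((D + (\<beta> - \<beta>\<^sub>0))\<^sup>2 * indicator {d<..d\<^sub>0} (x i) - 2 * (D + (\<beta> - \<beta>\<^sub>0)) * (indicator {d<..d\<^sub>0} (x i) * e i))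
  + ((\<beta> - \<beta>\<^sub>0)\<^sup>2 * indicator {d\<^sub>0<..} (x i) - 2 * (\<beta> - \<beta>\<^sub>0) * (indicator {d\<^sub>0<..} (x i) * e i)))"
  unfolding rss_def
 proof (rule sum.cong)
  fix i assume "i \<in> {..<n}"
  then have yi: "y i = change_point_fun (\<alpha>\<^sub>0, \<beta>\<^sub>0, d\<^sub>0) (x i) + e i" by (simp add: y)
  consider "x i \<le> d" | "d < x i" "x i \<le> d\<^sub>0" | "d\<^sub>0 < x i" by linarith
  then show "(y i - change_point_fun (\<alpha>, \<beta>, d) (x i))\<^sup>2 = (e i)\<^sup>2 + ((\<alpha> - \<alpha>\<^sub>0)\<^sup>2 * indicator {..d} (x i) - 2 * (\<alpha> - \<alpha>\<^sub>0) * (indicator {..d} (x i) * e i))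
  + ((D + (\<beta> - \<beta>\<^sub>0))\<^sup>2 * indicator {d<..d\<^sub>0} (x i) - 2 * (D + (\<beta> - \<beta>\<^sub>0)) * (indicator {d<..d\<^sub>0} (x i) * e i))
  + ((\<beta> - \<beta>\<^sub>0)\<^sup>2 * indicator {d\<^sub>0<..} (x i) - 2 * (\<beta> - \<beta>\<^sub>0) * (indicator {d\<^sub>0<..} (x i) * e i))"
   using assms by cases (auto simp: yi change_point_fun_def indicator_def power2_eq_square algebra_simps)
 qed simp
 then show ?thesis unfolding cnt_indicator esum_indicator
  by (simp only: sum.distrib sum_subtractf sum_distrib_left)
qed

lemma split_right:
 assumes "d\<^sub>0 \<le> d"
 shows "C {..d} = C {..d\<^sub>0} + C {d\<^sub>0<..d}" "E {..d} = E {..d\<^sub>0} + E {d\<^sub>0<..d}"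
  "C {d\<^sub>0<..} = C {d\<^sub>0<..d} + C {d<..}" "E {d\<^sub>0<..} = E {d\<^sub>0<..d} + E {d<..}"
proof -
 have "{..d} = {..d\<^sub>0} \<union> {d\<^sub>0<..d}" "{d\<^sub>0<..} = {d\<^sub>0<..d} \<union> {d<..}" using assms by auto
 moreover have "{..d\<^sub>0} \<inter> {d\<^sub>0<..d} = {}" "{d\<^sub>0<..d} \<inter> {d<..} = {}" by auto
 ultimately show "C {..d} = C {..d\<^sub>0} + C {d\<^sub>0<..d}" "E {..d} = E {..d\<^sub>0} + E {d\<^sub>0<..d}"
  "C {d\<^sub>0<..} = C {d\<^sub>0<..d} + C {d<..}" "E {d\<^sub>0<..} = E {d\<^sub>0<..d} + E {d<..}"
  by (simp_all only: cnt_Un esum_Un of_nat_add)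
qed

lemma split_left:
 assumes "d \<le> d\<^sub>0"
 shows "C {..d\<^sub>0} = C {..d} + C {d<..d\<^sub>0}" "E {..d\<^sub>0} = E {..d} + E {d<..d\<^sub>0}"
  "C {d<..} = C {d<..d\<^sub>0} + C {d\<^sub>0<..}" "E {d<..} = E {d<..d\<^sub>0} + E {d\<^sub>0<..}"
proof -
 have "{..d\<^sub>0} = {..d} \<union> {d<..d\<^sub>0}" "{d<..} = {d<..d\<^sub>0} \<union> {d\<^sub>0<..}" using assms by auto
 moreover have "{..d} \<inter> {d<..d\<^sub>0} = {}" "{d<..d\<^sub>0} \<inter> {d\<^sub>0<..} = {}" by auto
 ultimately show "C {..d\<^sub>0} = C {..d} + C {d<..d\<^sub>0}" "E {..d\<^sub>0} = E {..d} + E {d<..d\<^sub>0}"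
  "C {d<..} = C {d<..d\<^sub>0} + C {d\<^sub>0<..}" "E {d<..} = E {d<..d\<^sub>0} + E {d\<^sub>0<..}"
  by (simp_all only: cnt_Un esum_Un of_nat_add)
qed

text \<open>Only misclassified points contribute, each by a difference of two squares. The first
  factor is just \<beta> - \<alpha>, written around the truth.\<close>

lemma Q_diff_right:
 assumes "d\<^sub>0 \<le> d"
 shows "Q \<alpha> \<beta> d - Q \<alpha> \<beta> d\<^sub>0 = (D - (\<alpha> - \<alpha>\<^sub>0) + (\<beta> - \<beta>\<^sub>0)) * (C {d\<^sub>0<..d} * (D - (\<alpha> - \<alpha>\<^sub>0) - (\<beta> - \<beta>\<^sub>0)) + 2 * E {d\<^sub>0<..d})"
 unfolding Q_right[OF assms] Q_right[OF order_refl] split_right(3,4)[OF assms]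
 by (simp add: power2_eq_square algebra_simps)

lemma Q_diff_left:
 assumes "d \<le> d\<^sub>0"
 shows "Q \<alpha> \<beta> d - Q \<alpha> \<beta> d\<^sub>0 = (D - (\<alpha> - \<alpha>\<^sub>0) + (\<beta> - \<beta>\<^sub>0)) * (C {d<..d\<^sub>0} * (D + (\<alpha> - \<alpha>\<^sub>0) + (\<beta> - \<beta>\<^sub>0)) - 2 * E {d<..d\<^sub>0})"
 unfolding Q_left[OF assms] Q_left[OF order_refl] split_left(1,2)[OF assms]
 by (simp add: power2_eq_square algebra_simps)

text \<open>Comparison with the true parameter bounds three nonnegative quadratic terms by the
  noise. The side that keeps all of its points gives its coefficient within |D| / 2. Then every
  misclassified point costs at least D^2 / 4, so there are at most c n / 2 of them, and the other
  side retains c n / 2 points of its own, enough to control its coefficient as well.\<close>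

lemma consistency:
 fixes \<alpha> \<beta> d R \<eta> c \<delta> :: real
 assumes min: "\<And>\<theta>. \<theta> \<in> I \<Longrightarrow> Q \<alpha> \<beta> d \<le> rss n x y \<theta>" and I: "(\<alpha>\<^sub>0, \<beta>\<^sub>0, d\<^sub>0) \<in> I"
  and R: "\<bar>\<alpha> - \<alpha>\<^sub>0\<bar> \<le> R" "\<bar>\<beta> - \<beta>\<^sub>0\<bar> \<le> R" "\<bar>D\<bar> \<le> R"
  and sup: "\<And>t. \<bar>E {..t}\<bar> \<le> \<eta> * n" "\<And>t. \<bar>E {t<..}\<bar> \<le> \<eta> * n"
  and c: "c * n \<le> C {..d\<^sub>0}" "c * n \<le> C {d\<^sub>0<..}" "0 < c"
  and \<delta>: "0 < \<delta>" and \<kappa>: "12 * R * \<eta> \<le> c * \<delta>\<^sup>2 / 2" "12 * R * \<eta> \<le> c * D\<^sup>2 / 8"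
 shows "\<bar>\<alpha> - \<alpha>\<^sub>0\<bar> \<le> \<delta>" "\<bar>\<beta> - \<beta>\<^sub>0\<bar> \<le> \<delta>"
proof -
 define a where "a = \<alpha> - \<alpha>\<^sub>0"
 define b where "b = \<beta> - \<beta>\<^sub>0"
 have n0: "0 < real n" using n by simp
 have D0: "D \<noteq> 0" using neq by simp
 have R0: "0 \<le> R" using R(1) by simp
 have \<eta>0: "0 \<le> \<eta> * n" using sup(1)[of 0] by linarith
 have pr: "\<bar>u * v\<bar> \<le> U * V" if "\<bar>u\<bar> \<le> U" "\<bar>v\<bar> \<le> V" for u v U V :: real
  unfolding abs_mult using that by (intro mult_mono) (auto intro: order_trans[OF abs_ge_zero])
 have min0: "Q \<alpha> \<beta> d \<le> (\<Sum>i<n. (e i)\<^sup>2)"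
  using min[OF I] Q_right[of d\<^sub>0 \<alpha>\<^sub>0 \<beta>\<^sub>0] by simp
 have final: "\<bar>u\<bar> \<le> \<delta>" if "u\<^sup>2 * p \<le> 12 * R * \<eta> * n" "c * n / 2 \<le> p" for u p :: real
 proof -
  have "u\<^sup>2 * (c * n / 2) \<le> u\<^sup>2 * p" using that(2) by (intro mult_left_mono) auto
  also have "\<dots> \<le> 12 * R * \<eta> * n" by (rule that(1))
  also have "\<dots> \<le> c * \<delta>\<^sup>2 / 2 * n" using \<kappa>(1) n0 by (intro mult_right_mono) auto
  also have "\<dots> = \<delta>\<^sup>2 * (c * n / 2)" by simp
  finally have "u\<^sup>2 \<le> \<delta>\<^sup>2" using c(3) n0 by (subst (asm) mult_le_cancel_right) auto
  then show ?thesis using \<delta> by (simp add: abs_le_square_iff[symmetric])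
 qed
 have D_small: "p \<le> c * n / 2" if "w\<^sup>2 * p \<le> 12 * R * \<eta> * n" "\<bar>D\<bar> / 2 \<le> \<bar>w\<bar>" "0 \<le> p" for w p :: real
 proof -
  have "(\<bar>D\<bar> / 2)\<^sup>2 \<le> \<bar>w\<bar>\<^sup>2" using that(2) by (intro power_mono) auto
  then have "D\<^sup>2 / 4 * p \<le> w\<^sup>2 * p" using that(3) by (intro mult_right_mono) (auto simp: power_divide)
  also have "\<dots> \<le> 12 * R * \<eta> * n" by (rule that(1))
  also have "\<dots> \<le> c * D\<^sup>2 / 8 * n" using \<kappa>(2) n0 by (intro mult_right_mono) auto
  also have "\<dots> = D\<^sup>2 / 4 * (c * n / 2)" by simp
  finally show ?thesis using D0 by (subst (asm) mult_le_cancel_left) auto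
 qed
 have half: "\<bar>u\<bar> \<le> \<bar>D\<bar> / 2" if "u\<^sup>2 * p \<le> 12 * R * \<eta> * n" "c * n \<le> p" for u p :: real
 proof -
  have "u\<^sup>2 * (c * n) \<le> u\<^sup>2 * p" using that(2) by (intro mult_left_mono) auto
  also have "\<dots> \<le> 12 * R * \<eta> * n" by (rule that(1))
  also have "\<dots> \<le> c * D\<^sup>2 / 8 * n" using \<kappa>(2) n0 by (intro mult_right_mono) auto
  also have "\<dots> \<le> (\<bar>D\<bar> / 2)\<^sup>2 * (c * n)" using c n0 by (simp add: power_divide)
  finally have "u\<^sup>2 \<le> (\<bar>D\<bar> / 2)\<^sup>2" using c(3) n0 by (subst (asm) mult_le_cancel_right) auto
  then have "\<bar>u\<bar> \<le> \<bar>\<bar>D\<bar> / 2\<bar>" by (simp only: abs_le_square_iff)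
  then show ?thesis by simp
 qed
 have "\<bar>a\<bar> \<le> \<delta> \<and> \<bar>b\<bar> \<le> \<delta>"
 proof (cases "d\<^sub>0 \<le> d")
  case True
  have E2: "\<bar>E {d\<^sub>0<..d}\<bar> \<le> 2 * (\<eta> * n)" using split_right(2)[OF True] sup(1)[of d] sup(1)[of d\<^sub>0] by linarith
  have "a\<^sup>2 * C {..d\<^sub>0} + (D - a)\<^sup>2 * C {d\<^sub>0<..d} + b\<^sup>2 * C {d<..} \<le> 2 * (a * E {..d\<^sub>0}) - 2 * ((D - a) * E {d\<^sub>0<..d}) + 2 * (b * E {d<..})"
   using min0 unfolding Q_right[OF True] a_def[symmetric] b_def[symmetric] by linarith
  \<comment> \<open>Half-line sums are at most \<open>\<eta> * n\<close>, hence the interval sum is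
    at most twice this, and its factor is at most \<open>2 * R\<close>: the constant is 2 + 8 + 2 =
    12.\<close>
  also have "\<dots> \<le> 2 * (R * (\<eta> * n)) + 2 * (2 * R * (2 * (\<eta> * n))) + 2 * (R * (\<eta> * n))"
  proof -
   have "\<bar>D - a\<bar> \<le> 2 * R" using R unfolding a_def by linarith
   from pr[OF this E2] have 2: "\<bar>(D - a) * E {d\<^sub>0<..d}\<bar> \<le> 2 * R * (2 * (\<eta> * n))" .
   show ?thesis using 2 pr[OF R(1) sup(1)[of d\<^sub>0]] pr[OF R(2) sup(2)[of d]] unfolding a_def b_def by linarith
  qed
  finally have key: "a\<^sup>2 * C {..d\<^sub>0} + (D - a)\<^sup>2 * C {d\<^sub>0<..d} + b\<^sup>2 * C {d<..} \<le> 12 * R * \<eta> * n" by simp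
  have nn: "0 \<le> a\<^sup>2 * C {..d\<^sub>0}" "0 \<le> (D - a)\<^sup>2 * C {d\<^sub>0<..d}" "0 \<le> b\<^sup>2 * C {d<..}" by simp_all
  have ka: "a\<^sup>2 * C {..d\<^sub>0} \<le> 12 * R * \<eta> * n" and kd: "(D - a)\<^sup>2 * C {d\<^sub>0<..d} \<le> 12 * R * \<eta> * n" and kb: "b\<^sup>2 * C {d<..} \<le> 12 * R * \<eta> * n"
   using key nn by linarith+
  have "\<bar>a\<bar> \<le> \<bar>D\<bar> / 2" using half[OF ka c(1)] .
  then have "C {d\<^sub>0<..d} \<le> c * n / 2" by (intro D_small[OF kd]) (auto simp: abs_if split: if_splits)
  then have c3: "c * n / 2 \<le> C {d<..}" using split_right(3)[OF True] c(2) by linarith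
  have "c * n / 2 \<le> C {..d\<^sub>0}" using c n0 by (auto intro: order_trans[OF _ c(1)])
  then show ?thesis using final[OF ka] final[OF kb c3] by simp
 next
  case False
  then have F: "d \<le> d\<^sub>0" by simp
  have E2: "\<bar>E {d<..d\<^sub>0}\<bar> \<le> 2 * (\<eta> * n)" using split_left(2)[OF F] sup(1)[of d] sup(1)[of d\<^sub>0] by linarith
  have "a\<^sup>2 * C {..d} + (D + b)\<^sup>2 * C {d<..d\<^sub>0} + b\<^sup>2 * C {d\<^sub>0<..} \<le> 2 * (a * E {..d}) + 2 * ((D + b) * E {d<..d\<^sub>0}) + 2 * (b * E {d\<^sub>0<..})"
   using min0 unfolding Q_left[OF F] a_def[symmetric] b_def[symmetric] by linarith
  also have "\<dots> \<le> 2 * (R * (\<eta> * n)) + 2 * (2 * R * (2 * (\<eta> * n))) + 2 * (R * (\<eta> * n))"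
  proof -
   have "\<bar>D + b\<bar> \<le> 2 * R" using R unfolding b_def by linarith
   from pr[OF this E2] have 2: "\<bar>(D + b) * E {d<..d\<^sub>0}\<bar> \<le> 2 * R * (2 * (\<eta> * n))" .
   show ?thesis using 2 pr[OF R(1) sup(1)[of d]] pr[OF R(2) sup(2)[of d\<^sub>0]] unfolding a_def b_def by linarith
  qed
  finally have key: "a\<^sup>2 * C {..d} + (D + b)\<^sup>2 * C {d<..d\<^sub>0} + b\<^sup>2 * C {d\<^sub>0<..} \<le> 12 * R * \<eta> * n" by simp
  have nn: "0 \<le> a\<^sup>2 * C {..d}" "0 \<le> (D + b)\<^sup>2 * C {d<..d\<^sub>0}" "0 \<le> b\<^sup>2 * C {d\<^sub>0<..}" by simp_all
  have ka: "a\<^sup>2 * C {..d} \<le> 12 * R * \<eta> * n" and kd: "(D + b)\<^sup>2 * C {d<..d\<^sub>0} \<le> 12 * R * \<eta> * n" and kb: "b\<^sup>2 * C {d\<^sub>0<..} \<le> 12 * R * \<eta> * n"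
   using key nn by linarith+
  have "\<bar>b\<bar> \<le> \<bar>D\<bar> / 2" using half[OF kb c(2)] .
  then have "C {d<..d\<^sub>0} \<le> c * n / 2" by (intro D_small[OF kd]) (auto simp: abs_if split: if_splits)
  then have c3: "c * n / 2 \<le> C {..d}" using split_left(1)[OF F] c(1) by linarith
  have "c * n / 2 \<le> C {d\<^sub>0<..}" using c n0 by (auto intro: order_trans[OF _ c(2)])
  then show ?thesis using final[OF ka c3] final[OF kb] by simp
 qed
 then show "\<bar>\<alpha> - \<alpha>\<^sub>0\<bar> \<le> \<delta>" "\<bar>\<beta> - \<beta>\<^sub>0\<bar> \<le> \<delta>" by (auto simp: a_def b_def)
qed

text \<open>Both factors have the sign of \<open>D\<close>: in the second one a drift of at least
  3/4 |D| c stands against less than 2/4 |D| c of noise.\<close>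

lemma sign_product_pos:
 fixes u v c g :: real
 assumes u: "\<bar>u - D\<bar> < \<bar>D\<bar>" and v: "\<bar>v - D\<bar> \<le> \<bar>D\<bar> / 4" and g: "\<bar>g\<bar> < \<bar>D\<bar> / 4 * c" and c: "0 < c"
 shows "0 < u * (c * v + 2 * g)"
proof (cases "0 < D")
 case True
 have u0: "0 < u" using u True by (auto simp: abs_if split: if_splits)
 have "c * (3/4 * D) \<le> c * v" using v True c by (intro mult_left_mono) (auto simp: abs_if split: if_splits)
 moreover have "\<bar>g\<bar> < D / 4 * c" using g True by simp
 moreover have "0 < c * D" using c True by simp
 ultimately have "0 < c * v + 2 * g" by (simp add: algebra_simps abs_less_iff)
 then show ?thesis using u0 by simp
next
 case False
 then have D: "D < 0" using neq by simp
 have u0: "u < 0" using u D by (auto simp: abs_if split: if_splits)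
 have "c * v \<le> c * (3/4 * D)" using v D c by (intro mult_left_mono) (auto simp: abs_if split: if_splits)
 moreover have "\<bar>g\<bar> < - D / 4 * c" using g D by simp
 moreover have "c * D < 0" using c D by (simp add: mult_pos_neg)
 ultimately have "c * v + 2 * g < 0" by (simp add: algebra_simps abs_less_iff)
 then show ?thesis using u0 by (simp add: mult_neg_neg)
qed

text \<open>Beyond \<open>d\<^sub>0 + t\<close> at least \<open>k0\<close> points are misclassified.
  There the drift exceeds the noise, and the criterion is strictly larger than at
  \<open>d\<^sub>0\<close> with the same coefficients.\<close>

lemma rate_right:
 fixes \<alpha> \<beta> d t :: real and k0 :: nat
 assumes min: "Q \<alpha> \<beta> d \<le> Q \<alpha> \<beta> d\<^sub>0" and ab: "\<bar>\<alpha> - \<alpha>\<^sub>0\<bar> + \<bar>\<beta> - \<beta>\<^sub>0\<bar> \<le> \<bar>D\<bar> / 4"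
  and k0: "0 < k0" and slln: "\<And>t. k0 \<le> cnt n x {d\<^sub>0<..t} \<Longrightarrow> \<bar>E {d\<^sub>0<..t}\<bar> < \<bar>D\<bar> / 4 * C {d\<^sub>0<..t}"
  and K: "k0 \<le> cnt n x {d\<^sub>0<..d\<^sub>0 + t}"
 shows "d < d\<^sub>0 + t"
proof (rule ccontr)
 assume "\<not> d < d\<^sub>0 + t"
 then have "cnt n x {d\<^sub>0<..d\<^sub>0 + t} \<le> cnt n x {d\<^sub>0<..d}" by (intro cnt_mono) auto
 with K have k: "k0 \<le> cnt n x {d\<^sub>0<..d}" by simp
 then have ne: "{d\<^sub>0<..d} \<noteq> {}" using k0 by (metis cnt_empty not_less)
 then have d: "d\<^sub>0 \<le> d" by simp
 have "0 < (D - (\<alpha> - \<alpha>\<^sub>0) + (\<beta> - \<beta>\<^sub>0)) * (C {d\<^sub>0<..d} * (D - (\<alpha> - \<alpha>\<^sub>0) - (\<beta> - \<beta>\<^sub>0)) + 2 * E {d\<^sub>0<..d})"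
 proof (rule sign_product_pos)
  show "\<bar>D - (\<alpha> - \<alpha>\<^sub>0) + (\<beta> - \<beta>\<^sub>0) - D\<bar> < \<bar>D\<bar>" using ab neq by (auto simp: abs_if split: if_splits)
  show "\<bar>D - (\<alpha> - \<alpha>\<^sub>0) - (\<beta> - \<beta>\<^sub>0) - D\<bar> \<le> \<bar>D\<bar> / 4" using ab by linarith
  show "\<bar>E {d\<^sub>0<..d}\<bar> < \<bar>D\<bar> / 4 * C {d\<^sub>0<..d}" by (rule slln[OF k])
  show "0 < C {d\<^sub>0<..d}" using k k0 by simp
 qed
 then show False using Q_diff_right[OF d, of \<alpha> \<beta>] min by simp
qed

lemma rate_left:
 fixes \<alpha> \<beta> d t :: real and k0 :: nat
 assumes min: "Q \<alpha> \<beta> d \<le> Q \<alpha> \<beta> d\<^sub>0" and ab: "\<bar>\<alpha> - \<alpha>\<^sub>0\<bar> + \<bar>\<beta> - \<beta>\<^sub>0\<bar> \<le> \<bar>D\<bar> / 4"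
  and k0: "0 < k0" and slln: "\<And>t. k0 \<le> cnt n x {t<..d\<^sub>0} \<Longrightarrow> \<bar>E {t<..d\<^sub>0}\<bar> < \<bar>D\<bar> / 4 * C {t<..d\<^sub>0}"
  and K: "k0 \<le> cnt n x {d\<^sub>0 - t<..d\<^sub>0}"
 shows "d\<^sub>0 - t < d"
proof (rule ccontr)
 assume "\<not> d\<^sub>0 - t < d"
 then have "cnt n x {d\<^sub>0 - t<..d\<^sub>0} \<le> cnt n x {d<..d\<^sub>0}" by (intro cnt_mono) auto
 with K have k: "k0 \<le> cnt n x {d<..d\<^sub>0}" by simp
 then have ne: "{d<..d\<^sub>0} \<noteq> {}" using k0 by (metis cnt_empty not_less)
 then have d: "d \<le> d\<^sub>0" by simp
 have "0 < (D - (\<alpha> - \<alpha>\<^sub>0) + (\<beta> - \<beta>\<^sub>0)) * (C {d<..d\<^sub>0} * (D + (\<alpha> - \<alpha>\<^sub>0) + (\<beta> - \<beta>\<^sub>0)) + 2 * (- E {d<..d\<^sub>0}))"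
 proof (rule sign_product_pos)
  show "\<bar>D - (\<alpha> - \<alpha>\<^sub>0) + (\<beta> - \<beta>\<^sub>0) - D\<bar> < \<bar>D\<bar>" using ab neq by (auto simp: abs_if split: if_splits)
  show "\<bar>D + (\<alpha> - \<alpha>\<^sub>0) + (\<beta> - \<beta>\<^sub>0) - D\<bar> \<le> \<bar>D\<bar> / 4" using ab by linarith
  show "\<bar>- E {d<..d\<^sub>0}\<bar> < \<bar>D\<bar> / 4 * C {d<..d\<^sub>0}" using slln[OF k] by simp
  show "0 < C {d<..d\<^sub>0}" using k k0 by simp
 qed
 then show False using Q_diff_left[OF d, of \<alpha> \<beta>] min by simp
qed

lemma local_quadratic_zero:
 fixes c g r :: real
 assumes r: "0 < r" and q: "\<And>t. \<bar>t\<bar> \<le> r \<Longrightarrow> 0 \<le> c * t\<^sup>2 + 2 * g * t" and c: "0 \<le> c"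
 shows "g = 0"
proof (rule ccontr)
 assume g: "g \<noteq> 0"
 \<comment> \<open>A step against the sign of \<open>g\<close>, short enough for the linear term to
   beat the quadratic one; the added 1 covers \<open>c = 0\<close>.\<close>
 define s where "s = min r (\<bar>g\<bar> / (c + 1))"
 have s: "0 < s" "s \<le> r" using r g c by (auto simp: s_def)
 have "s * (c + 1) \<le> \<bar>g\<bar>" using c by (simp add: s_def pos_le_divide_eq[symmetric])
 then have "c * s \<le> \<bar>g\<bar>" using s by (simp add: algebra_simps)
 then have "c * s * s < 2 * \<bar>g\<bar> * s" using s g by (intro mult_strict_right_mono) auto
 moreover have "0 \<le> c * (- sgn g * s)\<^sup>2 + 2 * g * (- sgn g * s)"
  using s by (intro q) (auto simp: abs_mult abs_sgn_eq)
 moreover have "(- sgn g * s)\<^sup>2 = s * s" "g * sgn g = \<bar>g\<bar>" using g by (auto simp: power2_eq_square sgn_if abs_if)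
 moreover have "2 * g * (- sgn g * s) = - 2 * (g * sgn g) * s" by simp
 ultimately show False by (simp only: mult.assoc)
qed

text \<open>Near the truth the minimizer is interior, so the first order conditions hold in \<open>\<alpha>\<close> and \<open>\<beta>\<close>.\<close>

lemma first_order:
 fixes \<alpha> \<beta> d t R B :: real
 assumes min: "\<And>\<theta>. \<theta> \<in> cbox l u \<Longrightarrow> Q \<alpha> \<beta> d \<le> rss n x y \<theta>" and dI: "(\<alpha>, \<beta>, d) \<in> cbox l u"
  and int: "fst l < \<alpha>" "\<alpha> < fst u" "fst (snd l) < \<beta>" "\<beta> < fst (snd u)"
  and W: "d \<in> {d\<^sub>0 - t<..<d\<^sub>0 + t}"
  and B: "C {d\<^sub>0 - t<..d\<^sub>0 + t} + esum n x (\<lambda>i. \<bar>e i\<bar>) {d\<^sub>0 - t<..d\<^sub>0 + t} \<le> B"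
  and R: "\<bar>\<alpha> - \<alpha>\<^sub>0\<bar> + \<bar>\<beta> - \<beta>\<^sub>0\<bar> + \<bar>D\<bar> \<le> R" "1 \<le> R"
 shows "\<bar>(\<alpha> - \<alpha>\<^sub>0) * C {..d\<^sub>0} - E {..d\<^sub>0}\<bar> \<le> R * B" "\<bar>(\<beta> - \<beta>\<^sub>0) * C {d\<^sub>0<..} - E {d\<^sub>0<..}\<bar> \<le> R * B"
proof -
 define a where "a = \<alpha> - \<alpha>\<^sub>0"
 define b where "b = \<beta> - \<beta>\<^sub>0"
 define r where "r = min (min (\<alpha> - fst l) (fst u - \<alpha>)) (min (\<beta> - fst (snd l)) (fst (snd u) - \<beta>))"
 have r: "0 < r" using int by (simp add: r_def)
 have qa: "Q \<alpha> \<beta> d \<le> Q (\<alpha> + s) \<beta> d" and qb: "Q \<alpha> \<beta> d \<le> Q \<alpha> (\<beta> + s) d" if "\<bar>s\<bar> \<le> r" for s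
 proof -
  obtain l1 l2 l3 u1 u2 u3 where lu: "l = (l1, l2, l3)" "u = (u1, u2, u3)" by (metis prod.collapse)
  have "(\<alpha> + s, \<beta>, d) \<in> cbox l u" "(\<alpha>, \<beta> + s, d) \<in> cbox l u"
   using dI that by (auto simp: lu cbox_Pair_eq r_def abs_le_iff)
  then show "Q \<alpha> \<beta> d \<le> Q (\<alpha> + s) \<beta> d" "Q \<alpha> \<beta> d \<le> Q \<alpha> (\<beta> + s) d" using min by auto
 qed
 have sub: "C S \<le> C {d\<^sub>0 - t<..d\<^sub>0 + t}" "\<bar>E S\<bar> \<le> esum n x (\<lambda>i. \<bar>e i\<bar>) {d\<^sub>0 - t<..d\<^sub>0 + t}" if "S \<subseteq> {d\<^sub>0 - t<..d\<^sub>0 + t}" for S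
 proof -
  show "C S \<le> C {d\<^sub>0 - t<..d\<^sub>0 + t}" using cnt_mono[OF that] by simp
  have "\<bar>E S\<bar> \<le> esum n x (\<lambda>i. \<bar>e i\<bar>) S" unfolding esum_def by (rule sum_abs)
  also have "\<dots> \<le> esum n x (\<lambda>i. \<bar>e i\<bar>) {d\<^sub>0 - t<..d\<^sub>0 + t}" unfolding esum_def using that by (intro sum_mono2) auto
  finally show "\<bar>E S\<bar> \<le> esum n x (\<lambda>i. \<bar>e i\<bar>) {d\<^sub>0 - t<..d\<^sub>0 + t}" .
 qed
 \<comment> \<open>The remainders below have this form, with \<open>S\<close> the misclassified
   points, \<open>w\<close> equal to 1 or -1 and \<open>z\<close> a combination of \<open>a\<close>,
   \<open>b\<close> and \<open>D\<close>; hence the two demands on \<open>R\<close>.\<close>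
 have bnd: "\<bar>w * E S + z * C S\<bar> \<le> R * B" if "S \<subseteq> {d\<^sub>0 - t<..d\<^sub>0 + t}" "\<bar>w\<bar> \<le> R" "\<bar>z\<bar> \<le> R" for w z S
 proof -
  have "\<bar>w * E S + z * C S\<bar> \<le> \<bar>w\<bar> * \<bar>E S\<bar> + \<bar>z\<bar> * C S" by (rule order_trans[OF abs_triangle_ineq]) (simp add: abs_mult)
  also have "\<dots> \<le> R * \<bar>E S\<bar> + R * C S" using that by (intro add_mono mult_right_mono) auto
  also have "\<dots> = R * (\<bar>E S\<bar> + C S)" by (simp add: algebra_simps)
  also have "\<dots> \<le> R * B" using sub[OF that(1)] B R by (intro mult_left_mono) auto
  finally show ?thesis .
 qed
 have "\<bar>a * C {..d\<^sub>0} - E {..d\<^sub>0}\<bar> \<le> R * B \<and> \<bar>b * C {d\<^sub>0<..} - E {d\<^sub>0<..}\<bar> \<le> R * B"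
 proof (cases "d\<^sub>0 \<le> d")
  case True
  have S: "{d\<^sub>0<..d} \<subseteq> {d\<^sub>0 - t<..d\<^sub>0 + t}" using W by auto
  \<comment> \<open>The expansion in the shift \<open>s\<close> is a quadratic without constant
    term, so its linear coefficient vanishes. To the right of \<open>d\<^sub>0\<close> the
    coefficient of \<alpha> also collects the misclassified points, which \<alpha> has to
    fit.\<close>
  have "a * C {..d\<^sub>0} - E {..d\<^sub>0} - ((D - a) * C {d\<^sub>0<..d} + E {d\<^sub>0<..d}) = 0"
  proof (rule local_quadratic_zero[OF r])
   fix s assume "\<bar>s\<bar> \<le> r"
   from qa[OF this] show "0 \<le> (C {..d\<^sub>0} + C {d\<^sub>0<..d}) * s\<^sup>2 + 2 * (a * C {..d\<^sub>0} - E {..d\<^sub>0} - ((D - a) * C {d\<^sub>0<..d} + E {d\<^sub>0<..d})) * s"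
    unfolding Q_right[OF True] a_def by (simp add: power2_eq_square algebra_simps)
  qed simp
  then have 1: "a * C {..d\<^sub>0} - E {..d\<^sub>0} = 1 * E {d\<^sub>0<..d} + (D - a) * C {d\<^sub>0<..d}" by simp
  have "b * C {d<..} - E {d<..} = 0"
  proof (rule local_quadratic_zero[OF r])
   fix s assume "\<bar>s\<bar> \<le> r"
   from qb[OF this] show "0 \<le> C {d<..} * s\<^sup>2 + 2 * (b * C {d<..} - E {d<..}) * s"
    unfolding Q_right[OF True] b_def by (simp add: power2_eq_square algebra_simps)
  qed simp
  then have 2: "b * C {d\<^sub>0<..} - E {d\<^sub>0<..} = (-1) * E {d\<^sub>0<..d} + b * C {d\<^sub>0<..d}"
   unfolding split_right(3,4)[OF True] by (simp add: algebra_simps)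
  show ?thesis unfolding 1 2 using R by (intro conjI bnd[OF S]) (auto simp: a_def b_def)
 next
  case False
  then have F: "d \<le> d\<^sub>0" by simp
  have S: "{d<..d\<^sub>0} \<subseteq> {d\<^sub>0 - t<..d\<^sub>0 + t}" using W by auto
  have "a * C {..d} - E {..d} = 0"
  proof (rule local_quadratic_zero[OF r])
   fix s assume "\<bar>s\<bar> \<le> r"
   from qa[OF this] show "0 \<le> C {..d} * s\<^sup>2 + 2 * (a * C {..d} - E {..d}) * s"
    unfolding Q_left[OF F] a_def by (simp add: power2_eq_square algebra_simps)
  qed simp
  then have 1: "a * C {..d\<^sub>0} - E {..d\<^sub>0} = (-1) * E {d<..d\<^sub>0} + a * C {d<..d\<^sub>0}"
   unfolding split_left(1,2)[OF F] by (simp add: algebra_simps)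
  have "b * C {d\<^sub>0<..} - E {d\<^sub>0<..} + ((D + b) * C {d<..d\<^sub>0} - E {d<..d\<^sub>0}) = 0"
  proof (rule local_quadratic_zero[OF r])
   fix s assume "\<bar>s\<bar> \<le> r"
   from qb[OF this] show "0 \<le> (C {d\<^sub>0<..} + C {d<..d\<^sub>0}) * s\<^sup>2 + 2 * (b * C {d\<^sub>0<..} - E {d\<^sub>0<..} + ((D + b) * C {d<..d\<^sub>0} - E {d<..d\<^sub>0})) * s"
    unfolding Q_left[OF F] b_def by (simp add: power2_eq_square algebra_simps)
  qed simp
  then have 2: "b * C {d\<^sub>0<..} - E {d\<^sub>0<..} = 1 * E {d<..d\<^sub>0} + (- (D + b)) * C {d<..d\<^sub>0}" by (simp add: algebra_simps)
  show ?thesis unfolding 1 2 using R by (intro conjI bnd[OF S]) (auto simp: a_def b_def)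
 qed
 then show "\<bar>(\<alpha> - \<alpha>\<^sub>0) * C {..d\<^sub>0} - E {..d\<^sub>0}\<bar> \<le> R * B" "\<bar>(\<beta> - \<beta>\<^sub>0) * C {d\<^sub>0<..} - E {d\<^sub>0<..}\<bar> \<le> R * B"
  by (auto simp: a_def b_def)
qed

end

text \<open>The error splits into the defect of the first order condition divided by the count, and
  the noise ratio times the relative error of the count. The bound \<open>\<eta> \<le> p / 2\<close>
  keeps the count at least \<open>n * p / 2\<close>, which secures both denominators.\<close>

lemma ratio_linearization:
 fixes a E C B p \<eta> K n :: real
 assumes n: "0 < n" and p: "0 < p" and C: "\<bar>C / n - p\<bar> \<le> \<eta>" "\<eta> \<le> p / 2" and E: "\<bar>E\<bar> \<le> K * sqrt n"
  and B: "\<bar>a * C - E\<bar> \<le> B"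
 shows "\<bar>sqrt n * a - E / (p * sqrt n)\<bar> \<le> 2 * B / (p * sqrt n) + 2 * \<eta> * K / p\<^sup>2"
proof -
 have s: "0 < sqrt n" "sqrt n * sqrt n = n" using n by auto
 have Cn: "n * p / 2 \<le> C"
 proof -
  have "p / 2 \<le> C / n" using C by linarith
  then show ?thesis using n by (simp add: field_simps)
 qed
 have "0 < n * p / 2" using n p by simp
 then have C0: "0 < C" using Cn by linarith
 have B0: "0 \<le> B" using B by linarith
 have "sqrt n * a - E / (p * sqrt n) = sqrt n * ((a * C - E) / C) + E / sqrt n * ((n * p - C) / (C * p))"
  using C0 p s by (simp add: field_simps)
 then have "\<bar>sqrt n * a - E / (p * sqrt n)\<bar> \<le> sqrt n * (\<bar>a * C - E\<bar> / C) + \<bar>E\<bar> / sqrt n * (\<bar>n * p - C\<bar> / (C * p))"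
  using C0 p s by (auto simp: abs_mult intro: order_trans[OF abs_triangle_ineq])
 also have "sqrt n * (\<bar>a * C - E\<bar> / C) \<le> sqrt n * (B / (n * p / 2))"
  using C0 p s B Cn n B0 by (intro mult_left_mono frac_le) auto
 also have "\<dots> = 2 * B / (p * sqrt n)" using s p n by (simp add: field_simps)
 also have "\<bar>E\<bar> / sqrt n * (\<bar>n * p - C\<bar> / (C * p)) \<le> K * (n * \<eta> / ((n * p / 2) * p))"
 proof (rule mult_mono)
  show "\<bar>E\<bar> / sqrt n \<le> K" using E s by (simp add: field_simps)
  then show "0 \<le> K" using s by (rule_tac order_trans[of _ "\<bar>E\<bar> / sqrt n"]) auto
  have "n * (C / n - p) = C - n * p" using n by (simp add: field_simps)
  then have "\<bar>n * p - C\<bar> = \<bar>n * (C / n - p)\<bar>" by (simp add: abs_minus_commute)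
  also have "\<dots> = n * \<bar>C / n - p\<bar>" using n by (simp add: abs_mult)
  also have "\<dots> \<le> n * \<eta>" using C n by (intro mult_left_mono) auto
  finally have 1: "\<bar>n * p - C\<bar> \<le> n * \<eta>" .
  have 2: "n * p / 2 * p \<le> C * p" using Cn p by (intro mult_right_mono) auto
  have 3: "0 < n * p / 2 * p" using n p by simp
  have 4: "0 \<le> n * \<eta>" using 1 by (rule order_trans[OF abs_ge_zero])
  show "\<bar>n * p - C\<bar> / (C * p) \<le> n * \<eta> / (n * p / 2 * p)" by (rule frac_le[OF 4 1 3 2])
  show "0 \<le> \<bar>n * p - C\<bar> / (C * p)" using C0 p by simp
 qed
 also have "\<dots> = 2 * \<eta> * K / p\<^sup>2" using n p by (simp add: field_simps power2_eq_square)
 finally show ?thesis by simp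
qed

section \<open>The local process on a grid\<close>

text \<open>
 Cell number \<open>\<kappa>\<close> is \<open>(\<kappa>, \<kappa> + 1]\<close> in grid units, so \<open>grid_path z k\<close> is the value at grid point \<open>k\<close> of the
 path that vanishes at \<open>0\<close> and collects \<open>z \<kappa>\<close> when it crosses cell \<open>\<kappa>\<close> moving away from \<open>0\<close>.
\<close>

definition grid_path :: "(int \<Rightarrow> real) \<Rightarrow> int \<Rightarrow> real" where
 "grid_path z k = (if 0 \<le> k then \<Sum>\<kappa>\<in>{0..<k}. z \<kappa> else \<Sum>\<kappa>\<in>{k..<0}. z \<kappa>)"

text \<open>Unoccupied cells carry the jump 0; the restriction keeps the result extensional on
  \<open>cells\<close>, as the product space requires.\<close>

definition zero_extend :: "int set \<Rightarrow> int set \<Rightarrow> (int \<Rightarrow> real) \<Rightarrow> int \<Rightarrow> real" where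
 "zero_extend cells U z = (\<lambda>\<kappa>\<in>cells. if \<kappa> \<in> U then z \<kappa> else 0)"

text \<open>Here \<open>h\<close> is the mean number of points per cell. The factor before the
  measure is the Poisson probability of one point in each cell of \<open>U\<close> and none in the
  others.\<close>

definition grid_prob :: "real measure \<Rightarrow> real \<Rightarrow> int set \<Rightarrow> int set \<Rightarrow> (int \<Rightarrow> real) set \<Rightarrow> real" where
 "grid_prob \<nu> h cells U G = exp (- (h * card cells)) * h ^ card U *
   measure (PiM U (\<lambda>_. \<nu>)) {z \<in> space (PiM U (\<lambda>_. borel)). zero_extend cells U z \<in> G}"

lemma zero_extend_measurable:
 "zero_extend cells U \<in> measurable (PiM U (\<lambda>_. borel)) (PiM cells (\<lambda>_. borel))"
 unfolding zero_extend_def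
proof (rule measurable_restrict)
 fix \<kappa> assume "\<kappa> \<in> cells"
 show "(\<lambda>z. if \<kappa> \<in> U then z \<kappa> else 0) \<in> borel_measurable (PiM U (\<lambda>_. borel))"
  by (cases "\<kappa> \<in> U") (auto intro: measurable_component_singleton)
qed

lemma (in prob_space) iid_vector_law:
 assumes ind: "indep_vars (\<lambda>_. borel) V U" and law: "\<And>\<kappa>. \<kappa> \<in> U \<Longrightarrow> distr M borel (V \<kappa>) = \<nu>"
 shows "distr M (PiM U (\<lambda>_. borel)) (\<lambda>w. \<lambda>\<kappa>\<in>U. V \<kappa> w) = PiM U (\<lambda>_. \<nu> :: real measure)"
proof (cases "U = {}")
 case True
 show ?thesis unfolding True PiM_empty
 proof (rule measure_eqI)
  fix A assume "A \<in> sets (distr M (count_space {\<lambda>_. undefined}) (\<lambda>w. \<lambda>\<kappa>\<in>{}. V \<kappa> w))"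
  then have "A = {} \<or> A = {\<lambda>_. undefined}" by auto
  then show "emeasure (distr M (count_space {\<lambda>_. undefined}) (\<lambda>w. \<lambda>\<kappa>\<in>{}. V \<kappa> w)) A = emeasure (count_space {\<lambda>_. undefined}) A"
  proof -
   have e: "restrict f {} = (\<lambda>_. undefined)" for f :: "'b \<Rightarrow> real" by auto
   show ?thesis unfolding e using \<open>A = {} \<or> A = {\<lambda>_. undefined}\<close> by (auto simp: emeasure_distr emeasure_space_1)
  qed
 qed simp
next
 case False
 have "distr M (PiM U (\<lambda>_. borel)) (\<lambda>w. \<lambda>\<kappa>\<in>U. V \<kappa> w) = PiM U (\<lambda>\<kappa>. distr M borel (V \<kappa>))"
  using indep_vars_iff_distr_eq_PiM'[OF False, where M'="\<lambda>_. borel" and X=V] ind by (auto simp: indep_vars_def)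
 also have "\<dots> = PiM U (\<lambda>_. \<nu>)" by (intro PiM_cong) (auto simp: law)
 finally show ?thesis .
qed

text \<open>Counts the ways to assign sample indices to the occupied cells; relative to
  \<open>card S ^ card U\<close> it tends to 1 as \<open>S\<close> grows. Truncated subtraction
  makes the product 0 when \<open>S\<close> is too small.\<close>

lemma card_injections:
 fixes S :: "'b set"
 assumes "finite U" "finite S"
 shows "card {\<sigma> \<in> U \<rightarrow>\<^sub>E S. inj_on \<sigma> U} = (\<Prod>i<card U. card S - i)"
 using assms(1)
proof (induction U)
 case empty
 have "{\<sigma> \<in> {} \<rightarrow>\<^sub>E S. inj_on \<sigma> {}} = {\<lambda>_. undefined}" by auto
 then show ?case by simp
next
 case (insert x U)
 let ?I = "{\<sigma> \<in> U \<rightarrow>\<^sub>E S. inj_on \<sigma> U}"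
 have fin: "finite ?I" using finite_PiE[OF insert.hyps(1), of "\<lambda>_. S"] assms(2) by auto
 have eq: "{\<sigma> \<in> insert x U \<rightarrow>\<^sub>E S. inj_on \<sigma> (insert x U)} = (\<lambda>(g, y). g(x := y)) ` (SIGMA g:?I. S - g ` U)"
 proof (intro set_eqI iffI)
  fix \<sigma> assume s: "\<sigma> \<in> {\<sigma> \<in> insert x U \<rightarrow>\<^sub>E S. inj_on \<sigma> (insert x U)}"
  define g where "g = \<sigma>(x := undefined)"
  have gU: "g ` U = \<sigma> ` U" using insert.hyps by (auto simp: g_def image_def)
  have "g \<in> ?I" using s insert.hyps unfolding g_def by (auto simp: PiE_def Pi_def extensional_def inj_on_def)
  moreover have "\<sigma> x \<in> S - g ` U" unfolding gU using s insert.hyps by (auto simp: inj_on_def)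
  moreover have "\<sigma> = g(x := \<sigma> x)" by (simp add: g_def)
  ultimately show "\<sigma> \<in> (\<lambda>(g, y). g(x := y)) ` (SIGMA g:?I. S - g ` U)"
   by (intro image_eqI[of _ _ "(g, \<sigma> x)"]) auto
 next
  fix \<sigma> assume "\<sigma> \<in> (\<lambda>(g, y). g(x := y)) ` (SIGMA g:?I. S - g ` U)"
  then obtain g y where g: "g \<in> U \<rightarrow>\<^sub>E S" "inj_on g U" "y \<in> S - g ` U" "\<sigma> = g(x := y)" by auto
  have "\<sigma> \<in> insert x U \<rightarrow>\<^sub>E S" using g unfolding g(4) by (intro PiE_fun_upd) auto
  moreover have "inj_on \<sigma> (insert x U)" using g insert.hyps by (auto simp: inj_on_def)
  ultimately show "\<sigma> \<in> {\<sigma> \<in> insert x U \<rightarrow>\<^sub>E S. inj_on \<sigma> (insert x U)}" by simp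
 qed
 have inj: "inj_on (\<lambda>(g, y). g(x := y)) (SIGMA g:?I. S - g ` U)"
 proof (rule inj_onI, safe)
  fix g y h z assume g: "g \<in> U \<rightarrow>\<^sub>E S" and h: "h \<in> U \<rightarrow>\<^sub>E S" and e: "g(x := y) = h(x := z)"
  show "y = z" using fun_cong[OF e, of x] by simp
  show "g = h"
  proof
   fix t show "g t = h t"
   proof (cases "t = x")
    case True then show ?thesis using g h insert.hyps by (auto simp: PiE_def extensional_def)
   next
    case False then show ?thesis using fun_cong[OF e, of t] by simp
   qed
  qed
 qed
 have "card {\<sigma> \<in> insert x U \<rightarrow>\<^sub>E S. inj_on \<sigma> (insert x U)} = card (SIGMA g:?I. S - g ` U)"
  unfolding eq by (rule card_image[OF inj])
 also have "\<dots> = (\<Sum>g\<in>?I. card (S - g ` U))" by (rule card_SigmaI) (use fin assms in auto)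
 also have "\<dots> = (\<Sum>g\<in>?I. card S - card U)"
 proof (rule sum.cong)
  fix g assume g: "g \<in> ?I"
  then have "card (S - g ` U) = card S - card (g ` U)" using assms insert.hyps by (intro card_Diff_subset) auto
  also have "card (g ` U) = card U" using g by (intro card_image) auto
  finally show "card (S - g ` U) = card S - card U" .
 qed simp
 also have "\<dots> = (\<Prod>i<card U. card S - i) * (card S - card U)" by (simp add: insert.IH)
 finally show ?case using insert.hyps by simp
qed

text \<open>Within the unit disc n-th powers differ by at most n times the difference of the bases,
  so (1 + c / n)^n serves for comparison; \<open>c \<le> 0\<close> places 1 + c / n in the disc for
  large n. Dropping \<open>k\<close> factors is harmless because the bases tend to 1.\<close>

lemma power_limit:
 fixes z :: "nat \<Rightarrow> complex" and c :: real
 assumes z: "\<And>n. cmod (z n) \<le> 1" and c: "c \<le> 0" and lim: "(\<lambda>n. n * (z n - 1)) \<longlonglongrightarrow> of_real c"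
 shows "(\<lambda>n. z n ^ (n - k)) \<longlonglongrightarrow> of_real (exp c)"
proof -
 have a: "(\<lambda>n. cmod (n * (z n - 1) - of_real c)) \<longlonglongrightarrow> 0"
  using tendsto_norm[OF tendsto_diff[OF lim tendsto_const[of "of_real c"]]] by simp
 have b: "\<forall>\<^sub>F n in sequentially. cmod (z n ^ n - of_real ((1 + c / n) ^ n)) \<le> cmod (n * (z n - 1) - of_real c)"
  using eventually_ge_at_top[of "nat \<lceil>- c\<rceil>"] eventually_ge_at_top[of 1]
 proof eventually_elim
  case (elim n)
  have n: "- c \<le> n" "1 \<le> n" using elim by linarith+
  have "\<bar>1 + c / n\<bar> \<le> 1" using n c by (auto simp: abs_le_iff field_simps)
  then have "cmod (z n ^ n - (of_real (1 + c / n)) ^ n) \<le> n * cmod (z n - of_real (1 + c / n))"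
   using z[of n] by (intro norm_power_diff) (simp_all del: of_real_add)
  also have "\<dots> = cmod (of_nat n * (z n - of_real (1 + c / n)))" by (simp only: norm_mult norm_of_nat)
  also have "of_nat n * (z n - of_real (1 + c / n)) = n * (z n - 1) - of_real c"
   using n by (simp add: field_simps)
  finally show ?case by (simp only: of_real_power)
 qed
 have "(\<lambda>n. z n ^ n - of_real ((1 + c / n) ^ n)) \<longlonglongrightarrow> 0"
  by (rule Lim_null_comparison[OF b a])
 moreover have "(\<lambda>n. of_real ((1 + c / n) ^ n) :: complex) \<longlonglongrightarrow> of_real (exp c)"
  by (intro tendsto_of_real tendsto_exp_limit_sequentially)
 ultimately have 1: "(\<lambda>n. z n ^ n) \<longlonglongrightarrow> of_real (exp c)"
  using tendsto_add by fastforce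
 have z1: "z \<longlonglongrightarrow> 1"
 proof -
  have "(\<lambda>n. (1 / of_nat n) * (n * (z n - 1))) \<longlonglongrightarrow> 0 * of_real c"
   by (intro tendsto_mult lim lim_1_over_n)
  then have "(\<lambda>n. (1 / of_nat n) * (n * (z n - 1)) + 1) \<longlonglongrightarrow> 0 * of_real c + 1" by (intro tendsto_add tendsto_const)
  moreover have "\<forall>\<^sub>F n in sequentially. (1 / of_nat n) * (n * (z n - 1)) + 1 = z n"
   using eventually_ge_at_top[of 1] by eventually_elim simp
  ultimately show ?thesis by (auto elim: Lim_transform_eventually)
 qed
 have "(\<lambda>n. z n ^ n / z n ^ k) \<longlonglongrightarrow> of_real (exp c) / 1 ^ k"
  by (intro tendsto_divide 1 tendsto_power z1) simp
 moreover have "\<forall>\<^sub>F n in sequentially. z n ^ n / z n ^ k = z n ^ (n - k)"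
 proof -
  have "\<forall>\<^sub>F n in sequentially. z n \<noteq> 0" using tendsto_imp_eventually_ne[OF z1, of 0] by simp
  with eventually_ge_at_top[of k] show ?thesis by eventually_elim (simp add: power_diff)
 qed
 ultimately show ?thesis by (auto elim: Lim_transform_eventually)
qed

section \<open>The transform of one observation outside the window\<close>

context regular_change_point_model
begin

abbreviation jump_sign :: real where "jump_sign \<equiv> sgn (\<beta>\<^sub>0 - \<alpha>\<^sub>0)"
abbreviation jump_mean :: real where "jump_mean \<equiv> \<bar>\<alpha>\<^sub>0 - \<beta>\<^sub>0\<bar> / 2"

text \<open>Crossing an observation away from the change point changes the criterion at the true
  coefficients by \<open>2 * \<bar>\<beta>\<^sub>0 - \<alpha>\<^sub>0\<bar>\<close> times this
  value. The sign of the noise depends on the side, while the drift is upward on both.\<close>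

definition jump :: "int \<Rightarrow> real \<Rightarrow> real" where
 "jump \<kappa> e = (if 0 \<le> \<kappa> then jump_sign else - jump_sign) * e + jump_mean"

definition jump_law :: "real measure" where
 "jump_law = distr M borel (\<lambda>w. \<xi> w + jump_mean)"

definition cell :: "real \<Rightarrow> nat \<Rightarrow> int \<Rightarrow> real set" where
 "cell h n \<kappa> = {d\<^sub>0 + h * \<kappa> / n<..d\<^sub>0 + h * (\<kappa> + 1) / n}"

definition window :: "real \<Rightarrow> nat \<Rightarrow> real set" where
 "window K n = {d\<^sub>0 - K / n<..d\<^sub>0 + K / n}"

text \<open>Chosen so that \<open>u\<close> and \<open>v\<close> times the scaled errors of the two
  coefficients add up, to first order, to the sum of \<open>\<xi>s i * weight u v (Xs i)\<close>
  over the sample divided by sqrt n.\<close>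

definition weight :: "real \<Rightarrow> real \<Rightarrow> real \<Rightarrow> real" where
 "weight u v x = (if x \<le> d\<^sub>0 then u / p\<^sub>L else v / p\<^sub>R)"

definition outer_sum :: "real \<Rightarrow> real \<Rightarrow> real \<Rightarrow> nat \<Rightarrow> 'a \<Rightarrow> real" where
 "outer_sum u v K n w = (\<Sum>i | i < n \<and> Xs i w \<notin> window K n. \<xi>s i w * weight u v (Xs i w)) / sqrt n"

definition limit_variance :: "real \<Rightarrow> real \<Rightarrow> real" where
 "limit_variance u v = \<sigma>2 * (u\<^sup>2 / p\<^sub>L + v\<^sup>2 / p\<^sub>R)"

definition cell_jump :: "real \<Rightarrow> nat \<Rightarrow> 'a \<Rightarrow> int \<Rightarrow> real" where
 "cell_jump h n w \<kappa> = esum n (\<lambda>i. Xs i w) (\<lambda>i. jump \<kappa> (\<xi>s i w)) (cell h n \<kappa>)"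

definition occupied :: "real \<Rightarrow> int set \<Rightarrow> int set \<Rightarrow> nat \<Rightarrow> 'a \<Rightarrow> bool" where
 "occupied h cells U n w \<longleftrightarrow> (\<forall>\<kappa>\<in>cells. cnt n (\<lambda>i. Xs i w) (cell h n \<kappa>) = (if \<kappa> \<in> U then 1 else 0))"

lemma sets_cell [measurable]: "cell h n \<kappa> \<in> sets borel" by (simp add: cell_def)
lemma sets_window [measurable]: "window K n \<in> sets borel" by (simp add: window_def)

lemma weight_measurable [measurable]: "weight u v \<in> borel_measurable borel"
 unfolding weight_def by measurable

lemma weight_bound: "\<bar>weight u v x\<bar> \<le> \<bar>u\<bar> / p\<^sub>L + \<bar>v\<bar> / p\<^sub>R"
 using p_pos by (auto simp: weight_def abs_divide intro: order_trans[OF _ add_increasing] add_increasing add_increasing2)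

lemma jump_measurable [measurable]: "jump \<kappa> \<in> borel_measurable borel"
 unfolding jump_def by measurable

text \<open>Symmetry of the noise removes the sign that distinguishes the two sides.\<close>

lemma jump_law_\<xi>s: "distr M borel (\<lambda>w. jump \<kappa> (\<xi>s i w)) = jump_law"
proof -
 have "distr M borel (\<lambda>w. jump \<kappa> (\<xi>s i w)) = distr (distr M borel (\<xi>s i)) borel (jump \<kappa>)"
  by (subst distr_distr) (auto simp: comp_def)
 also have "\<dots> = distr M borel (\<lambda>w. jump \<kappa> (\<xi> w))" unfolding \<xi>s_law by (subst distr_distr) (auto simp: comp_def)
 also have "\<dots> = jump_law"
 proof -
  have s: "jump_sign = 1 \<or> jump_sign = -1" using \<alpha>\<^sub>0_neq_\<beta>\<^sub>0 by (auto simp: sgn_if)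
  have neg: "distr M borel (\<lambda>w. - \<xi> w + jump_mean) = jump_law"
  proof -
   have "distr M borel (\<lambda>w. - \<xi> w + jump_mean) = distr (distr M borel (\<lambda>w. - \<xi> w)) borel (\<lambda>x. x + jump_mean)"
    by (subst distr_distr) (auto simp: comp_def)
   then show ?thesis unfolding \<xi>_symmetric jump_law_def by (subst (asm) distr_distr) (auto simp: comp_def)
  qed
  have "(\<lambda>w. jump \<kappa> (\<xi> w)) = (\<lambda>w. \<xi> w + jump_mean) \<or> (\<lambda>w. jump \<kappa> (\<xi> w)) = (\<lambda>w. - \<xi> w + jump_mean)"
   using s by (auto simp: jump_def fun_eq_iff)
  then show ?thesis using neg by (auto simp: jump_law_def)
 qed
 finally show ?thesis .
qed

lemma noise_design_expectation:
 assumes [measurable]: "f \<in> borel_measurable borel" "g \<in> borel_measurable borel"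
  and f: "integrable M (\<lambda>w. f (\<xi> w))" and g: "integrable M (\<lambda>w. g (X w))"
 shows "integrable M (\<lambda>w. f (\<xi> w) * (g (X w) :: real))"
  "expectation (\<lambda>w. f (\<xi> w) * g (X w)) = expectation (\<lambda>w. f (\<xi> w)) * expectation (\<lambda>w. g (X w))"
proof -
 have iv: "indep_var borel (\<lambda>w. g (X w)) borel (\<lambda>w. f (\<xi> w))"
  using indep_var_compose[OF X_\<xi>_indep, of g borel f borel] by (simp add: comp_def)
 show "integrable M (\<lambda>w. f (\<xi> w) * g (X w))" using indep_var_integrable[OF iv g f] by (simp add: mult.commute)
 show "expectation (\<lambda>w. f (\<xi> w) * g (X w)) = expectation (\<lambda>w. f (\<xi> w)) * expectation (\<lambda>w. g (X w))"
  using indep_var_lebesgue_integral[OF iv g f] by (simp add: mult.commute)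
qed

lemma indicator_expectation: "B \<in> sets borel \<Longrightarrow> expectation (\<lambda>w. indicator B (X w)) = prob {w\<in>space M. X w \<in> B}"
proof -
 assume [measurable]: "B \<in> sets borel"
 have "expectation (\<lambda>w. indicat_real B (X w)) = expectation (indicat_real {w\<in>space M. X w \<in> B})"
  by (rule Bochner_Integration.integral_cong) (auto simp: indicator_def)
 then show ?thesis by simp
qed

lemma score_moments:
 fixes u v :: real
 defines "T \<equiv> \<lambda>w. \<xi> w * weight u v (X w)"
 shows "integrable M T" "expectation T = 0" "integrable M (\<lambda>w. (T w)\<^sup>2)" "expectation (\<lambda>w. (T w)\<^sup>2) = limit_variance u v"
proof -
 have wi: "integrable M (\<lambda>w. weight u v (X w))"
  by (rule integrable_const_bound[of _ "\<bar>u\<bar> / p\<^sub>L + \<bar>v\<bar> / p\<^sub>R"]) (use weight_bound in auto)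
 show "integrable M T" "expectation T = 0"
  unfolding T_def using noise_design_expectation[of "\<lambda>x. x" "weight u v"] \<xi>_integrable wi expectation_\<xi> by auto
 have w2: "(weight u v x)\<^sup>2 = (u / p\<^sub>L)\<^sup>2 * indicator {..d\<^sub>0} x + (v / p\<^sub>R)\<^sup>2 * indicator {d\<^sub>0<..} x" for x
  by (auto simp: weight_def indicator_def)
 have ii: "integrable M (\<lambda>w. indicator B (X w) :: real)" if "B \<in> sets borel" for B
  using that by (intro integrable_const_bound[of _ 1]) (auto simp: indicator_def)
 have w2i: "integrable M (\<lambda>w. (weight u v (X w))\<^sup>2)" unfolding w2 using ii by simp
 have w2e: "expectation (\<lambda>w. (weight u v (X w))\<^sup>2) = u\<^sup>2 / p\<^sub>L + v\<^sup>2 / p\<^sub>R"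
 proof -
  have "expectation (\<lambda>w. (weight u v (X w))\<^sup>2) = (u / p\<^sub>L)\<^sup>2 * p\<^sub>L + (v / p\<^sub>R)\<^sup>2 * p\<^sub>R"
   unfolding w2 p\<^sub>L_def p\<^sub>R_def using ii by (simp add: indicator_expectation)
  also have "\<dots> = u\<^sup>2 / p\<^sub>L + v\<^sup>2 / p\<^sub>R" using p_pos by (simp add: power2_eq_square)
  finally show ?thesis .
 qed
 show "integrable M (\<lambda>w. (T w)\<^sup>2)" "expectation (\<lambda>w. (T w)\<^sup>2) = limit_variance u v"
  unfolding T_def power_mult_distrib using noise_design_expectation[of "\<lambda>x. x\<^sup>2" "\<lambda>x. (weight u v x)\<^sup>2"] \<xi>_square_integrable w2i w2e
  by (auto simp: limit_variance_def \<sigma>2_def)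
qed

text \<open>The factor of a single observation. The indicator makes it the transform of a
  subprobability, so the limit of its power also carries the void probability of the window.\<close>

definition outer_char :: "real \<Rightarrow> real \<Rightarrow> real \<Rightarrow> nat \<Rightarrow> complex" where
 "outer_char u v K n = expectation (\<lambda>w. indicator (- window K n) (X w) * iexp (\<xi> w * weight u v (X w) / sqrt n))"

lemma outer_char_le_1: "cmod (outer_char u v K n) \<le> 1"
proof -
 have "cmod (outer_char u v K n) \<le> expectation (\<lambda>w. cmod (indicator (- window K n) (X w) * iexp (\<xi> w * weight u v (X w) / sqrt n)))"
  unfolding outer_char_def by (rule integral_norm_bound)
 also have "\<dots> \<le> expectation (\<lambda>_. 1)"
 proof (rule integral_mono)
  show "integrable M (\<lambda>w. cmod (indicator (- window K n) (X w) * iexp (\<xi> w * weight u v (X w) / sqrt n)))"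
   by (rule integrable_const_bound[of _ 1]) (auto simp: indicator_def norm_mult simp del: of_real_divide of_real_mult)
 qed (auto simp: indicator_def norm_mult simp del: of_real_divide of_real_mult)
 finally show ?thesis by (simp add: prob_space)
qed

text \<open>Three contributions: the transform of the full score to second order gives minus half
  the variance; removing the window costs its mass, and n times that mass tends to
  \<open>2 * K * f_X d\<^sub>0\<close>; the interaction of the two is only O(n^(-3/2)).\<close>

lemma outer_char_limit:
 assumes K: "0 \<le> K"
 shows "(\<lambda>n. of_nat n * (outer_char u v K n - 1)) \<longlonglongrightarrow> of_real (- limit_variance u v / 2 - 2 * K * f_X d\<^sub>0)"
proof -
 define T where "T w = \<xi> w * weight u v (X w)" for w
 note T = score_moments[of u v, folded T_def]
 have Tm[measurable]: "T \<in> borel_measurable M" using T(1) by auto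
 define c1 where "c1 = \<bar>u\<bar> / p\<^sub>L + \<bar>v\<bar> / p\<^sub>R"
 have Tb: "\<bar>T w\<bar> \<le> \<bar>\<xi> w\<bar> * c1" for w
  unfolding T_def abs_mult c1_def by (intro mult_left_mono weight_bound) simp
 have c10: "0 \<le> c1" using p_pos by (simp add: c1_def)
 define P where "P n = prob {w\<in>space M. X w \<in> window K n}" for n
 have nP: "(\<lambda>n. n * P n) \<longlonglongrightarrow> 2 * K * f_X d\<^sub>0"
  using local_mass[of "-K" K] K by (simp add: P_def window_def algebra_simps)
 have ie: "integrable M (\<lambda>w. iexp (T w / sqrt n))" for n :: nat by (intro integrable_iexp) auto
 have iw: "integrable M (\<lambda>w. indicator (window K n) (X w) :: real)" for n :: nat
  by (rule integrable_const_bound[of _ 1]) (auto simp: indicator_def)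
 define R where "R n = expectation (\<lambda>w. indicator (window K n) (X w) * (iexp (T w / sqrt n) - 1))" for n :: nat
 have iR: "integrable M (\<lambda>w. indicator (window K n) (X w) * (iexp (T w / sqrt n) - 1))" for n :: nat
 proof (rule integrable_const_bound[of _ 2])
  have "cmod (iexp t - 1) \<le> 2" for t :: real
   using norm_triangle_ineq4[of "iexp t" 1] by simp
  then have "cmod (indicator (window K n) (X w) * (iexp (T w / sqrt n) - 1)) \<le> 2" for w
   by (auto simp: indicator_def norm_mult simp del: of_real_divide)
  then show "AE w in M. cmod (indicator (window K n) (X w) * (iexp (T w / sqrt n) - 1)) \<le> 2" by simp
 qed measurable
 have dec: "outer_char u v K n = expectation (\<lambda>w. iexp (T w / sqrt n)) - of_real (P n) - R n" for n
 proof -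
  have "outer_char u v K n = expectation (\<lambda>w. iexp (T w / sqrt n) - of_real (indicator (window K n) (X w)) - indicator (window K n) (X w) * (iexp (T w / sqrt n) - 1))"
   unfolding outer_char_def T_def by (rule Bochner_Integration.integral_cong) (auto simp: indicator_def)
  also have "\<dots> = expectation (\<lambda>w. iexp (T w / sqrt n)) - expectation (\<lambda>w. of_real (indicator (window K n) (X w))) - R n"
   unfolding R_def using ie[of n] iR[of n] iw[of n] by (subst Bochner_Integration.integral_diff Bochner_Integration.integral_diff) (auto simp del: of_real_indicator)
  also have "expectation (\<lambda>w. complex_of_real (indicator (window K n) (X w))) = of_real (P n)"
   unfolding P_def by (subst integral_complex_of_real) (simp add: indicator_expectation)
  finally show ?thesis .
 qed
 have R0: "(\<lambda>n. of_nat n * R n) \<longlonglongrightarrow> 0"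
 proof (rule Lim_null_comparison)
  show "\<forall>\<^sub>F n in sequentially. norm (of_nat n * R n) \<le> (c1 * expectation (\<lambda>w. \<bar>\<xi> w\<bar>)) * (n * P n) * (1 / sqrt n)"
  proof (rule eventually_sequentiallyI[of 1])
   fix n :: nat assume n: "1 \<le> n"
   have Mi: "integrable M (\<lambda>w. \<bar>\<xi> w\<bar> * indicator (window K n) (X w))"
    "expectation (\<lambda>w. \<bar>\<xi> w\<bar> * indicator (window K n) (X w)) = expectation (\<lambda>w. \<bar>\<xi> w\<bar>) * P n"
    using noise_design_expectation[of abs "indicator (window K n)"] \<xi>_integrable iw[of n] indicator_expectation[of "window K n"]
    by (auto simp: P_def)
   have "norm (R n) \<le> expectation (\<lambda>w. norm (indicator (window K n) (X w) * (iexp (T w / sqrt n) - 1)))"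
    unfolding R_def by (rule integral_norm_bound)
   also have "\<dots> \<le> expectation (\<lambda>w. (c1 / sqrt n) * (\<bar>\<xi> w\<bar> * indicator (window K n) (X w)))"
   proof (rule integral_mono)
    show "integrable M (\<lambda>w. norm (indicator (window K n) (X w) * (iexp (T w / sqrt n) - 1)))" using iR by (rule integrable_norm)
    show "integrable M (\<lambda>w. (c1 / sqrt n) * (\<bar>\<xi> w\<bar> * indicator (window K n) (X w)))" using Mi(1) by (rule integrable_mult_right)
    fix w
    have "cmod (iexp (T w / sqrt n) - 1) \<le> \<bar>T w / sqrt n\<bar>"
     using iexp_approx1[of "T w / sqrt n" 0] by simp
    also have "\<dots> \<le> \<bar>\<xi> w\<bar> * c1 / sqrt n" using Tb[of w] by (simp add: abs_divide divide_right_mono)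
    finally show "norm (indicator (window K n) (X w) * (iexp (T w / sqrt n) - 1)) \<le> (c1 / sqrt n) * (\<bar>\<xi> w\<bar> * indicator (window K n) (X w))"
     by (auto simp: indicator_def norm_mult mult.commute simp del: of_real_divide)
   qed
   also have "\<dots> = (c1 * expectation (\<lambda>w. \<bar>\<xi> w\<bar>)) * P n * (1 / sqrt n)" using Mi(2) by simp
   finally have "norm (R n) \<le> (c1 * expectation (\<lambda>w. \<bar>\<xi> w\<bar>)) * P n * (1 / sqrt n)" .
   then have "real n * norm (R n) \<le> real n * ((c1 * expectation (\<lambda>w. \<bar>\<xi> w\<bar>)) * P n * (1 / sqrt n))" by (intro mult_left_mono) auto
   then show "norm (of_nat n * R n) \<le> (c1 * expectation (\<lambda>w. \<bar>\<xi> w\<bar>)) * (n * P n) * (1 / sqrt n)" by (simp add: norm_mult ac_simps)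
  qed
  have "(\<lambda>n. 1 / sqrt (real n)) \<longlonglongrightarrow> 0"
   by (intro tendsto_divide_0[OF tendsto_const] filterlim_at_top_imp_at_infinity filterlim_compose[OF sqrt_at_top filterlim_real_sequentially])
  then have "(\<lambda>n. (c1 * expectation (\<lambda>w. \<bar>\<xi> w\<bar>)) * (n * P n) * (1 / sqrt n)) \<longlonglongrightarrow> (c1 * expectation (\<lambda>w. \<bar>\<xi> w\<bar>)) * (2 * K * f_X d\<^sub>0) * 0"
   by (intro tendsto_mult tendsto_const nP)
  then show "(\<lambda>n. (c1 * expectation (\<lambda>w. \<bar>\<xi> w\<bar>)) * (n * P n) * (1 / sqrt n)) \<longlonglongrightarrow> 0" by simp
 qed
 define v2 where "v2 = limit_variance u v"
 have main: "(\<lambda>n. of_nat n * (expectation (\<lambda>w. iexp (T w / sqrt n)) - (1 - of_real (v2 / (2 * n))))) \<longlonglongrightarrow> 0"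
 proof (rule Lim_null_comparison)
  show "\<forall>\<^sub>F n in sequentially. norm (of_nat n * (expectation (\<lambda>w. iexp (T w / sqrt n)) - (1 - of_real (v2 / (2 * n))))) \<le>
    expectation (\<lambda>w. min (6 * (T w)\<^sup>2) (\<bar>1 / sqrt n\<bar> * \<bar>T w\<bar>^3)) / 6"
  proof (rule eventually_sequentiallyI[of 1])
   fix n :: nat assume n: "1 \<le> n"
   have ch: "char (distr M borel T) (1 / sqrt n) = expectation (\<lambda>w. iexp (T w / sqrt n))"
    unfolding char_def by (subst integral_distr) auto
   have "cmod (char (distr M borel T) (1 / sqrt n) - (1 - of_real ((1 / sqrt n)\<^sup>2 * v2 / 2))) \<le>
     ((1 / sqrt n)\<^sup>2 / 6) * expectation (\<lambda>w. min (6 * (T w)\<^sup>2) (\<bar>1 / sqrt n\<bar> * \<bar>T w\<bar>^3))"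
    using char_approx3'[OF Tm T(1,3,2) _ refl, of v2 "1 / sqrt n"] T(2,4) by (simp add: v2_def)
   then have "n * cmod (expectation (\<lambda>w. iexp (T w / sqrt n)) - (1 - of_real (v2 / (2 * n)))) \<le>
     n * ((1 / n / 6) * expectation (\<lambda>w. min (6 * (T w)\<^sup>2) (\<bar>1 / sqrt n\<bar> * \<bar>T w\<bar>^3)))"
    unfolding ch using n by (intro mult_left_mono) (simp_all add: power_divide mult.commute)
   then show "norm (of_nat n * (expectation (\<lambda>w. iexp (T w / sqrt n)) - (1 - of_real (v2 / (2 * n))))) \<le>
    expectation (\<lambda>w. min (6 * (T w)\<^sup>2) (\<bar>1 / sqrt n\<bar> * \<bar>T w\<bar>^3)) / 6"
    using n by (simp add: norm_mult)
  qed
  \<comment> \<open>Only second moments are available, so the cubic remainder is truncated at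
    \<open>6 * (T w)^2\<close>, which dominates it, and it tends to 0 pointwise.\<close>
  have "(\<lambda>n. expectation (\<lambda>w. min (6 * (T w)\<^sup>2) (\<bar>1 / sqrt (real n)\<bar> * \<bar>T w\<bar>^3))) \<longlonglongrightarrow> expectation (\<lambda>w. 0)"
  proof (rule integral_dominated_convergence[where w="\<lambda>w. 6 * (T w)\<^sup>2"])
   show "integrable M (\<lambda>w. 6 * (T w)\<^sup>2)" using T(3) by simp
   have "(\<lambda>n. min (6 * y\<^sup>2) (\<bar>1 / sqrt (real n)\<bar> * \<bar>y\<bar>^3)) \<longlonglongrightarrow> 0" for y :: real
   proof -
    have "(\<lambda>n. 1 / sqrt (real n)) \<longlonglongrightarrow> 0"
     by (intro tendsto_divide_0[OF tendsto_const] filterlim_at_top_imp_at_infinity filterlim_compose[OF sqrt_at_top filterlim_real_sequentially])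
    then have "(\<lambda>n. min (6 * y\<^sup>2) (\<bar>1 / sqrt (real n)\<bar> * \<bar>y\<bar>^3)) \<longlonglongrightarrow> min (6 * y\<^sup>2) (\<bar>0\<bar> * \<bar>y\<bar>^3)"
     by (intro tendsto_min tendsto_mult tendsto_rabs tendsto_const)
    moreover have "min (6 * y\<^sup>2) (\<bar>0\<bar> * \<bar>y\<bar>^3) = 0" by (auto simp: min_def)
    ultimately show ?thesis by simp
   qed
   then show "AE w in M. (\<lambda>n. min (6 * (T w)\<^sup>2) (\<bar>1 / sqrt (real n)\<bar> * \<bar>T w\<bar>^3)) \<longlonglongrightarrow> 0" by simp
   have "norm (min (6 * y\<^sup>2) (\<bar>1 / sqrt (real n)\<bar> * \<bar>y\<bar>^3)) \<le> 6 * y\<^sup>2" for y :: real and n by (auto simp: min_def)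
   then show "AE w in M. norm (min (6 * (T w)\<^sup>2) (\<bar>1 / sqrt (real n)\<bar> * \<bar>T w\<bar>^3)) \<le> 6 * (T w)\<^sup>2" for n by simp
  qed measurable
  then show "(\<lambda>n. expectation (\<lambda>w. min (6 * (T w)\<^sup>2) (\<bar>1 / sqrt (real n)\<bar> * \<bar>T w\<bar>^3)) / 6) \<longlonglongrightarrow> 0"
   by (auto intro!: tendsto_divide_zero)
 qed
 have "(\<lambda>n. of_nat n * (expectation (\<lambda>w. iexp (T w / sqrt n)) - (1 - of_real (v2 / (2 * n)))) - of_nat n * R n - of_real (n * P n) - of_real (v2 / 2)) \<longlonglongrightarrow>
   0 - 0 - of_real (2 * K * f_X d\<^sub>0) - of_real (v2 / 2)"
  by (intro tendsto_diff main R0 tendsto_of_real nP tendsto_const)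
 moreover have "\<forall>\<^sub>F n in sequentially. of_nat n * (expectation (\<lambda>w. iexp (T w / sqrt n)) - (1 - of_real (v2 / (2 * n)))) - of_nat n * R n - of_real (n * P n) - of_real (v2 / 2)
   = of_nat n * (outer_char u v K n - 1)"
 proof (rule eventually_sequentiallyI[of 1])
  fix n :: nat assume n: "1 \<le> n"
  have "complex_of_real (v2 / 2) = of_nat n * of_real (v2 / (2 * n))" using n by simp
  then show "of_nat n * (expectation (\<lambda>w. iexp (T w / sqrt n)) - (1 - of_real (v2 / (2 * n)))) - of_nat n * R n - of_real (n * P n) - of_real (v2 / 2)
   = of_nat n * (outer_char u v K n - 1)"
   unfolding dec by (simp add: algebra_simps)
 qed
 ultimately have "(\<lambda>n. of_nat n * (outer_char u v K n - 1)) \<longlonglongrightarrow> 0 - 0 - of_real (2 * K * f_X d\<^sub>0) - of_real (v2 / 2)"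
  by (rule Lim_transform_eventually)
 moreover have "0 - 0 - 2 * K * f_X d\<^sub>0 - v2 / 2 = - limit_variance u v / 2 - 2 * K * f_X d\<^sub>0" by (simp add: v2_def)
 from arg_cong[OF this, of complex_of_real]
 have "0 - 0 - complex_of_real (2 * K * f_X d\<^sub>0) - of_real (v2 / 2) = of_real (- limit_variance u v / 2 - 2 * K * f_X d\<^sub>0)"
  by (simp only: of_real_diff of_real_0)
 ultimately show ?thesis by (simp only:)
qed

end

lemma (in prob_space) indep_vars_reindex_inj:
 assumes ind: "indep_vars (\<lambda>_. N) V I" and \<sigma>: "inj_on \<sigma> U" "\<sigma> ` U \<subseteq> I"
 shows "indep_vars (\<lambda>_. N) (\<lambda>\<kappa>. V (\<sigma> \<kappa>)) U"
proof -
 have "disjoint_family_on (\<lambda>\<kappa>. {\<sigma> \<kappa>}) U" using \<sigma>(1) by (auto simp: disjoint_family_on_def inj_on_def)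
 then have r: "indep_vars (\<lambda>\<kappa>. PiM {\<sigma> \<kappa>} (\<lambda>_. N)) (\<lambda>\<kappa> w. restrict (\<lambda>i. V i w) {\<sigma> \<kappa>}) U"
  using \<sigma>(2) by (intro indep_vars_restrict[OF ind]) auto
 have "indep_vars (\<lambda>_. N) (\<lambda>\<kappa> w. (\<lambda>f. f (\<sigma> \<kappa>)) (restrict (\<lambda>i. V i w) {\<sigma> \<kappa>})) U"
  by (rule indep_vars_compose2[OF r]) (auto intro: measurable_component_singleton)
 then show ?thesis by simp
qed

section \<open>Placements of observations in the cells of the window\<close>

context regular_change_point_model
begin

text \<open>Cells are open on the left and closed on the right because the model counts x = d to the
  left level; hence a ceiling and the shift by 1.\<close>

lemma cell_iff:
 assumes "1 \<le> n" "0 < h"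
 shows "x \<in> cell h n \<kappa> \<longleftrightarrow> \<kappa> = \<lceil>(x - d\<^sub>0) * n / h\<rceil> - 1"
proof -
 have n: "0 < real n" using assms by simp
 have "x \<in> cell h n \<kappa> \<longleftrightarrow> \<kappa> < (x - d\<^sub>0) * n / h \<and> (x - d\<^sub>0) * n / h \<le> \<kappa> + 1"
  unfolding cell_def using assms n by (auto simp: field_simps)
 also have "\<dots> \<longleftrightarrow> \<lceil>(x - d\<^sub>0) * n / h\<rceil> = \<kappa> + 1" by (auto simp: ceiling_eq_iff)
 finally show ?thesis by auto
qed

lemma window_iff:
 assumes "1 \<le> n" "0 < h"
 shows "x \<in> window (h * real m) n \<longleftrightarrow> (\<exists>\<kappa>\<in>{- int m..<int m}. x \<in> cell h n \<kappa>)"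
proof -
 have n: "0 < real n" using assms by simp
 let ?y = "(x - d\<^sub>0) * n / h"
 have "x \<in> window (h * real m) n \<longleftrightarrow> - real m < ?y \<and> ?y \<le> real m"
  unfolding window_def using assms n by (auto simp: field_simps)
 also have "\<dots> \<longleftrightarrow> - int m < \<lceil>?y\<rceil> \<and> \<lceil>?y\<rceil> \<le> int m"
  by (simp add: less_ceiling_iff ceiling_le_iff)
 also have "\<dots> \<longleftrightarrow> (\<exists>\<kappa>\<in>{- int m..<int m}. \<kappa> = \<lceil>?y\<rceil> - 1)" by auto
 finally show ?thesis unfolding cell_iff[OF assms] .
qed

context
 fixes h :: real and m :: nat and U :: "int set" and G :: "(int \<Rightarrow> real) set" and u v :: real
 assumes h: "0 < h" and U: "U \<subseteq> {- int m..<int m}" and G: "G \<in> sets (PiM {- int m..<int m} (\<lambda>_. borel))"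
begin

abbreviation (input) cells where "cells \<equiv> {- int m..<int m}"
abbreviation (input) half_width where "half_width \<equiv> h * real m"

definition outer_factor :: "nat \<Rightarrow> real \<times> real \<Rightarrow> complex" where
 "outer_factor n p = indicator (- window half_width n) (fst p) * iexp (snd p * weight u v (fst p) / sqrt n)"

definition placement :: "nat \<Rightarrow> (int \<Rightarrow> nat) \<Rightarrow> 'a \<Rightarrow> bool" where
 "placement n \<sigma> w \<longleftrightarrow> (\<forall>\<kappa>\<in>U. Xs (\<sigma> \<kappa>) w \<in> cell h n \<kappa>) \<and> (\<forall>i\<in>{..<n} - \<sigma> ` U. Xs i w \<notin> window half_width n)"

text \<open>The indicator of \<open>placement\<close> and the exponential of the outer sum as one
  product over single observations, so that the expectation can factor over the i.i.d.
  sample.\<close>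

definition placement_weight :: "nat \<Rightarrow> (int \<Rightarrow> nat) \<Rightarrow> 'a \<Rightarrow> complex" where
 "placement_weight n \<sigma> w = (\<Prod>\<kappa>\<in>U. indicator (cell h n \<kappa>) (Xs (\<sigma> \<kappa>) w)) * (\<Prod>i\<in>{..<n} - \<sigma> ` U. outer_factor n (Xs i w, \<xi>s i w))"

definition placed_jumps :: "(int \<Rightarrow> nat) \<Rightarrow> 'a \<Rightarrow> int \<Rightarrow> real" where
 "placed_jumps \<sigma> w = (\<lambda>\<kappa>\<in>U. jump \<kappa> (\<xi>s (\<sigma> \<kappa>) w))"

lemma finU: "finite U" using U by (rule finite_subset) simp

lemma outer_factor_measurable [measurable]: "outer_factor n \<in> borel_measurable (borel \<Otimes>\<^sub>M borel)"
 unfolding outer_factor_def by measurable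

lemma placement_occupied:
 assumes n: "1 \<le> n" and \<sigma>: "\<sigma> \<in> U \<rightarrow>\<^sub>E {..<n}" "inj_on \<sigma> U" and p: "placement n \<sigma> w"
 shows "\<And>\<kappa>. \<kappa> \<in> cells \<Longrightarrow> {i. i < n \<and> Xs i w \<in> cell h n \<kappa>} = (if \<kappa> \<in> U then {\<sigma> \<kappa>} else {})"
  and "occupied h cells U n w" and "{i. i < n \<and> Xs i w \<notin> window half_width n} = {..<n} - \<sigma> ` U"
proof -
 have same: "\<kappa> = \<kappa>'" if "x \<in> cell h n \<kappa>" "x \<in> cell h n \<kappa>'" for x \<kappa> \<kappa>'
  using that by (simp add: cell_iff[OF n h])
 have in\<sigma>: "\<exists>\<kappa>'\<in>U. i = \<sigma> \<kappa>' \<and> \<kappa>' = \<kappa>" if "i < n" "Xs i w \<in> cell h n \<kappa>" "\<kappa> \<in> cells" for i \<kappa>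
 proof -
  have "Xs i w \<in> window half_width n" using that by (auto simp: window_iff[OF n h])
  then have "i \<in> \<sigma> ` U" using p that(1) unfolding placement_def by blast
  then obtain \<kappa>' where "\<kappa>' \<in> U" "i = \<sigma> \<kappa>'" by blast
  moreover then have "Xs i w \<in> cell h n \<kappa>'" using p by (auto simp: placement_def)
  ultimately show ?thesis using same that(2) by blast
 qed
 show *: "{i. i < n \<and> Xs i w \<in> cell h n \<kappa>} = (if \<kappa> \<in> U then {\<sigma> \<kappa>} else {})" if "\<kappa> \<in> cells" for \<kappa>
 proof (cases "\<kappa> \<in> U")
  case True
  then have "\<sigma> \<kappa> < n" "Xs (\<sigma> \<kappa>) w \<in> cell h n \<kappa>" using \<sigma>(1) p by (auto simp: placement_def)
  moreover have "i = \<sigma> \<kappa>" if "i < n" "Xs i w \<in> cell h n \<kappa>" for i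
   using in\<sigma>[OF that \<open>\<kappa> \<in> cells\<close>] by blast
  ultimately have "{i. i < n \<and> Xs i w \<in> cell h n \<kappa>} = {\<sigma> \<kappa>}" by blast
  then show ?thesis using True by simp
 next
  case False
  then show ?thesis using in\<sigma>[OF _ _ that] by auto
 qed
 show "occupied h cells U n w" unfolding occupied_def cnt_def using * by auto
 show "{i. i < n \<and> Xs i w \<notin> window half_width n} = {..<n} - \<sigma> ` U"
 proof -
  have "Xs (\<sigma> \<kappa>) w \<in> window half_width n" if "\<kappa> \<in> U" for \<kappa>
   using that p U by (auto simp: window_iff[OF n h] placement_def)
  then show ?thesis using p by (auto simp: placement_def)
 qed
qed

lemma occupied_placement:
 assumes n: "1 \<le> n" and occ: "occupied h cells U n w"
 shows "\<exists>\<sigma>. \<sigma> \<in> U \<rightarrow>\<^sub>E {..<n} \<and> inj_on \<sigma> U \<and> placement n \<sigma> w"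
proof -
 have "\<forall>\<kappa>\<in>U. \<exists>i. {i. i < n \<and> Xs i w \<in> cell h n \<kappa>} = {i}"
 proof
  fix \<kappa> assume "\<kappa> \<in> U"
  then have "card {i. i < n \<and> Xs i w \<in> cell h n \<kappa>} = 1" using occ U by (auto simp: occupied_def cnt_def)
  then show "\<exists>i. {i. i < n \<and> Xs i w \<in> cell h n \<kappa>} = {i}" by (rule card_1_singletonE) blast
 qed
 then obtain s where s: "\<And>\<kappa>. \<kappa> \<in> U \<Longrightarrow> {i. i < n \<and> Xs i w \<in> cell h n \<kappa>} = {s \<kappa>}" by metis
 define \<sigma> where "\<sigma> = restrict s U"
 have s1: "s \<kappa> < n" "Xs (s \<kappa>) w \<in> cell h n \<kappa>" if "\<kappa> \<in> U" for \<kappa> using s[OF that] by auto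
 have "\<sigma> \<in> U \<rightarrow>\<^sub>E {..<n}" using s1 by (auto simp: \<sigma>_def)
 moreover have "inj_on \<sigma> U"
 proof (rule inj_onI)
  fix \<kappa> \<kappa>' assume k: "\<kappa> \<in> U" "\<kappa>' \<in> U" "\<sigma> \<kappa> = \<sigma> \<kappa>'"
  then have "Xs (s \<kappa>) w \<in> cell h n \<kappa>" "Xs (s \<kappa>) w \<in> cell h n \<kappa>'" using s1[of \<kappa>] s1[of \<kappa>'] by (auto simp: \<sigma>_def)
  then show "\<kappa> = \<kappa>'" by (simp add: cell_iff[OF n h])
 qed
 moreover have "placement n \<sigma> w"
 proof -
  have "Xs i w \<notin> window half_width n" if i: "i < n" "i \<notin> \<sigma> ` U" for i
  proof
   assume "Xs i w \<in> window half_width n"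
   then obtain \<kappa> where k: "\<kappa> \<in> cells" "Xs i w \<in> cell h n \<kappa>" by (auto simp: window_iff[OF n h])
   have "\<kappa> \<in> U"
   proof (rule ccontr)
    assume "\<kappa> \<notin> U"
    then have "card {i. i < n \<and> Xs i w \<in> cell h n \<kappa>} = 0" using occ k(1) by (auto simp: occupied_def cnt_def)
    then have "{i. i < n \<and> Xs i w \<in> cell h n \<kappa>} = {}" by (subst (asm) card_0_eq) auto
    then show False using i k by auto
   qed
   then have "i = \<sigma> \<kappa>" using s[of \<kappa>] i k by (auto simp: \<sigma>_def)
   then show False using i \<open>\<kappa> \<in> U\<close> by auto
  qed
  then show ?thesis using s1 by (auto simp: placement_def \<sigma>_def)
 qed
 ultimately show ?thesis by blast
qed

lemma placement_weight_eq:
 assumes n: "1 \<le> n" and \<sigma>: "\<sigma> \<in> U \<rightarrow>\<^sub>E {..<n}" "inj_on \<sigma> U"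
 shows "placement_weight n \<sigma> w = (if placement n \<sigma> w then iexp (outer_sum u v half_width n w) else 0)"
proof (cases "placement n \<sigma> w")
 case True
 have 1: "(\<Prod>\<kappa>\<in>U. indicator (cell h n \<kappa>) (Xs (\<sigma> \<kappa>) w)) = (1::complex)"
  using True by (intro prod.neutral) (auto simp: placement_def)
 have "(\<Prod>i\<in>{..<n} - \<sigma> ` U. outer_factor n (Xs i w, \<xi>s i w)) = (\<Prod>i\<in>{..<n} - \<sigma> ` U. iexp (\<xi>s i w * weight u v (Xs i w) / sqrt n))"
  using True by (intro prod.cong) (auto simp: placement_def outer_factor_def)
 also have "\<dots> = iexp (\<Sum>i\<in>{..<n} - \<sigma> ` U. \<xi>s i w * weight u v (Xs i w) / sqrt n)"
  by (simp add: exp_sum sum_distrib_left)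
 also have "(\<Sum>i\<in>{..<n} - \<sigma> ` U. \<xi>s i w * weight u v (Xs i w) / sqrt n) = outer_sum u v half_width n w"
  unfolding outer_sum_def placement_occupied(3)[OF n \<sigma> True] by (simp add: sum_divide_distrib)
 finally show ?thesis using True 1 by (simp add: placement_weight_def)
next
 case False
 then consider \<kappa> where "\<kappa> \<in> U" "Xs (\<sigma> \<kappa>) w \<notin> cell h n \<kappa>" | i where "i \<in> {..<n} - \<sigma> ` U" "Xs i w \<in> window half_width n"
  by (auto simp: placement_def)
 then have "placement_weight n \<sigma> w = 0"
 proof cases
  case 1
  then have "(\<Prod>\<kappa>\<in>U. indicator (cell h n \<kappa>) (Xs (\<sigma> \<kappa>) w)) = (0::complex)"
   using finU by (intro prod_zero bexI[of _ \<kappa>]) auto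
  then show ?thesis by (simp add: placement_weight_def)
 next
  case 2
  then have "(\<Prod>i\<in>{..<n} - \<sigma> ` U. outer_factor n (Xs i w, \<xi>s i w)) = 0"
   by (intro prod_zero bexI[of _ i]) (auto simp: outer_factor_def)
  then show ?thesis by (simp add: placement_weight_def)
 qed
 then show ?thesis using False by simp
qed

lemma placed_jumps_eq:
 assumes n: "1 \<le> n" and \<sigma>: "\<sigma> \<in> U \<rightarrow>\<^sub>E {..<n}" "inj_on \<sigma> U" and p: "placement n \<sigma> w"
 shows "(\<lambda>\<kappa>\<in>cells. cell_jump h n w \<kappa>) = zero_extend cells U (placed_jumps \<sigma> w)"
proof
 fix \<kappa>
 show "(\<lambda>\<kappa>\<in>cells. cell_jump h n w \<kappa>) \<kappa> = zero_extend cells U (placed_jumps \<sigma> w) \<kappa>"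
  using placement_occupied(1)[OF n \<sigma> p, of \<kappa>]
  by (auto simp: zero_extend_def placed_jumps_def cell_jump_def esum_def)
qed

text \<open>On the occupied event exactly one injective placement holds, the one that names the
  index found in each cell; off this event none does. So at most one term of the sum is
  nonzero.\<close>

lemma occupied_expansion:
 assumes n: "1 \<le> n"
 shows "of_bool (occupied h cells U n w \<and> (\<lambda>\<kappa>\<in>cells. cell_jump h n w \<kappa>) \<in> G) * iexp (outer_sum u v half_width n w) =
  (\<Sum>\<sigma>\<in>{\<sigma> \<in> U \<rightarrow>\<^sub>E {..<n}. inj_on \<sigma> U}. placement_weight n \<sigma> w * indicator G (zero_extend cells U (placed_jumps \<sigma> w)))"
proof -
 let ?S = "{\<sigma> \<in> U \<rightarrow>\<^sub>E {..<n}. inj_on \<sigma> U}"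
 have finS: "finite ?S" using finite_PiE[OF finU, of "\<lambda>_. {..<n}"] by auto
 show ?thesis
 proof (cases "occupied h cells U n w")
  case True
  then obtain \<sigma> where \<sigma>: "\<sigma> \<in> U \<rightarrow>\<^sub>E {..<n}" "inj_on \<sigma> U" and p: "placement n \<sigma> w"
   using occupied_placement[OF n] by blast
  have uniq: "\<tau> = \<sigma>" if t: "\<tau> \<in> ?S" "placement n \<tau> w" for \<tau>
  proof (rule PiE_ext[of _ U "\<lambda>_. {..<n}"])
   show "\<tau> \<kappa> = \<sigma> \<kappa>" if "\<kappa> \<in> U" for \<kappa>
   proof -
    have "\<kappa> \<in> cells" using that U by auto
    have "\<tau> \<in> U \<rightarrow>\<^sub>E {..<n}" "inj_on \<tau> U" using t by auto
    from placement_occupied(1)[OF n this t(2) \<open>\<kappa> \<in> cells\<close>] placement_occupied(1)[OF n \<sigma> p \<open>\<kappa> \<in> cells\<close>]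
    show ?thesis using that by simp
   qed
  qed (use t \<sigma> in auto)
  have "(\<Sum>\<sigma>\<in>?S. placement_weight n \<sigma> w * indicator G (zero_extend cells U (placed_jumps \<sigma> w))) =
   (\<Sum>\<tau>\<in>{\<sigma>}. placement_weight n \<tau> w * indicator G (zero_extend cells U (placed_jumps \<tau> w)))"
  proof (rule sum.mono_neutral_right[OF finS])
   show "\<forall>\<tau>\<in>?S - {\<sigma>}. placement_weight n \<tau> w * indicator G (zero_extend cells U (placed_jumps \<tau> w)) = 0"
   proof
    fix \<tau> assume \<tau>: "\<tau> \<in> ?S - {\<sigma>}"
    then have "\<not> placement n \<tau> w" using uniq by blast
    moreover have "\<tau> \<in> U \<rightarrow>\<^sub>E {..<n}" "inj_on \<tau> U" using \<tau> by auto
    ultimately show "placement_weight n \<tau> w * indicator G (zero_extend cells U (placed_jumps \<tau> w)) = 0"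
     using placement_weight_eq[OF n, of \<tau> w] by simp
   qed
  qed (use \<sigma> in auto)
  also have "\<dots> = placement_weight n \<sigma> w * indicator G (zero_extend cells U (placed_jumps \<sigma> w))"
   by (simp only: sum.insert finite.emptyI empty_iff not_False_eq_True sum.empty add_0_right)
  also have "\<dots> = iexp (outer_sum u v half_width n w) * indicator G (\<lambda>\<kappa>\<in>cells. cell_jump h n w \<kappa>)"
   unfolding placed_jumps_eq[OF n \<sigma> p] placement_weight_eq[OF n \<sigma>] using p by simp
  finally show ?thesis using True by (auto simp: indicator_def)
 next
  case False
  have "(\<Sum>\<sigma>\<in>?S. placement_weight n \<sigma> w * indicator G (zero_extend cells U (placed_jumps \<sigma> w))) = 0"
  proof (rule sum.neutral, rule ballI)
   fix \<tau> assume "\<tau> \<in> ?S"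
   then have t: "\<tau> \<in> U \<rightarrow>\<^sub>E {..<n}" "inj_on \<tau> U" by auto
   have "\<not> placement n \<tau> w" using placement_occupied(2)[OF n t] False by blast
   then show "placement_weight n \<tau> w * indicator G (zero_extend cells U (placed_jumps \<tau> w)) = 0"
    using placement_weight_eq[OF n t, of w] by simp
  qed
  then show ?thesis using False by simp
 qed
qed

text \<open>The jumps in the cells involve only the noise of the placed observations, while the
  placement and the outer sum involve the positions and the noise of the others. The jumps therefore
  separate, and what remains is a product over independent observations.\<close>

lemma placement_expectation:
 assumes \<sigma>: "\<sigma> \<in> U \<rightarrow>\<^sub>E {..<n}" "inj_on \<sigma> U"
 shows "integrable M (\<lambda>w. placement_weight n \<sigma> w * indicator G (zero_extend cells U (placed_jumps \<sigma> w)))"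
  and "expectation (\<lambda>w. placement_weight n \<sigma> w * indicator G (zero_extend cells U (placed_jumps \<sigma> w))) =
   (\<Prod>\<kappa>\<in>U. of_real (prob {w\<in>space M. X w \<in> cell h n \<kappa>})) * outer_char u v half_width n ^ (n - card U) *
   of_real (measure (PiM U (\<lambda>_. jump_law)) {z \<in> space (PiM U (\<lambda>_. borel)). zero_extend cells U z \<in> G})"
proof -
 \<comment> \<open>\<open>A\<close> takes all design coordinates but only the noise of unplaced
   indices; \<open>B\<close> takes the noise of the placed ones. The two are disjoint.\<close>
 define A where "A = Inl ` {..<n} \<union> Inr ` ({..<n} - \<sigma> ` U)"
 define B :: "(nat + nat) set" where "B = Inr ` (\<sigma> ` U)"
 define F1 where "F1 f = (\<Prod>\<kappa>\<in>U. indicator (cell h n \<kappa>) (f (Inl (\<sigma> \<kappa>)))) * (\<Prod>i\<in>{..<n} - \<sigma> ` U. outer_factor n (f (Inl i), f (Inr i)))" for f :: "nat + nat \<Rightarrow> real"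
 define F2 where "F2 f = (indicator G (zero_extend cells U (\<lambda>\<kappa>\<in>U. jump \<kappa> (f (Inr (\<sigma> \<kappa>))))) :: complex)" for f :: "nat + nat \<Rightarrow> real"
 have \<sigma>n: "\<sigma> \<kappa> < n" if "\<kappa> \<in> U" for \<kappa> using \<sigma> that by auto
 have comp: "(\<lambda>f. f k) \<in> borel_measurable (PiM S (\<lambda>_. borel :: real measure))" if "k \<in> S" for k :: "nat + nat" and S
  using that by (rule measurable_component_singleton)
 have F1m: "F1 \<in> borel_measurable (PiM A (\<lambda>_. borel))"
  unfolding F1_def
 proof (intro borel_measurable_times borel_measurable_prod)
  fix \<kappa> assume "\<kappa> \<in> U"
  then have "Inl (\<sigma> \<kappa>) \<in> A" using \<sigma>n by (auto simp: A_def)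
  from comp[OF this] show "(\<lambda>f. indicator (cell h n \<kappa>) (f (Inl (\<sigma> \<kappa>))) :: complex) \<in> borel_measurable (PiM A (\<lambda>_. borel))"
   by (rule measurable_compose) measurable
 next
  fix i assume "i \<in> {..<n} - \<sigma> ` U"
  then have "Inl i \<in> A" "Inr i \<in> A" by (auto simp: A_def)
  from measurable_Pair[OF comp[OF this(1)] comp[OF this(2)]]
  show "(\<lambda>f. outer_factor n (f (Inl i), f (Inr i))) \<in> borel_measurable (PiM A (\<lambda>_. borel))"
   by (rule measurable_compose) measurable
 qed
 have F2m: "F2 \<in> borel_measurable (PiM B (\<lambda>_. borel))"
 proof -
  have "(\<lambda>f. \<lambda>\<kappa>\<in>U. jump \<kappa> (f (Inr (\<sigma> \<kappa>)))) \<in> measurable (PiM B (\<lambda>_. borel :: real measure)) (PiM U (\<lambda>_. borel))"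
  proof (rule measurable_restrict)
   fix \<kappa> assume "\<kappa> \<in> U"
   then have "Inr (\<sigma> \<kappa>) \<in> B" by (auto simp: B_def)
   from comp[OF this] show "(\<lambda>f. jump \<kappa> (f (Inr (\<sigma> \<kappa>)))) \<in> borel_measurable (PiM B (\<lambda>_. borel))"
    by (rule measurable_compose) measurable
  qed
  from measurable_compose[OF measurable_compose[OF this zero_extend_measurable[of cells U]] borel_measurable_indicator[OF G]]
  show ?thesis unfolding F2_def by simp
 qed
 define crd where "crd S w = restrict (\<lambda>k. case_sum Xs \<xi>s k w) S" for S w
 have iv: "indep_var (PiM A (\<lambda>_. borel)) (crd A) (PiM B (\<lambda>_. borel)) (crd B)"
  unfolding crd_def by (rule indep_var_restrict[OF coordinates_indep]) (auto simp: A_def B_def)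
 note ivc = indep_var_compose[OF iv F1m F2m]
 have e1: "(F1 \<circ> crd A) w = placement_weight n \<sigma> w" for w
  unfolding comp_def F1_def placement_weight_def
  by (intro arg_cong2[where f="(*)"] prod.cong) (auto simp: crd_def A_def \<sigma>n)
 have e2: "(F2 \<circ> crd B) w = indicator G (zero_extend cells U (placed_jumps \<sigma> w))" for w
 proof -
  have "(\<lambda>\<kappa>\<in>U. jump \<kappa> (crd B w (Inr (\<sigma> \<kappa>)))) = placed_jumps \<sigma> w"
   by (auto simp: placed_jumps_def crd_def B_def fun_eq_iff)
  then show ?thesis by (simp add: F2_def)
 qed
 have pm[measurable]: "placement_weight n \<sigma> \<in> borel_measurable M"
  using indep_var_rv1[OF ivc] e1 by (simp cong: measurable_cong)
 have jm[measurable]: "(\<lambda>w. indicator G (zero_extend cells U (placed_jumps \<sigma> w)) :: complex) \<in> borel_measurable M"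
  using indep_var_rv2[OF ivc] e2 by (simp cong: measurable_cong)
 have of1: "cmod (outer_factor n p) \<le> 1" for p
  by (auto simp: outer_factor_def indicator_def norm_mult simp del: of_real_mult of_real_divide)
 have pw1: "cmod (placement_weight n \<sigma> w) \<le> 1" for w
 proof -
  have "(\<Prod>\<kappa>\<in>U. cmod (indicator (cell h n \<kappa>) (Xs (\<sigma> \<kappa>) w))) \<le> 1" by (intro prod_le_1) (auto simp: indicator_def)
  moreover have "(\<Prod>i\<in>{..<n} - \<sigma> ` U. cmod (outer_factor n (Xs i w, \<xi>s i w))) \<le> 1" using of1 by (intro prod_le_1) auto
  ultimately show ?thesis unfolding placement_weight_def norm_mult prod_norm[symmetric]
   by (intro mult_le_one) (auto intro: prod_nonneg)
 qed
 have i1: "integrable M (placement_weight n \<sigma>)" by (rule integrable_const_bound[of _ 1]) (use pw1 in auto)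
 have i2: "integrable M (\<lambda>w. indicator G (zero_extend cells U (placed_jumps \<sigma> w)) :: complex)"
 proof (rule integrable_const_bound[of _ 1])
  show "AE w in M. cmod (indicator G (zero_extend cells U (placed_jumps \<sigma> w))) \<le> 1" by (auto simp: indicator_def)
 qed (rule jm)
 have ind: "indep_var borel (placement_weight n \<sigma>) borel (\<lambda>w. indicator G (zero_extend cells U (placed_jumps \<sigma> w)) :: complex)"
 proof -
  have "F1 \<circ> crd A = placement_weight n \<sigma>" "F2 \<circ> crd B = (\<lambda>w. indicator G (zero_extend cells U (placed_jumps \<sigma> w)))"
   using e1 e2 by (intro ext, blast)+
  with ivc show ?thesis by (simp only:)
 qed
 show "integrable M (\<lambda>w. placement_weight n \<sigma> w * indicator G (zero_extend cells U (placed_jumps \<sigma> w)))"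
  by (rule indep_var_integrable[OF ind i1 i2])
 \<comment> \<open>One factor per observation: a placed index contributes the indicator of its cell,
   every other index \<open>outer_factor\<close>.\<close>
 define Fi where "Fi i p = (if i \<in> \<sigma> ` U then indicator (cell h n (the_inv_into U \<sigma> i)) (fst p) else outer_factor n p)" for i and p :: "real \<times> real"
 have Fim[measurable]: "Fi i \<in> borel_measurable (borel \<Otimes>\<^sub>M borel)" for i
  unfolding Fi_def by (cases "i \<in> \<sigma> ` U") (simp_all, measurable)
 have sub: "\<sigma> ` U \<subseteq> {..<n}" using \<sigma>n by auto
 have split: "(\<Prod>i<n. h i) = (\<Prod>\<kappa>\<in>U. h (\<sigma> \<kappa>)) * (\<Prod>i\<in>{..<n} - \<sigma> ` U. h i)" for h :: "nat \<Rightarrow> complex"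
  using prod.subset_diff[OF sub, of h] by (simp add: prod.reindex[OF \<sigma>(2)] mult.commute)
 have pw: "placement_weight n \<sigma> w = (\<Prod>i<n. Fi i (Xs i w, \<xi>s i w))" for w
  unfolding split placement_weight_def
  by (intro arg_cong2[where f="(*)"] prod.cong) (auto simp: Fi_def the_inv_into_f_f[OF \<sigma>(2)])
 have Fi1: "cmod (Fi i p) \<le> 1" for i p using of1[of p] by (auto simp: Fi_def indicator_def)
 have E1: "expectation (placement_weight n \<sigma>) = (\<Prod>\<kappa>\<in>U. of_real (prob {w\<in>space M. X w \<in> cell h n \<kappa>})) * outer_char u v half_width n ^ (n - card U)"
 proof -
  have indF: "indep_vars (\<lambda>_. borel) (\<lambda>i w. Fi i (Xs i w, \<xi>s i w)) {..<n}"
   by (rule indep_vars_compose2[OF indep_vars_subset[OF sample_indep subset_UNIV]]) measurable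
  have intF: "integrable M (\<lambda>w. Fi i (Xs i w, \<xi>s i w))" for i
   by (rule integrable_const_bound[of _ 1]) (use Fi1 in auto)
  have "expectation (placement_weight n \<sigma>) = expectation (\<lambda>w. \<Prod>i<n. Fi i (Xs i w, \<xi>s i w))" by (simp add: pw[symmetric])
  also have "\<dots> = (\<Prod>i<n. expectation (\<lambda>w. Fi i (Xs i w, \<xi>s i w)))"
   by (rule indep_vars_lebesgue_integral[OF _ indF intF]) simp
  also have "\<dots> = (\<Prod>i<n. expectation (\<lambda>w. Fi i (X w, \<xi> w)))" by (intro prod.cong refl expectation_sample) measurable
  also have "\<dots> = (\<Prod>\<kappa>\<in>U. expectation (\<lambda>w. Fi (\<sigma> \<kappa>) (X w, \<xi> w))) * (\<Prod>i\<in>{..<n} - \<sigma> ` U. expectation (\<lambda>w. Fi i (X w, \<xi> w)))"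
   by (rule split)
  also have "(\<Prod>\<kappa>\<in>U. expectation (\<lambda>w. Fi (\<sigma> \<kappa>) (X w, \<xi> w))) = (\<Prod>\<kappa>\<in>U. of_real (prob {w\<in>space M. X w \<in> cell h n \<kappa>}))"
  proof (rule prod.cong)
   fix \<kappa> assume k: "\<kappa> \<in> U"
   have "expectation (\<lambda>w. Fi (\<sigma> \<kappa>) (X w, \<xi> w)) = expectation (\<lambda>w. complex_of_real (indicator (cell h n \<kappa>) (X w)))"
    using k by (intro Bochner_Integration.integral_cong) (auto simp: Fi_def the_inv_into_f_f[OF \<sigma>(2)] indicator_def)
   also have "\<dots> = of_real (prob {w\<in>space M. X w \<in> cell h n \<kappa>})"
    by (subst integral_complex_of_real) (simp add: indicator_expectation)
   finally show "expectation (\<lambda>w. Fi (\<sigma> \<kappa>) (X w, \<xi> w)) = of_real (prob {w\<in>space M. X w \<in> cell h n \<kappa>})" .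
  qed simp
  also have "(\<Prod>i\<in>{..<n} - \<sigma> ` U. expectation (\<lambda>w. Fi i (X w, \<xi> w))) = (\<Prod>i\<in>{..<n} - \<sigma> ` U. outer_char u v half_width n)"
   by (intro prod.cong) (auto simp: Fi_def outer_factor_def outer_char_def)
  also have "\<dots> = outer_char u v half_width n ^ (n - card U)"
   using sub finU \<sigma>(2) by (simp add: card_Diff_subset card_image)
  finally show ?thesis .
 qed
 have E2: "expectation (\<lambda>w. indicator G (zero_extend cells U (placed_jumps \<sigma> w)) :: complex) =
   of_real (measure (PiM U (\<lambda>_. jump_law)) {z \<in> space (PiM U (\<lambda>_. borel)). zero_extend cells U z \<in> G})"
 proof -
  have ij: "indep_vars (\<lambda>_. borel) (\<lambda>\<kappa> w. jump \<kappa> (\<xi>s (\<sigma> \<kappa>) w)) U"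
   by (rule indep_vars_compose2[OF indep_vars_reindex_inj[OF \<xi>s_indep[of UNIV] \<sigma>(2) subset_UNIV]]) measurable
  have law: "distr M (PiM U (\<lambda>_. borel)) (placed_jumps \<sigma>) = PiM U (\<lambda>_. jump_law)"
   unfolding placed_jumps_def by (rule iid_vector_law[OF ij]) (rule jump_law_\<xi>s)
  have mj: "placed_jumps \<sigma> \<in> measurable M (PiM U (\<lambda>_. borel))"
   unfolding placed_jumps_def by (rule measurable_restrict) measurable
  let ?G' = "{z \<in> space (PiM U (\<lambda>_. borel)). zero_extend cells U z \<in> G}"
  have G': "?G' \<in> sets (PiM U (\<lambda>_. borel))"
   using measurable_sets[OF zero_extend_measurable G] by (simp add: vimage_def Int_def conj_commute)
  have sp: "placed_jumps \<sigma> w \<in> space (PiM U (\<lambda>_. borel))" if "w \<in> space M" for w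
   using measurable_space[OF mj that] .
  have "expectation (\<lambda>w. indicator G (zero_extend cells U (placed_jumps \<sigma> w)) :: complex) = expectation (\<lambda>w. complex_of_real (indicator (placed_jumps \<sigma> -` ?G' \<inter> space M) w))"
   using sp by (intro Bochner_Integration.integral_cong) (auto simp: indicator_def)
  also have "\<dots> = of_real (prob (placed_jumps \<sigma> -` ?G' \<inter> space M))"
   by (subst integral_complex_of_real) simp
  also have "prob (placed_jumps \<sigma> -` ?G' \<inter> space M) = measure (distr M (PiM U (\<lambda>_. borel)) (placed_jumps \<sigma>)) ?G'"
   by (rule measure_distr[OF mj G', symmetric])
  finally show ?thesis unfolding law .
 qed
 show "expectation (\<lambda>w. placement_weight n \<sigma> w * indicator G (zero_extend cells U (placed_jumps \<sigma> w))) =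
   (\<Prod>\<kappa>\<in>U. of_real (prob {w\<in>space M. X w \<in> cell h n \<kappa>})) * outer_char u v half_width n ^ (n - card U) *
   of_real (measure (PiM U (\<lambda>_. jump_law)) {z \<in> space (PiM U (\<lambda>_. borel)). zero_extend cells U z \<in> G})"
  unfolding indep_var_lebesgue_integral[OF ind i1 i2] E1 E2 ..
qed

text \<open>With k occupied cells there are about n^k placements, each with k cell probabilities of
  order 1 / n, which leaves the k-th power of the mean count per cell. The n - k outer factors
  supply the Gaussian factor and the void probability.\<close>

theorem grid_limit:
 "(\<lambda>n. expectation (\<lambda>w. of_bool (occupied h {- int m..<int m} U n w \<and> (\<lambda>\<kappa>\<in>{- int m..<int m}. cell_jump h n w \<kappa>) \<in> G) *
   iexp (outer_sum u v (h * real m) n w)))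
  \<longlonglongrightarrow> of_real (exp (- limit_variance u v / 2) * grid_prob jump_law (h * f_X d\<^sub>0) {- int m..<int m} U G)"
proof -
 let ?q = "measure (PiM U (\<lambda>_. jump_law)) {z \<in> space (PiM U (\<lambda>_. borel)). zero_extend cells U z \<in> G}"
 let ?p = "\<lambda>n \<kappa>. prob {w\<in>space M. X w \<in> cell h n \<kappa>}"
 let ?j = "card U"
 have "(\<lambda>n. (\<Prod>i<?j. complex_of_real (1 - i / n)) * (\<Prod>\<kappa>\<in>U. of_real (n * ?p n \<kappa>)) * outer_char u v half_width n ^ (n - ?j) * of_real ?q) \<longlonglongrightarrow>
  (\<Prod>i<?j. complex_of_real (1 - 0)) * (\<Prod>\<kappa>\<in>U. of_real (f_X d\<^sub>0 * h)) * of_real (exp (- limit_variance u v / 2 - 2 * half_width * f_X d\<^sub>0)) * of_real ?q"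
 proof (intro tendsto_mult tendsto_prod tendsto_const)
  show "(\<lambda>n. complex_of_real (1 - real i / real n)) \<longlonglongrightarrow> complex_of_real (1 - 0)" for i :: nat
   by (intro tendsto_of_real tendsto_diff tendsto_const lim_const_over_n)
  show "(\<lambda>n. complex_of_real (real n * ?p n \<kappa>)) \<longlonglongrightarrow> complex_of_real (f_X d\<^sub>0 * h)" for \<kappa>
   using local_mass[of "h * \<kappa>" "h * (\<kappa> + 1)"] h by (intro tendsto_of_real) (simp add: cell_def algebra_simps)
  show "(\<lambda>n. outer_char u v half_width n ^ (n - ?j)) \<longlonglongrightarrow> of_real (exp (- limit_variance u v / 2 - 2 * half_width * f_X d\<^sub>0))"
  proof (rule power_limit[OF outer_char_le_1])
   show "- limit_variance u v / 2 - 2 * half_width * f_X d\<^sub>0 \<le> 0"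
   proof -
    have "0 \<le> limit_variance u v"
     unfolding limit_variance_def using p_pos \<sigma>2_nonneg by (intro mult_nonneg_nonneg add_nonneg_nonneg divide_nonneg_nonneg) auto
    moreover have "0 \<le> 2 * half_width * f_X d\<^sub>0" using h density_pos by simp
    ultimately show ?thesis by simp
   qed
   show "(\<lambda>n. of_nat n * (outer_char u v half_width n - 1)) \<longlonglongrightarrow> of_real (- limit_variance u v / 2 - 2 * half_width * f_X d\<^sub>0)"
    using h by (intro outer_char_limit) simp
  qed
 qed
 moreover have "(\<Prod>i<?j. complex_of_real (1 - 0)) * (\<Prod>\<kappa>\<in>U. of_real (f_X d\<^sub>0 * h)) * of_real (exp (- limit_variance u v / 2 - 2 * half_width * f_X d\<^sub>0)) * of_real ?q =
  complex_of_real (exp (- limit_variance u v / 2) * grid_prob jump_law (h * f_X d\<^sub>0) cells U G)"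
 proof -
  \<comment> \<open>The window consists of \<open>2 * m\<close> cells of width \<open>h\<close>, so
    its void probability is the exponential factor of \<open>grid_prob\<close>.\<close>
  have "exp (- limit_variance u v / 2 - 2 * half_width * f_X d\<^sub>0) = exp (- limit_variance u v / 2) * exp (- (h * f_X d\<^sub>0 * card cells))"
   unfolding exp_add[symmetric] by (simp add: algebra_simps)
  then show ?thesis by (simp only: grid_prob_def) (simp add: mult_ac)
 qed
 moreover have "\<forall>\<^sub>F n in sequentially. (\<Prod>i<?j. complex_of_real (1 - i / n)) * (\<Prod>\<kappa>\<in>U. of_real (n * ?p n \<kappa>)) * outer_char u v half_width n ^ (n - ?j) * of_real ?q =
  expectation (\<lambda>w. of_bool (occupied h cells U n w \<and> (\<lambda>\<kappa>\<in>cells. cell_jump h n w \<kappa>) \<in> G) * iexp (outer_sum u v half_width n w))"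
  using eventually_ge_at_top[of "max 1 ?j"]
 proof eventually_elim
  case (elim n)
  then have n: "1 \<le> n" "?j \<le> n" by auto
  let ?S = "{\<sigma> \<in> U \<rightarrow>\<^sub>E {..<n}. inj_on \<sigma> U}"
  have "expectation (\<lambda>w. of_bool (occupied h cells U n w \<and> (\<lambda>\<kappa>\<in>cells. cell_jump h n w \<kappa>) \<in> G) * iexp (outer_sum u v half_width n w)) =
   (\<Sum>\<sigma>\<in>?S. expectation (\<lambda>w. placement_weight n \<sigma> w * indicator G (zero_extend cells U (placed_jumps \<sigma> w))))"
   unfolding occupied_expansion[OF n(1)] by (rule Bochner_Integration.integral_sum) (auto intro: placement_expectation(1))
  also have "\<dots> = (\<Sum>\<sigma>\<in>?S. (\<Prod>\<kappa>\<in>U. of_real (?p n \<kappa>)) * outer_char u v half_width n ^ (n - ?j) * of_real ?q)"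
   by (intro sum.cong refl placement_expectation(2)) auto
  also have "\<dots> = of_nat (card ?S) * ((\<Prod>\<kappa>\<in>U. of_real (?p n \<kappa>)) * outer_char u v half_width n ^ (n - ?j) * of_real ?q)" by simp
  also have "complex_of_nat (card ?S) = (\<Prod>i<?j. complex_of_real (1 - i / n)) * of_nat n ^ ?j"
  proof -
   have "card ?S = (\<Prod>i<?j. n - i)" using card_injections[OF finU, of "{..<n}"] by simp
   then have "complex_of_nat (card ?S) = (\<Prod>i<?j. complex_of_nat (n - i))" by simp
   also have "\<dots> = (\<Prod>i<?j. complex_of_real (1 - i / n) * of_nat n)"
   proof (rule prod.cong)
    fix i assume "i \<in> {..<?j}"
    then have "real (n - i) = (1 - i / n) * n" using n by (simp add: field_simps of_nat_diff)
    then have "complex_of_real (real (n - i)) = complex_of_real ((1 - i / n) * n)" by (simp only:)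
    then show "complex_of_nat (n - i) = complex_of_real (1 - i / n) * of_nat n" by simp
   qed simp
   finally show ?thesis by (simp add: prod.distrib)
  qed
  finally have "expectation (\<lambda>w. of_bool (occupied h cells U n w \<and> (\<lambda>\<kappa>\<in>cells. cell_jump h n w \<kappa>) \<in> G) * iexp (outer_sum u v half_width n w)) =
   (\<Prod>i<?j. complex_of_real (1 - i / n)) * of_nat n ^ ?j * ((\<Prod>\<kappa>\<in>U. of_real (?p n \<kappa>)) * outer_char u v half_width n ^ (n - ?j) * of_real ?q)" .
  moreover have "(\<Prod>\<kappa>\<in>U. complex_of_real (n * ?p n \<kappa>)) = of_nat n ^ ?j * (\<Prod>\<kappa>\<in>U. of_real (?p n \<kappa>))"
   by (simp add: prod.distrib)
  ultimately show ?case by (simp only: mult.assoc)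
 qed
 ultimately show ?thesis by (auto elim: Lim_transform_eventually)
qed

end

end

section \<open>The compound Poisson process on a grid\<close>

text \<open>The increment over a cell is taken in the direction away from 0, so that
  \<open>grid_path\<close> rebuilds the path from it.\<close>

definition path_jump :: "real \<Rightarrow> (real \<Rightarrow> real) \<Rightarrow> int \<Rightarrow> real" where
 "path_jump h v \<kappa> = (if 0 \<le> \<kappa> then v (h * (real_of_int \<kappa> + 1)) - v (h * real_of_int \<kappa>) else v (h * real_of_int \<kappa>) - v (h * (real_of_int \<kappa> + 1)))"

lemma grid_path_path_jump:
 assumes v0: "v 0 = 0"
 shows "grid_path (path_jump h v) k = v (h * k)"
proof (cases "0 \<le> k")
 case True
 have "(\<Sum>\<kappa>\<in>{0..<int j}. path_jump h v \<kappa>) = v (h * j)" for j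
 proof (induction j)
  case (Suc j)
  have "{0..<int (Suc j)} = insert (int j) {0..<int j}" by auto
  then show ?case using Suc by (simp add: path_jump_def algebra_simps)
 qed (simp add: v0)
 from this[of "nat k"] show ?thesis using True by (simp add: grid_path_def)
next
 case False
 have "(\<Sum>\<kappa>\<in>{- int j..<0}. path_jump h v \<kappa>) = v (- (h * j))" for j
 proof (induction j)
  case (Suc j)
  have "{- int (Suc j)..<0} = insert (- int (Suc j)) {- int j..<0}" by auto
  then show ?case using Suc by (simp add: path_jump_def algebra_simps)
 qed (simp add: v0)
 from this[of "nat (- k)"] show ?thesis using False by (simp add: grid_path_def)
qed

lemma grid_path_cong:
 assumes "k \<in> {- int m..int m}" "\<And>\<kappa>. \<kappa> \<in> {- int m..<int m} \<Longrightarrow> z \<kappa> = z' \<kappa>"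
 shows "grid_path z k = grid_path z' k"
 unfolding grid_path_def using assms by (auto intro!: sum.cong)

section \<open>Increments of a Poisson process\<close>

context poisson_process
begin

lemma increments_pattern:
 assumes h: "0 < h"
 shows "prob {w\<in>space M. \<forall>j<m. N (h * (real j + 1)) w - N (h * real j) w = c j} = (\<Prod>j<m. pmf (poisson_pmf (rate * h)) (c j))"
proof (cases "m = 0")
 case True then show ?thesis by (simp add: prob_space)
next
 case False
 define \<tau> where "\<tau> i = h * real i" for i :: nat
 have \<tau>: "0 \<le> \<tau> 0" "mono \<tau>" using h by (auto simp: \<tau>_def mono_def)
 note ind = N_increments_indep[OF \<tau>]
 have "{w\<in>space M. \<forall>j<m. N (h * (real j + 1)) w - N (h * real j) w = c j} =
   (\<Inter>j\<in>{..<m}. (\<lambda>w. N (\<tau> (Suc j)) w - N (\<tau> j) w) -` {c j} \<inter> space M)"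
  using False by (auto simp: \<tau>_def add.commute)
 also have "prob \<dots> = (\<Prod>j<m. prob ((\<lambda>w. N (\<tau> (Suc j)) w - N (\<tau> j) w) -` {c j} \<inter> space M))"
  using False by (intro indep_varsD[OF ind]) auto
 also have "\<dots> = (\<Prod>j<m. pmf (poisson_pmf (rate * h)) (c j))"
 proof (rule prod.cong)
  fix j
  have m: "(\<lambda>w. N (\<tau> (Suc j)) w - N (\<tau> j) w) \<in> measurable M (count_space UNIV)"
   using ind by (auto simp: indep_vars_def)
  have "prob ((\<lambda>w. N (\<tau> (Suc j)) w - N (\<tau> j) w) -` {c j} \<inter> space M) =
   measure (distr M (count_space UNIV) (\<lambda>w. N (\<tau> (Suc j)) w - N (\<tau> j) w)) {c j}"
   by (rule measure_distr[OF m, symmetric]) simp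
  also have "\<dots> = measure (measure_pmf (poisson_pmf (rate * (\<tau> (Suc j) - \<tau> j)))) {c j}"
   using h by (subst N_increments_poisson) (auto simp: \<tau>_def)
  also have "\<tau> (Suc j) - \<tau> j = h" by (simp add: \<tau>_def algebra_simps)
  finally show "prob ((\<lambda>w. N (\<tau> (Suc j)) w - N (\<tau> j) w) -` {c j} \<inter> space M) = pmf (poisson_pmf (rate * h)) (c j)"
   by (simp add: measure_pmf_single)
 qed simp
 finally show ?thesis .
qed

lemma increment_law:
 assumes "0 \<le> s" "s < t"
 shows "prob {w\<in>space M. N t w - N s w \<in> A} = measure (measure_pmf (poisson_pmf (rate * (t - s)))) A"
proof -
 have m: "(\<lambda>w. N t w - N s w) \<in> measurable M (count_space UNIV)"
  using N_measurable[of t] N_measurable[of s] assms by simp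
 have "prob {w\<in>space M. N t w - N s w \<in> A} = prob ((\<lambda>w. N t w - N s w) -` A \<inter> space M)"
  by (rule arg_cong[where f=prob]) auto
 also have "\<dots> = measure (distr M (count_space UNIV) (\<lambda>w. N t w - N s w)) A"
  by (rule measure_distr[OF m, symmetric]) simp
 finally show ?thesis unfolding N_increments_poisson[OF assms] .
qed

text \<open>The defect is of second order in the length, which makes cells with two points
  negligible on a fine mesh; it follows from \<open>exp (- x) \<ge> 1 - x\<close>.\<close>

lemma increment_ge_2:
 assumes "0 \<le> s" "s < t"
 shows "prob {w\<in>space M. 2 \<le> N t w - N s w} \<le> (rate * (t - s))\<^sup>2"
proof -
 define hh where "hh = rate * (t - s)"
 have hh: "0 < hh" using rate_pos assms by (simp add: hh_def)
 have "prob {w\<in>space M. 2 \<le> N t w - N s w} = measure (measure_pmf (poisson_pmf hh)) (UNIV - {0, 1})"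
 proof -
  have "{w\<in>space M. 2 \<le> N t w - N s w} = {w\<in>space M. N t w - N s w \<in> UNIV - {0, 1}}" by auto
  then show ?thesis unfolding hh_def using increment_law[OF assms, of "UNIV - {0, 1}"] by (simp only:)
 qed
 also have "\<dots> = 1 - measure (measure_pmf (poisson_pmf hh)) {0, 1}"
  using measure_pmf.prob_compl[of "{0, 1}" "poisson_pmf hh"] by simp
 also have "measure (measure_pmf (poisson_pmf hh)) {0, 1} = exp (- hh) * (1 + hh)"
  by (subst measure_measure_pmf_finite) (use hh in \<open>auto simp: algebra_simps\<close>)
 also have "1 - exp (- hh) * (1 + hh) \<le> 1 - (1 - hh) * (1 + hh)"
  using exp_ge_add_one_self[of "- hh"] hh by (intro diff_left_mono mult_right_mono) auto
 also have "\<dots> = hh\<^sup>2" by (simp add: power2_eq_square algebra_simps)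
 finally show ?thesis unfolding hh_def .
qed

text \<open>Each Poisson weight is at most \<open>x ^ k / exp x\<close> with
  \<open>x = rate * K\<close>, which tends to 0. The bound is asked for all large \<open>K\<close>
  because the width of the window is enlarged later.\<close>

lemma few_points_unlikely:
 assumes \<epsilon>: "0 < \<epsilon>"
 shows "\<exists>K0>0. \<forall>K\<ge>K0. prob {w\<in>space M. N K w < k0} \<le> \<epsilon>"
proof -
 have "((\<lambda>x::real. \<Sum>k<k0. x ^ k / exp x) \<longlongrightarrow> (\<Sum>k<k0. 0)) at_top"
  by (intro tendsto_sum tendsto_power_div_exp_0)
 then have "\<forall>\<^sub>F x::real in at_top. (\<Sum>k<k0. x ^ k / exp x) < \<epsilon>"
  using \<epsilon> by (intro order_tendstoD(2)[of _ 0]) simp_all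
 then obtain x0 :: real where x0: "\<And>x. x0 \<le> x \<Longrightarrow> (\<Sum>k<k0. x ^ k / exp x) < \<epsilon>" by (auto simp: eventually_at_top_linorder)
 show ?thesis
 proof (intro exI conjI allI impI)
  show "0 < max 1 (x0 / rate)" by simp
  fix K assume K: "max 1 (x0 / rate) \<le> K"
  have K0: "0 < K" using K by simp
  have x: "x0 \<le> rate * K" "0 \<le> rate * K" using K rate_pos by (auto simp: field_simps)
  have "{w\<in>space M. N K w < k0} = {w\<in>space M. N K w - N 0 w \<in> {..<k0}}" using N_0 by auto
  then have "prob {w\<in>space M. N K w < k0} = measure (measure_pmf (poisson_pmf (rate * K))) {..<k0}"
   using increment_law[of 0 K "{..<k0}"] K0 by simp
  also have "\<dots> = (\<Sum>k<k0. pmf (poisson_pmf (rate * K)) k)" by (rule measure_measure_pmf_finite) simp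
  also have "\<dots> \<le> (\<Sum>k<k0. (rate * K) ^ k / exp (rate * K))"
  proof (rule sum_mono)
   fix k
   have "pmf (poisson_pmf (rate * K)) k = (rate * K) ^ k / exp (rate * K) / fact k"
    using mult_pos_pos[OF rate_pos K0] by (simp add: exp_minus divide_inverse)
   also have "\<dots> \<le> (rate * K) ^ k / exp (rate * K) / 1" using x by (intro divide_left_mono) (auto simp: fact_ge_1)
   finally show "pmf (poisson_pmf (rate * K)) k \<le> (rate * K) ^ k / exp (rate * K)" by simp
  qed
  also have "\<dots> \<le> \<epsilon>" using x0[OF x(1)] by simp
  finally show "prob {w\<in>space M. N K w < k0} \<le> \<epsilon>" .
 qed
qed

end

section \<open>Grid increments of the two-sided process\<close>

context two_sided_cpp
begin

abbreviation path where "path \<equiv> cpp_path N1 N2 Z1 Z2"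
abbreviation piece where "piece \<equiv> cpp_piece N1 N2"

lemma N_measurable' [measurable]:
 "0 \<le> t \<Longrightarrow> N1 t \<in> measurable M (count_space UNIV)" "0 \<le> t \<Longrightarrow> N2 t \<in> measurable M (count_space UNIV)"
 using right.N_measurable left.N_measurable by auto

lemma Z_measurable [measurable]: "Z1 i \<in> borel_measurable M" "Z2 i \<in> borel_measurable M"
proof -
 have "case_sum Z1 Z2 k \<in> borel_measurable M" for k using jumps_indep by (auto simp: right.indep_vars_def)
 from this[of "Inl i"] this[of "Inr i"] show "Z1 i \<in> borel_measurable M" "Z2 i \<in> borel_measurable M" by auto
qed

lemma path_0: "w \<in> space M \<Longrightarrow> path w 0 = 0"
 by (simp add: cpp_path_def right.N_0)

lemma piece_mono: "w \<in> space M \<Longrightarrow> s \<le> t \<Longrightarrow> piece w s \<le> piece w t"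
 using monotone_onD[OF right.N_mono, of w s t] monotone_onD[OF left.N_mono, of w "-t" "-s"]
 by (auto simp: cpp_piece_def)

text \<open>The two branches of \<open>piece\<close> share only the value 0, where both sums are
  empty; so the number of the piece determines the value of the path.\<close>

lemma path_piece: "piece w s = piece w t \<Longrightarrow> path w s = path w t"
proof -
 assume a: "piece w s = piece w t"
 have "int i = - int j \<longleftrightarrow> i = 0 \<and> j = 0" "- int i = int j \<longleftrightarrow> i = 0 \<and> j = 0" for i j by auto
 with a show ?thesis by (auto simp: cpp_piece_def cpp_path_def split: if_splits)
qed

definition limit_occupied :: "real \<Rightarrow> int set \<Rightarrow> int set \<Rightarrow> 'b \<Rightarrow> bool" where
 "limit_occupied h cells U w \<longleftrightarrow> (\<forall>\<kappa>\<in>cells. piece w (h * (real_of_int \<kappa> + 1)) - piece w (h * real_of_int \<kappa>) = (if \<kappa> \<in> U then 1 else 0))"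

lemma limit_occupied_iff:
 assumes w: "w \<in> space M" and h: "0 < h"
 shows "limit_occupied h {- int m..<int m} U w \<longleftrightarrow>
  (\<forall>j<m. N1 (h * (real j + 1)) w - N1 (h * real j) w = of_bool (int j \<in> U)) \<and>
  (\<forall>j<m. N2 (h * (real j + 1)) w - N2 (h * real j) w = of_bool (- int j - 1 \<in> U))"
proof -
 have R: "piece w (h * (real_of_int (int j) + 1)) - piece w (h * real_of_int (int j)) = (if int j \<in> U then 1 else 0) \<longleftrightarrow>
   N1 (h * (real j + 1)) w - N1 (h * real j) w = of_bool (int j \<in> U)" for j
 proof -
  have "N1 (h * real j) w \<le> N1 (h * (real j + 1)) w"
   using h by (intro monotone_onD[OF right.N_mono[OF w]]) auto
  then show ?thesis using h by (auto simp: cpp_piece_def zero_le_mult_iff)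
 qed
 have L: "piece w (h * (real_of_int (- int j - 1) + 1)) - piece w (h * real_of_int (- int j - 1)) = (if - int j - 1 \<in> U then 1 else 0) \<longleftrightarrow>
   N2 (h * (real j + 1)) w - N2 (h * real j) w = of_bool (- int j - 1 \<in> U)" for j
 proof -
  have le: "N2 (h * real j) w \<le> N2 (h * (real j + 1)) w"
   using h by (intro monotone_onD[OF left.N_mono[OF w]]) auto
  have e1: "piece w (h * real_of_int (- int j - 1)) = - int (N2 (h * (real j + 1)) w)"
  proof -
   have "h * real_of_int (- int j - 1) = - (h * (real j + 1))" by (simp add: algebra_simps)
   moreover have "0 < h * (real j + 1)" using h by simp
   ultimately show ?thesis by (simp add: cpp_piece_def)
  qed
  \<comment> \<open>At \<open>j = 0\<close> the right end of the cell is 0, where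
    \<open>cpp_piece\<close> switches to \<open>N1\<close>; both counts vanish there.\<close>
  have e2: "piece w (h * (real_of_int (- int j - 1) + 1)) = - int (N2 (h * real j) w)"
  proof (cases "j = 0")
   case True then show ?thesis using w by (simp add: cpp_piece_def right.N_0 left.N_0)
  next
   case False
   then have "0 < h * real j" using h by simp
   moreover have "h * (real_of_int (- int j - 1) + 1) = - (h * real j)" by simp
   ultimately show ?thesis by (simp add: cpp_piece_def)
  qed
  show ?thesis unfolding e1 e2 using le by auto
 qed
 have "(\<forall>\<kappa>\<in>{- int m..<int m}. P \<kappa>) \<longleftrightarrow> (\<forall>j<m. P (int j)) \<and> (\<forall>j<m. P (- int j - 1))" for P
 proof (intro iffI conjI ballI allI impI)
  fix \<kappa> assume a: "(\<forall>j<m. P (int j)) \<and> (\<forall>j<m. P (- int j - 1))" "\<kappa> \<in> {- int m..<int m}"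
  show "P \<kappa>"
  proof (cases "0 \<le> \<kappa>")
   case True
   then have "nat \<kappa> < m" "int (nat \<kappa>) = \<kappa>" using a by auto
   then show ?thesis using a by metis
  next
   case False
   then have "nat (- \<kappa> - 1) < m" "- int (nat (- \<kappa> - 1)) - 1 = \<kappa>" using a by auto
   then show ?thesis using a by metis
  qed
 qed auto
 from this[of "\<lambda>\<kappa>. piece w (h * (real_of_int \<kappa> + 1)) - piece w (h * real_of_int \<kappa>) = (if \<kappa> \<in> U then 1 else 0)"]
 show ?thesis unfolding limit_occupied_def R L .
qed

text \<open>The jumps of each side are used in order of distance from 0, so the jump in an occupied
  cell is numbered by the occupied cells between it and 0.\<close>

definition jump_index :: "int set \<Rightarrow> int \<Rightarrow> nat + nat" where
 "jump_index U \<kappa> = (if 0 \<le> \<kappa> then Inl (card (U \<inter> {0..<\<kappa>})) else Inr (card (U \<inter> {\<kappa> + 1..<0})))"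

lemma jump_index_inj: "finite U \<Longrightarrow> inj_on (jump_index U) U"
proof (rule linorder_inj_onI)
 fix \<kappa> \<kappa>' assume U: "finite U" "\<kappa> \<in> U" "\<kappa>' \<in> U" and lt: "\<kappa> < \<kappa>'"
 show "jump_index U \<kappa> \<noteq> jump_index U \<kappa>'"
 proof (cases "0 \<le> \<kappa>")
  case True
  have "U \<inter> {0..<\<kappa>} \<subset> U \<inter> {0..<\<kappa>'}" using U lt True by auto
  then have "card (U \<inter> {0..<\<kappa>}) < card (U \<inter> {0..<\<kappa>'})" using U by (intro psubset_card_mono) auto
  then show ?thesis using True lt by (simp add: jump_index_def)
 next
  case False
  show ?thesis
  proof (cases "0 \<le> \<kappa>'")
   case True then show ?thesis using False by (simp add: jump_index_def)
  next
   case F2: False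
   have "\<kappa>' \<in> U \<inter> {\<kappa> + 1..<0}" "\<kappa>' \<notin> U \<inter> {\<kappa>' + 1..<0}" using U lt F2 by auto
   moreover have "U \<inter> {\<kappa>' + 1..<0} \<subseteq> U \<inter> {\<kappa> + 1..<0}" using lt by auto
   ultimately have "U \<inter> {\<kappa>' + 1..<0} \<subset> U \<inter> {\<kappa> + 1..<0}" by blast
   then have "card (U \<inter> {\<kappa>' + 1..<0}) < card (U \<inter> {\<kappa> + 1..<0})" using U by (intro psubset_card_mono) auto
   then show ?thesis using False F2 by (simp add: jump_index_def)
  qed
 qed
qed auto

lemma grid_interval_Suc:
 "U \<inter> {0..<int (Suc j)} = (if int j \<in> U then insert (int j) (U \<inter> {0..<int j}) else U \<inter> {0..<int j})"
 "U \<inter> {- int (Suc j)..<0} = (if - int j - 1 \<in> U then insert (- int j - 1) (U \<inter> {- int j..<0}) else U \<inter> {- int j..<0})"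
proof -
 have "{0..<int (Suc j)} = insert (int j) {0..<int j}" "{- int (Suc j)..<0} = insert (- int j - 1) {- int j..<0}" by auto
 then show "U \<inter> {0..<int (Suc j)} = (if int j \<in> U then insert (int j) (U \<inter> {0..<int j}) else U \<inter> {0..<int j})"
  "U \<inter> {- int (Suc j)..<0} = (if - int j - 1 \<in> U then insert (- int j - 1) (U \<inter> {- int j..<0}) else U \<inter> {- int j..<0})"
  by (simp_all only: Int_insert_right)
qed

text \<open>On this event the number of points up to a grid point equals the number of occupied
  cells up to it, so across a cell the partial sum of jumps advances by exactly the variable that
  \<open>jump_index\<close> names.\<close>

lemma path_jump_occupied:
 assumes w: "w \<in> space M" and h: "0 < h" and U: "U \<subseteq> {- int m..<int m}" and occ: "limit_occupied h {- int m..<int m} U w"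
 shows "(\<lambda>\<kappa>\<in>{- int m..<int m}. path_jump h (path w) \<kappa>) =
  zero_extend {- int m..<int m} U (\<lambda>\<kappa>\<in>U. case_sum Z1 Z2 (jump_index U \<kappa>) w)"
proof
 fix \<kappa>
 have finU: "finite U" using U by (rule finite_subset) simp
 note o = occ[unfolded limit_occupied_iff[OF w h]]
 have n1: "N1 (h * real j) w = card (U \<inter> {0..<int j})" if "j \<le> m" for j
  using that
 proof (induction j)
  case (Suc j)
  have "N1 (h * real j) w \<le> N1 (h * (real j + 1)) w"
   using h by (intro monotone_onD[OF right.N_mono[OF w]]) auto
  moreover have "N1 (h * (real j + 1)) w - N1 (h * real j) w = of_bool (int j \<in> U)"
   by (rule conjunct1[OF o, rule_format]) (use Suc.prems in simp)
  ultimately have "N1 (h * real (Suc j)) w = N1 (h * real j) w + of_bool (int j \<in> U)" by (simp add: add.commute)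
  also have "\<dots> = card (U \<inter> {0..<int j}) + of_bool (int j \<in> U)" using Suc by simp
  also have "\<dots> = card (U \<inter> {0..<int (Suc j)})"
  proof -
   note grid_interval_Suc(1)[of U j]
   then show ?thesis using finU by simp
  qed
  finally show ?case .
 qed (simp add: right.N_0[OF w])
 have n2: "N2 (h * real j) w = card (U \<inter> {- int j..<0})" if "j \<le> m" for j
  using that
 proof (induction j)
  case (Suc j)
  have "N2 (h * real j) w \<le> N2 (h * (real j + 1)) w"
   using h by (intro monotone_onD[OF left.N_mono[OF w]]) auto
  moreover have "N2 (h * (real j + 1)) w - N2 (h * real j) w = of_bool (- int j - 1 \<in> U)"
   by (rule conjunct2[OF o, rule_format]) (use Suc.prems in simp)
  ultimately have "N2 (h * real (Suc j)) w = N2 (h * real j) w + of_bool (- int j - 1 \<in> U)" by (simp add: add.commute)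
  also have "\<dots> = card (U \<inter> {- int j..<0}) + of_bool (- int j - 1 \<in> U)" using Suc by simp
  also have "\<dots> = card (U \<inter> {- int (Suc j)..<0})"
  proof -
   note grid_interval_Suc(2)[of U j]
   then show ?thesis using finU by simp
  qed
  finally show ?case .
 qed (simp add: left.N_0[OF w])
 show "(\<lambda>\<kappa>\<in>{- int m..<int m}. path_jump h (path w) \<kappa>) \<kappa> =
  zero_extend {- int m..<int m} U (\<lambda>\<kappa>\<in>U. case_sum Z1 Z2 (jump_index U \<kappa>) w) \<kappa>"
 proof (cases "\<kappa> \<in> {- int m..<int m}")
  case \<kappa>: True
  have sum1: "(\<Sum>i<k + of_bool b. f i) - (\<Sum>i<k. f i) = (if b then f k else 0)" for f :: "nat \<Rightarrow> real" and k b
   by (cases b) auto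
  show ?thesis
  proof (cases "0 \<le> \<kappa>")
   case True
   define j where "j = nat \<kappa>"
   have j: "\<kappa> = int j" "j < m" "Suc j \<le> m" "j \<le> m" using True \<kappa> by (auto simp: j_def)
   have "N1 (h * (real j + 1)) w = card (U \<inter> {0..<int j}) + of_bool (int j \<in> U)"
   proof -
    note grid_interval_Suc(1)[of U j]
    then show ?thesis using n1[OF j(3)] finU by (simp add: add.commute)
   qed
   then have "path_jump h (path w) \<kappa> = (if int j \<in> U then Z1 (card (U \<inter> {0..<int j})) w else 0)"
    using h n1[OF j(4)] sum1[of "\<lambda>i. Z1 i w"] by (simp add: path_jump_def j(1) cpp_path_def)
   then show ?thesis using \<kappa> by (simp add: zero_extend_def jump_index_def j(1))
  next
   case False
   define j where "j = nat (- \<kappa> - 1)"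
   have j: "\<kappa> = - int j - 1" "j < m" "Suc j \<le> m" "j \<le> m" using False \<kappa> by (auto simp: j_def)
   have "N2 (h * (real j + 1)) w = card (U \<inter> {- int j..<0}) + of_bool (- int j - 1 \<in> U)"
   proof -
    note grid_interval_Suc(2)[of U j]
    then show ?thesis using n2[OF j(3)] finU by (simp add: add.commute)
   qed
   moreover have "path w (h * real_of_int \<kappa>) = (\<Sum>i<N2 (h * (real j + 1)) w. Z2 i w)"
   proof -
    have e: "h * real_of_int \<kappa> = - (h * (real j + 1))" by (simp add: j(1) algebra_simps)
    have "0 < h * (real j + 1)" using h by simp
    then show ?thesis unfolding e by (simp add: cpp_path_def)
   qed
   moreover have "path w (h * (real_of_int \<kappa> + 1)) = (\<Sum>i<N2 (h * real j) w. Z2 i w)"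
   proof (cases "j = 0")
    case True then show ?thesis using w by (simp add: cpp_path_def right.N_0 left.N_0 j(1))
   next
    case F: False
    have e: "h * (real_of_int \<kappa> + 1) = - (h * real j)" by (simp add: j(1))
    have "0 < h * real j" using h F by simp
    then show ?thesis unfolding e by (simp add: cpp_path_def)
   qed
   ultimately have "path_jump h (path w) \<kappa> = (if - int j - 1 \<in> U then Z2 (card (U \<inter> {- int j..<0})) w else 0)"
    using False n2[OF j(4)] sum1[of "\<lambda>i. Z2 i w"] by (simp add: path_jump_def)
   then show ?thesis using \<kappa> False by (simp add: zero_extend_def jump_index_def j(1))
  qed
 qed (auto simp: zero_extend_def)
qed

text \<open>The jump event and the counting event lie in independent \<sigma>-algebras. The counting
  event factors over the two sides and, by independent increments, over the cells; the jumps in the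
  cells of \<open>U\<close> are an i.i.d. vector selected by the deterministic numbering
  \<open>jump_index\<close>.\<close>

lemma occupied_prob:
 fixes m :: nat
 assumes h: "0 < h" and U: "U \<subseteq> {- int m..<int m}" and G: "G \<in> sets (PiM {- int m..<int m} (\<lambda>_. borel))"
 defines "E \<equiv> {w\<in>space M. limit_occupied h {- int m..<int m} U w \<and> (\<lambda>\<kappa>\<in>{- int m..<int m}. path_jump h (path w) \<kappa>) \<in> G}"
 shows "E \<in> sets M" and "measure M E = grid_prob \<mu> (h * rate) {- int m..<int m} U G"
proof -
 let ?cells = "{- int m..<int m}"
 let ?PN = "\<Pi>\<^sub>M t\<in>{0::real..}. count_space (UNIV::nat set)"
 define B1 where "B1 = {f\<in>space ?PN. \<forall>j<m. f (h * (real j + 1)) - f (h * real j) = of_bool (int j \<in> U)}"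
 define B2 where "B2 = {f\<in>space ?PN. \<forall>j<m. f (h * (real j + 1)) - f (h * real j) = of_bool (- int j - 1 \<in> U)}"
 define A where "A = {f\<in>space (\<Pi>\<^sub>M k\<in>UNIV. borel). zero_extend ?cells U (\<lambda>\<kappa>\<in>U. f (jump_index U \<kappa>)) \<in> G}"
 have finU: "finite U" using U by (rule finite_subset) simp
 have Bm: "{f\<in>space ?PN. \<forall>j<m. f (h * (real j + 1)) - f (h * real j) = c j} \<in> sets ?PN" for c :: "nat \<Rightarrow> nat"
 proof -
  have comp: "(\<lambda>f. f t) \<in> measurable ?PN (count_space UNIV)" if "0 \<le> t" for t :: real
   using that by (intro measurable_component_singleton) auto
  have p: "Measurable.pred ?PN (\<lambda>f. f (h * (real j + 1)) - f (h * real j) = c j)" for j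
  proof -
   have [measurable]: "(\<lambda>f. f (h * (real j + 1))) \<in> measurable ?PN (count_space UNIV)" "(\<lambda>f. f (h * real j)) \<in> measurable ?PN (count_space UNIV)"
    using h by (auto intro!: comp)
   show ?thesis by measurable
  qed
  have "Measurable.pred ?PN (\<lambda>f. \<forall>j\<in>{..<m}. f (h * (real j + 1)) - f (h * real j) = c j)"
   by (rule pred_intros_finite(3)) (auto intro: p)
  then show ?thesis by (simp only: pred_def Ball_def lessThan_iff)
 qed
 have B1m: "B1 \<in> sets ?PN" unfolding B1_def by (rule Bm)
 have B2m: "B2 \<in> sets ?PN" unfolding B2_def by (rule Bm)
 have Am: "A \<in> sets (\<Pi>\<^sub>M k\<in>UNIV. borel)"
 proof -
  have "(\<lambda>f. \<lambda>\<kappa>\<in>U. f (jump_index U \<kappa>)) \<in> measurable (\<Pi>\<^sub>M k\<in>UNIV. borel :: real measure) (PiM U (\<lambda>_. borel))"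
   by (intro measurable_restrict measurable_component_singleton) auto
  from measurable_sets[OF measurable_compose[OF this zero_extend_measurable[of ?cells U]] G]
  show ?thesis by (simp add: A_def vimage_def Int_def conj_commute)
 qed
 define a where "a = (\<lambda>w k. case_sum Z1 Z2 k w) -` A \<inter> space M"
 define b where "b = (\<lambda>w. (\<lambda>t\<in>{0..}. N1 t w, \<lambda>t\<in>{0..}. N2 t w)) -` (B1 \<times> B2) \<inter> space M"
 have a_in: "a \<in> sets (vimage_algebra (space M) (\<lambda>w k. case_sum Z1 Z2 k w) (\<Pi>\<^sub>M k\<in>UNIV. borel))"
  unfolding a_def by (rule in_vimage_algebra[OF Am])
 have b_in: "b \<in> sets (vimage_algebra (space M) (\<lambda>w. (\<lambda>t\<in>{0..}. N1 t w, \<lambda>t\<in>{0..}. N2 t w)) (?PN \<Otimes>\<^sub>M ?PN))"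
  unfolding b_def by (rule in_vimage_algebra) (intro pair_measureI B1m B2m)
 have prod: "measure M (a \<inter> b) = measure M a * measure M b"
  by (rule right.indep_setD[OF jumps_N_indep a_in b_in])
 have a_ev: "a \<in> sets M" and b_ev: "b \<in> sets M"
  using right.indep_setD_ev1[OF jumps_N_indep] right.indep_setD_ev2[OF jumps_N_indep] a_in b_in by blast+
 have spN: "(\<lambda>t\<in>{0..}. N w t) \<in> space ?PN" for N and w :: 'b by (auto simp: space_PiM)
 have b_iff: "w \<in> b \<longleftrightarrow> limit_occupied h ?cells U w" if "w \<in> space M" for w
  unfolding b_def B1_def B2_def limit_occupied_iff[OF that h] using that spN h by auto
 have a_iff: "w \<in> a \<longleftrightarrow> zero_extend ?cells U (\<lambda>\<kappa>\<in>U. case_sum Z1 Z2 (jump_index U \<kappa>) w) \<in> G" if "w \<in> space M" for w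
  unfolding a_def A_def using that by (auto simp: space_PiM)
 have E_eq: "E = a \<inter> b"
 proof (intro set_eqI)
  fix w
  show "w \<in> E \<longleftrightarrow> w \<in> a \<inter> b"
  proof (cases "w \<in> space M")
   case True
   then show ?thesis unfolding E_def using b_iff[OF True] a_iff[OF True] path_jump_occupied[OF True h U] by auto
  qed (auto simp: E_def a_def)
 qed
 show "E \<in> sets M" unfolding E_eq using a_ev b_ev by auto
 have Pa: "measure M a = measure (PiM U (\<lambda>_. \<mu>)) {z \<in> space (PiM U (\<lambda>_. borel)). zero_extend ?cells U z \<in> G}"
 proof -
  let ?V = "\<lambda>w. \<lambda>\<kappa>\<in>U. case_sum Z1 Z2 (jump_index U \<kappa>) w"
  have ij: "right.indep_vars (\<lambda>_. borel) (\<lambda>\<kappa>. case_sum Z1 Z2 (jump_index U \<kappa>)) U"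
   by (rule right.indep_vars_reindex_inj[OF jumps_indep jump_index_inj[OF finU]]) auto
  have law: "distr M (PiM U (\<lambda>_. borel)) ?V = PiM U (\<lambda>_. \<mu>)"
  proof (rule right.iid_vector_law[OF ij])
   show "distr M borel (case_sum Z1 Z2 (jump_index U \<kappa>)) = \<mu>" for \<kappa>
    by (cases "jump_index U \<kappa>") (auto simp: Z1_law Z2_law)
  qed
  have mj: "?V \<in> measurable M (PiM U (\<lambda>_. borel))"
   using ij by (intro measurable_restrict) (auto simp: right.indep_vars_def)
  have G': "{z \<in> space (PiM U (\<lambda>_. borel)). zero_extend ?cells U z \<in> G} \<in> sets (PiM U (\<lambda>_. borel))"
   using measurable_sets[OF zero_extend_measurable G] by (simp add: vimage_def Int_def conj_commute)
  have "a = ?V -` {z \<in> space (PiM U (\<lambda>_. borel)). zero_extend ?cells U z \<in> G} \<inter> space M"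
   using a_iff measurable_space[OF mj] by (auto simp: a_def)
  then show ?thesis using measure_distr[OF mj G'] unfolding law by simp
 qed
 have Pb: "measure M b = (\<Prod>j<m. pmf (poisson_pmf (rate * h)) (of_bool (int j \<in> U))) * (\<Prod>j<m. pmf (poisson_pmf (rate * h)) (of_bool (- int j - 1 \<in> U)))"
 proof -
  have "measure M b = measure M ((\<lambda>w. \<lambda>t\<in>{0..}. N1 t w) -` B1 \<inter> space M) * measure M ((\<lambda>w. \<lambda>t\<in>{0..}. N2 t w) -` B2 \<inter> space M)"
   unfolding b_def by (rule right.indep_varD[OF N1_N2_indep B1m B2m])
  moreover have "(\<lambda>w. \<lambda>t\<in>{0..}. N1 t w) -` B1 \<inter> space M = {w\<in>space M. \<forall>j<m. N1 (h * (real j + 1)) w - N1 (h * real j) w = of_bool (int j \<in> U)}"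
   unfolding B1_def using spN h by auto
  moreover have "(\<lambda>w. \<lambda>t\<in>{0..}. N2 t w) -` B2 \<inter> space M = {w\<in>space M. \<forall>j<m. N2 (h * (real j + 1)) w - N2 (h * real j) w = of_bool (- int j - 1 \<in> U)}"
   unfolding B2_def using spN h by auto
  ultimately show ?thesis using right.increments_pattern[OF h] left.increments_pattern[OF h] by simp
 qed
 let ?hh = "h * rate"
 have hh: "0 < ?hh" using h right.rate_pos by simp
 have pp: "pmf (poisson_pmf (rate * h)) (of_bool q) = exp (- ?hh) * (if q then ?hh else 1)" for q
  using hh by (cases q) (simp_all add: mult.commute)
 have pc: "(\<Prod>j<m. if Q j then ?hh else 1) = ?hh ^ card {j. j < m \<and> Q j}" for Q
 proof -
  have "(\<Prod>j<m. if Q j then ?hh else 1) = (\<Prod>j\<in>{j. j < m \<and> Q j}. ?hh)"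
   by (rule prod.mono_neutral_cong_right) auto
  then show ?thesis by simp
 qed
 have card: "card {j. j < m \<and> int j \<in> U} + card {j. j < m \<and> - int j - 1 \<in> U} = card U"
 proof -
  have "U = int ` {j. j < m \<and> int j \<in> U} \<union> (\<lambda>j. - int j - 1) ` {j. j < m \<and> - int j - 1 \<in> U}"
  proof (intro set_eqI iffI)
   fix \<kappa> assume k: "\<kappa> \<in> U"
   then have b: "- int m \<le> \<kappa>" "\<kappa> < int m" using U by auto
   show "\<kappa> \<in> int ` {j. j < m \<and> int j \<in> U} \<union> (\<lambda>j. - int j - 1) ` {j. j < m \<and> - int j - 1 \<in> U}"
   proof (cases "0 \<le> \<kappa>")
    case True
    then have "\<kappa> = int (nat \<kappa>)" "nat \<kappa> < m" using b by auto
    then show ?thesis using k by (metis (mono_tags, lifting) UnI1 image_eqI mem_Collect_eq)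
   next
    case False
    then have "\<kappa> = - int (nat (- \<kappa> - 1)) - 1" "nat (- \<kappa> - 1) < m" using b by auto
    then show ?thesis using k by (metis (mono_tags, lifting) UnI2 image_eqI mem_Collect_eq)
   qed
  qed auto
  then have "card U = card (int ` {j. j < m \<and> int j \<in> U} \<union> (\<lambda>j. - int j - 1) ` {j. j < m \<and> - int j - 1 \<in> U})" by simp
  also have "\<dots> = card (int ` {j. j < m \<and> int j \<in> U}) + card ((\<lambda>j. - int j - 1) ` {j. j < m \<and> - int j - 1 \<in> U})"
   by (rule card_Un_disjoint) auto
  also have "\<dots> = card {j. j < m \<and> int j \<in> U} + card {j. j < m \<and> - int j - 1 \<in> U}"
   by (intro arg_cong2[where f="(+)"] card_image) (auto simp: inj_on_def)
  finally show ?thesis by simp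
 qed
 have "measure M b = (exp (- ?hh) ^ m * exp (- ?hh) ^ m) * ?hh ^ card U"
  unfolding Pb pp prod.distrib pc card[symmetric] power_add by simp
 also have "exp (- ?hh) ^ m * exp (- ?hh) ^ m = exp (- (?hh * card ?cells))"
  by (simp add: exp_of_nat_mult[symmetric] exp_add[symmetric] algebra_simps)
 finally have Pb': "measure M b = exp (- (?hh * card ?cells)) * ?hh ^ card U" .
 show "measure M E = grid_prob \<mu> ?hh ?cells U G"
  unfolding E_eq prod Pa Pb' grid_prob_def by simp
qed

text \<open>A union bound over the \<open>2 * m\<close> cells. With \<open>h = K / m\<close> the
  error is of order 1 / m, so on a fine mesh each cell holds at most one point.\<close>

lemma not_simple_prob:
 fixes m :: nat
 assumes h: "0 < h"
 shows "\<exists>A\<in>sets M. 1 - 2 * real m * (h * rate)\<^sup>2 \<le> measure M A \<and> (\<forall>w\<in>A. \<exists>U\<subseteq>{- int m..<int m}. limit_occupied h {- int m..<int m} U w)"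
proof -
 define Z where "Z N j = {w\<in>space M. 2 \<le> N (h * (real j + 1)) w - N (h * real j) w}" for N :: "real \<Rightarrow> 'b \<Rightarrow> nat" and j :: nat
 have nn: "0 \<le> h * (real j + 1)" "0 \<le> h * real j" for j using h by auto
 have Zm: "Z N1 j \<in> sets M" "Z N2 j \<in> sets M" for j
  unfolding Z_def using N_measurable'[OF nn(1)] N_measurable'[OF nn(2)] by measurable
 have ZP: "measure M (Z N1 j) \<le> (h * rate)\<^sup>2" "measure M (Z N2 j) \<le> (h * rate)\<^sup>2" for j
  unfolding Z_def using right.increment_ge_2[of "h * real j" "h * (real j + 1)"] left.increment_ge_2[of "h * real j" "h * (real j + 1)"] h
  by (auto simp: algebra_simps)
 define B where "B = (\<Union>j<m. Z N1 j) \<union> (\<Union>j<m. Z N2 j)"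
 have Bm: "B \<in> sets M" unfolding B_def using Zm by auto
 have "measure M B \<le> measure M (\<Union>j<m. Z N1 j) + measure M (\<Union>j<m. Z N2 j)"
  unfolding B_def using Zm by (intro measure_Un_le) auto
 also have "\<dots> \<le> (\<Sum>j<m. measure M (Z N1 j)) + (\<Sum>j<m. measure M (Z N2 j))"
  using Zm by (intro add_mono measure_UNION_le) auto
 also have "\<dots> \<le> (\<Sum>j<m. (h * rate)\<^sup>2) + (\<Sum>j<m. (h * rate)\<^sup>2)" using ZP by (intro add_mono sum_mono) auto
 finally have BP: "measure M B \<le> 2 * real m * (h * rate)\<^sup>2" by simp
 show ?thesis
 proof (intro bexI conjI ballI)
  show "space M - B \<in> sets M" using Bm by auto
  show "1 - 2 * real m * (h * rate)\<^sup>2 \<le> measure M (space M - B)" using BP right.prob_compl[OF Bm] by simp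
  fix w assume w: "w \<in> space M - B"
  define U where "U = {\<kappa>\<in>{- int m..<int m}. if 0 \<le> \<kappa> then N1 (h * (real (nat \<kappa>) + 1)) w - N1 (h * real (nat \<kappa>)) w = 1
    else N2 (h * (real (nat (- \<kappa> - 1)) + 1)) w - N2 (h * real (nat (- \<kappa> - 1))) w = 1}"
  have b: "N1 (h * (real j + 1)) w - N1 (h * real j) w < 2" "N2 (h * (real j + 1)) w - N2 (h * real j) w < 2" if "j < m" for j
   using w that by (auto simp: B_def Z_def not_le)
  have u: "int j \<in> U \<longleftrightarrow> N1 (h * (real j + 1)) w - N1 (h * real j) w = 1" "- int j - 1 \<in> U \<longleftrightarrow> N2 (h * (real j + 1)) w - N2 (h * real j) w = 1"
   if "j < m" for j
   using that by (auto simp: U_def)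
  have "limit_occupied h {- int m..<int m} U w"
   unfolding limit_occupied_iff[OF DiffD1[OF w] h]
  proof (intro conjI allI impI)
   fix j assume j: "j < m"
   show "N1 (h * (real j + 1)) w - N1 (h * real j) w = of_bool (int j \<in> U)"
    using b(1)[OF j] u(1)[OF j] by (cases "int j \<in> U") auto
   show "N2 (h * (real j + 1)) w - N2 (h * real j) w = of_bool (- int j - 1 \<in> U)"
    using b(2)[OF j] u(2)[OF j] by (cases "- int j - 1 \<in> U") auto
  qed
  then show "\<exists>U\<subseteq>{- int m..<int m}. limit_occupied h {- int m..<int m} U w" by (intro exI[of _ U]) (auto simp: U_def)
 qed
qed

end

text \<open>\<open>chain_strong_law\<close> for initial segments of the centred steps, with the
  drift itself as the constant: a deviation below the drift keeps the sum positive.\<close>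

lemma (in prob_space) random_walk_positive:
 fixes Z :: "nat \<Rightarrow> 'a \<Rightarrow> real"
 assumes ind: "indep_vars (\<lambda>_. borel) Z UNIV" and law: "\<And>i. distr M borel (Z i) = \<mu>"
  and int: "integrable \<mu> (\<lambda>x. x)" "integrable \<mu> (\<lambda>x. x\<^sup>2)" and c: "0 < integral\<^sup>L \<mu> (\<lambda>x. x)" and \<epsilon>: "0 < \<epsilon>"
 shows "\<exists>k0>0. \<exists>A\<in>events. 1 - \<epsilon> \<le> prob A \<and> (\<forall>w\<in>A. \<forall>k\<ge>k0. 0 < (\<Sum>i<k. Z i w))"
proof -
 define c where "c = integral\<^sup>L \<mu> (\<lambda>x. x)"
 have rv[measurable]: "Z i \<in> borel_measurable M" for i using ind by (auto simp: indep_vars_def)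
 define Y where "Y i w = Z i w - c" for i w
 have indY: "indep_vars (\<lambda>_. borel) Y J" for J
  unfolding Y_def using indep_vars_compose2[OF indep_vars_subset[OF ind subset_UNIV], of J "\<lambda>_ x. x - c" "\<lambda>_. borel"] by simp
 have Zi: "integrable M (Z i)" "expectation (Z i) = c" "integrable M (\<lambda>w. (Z i w)\<^sup>2)" for i
  using int unfolding c_def law[of i, symmetric] by (auto simp: integrable_distr_eq integral_distr)
 define s2 where "s2 = integral\<^sup>L \<mu> (\<lambda>x. (x - c)\<^sup>2)"
 have Y2e: "expectation (\<lambda>w. (Y i w)\<^sup>2) = s2" for i
  unfolding s2_def law[of i, symmetric] Y_def by (subst integral_distr) auto
 have Y2i: "integrable M (\<lambda>w. (Y i w)\<^sup>2)" for i
  unfolding Y_def power2_diff using Zi by (auto intro!: Bochner_Integration.integrable_add Bochner_Integration.integrable_diff)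
 have Y0: "expectation (Y i) = 0" for i unfolding Y_def using Zi by (simp add: prob_space)
 have s20: "0 \<le> s2" unfolding s2_def by simp
 have c0: "0 < c" using c by (simp add: c_def)
 obtain k0 :: nat where k: "4 * s2 / (c\<^sup>2 * \<epsilon>) < k0" using reals_Archimedean2 by blast
 have "0 \<le> 4 * s2 / (c\<^sup>2 * \<epsilon>)" using c0 \<epsilon> s20 by simp
 then have "0 < real k0" using k by linarith
 then have k0: "0 < k0" by simp
 then have k0': "4 * s2 / (c\<^sup>2 * k0) \<le> \<epsilon>" using k c0 \<epsilon> by (simp add: field_simps)
 \<comment> \<open>The strong law covers finitely many indices at a time; its bound does not depend
   on \<open>m\<close>, so it passes to the increasing union.\<close>
 define B where "B m = {w\<in>space M. \<exists>k\<in>{k0..m}. c * k \<le> \<bar>\<Sum>i<k. Y i w\<bar>}" for m :: nat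
 have [measurable]: "Y i \<in> borel_measurable M" for i unfolding Y_def by measurable
 have Bm: "B m \<in> events" for m unfolding B_def by measurable
 have BP: "prob (B m) \<le> \<epsilon>" for m
 proof -
  have "B m = {w\<in>space M. \<exists>S\<in>(\<lambda>k. {..<k}) ` {..m}. k0 \<le> card S \<and> c * card S \<le> \<bar>\<Sum>i\<in>S. Y i w\<bar>}"
   by (auto simp: B_def)
  also have "prob \<dots> \<le> 4 * s2 / (c\<^sup>2 * k0)"
   by (rule chain_strong_law[OF indY[of "{..<m}"]]) (use Y0 Y2i Y2e c0 k0 s20 in auto)
  finally show ?thesis using k0' by simp
 qed
 have inc: "incseq B" by (rule incseq_SucI) (auto simp: B_def)
 have "(\<lambda>m. prob (B m)) \<longlonglongrightarrow> prob (\<Union>m. B m)"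
  by (rule finite_Lim_measure_incseq) (use Bm inc in auto)
 then have UP: "prob (\<Union>m. B m) \<le> \<epsilon>" by (rule LIMSEQ_le_const2) (use BP in auto)
 have Um: "(\<Union>m. B m) \<in> events" using Bm by auto
 show ?thesis
 proof (intro exI[of _ k0] conjI k0 bexI ballI allI impI)
  show "space M - (\<Union>m. B m) \<in> events" using Um by auto
  show "1 - \<epsilon> \<le> prob (space M - (\<Union>m. B m))" using UP prob_compl[OF Um] by simp
  fix w k assume w: "w \<in> space M - (\<Union>m. B m)" and kk: "k0 \<le> k"
  then have "w \<notin> B k" by auto
  then have "\<bar>\<Sum>i<k. Y i w\<bar> < c * k" using w kk by (auto simp: B_def not_le)
  moreover have "(\<Sum>i<k. Y i w) = (\<Sum>i<k. Z i w) - c * k" by (simp add: Y_def sum_subtractf mult.commute)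
  ultimately show "0 < (\<Sum>i<k. Z i w)" by linarith
 qed
qed

text \<open>Beyond \<open>K\<close> each counting process has passed the index after which its
  random walk stays positive. Since the path vanishes at 0, its minimizers are confined to the
  window. The four errors belong to two walks and two counting processes.\<close>

lemma (in two_sided_cpp) path_positive_far_out:
 assumes int: "integrable \<mu> (\<lambda>x. x)" "integrable \<mu> (\<lambda>x. x\<^sup>2)" and c: "0 < integral\<^sup>L \<mu> (\<lambda>x. x)" and \<epsilon>: "0 < \<epsilon>"
 shows "\<exists>K0>0. \<forall>K\<ge>K0. \<exists>A\<in>sets M. 1 - 4 * \<epsilon> \<le> measure M A \<and> (\<forall>w\<in>A. \<forall>t. K \<le> \<bar>t\<bar> \<longrightarrow> 0 < path w t)"
proof -
 have i1: "right.indep_vars (\<lambda>_. borel) Z1 UNIV"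
  using right.indep_vars_reindex_inj[OF jumps_indep, of Inl UNIV] by (auto simp: inj_on_def)
 have i2: "right.indep_vars (\<lambda>_. borel) Z2 UNIV"
  using right.indep_vars_reindex_inj[OF jumps_indep, of Inr UNIV] by (auto simp: inj_on_def)
 obtain k1 A1 where 1: "0 < k1" "A1 \<in> sets M" "1 - \<epsilon> \<le> measure M A1" "\<forall>w\<in>A1. \<forall>k\<ge>k1. 0 < (\<Sum>i<k. Z1 i w)"
  using right.random_walk_positive[OF i1 Z1_law int c \<epsilon>] by blast
 obtain k2 A2 where 2: "0 < k2" "A2 \<in> sets M" "1 - \<epsilon> \<le> measure M A2" "\<forall>w\<in>A2. \<forall>k\<ge>k2. 0 < (\<Sum>i<k. Z2 i w)"
  using right.random_walk_positive[OF i2 Z2_law int c \<epsilon>] by blast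
 obtain K1 where K1: "0 < K1" "\<forall>K\<ge>K1. measure M {w\<in>space M. N1 K w < k1} \<le> \<epsilon>" using right.few_points_unlikely[OF \<epsilon>] by blast
 obtain K2 where K2: "0 < K2" "\<forall>K\<ge>K2. measure M {w\<in>space M. N2 K w < k2} \<le> \<epsilon>" using left.few_points_unlikely[OF \<epsilon>] by blast
 show ?thesis
 proof (intro exI[of _ "max K1 K2"] conjI allI impI)
  show "0 < max K1 K2" using K1 by simp
  fix K assume K: "max K1 K2 \<le> K"
  have K0: "0 < K" using K K1 by simp
  define B1 where "B1 = {w\<in>space M. N1 K w < k1}"
  define B2 where "B2 = {w\<in>space M. N2 K w < k2}"
  have Bm: "B1 \<in> sets M" "B2 \<in> sets M" unfolding B1_def B2_def using N_measurable'[of K] K0 by (simp_all, measurable)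
  define C where "C = (space M - A1) \<union> (space M - A2) \<union> B1 \<union> B2"
  have Cm: "C \<in> sets M" unfolding C_def using 1 2 Bm by auto
  have "measure M C \<le> measure M (space M - A1) + measure M (space M - A2) + measure M B1 + measure M B2"
  proof -
   have "measure M C \<le> measure M ((space M - A1) \<union> (space M - A2) \<union> B1) + measure M B2"
    unfolding C_def using 1 2 Bm by (intro measure_Un_le) auto
   also have "measure M ((space M - A1) \<union> (space M - A2) \<union> B1) \<le> measure M ((space M - A1) \<union> (space M - A2)) + measure M B1"
    using 1 2 Bm by (intro measure_Un_le) auto
   also have "measure M ((space M - A1) \<union> (space M - A2)) \<le> measure M (space M - A1) + measure M (space M - A2)"
    using 1 2 by (intro measure_Un_le) auto
   finally show ?thesis by simp
  qed
  also have "\<dots> \<le> \<epsilon> + \<epsilon> + \<epsilon> + \<epsilon>"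
   using 1 2 K K1 K2 right.prob_compl[of A1] right.prob_compl[of A2] unfolding B1_def B2_def by (intro add_mono) auto
  finally have CP: "measure M C \<le> 4 * \<epsilon>" by simp
  show "\<exists>A\<in>sets M. 1 - 4 * \<epsilon> \<le> measure M A \<and> (\<forall>w\<in>A. \<forall>t. K \<le> \<bar>t\<bar> \<longrightarrow> 0 < path w t)"
  proof (intro bexI conjI ballI allI impI)
   show "space M - C \<in> sets M" using Cm by auto
   show "1 - 4 * \<epsilon> \<le> measure M (space M - C)" using CP right.prob_compl[OF Cm] by simp
   fix w t assume w: "w \<in> space M - C" and t: "K \<le> \<bar>t\<bar>"
   then have w': "w \<in> space M" "w \<in> A1" "w \<in> A2" "k1 \<le> N1 K w" "k2 \<le> N2 K w" by (auto simp: C_def B1_def B2_def)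
   show "0 < path w t"
   proof (cases "0 \<le> t")
    case True
    then have "N1 K w \<le> N1 t w" using t K0 by (intro monotone_onD[OF right.N_mono[OF w'(1)]]) auto
    then show ?thesis using True w' 1(4) by (simp add: cpp_path_def)
   next
    case False
    then have "N2 K w \<le> N2 (- t) w" using t K0 by (intro monotone_onD[OF left.N_mono[OF w'(1)]]) auto
    then show ?thesis using False w' 2(4) by (simp add: cpp_path_def)
   qed
  qed
 qed
qed

section \<open>Midpoints of minimizing intervals\<close>

text \<open>The set has to be known only up to the mesh; which endpoints belong to it is
  immaterial.\<close>

lemma interval_midpoint_near:
 assumes A: "A \<subseteq> {p - h..q + h}" and pq: "p \<in> A" "q \<in> A" and h: "0 \<le> h"
 shows "\<bar>interval_midpoint A - (p + q) / 2\<bar> \<le> h"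
proof -
 have bb: "bdd_below A" "bdd_above A" using A by (auto intro: bdd_below_mono bdd_above_mono)
 have ne: "A \<noteq> {}" using pq by auto
 have "Inf A \<le> p" "q \<le> Sup A" using pq bb by (auto intro: cInf_lower cSup_upper)
 moreover have "p - h \<le> Inf A" using A by (intro cInf_greatest[OF ne]) auto
 moreover have "Sup A \<le> q + h" using A by (intro cSup_least[OF ne]) auto
 ultimately show ?thesis by (simp add: interval_midpoint_def midpoint_def abs_le_iff field_simps)
qed

lemma grid_point:
 fixes h :: real and k :: int and m :: nat
 assumes h: "0 < h" and that: "k \<in> {- int m..int m}"
 shows "h * k \<in> {- (h * m)..h * m}"
proof -
 have "real_of_int (- int m) \<le> real_of_int k" "real_of_int k \<le> real_of_int (int m)" using that by (auto simp del: of_int_minus of_int_of_nat_eq)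
 then have "- real m \<le> real_of_int k" "real_of_int k \<le> real m" by simp_all
 then have "h * (- real m) \<le> h * k" "h * k \<le> h * real m" using h by (intro mult_left_mono; simp)+
 then show ?thesis by simp
qed

text \<open>Between neighbouring grid points \<open>q\<close> rises by at most 1, so any value taken
  in between is already taken at one of the two.\<close>

lemma grid_near:
 fixes h t :: real and q :: "real \<Rightarrow> int" and m :: nat
 assumes h: "0 < h" and mono: "\<And>s t. s \<le> t \<Longrightarrow> q s \<le> q t"
  and simple: "\<And>\<kappa>. \<kappa> \<in> {- int m..<int m} \<Longrightarrow> q (h * (real_of_int \<kappa> + 1)) - q (h * real_of_int \<kappa>) \<le> 1"
  and t: "t \<in> {- (h * m)<..<h * m}"
 shows "\<exists>k\<in>{- int m..int m}. q t = q (h * k)"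
proof -
 define k where "k = \<lfloor>t / h\<rfloor>"
 have k1: "h * k \<le> t" "t \<le> h * (real_of_int k + 1)"
 proof -
  have "real_of_int k \<le> t / h" "t / h \<le> real_of_int k + 1" unfolding k_def by linarith+
  then show "h * k \<le> t" "t \<le> h * (real_of_int k + 1)" using h by (simp_all add: field_simps)
 qed
 have "- real m < t / h" "t / h < real m" using t h by (auto simp: field_simps)
 then have km: "k \<in> {- int m..<int m}" unfolding k_def by (auto simp: le_floor_iff floor_less_iff)
 have "q (h * k) \<le> q t" "q t \<le> q (h * (real_of_int k + 1))" using mono k1 by auto
 then have "q t = q (h * k) \<or> q t = q (h * (real_of_int k + 1))" using simple[OF km] by linarith
 then obtain k' where k': "k' \<in> {- int m..int m}" "q t = q (h * k')"
 proof
  assume "q t = q (h * k)" then show thesis using km by (intro that[of k]) auto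
 next
  assume "q t = q (h * (real_of_int k + 1))" then show thesis using km by (intro that[of "k + 1"]) auto
 qed
 then show ?thesis by auto
qed

text \<open>Here \<open>q\<close> numbers the pieces of constancy of \<open>g\<close>.\<close>

lemma grid_argmin:
 fixes h :: real and g :: "real \<Rightarrow> real" and q :: "real \<Rightarrow> int" and m :: nat and a b :: int
 assumes h: "0 < h" and mono: "\<And>s t. s \<le> t \<Longrightarrow> q s \<le> q t"
  and T: "{- (h * m)..h * m} \<subseteq> T"
  and det: "\<And>s t. s \<in> {- (h * m)..h * m} \<Longrightarrow> t \<in> {- (h * m)..h * m} \<Longrightarrow> q s = q t \<Longrightarrow> g s = g t"
  and simple: "\<And>\<kappa>. \<kappa> \<in> {- int m..<int m} \<Longrightarrow> q (h * (real_of_int \<kappa> + 1)) - q (h * real_of_int \<kappa>) \<le> 1"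
  and ab: "- int m < a" "a \<le> b" "b < int m" "q (h * a) = q (h * b)"
  and gap: "\<And>k. k \<in> {- int m..int m} \<Longrightarrow> k \<notin> {a..b} \<Longrightarrow> g (h * a) < g (h * k)"
  and ne: "argmin_set g T \<noteq> {}" and inside: "argmin_set g T \<subseteq> {- (h * m)<..<h * m}"
 shows "argmin_set g T \<subseteq> {h * a - h..h * b + h} \<and> h * a \<in> argmin_set g T \<and> h * b \<in> argmin_set g T"
proof -
 note gridT = grid_point[OF h]
 have near: "\<exists>k\<in>{- int m..int m}. q t = q (h * k) \<and> g t = g (h * k)" if t: "t \<in> {- (h * m)<..<h * m}" for t
 proof -
  obtain k where k: "k \<in> {- int m..int m}" "q t = q (h * k)" using grid_near[OF h mono simple t] by blast
  moreover have "g t = g (h * k)" using t by (intro det[OF _ gridT[OF k(1)] k(2)]) auto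
  ultimately show ?thesis by auto
 qed
 have am: "a \<in> {- int m..int m}" "b \<in> {- int m..int m}" using ab by auto
 obtain t0 where t0: "t0 \<in> argmin_set g T" using ne by auto
 have argmin_iff: "t \<in> argmin_set g T \<longleftrightarrow> t \<in> T \<and> (\<forall>s\<in>T. g t \<le> g s)" for t
  by (auto simp: argmin_set_def is_arg_min_def not_less)
 \<comment> \<open>Every piece in the window meets the grid, so minimality can be tested on the
   grid, and the gap forces a minimizer onto the piece of \<open>a\<close>.\<close>
 have piece: "q t = q (h * a) \<and> g t = g (h * a)" if t: "t \<in> argmin_set g T" for t
 proof -
  have "t \<in> {- (h * m)<..<h * m}" using t inside by auto
  from near[OF this] obtain k where k: "k \<in> {- int m..int m}" "q t = q (h * k)" "g t = g (h * k)" by auto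
  have "g t \<le> g (h * a)" using t gridT[OF am(1)] T by (auto simp: argmin_iff)
  then have "k \<in> {a..b}" using gap[OF k(1)] k(3) by (cases "k \<in> {a..b}") auto
  then have "q (h * a) \<le> q (h * k)" "q (h * k) \<le> q (h * b)" using h by (auto intro!: mono)
  then have "q t = q (h * a)" using k(2) ab(4) by simp
  moreover have "g (h * k) = g (h * a)" using k(2) calculation by (intro det gridT k am) auto
  ultimately show ?thesis using k(3) by simp
 qed
 have pa: "h * a \<in> argmin_set g T"
  unfolding argmin_iff using t0 piece[OF t0] gridT[OF am(1)] T by (auto simp: argmin_iff)
 have pb: "h * b \<in> argmin_set g T"
 proof -
  have "g (h * b) = g (h * a)" using ab(4) by (intro det gridT am) auto
  then show ?thesis using pa gridT[OF am(2)] T by (auto simp: argmin_iff)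
 qed
 have out: "q (h * k) \<noteq> q (h * a)" if "k \<in> {- int m..int m}" "k \<notin> {a..b}" for k
  using gap[OF that] det[OF gridT[OF that(1)] gridT[OF am(1)]] by force
 moreover have "argmin_set g T \<subseteq> {h * a - h..h * b + h}"
 proof
  fix t assume t: "t \<in> argmin_set g T"
  note p = piece[OF t]
  \<comment> \<open>\<open>a - 1\<close> is still a grid point because \<open>- int m < a\<close>.
    Its piece differs from that of \<open>a\<close>, and by monotonicity so does every piece further
    left.\<close>
  have "\<not> t < h * a - h"
  proof
   assume "t < h * a - h"
   then have "t \<le> h * real_of_int (a - 1)" by (simp add: algebra_simps)
   then have "q t \<le> q (h * real_of_int (a - 1))" by (rule mono)
   moreover have "q (h * real_of_int (a - 1)) \<le> q (h * a)" using h by (intro mono) auto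
   moreover have "q (h * real_of_int (a - 1)) \<noteq> q (h * a)" using ab by (intro out) auto
   ultimately show False using p by simp
  qed
  moreover have "\<not> h * b + h < t"
  proof
   assume "h * b + h < t"
   then have "h * real_of_int (b + 1) \<le> t" by (simp add: algebra_simps)
   then have "q (h * real_of_int (b + 1)) \<le> q t" by (rule mono)
   moreover have "q (h * b) \<le> q (h * real_of_int (b + 1))" using h by (intro mono) auto
   moreover have "q (h * real_of_int (b + 1)) \<noteq> q (h * a)" using ab by (intro out) auto
   ultimately show False using p ab(4) by simp
  qed
  ultimately show "t \<in> {h * a - h..h * b + h}" by simp
 qed
 ultimately show ?thesis using pa pb by blast
qed

text \<open>The value at \<open>a\<close> represents the flat stretch from \<open>a\<close> to
  \<open>b\<close>. The gap \<open>\<eta>\<close> leaves room for the perturbation of the criterion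
  by the estimated coefficients.\<close>

definition strict_grid_min :: "nat \<Rightarrow> real \<Rightarrow> int \<Rightarrow> int \<Rightarrow> (int \<Rightarrow> real) set" where
 "strict_grid_min m \<eta> a b = {z \<in> space (PiM {- int m..<int m} (\<lambda>_. borel)).
   \<forall>k\<in>{- int m..int m} - {a..b}. grid_path z a + \<eta> \<le> grid_path z k}"

text \<open>No point lies between \<open>a\<close> and \<open>b\<close>, so the path is flat there.
  Both stay strictly inside the window so that their outer neighbours are grid points.\<close>

definition grid_patterns :: "nat \<Rightarrow> (int set \<times> int \<times> int) set" where
 "grid_patterns m = {(U, a, b). U \<subseteq> {- int m..<int m} \<and> - int m < a \<and> a \<le> b \<and> b < int m \<and> U \<inter> {a..<b} = {}}"

definition pattern_mid :: "int set \<times> int \<times> int \<Rightarrow> real" where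
 "pattern_mid = (\<lambda>(U, a, b). (real_of_int a + real_of_int b) / 2)"

definition pattern_prob :: "real measure \<Rightarrow> real \<Rightarrow> real \<Rightarrow> nat \<Rightarrow> real \<Rightarrow> int set \<times> int \<times> int \<Rightarrow> real" where
 "pattern_prob \<nu> r h m \<eta> = (\<lambda>(U, a, b). grid_prob \<nu> (h * r) {- int m..<int m} U (strict_grid_min m \<eta> a b))"

lemma finite_grid_patterns: "finite (grid_patterns m)"
 by (rule finite_subset[of _ "Pow {- int m..<int m} \<times> {- int m..int m} \<times> {- int m..int m}"]) (auto simp: grid_patterns_def)

lemma strict_grid_min_sets:
 assumes "a \<in> {- int m..int m}"
 shows "strict_grid_min m \<eta> a b \<in> sets (PiM {- int m..<int m} (\<lambda>_. borel))"
proof -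
 let ?P = "PiM {- int m..<int m} (\<lambda>_. borel :: real measure)"
 have gm: "(\<lambda>z. grid_path z k) \<in> borel_measurable ?P" if "k \<in> {- int m..int m}" for k
 proof (cases "0 \<le> k")
  case True
  have "(\<lambda>z. \<Sum>\<kappa>\<in>{0..<k}. z \<kappa>) \<in> borel_measurable ?P"
   using that by (intro borel_measurable_sum measurable_component_singleton) auto
  then show ?thesis using True by (simp add: grid_path_def)
 next
  case False
  have "(\<lambda>z. \<Sum>\<kappa>\<in>{k..<0}. z \<kappa>) \<in> borel_measurable ?P"
   using that False by (intro borel_measurable_sum measurable_component_singleton) auto
  then show ?thesis using False by (simp add: grid_path_def)
 qed
 have "Measurable.pred ?P (\<lambda>z. \<forall>k\<in>{- int m..int m} - {a..b}. grid_path z a + \<eta> \<le> grid_path z k)"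
 proof (rule pred_intros_finite(3))
  fix k assume k: "k \<in> {- int m..int m} - {a..b}"
  then have gk: "(\<lambda>z. grid_path z a) \<in> borel_measurable ?P" "(\<lambda>z. grid_path z k) \<in> borel_measurable ?P"
   using assms gm by auto
  show "Measurable.pred ?P (\<lambda>z. grid_path z a + \<eta> \<le> grid_path z k)"
   unfolding pred_def by (intro borel_measurable_le borel_measurable_add borel_measurable_const gk)
 qed simp
 then show ?thesis by (simp add: strict_grid_min_def pred_def)
qed

lemma grid_path_flat:
 assumes "(U, a, b) \<in> grid_patterns m" "\<And>\<kappa>. \<kappa> \<in> {- int m..<int m} \<Longrightarrow> \<kappa> \<notin> U \<Longrightarrow> z \<kappa> = 0" "k \<in> {a..b}"
 shows "grid_path z k = grid_path z a"
proof -
 have zero: "z \<kappa> = 0" if "\<kappa> \<in> {a..<b}" for \<kappa>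
 proof -
  have "\<kappa> \<notin> U" "\<kappa> \<in> {- int m..<int m}" using assms(1) that by (auto simp: grid_patterns_def)
  then show ?thesis using assms(2) by blast
 qed
 have ak: "a \<le> k" "k \<le> b" using assms(3) by auto
 show ?thesis
 proof (cases "0 \<le> a")
  case True
  then have "{0..<k} = {0..<a} \<union> {a..<k}" using ak by auto
  moreover have "(\<Sum>\<kappa>\<in>{a..<k}. z \<kappa>) = 0" using ak by (intro sum.neutral ballI zero) auto
  ultimately show ?thesis using True ak by (simp add: grid_path_def sum.union_disjoint)
 next
  case False
  show ?thesis
  proof (cases "0 \<le> k")
   case True
   have "(\<Sum>\<kappa>\<in>{0..<k}. z \<kappa>) = 0" "(\<Sum>\<kappa>\<in>{a..<0}. z \<kappa>) = 0" using ak False True by (intro sum.neutral ballI zero; auto)+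
   then show ?thesis using False True by (simp add: grid_path_def)
  next
   case F: False
   then have "{a..<0} = {a..<k} \<union> {k..<0}" using ak by auto
   moreover have "(\<Sum>\<kappa>\<in>{a..<k}. z \<kappa>) = 0" using ak by (intro sum.neutral ballI zero) auto
   ultimately show ?thesis using False F ak by (simp add: grid_path_def sum.union_disjoint)
  qed
 qed
qed

text \<open>Each of the two stretches carries the lowest grid value, so they share it; a grid point
  with that value cannot lie outside either of them, hence they coincide.\<close>

lemma strict_grid_min_unique:
 assumes p: "(U, a, b) \<in> grid_patterns m" "(U, a', b') \<in> grid_patterns m" and \<eta>: "0 < \<eta>"
  and z: "\<And>\<kappa>. \<kappa> \<in> {- int m..<int m} \<Longrightarrow> \<kappa> \<notin> U \<Longrightarrow> z \<kappa> = 0"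
  and m: "z \<in> strict_grid_min m \<eta> a b" "z \<in> strict_grid_min m \<eta> a' b'"
 shows "a = a' \<and> b = b'"
proof -
 have r: "- int m < a" "a \<le> b" "b < int m" "- int m < a'" "a' \<le> b'" "b' < int m" using p by (auto simp: grid_patterns_def)
 note f1 = grid_path_flat[where z=z, OF p(1) z] and f2 = grid_path_flat[where z=z, OF p(2) z]
 have g1: "grid_path z a + \<eta> \<le> grid_path z k" if "k \<in> {- int m..int m}" "k \<notin> {a..b}" for k
  using m(1) that by (auto simp: strict_grid_min_def)
 have g2: "grid_path z a' + \<eta> \<le> grid_path z k" if "k \<in> {- int m..int m}" "k \<notin> {a'..b'}" for k
  using m(2) that by (auto simp: strict_grid_min_def)
 have eq: "grid_path z a = grid_path z a'"
 proof (rule ccontr)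
  assume ne: "grid_path z a \<noteq> grid_path z a'"
  then have "a' \<notin> {a..b}" "a \<notin> {a'..b'}" using f1[of a'] f2[of a] by auto
  then show False using g1[of a'] g2[of a] r \<eta> by auto
 qed
 have "k \<in> {a..b}" if "k \<in> {a'..b'}" for k
  using g1[of k] f2[of k] that r eq \<eta> by force
 moreover have "k \<in> {a'..b'}" if "k \<in> {a..b}" for k
  using g2[of k] f1[of k] that r eq \<eta> by force
 ultimately have "{a..b} = {a'..b'}" by blast
 then show ?thesis using r by (simp add: Icc_eq_Icc)
qed

text \<open>On \<open>A\<close> the phase \<open>Y\<close> is within \<open>\<rho>\<close> of
  \<open>Ou\<close> plus a constant, and |exp(ix) - 1| \<le> |x|; off \<open>A\<close> both
  integrands have modulus at most 1. The sample takes the outer sum as \<open>Ou\<close>, the limit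
  process takes 0.\<close>

lemma (in prob_space) char_discretize:
 fixes Y Ou :: "'a \<Rightarrow> real" and c :: "'i \<Rightarrow> real"
 assumes [measurable]: "Y \<in> borel_measurable M" "Ou \<in> borel_measurable M" and J: "finite J" and E: "\<And>j. j \<in> J \<Longrightarrow> E j \<in> events"
  and disj: "disjoint_family_on E J" and A: "A \<in> events" "1 - \<epsilon> \<le> prob A"
  and near: "\<And>w. w \<in> A \<Longrightarrow> \<exists>j\<in>J. w \<in> E j \<and> \<bar>Y w - Ou w - c j\<bar> \<le> \<rho>" and \<rho>: "0 \<le> \<rho>"
 shows "cmod (expectation (\<lambda>w. iexp (Y w)) - (\<Sum>j\<in>J. iexp (c j) * expectation (\<lambda>w. indicator (E j) w * iexp (Ou w)))) \<le> \<rho> + 2 * \<epsilon>"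
proof -
 define S where "S w = (\<Sum>j\<in>J. iexp (c j) * (indicator (E j) w * iexp (Ou w)))" for w
 have ii: "integrable M (\<lambda>w. iexp (Y w))" by (intro integrable_iexp) auto
 have ij: "integrable M (\<lambda>w. indicator (E j) w * iexp (Ou w))" if "j \<in> J" for j
 proof (rule integrable_const_bound[of _ 1])
  note [measurable] = E[OF that]
  show "(\<lambda>w. indicator (E j) w * iexp (Ou w)) \<in> borel_measurable M" by measurable
 qed (auto simp: indicator_def)
 have iS: "integrable M S" unfolding S_def by (intro Bochner_Integration.integrable_sum integrable_mult_right ij)
 have Sv: "S w = iexp (c j) * iexp (Ou w)" if "j \<in> J" "w \<in> E j" for w j
 proof -
  have "indicator (E i) w = (0::complex)" if "i \<in> J - {j}" for i
   using disj that \<open>j \<in> J\<close> \<open>w \<in> E j\<close> by (auto simp: disjoint_family_on_def indicator_def)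
  then have "S w = (\<Sum>i\<in>{j}. iexp (c i) * (indicator (E i) w * iexp (Ou w)))"
   unfolding S_def using J that by (intro sum.mono_neutral_right) auto
  then show ?thesis using that by simp
 qed
 have S0: "S w = 0" if "\<And>j. j \<in> J \<Longrightarrow> w \<notin> E j" for w
  unfolding S_def using that by (intro sum.neutral) auto
 have S1: "cmod (S w) \<le> 1" for w
 proof (cases "\<exists>j\<in>J. w \<in> E j")
  case True
  then obtain j where "j \<in> J" "w \<in> E j" by auto
  from Sv[OF this] show ?thesis by (simp add: norm_mult)
 next
  case False then show ?thesis using S0[of w] by auto
 qed
 have pw: "cmod (iexp (Y w) - S w) \<le> \<rho> + 2 * indicator (space M - A) w" if "w \<in> space M" for w
 proof (cases "w \<in> A")
  case True
  then obtain j where j: "j \<in> J" "w \<in> E j" "\<bar>Y w - Ou w - c j\<bar> \<le> \<rho>" using near by blast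
  have "iexp (Y w) - S w = iexp (c j + Ou w) * (iexp (Y w - Ou w - c j) - 1)"
   unfolding Sv[OF j(1,2)] by (simp add: right_diff_distrib flip: exp_add) (simp add: algebra_simps)
  then have "cmod (iexp (Y w) - S w) = cmod (iexp (Y w - Ou w - c j) - 1)" by (simp only: norm_mult norm_exp_i_times mult_1_left)
  also have "\<dots> \<le> \<bar>Y w - Ou w - c j\<bar>" using iexp_approx1[of "Y w - Ou w - c j" 0] by simp
  also have "\<dots> \<le> \<rho>" by (rule j(3))
  finally show ?thesis by (simp add: indicator_def)
 next
  case False
  have "cmod (iexp (Y w) - S w) \<le> 1 + 1" by (rule order_trans[OF norm_triangle_ineq4]) (use S1 in \<open>auto intro!: add_mono\<close>)
  then show ?thesis using False that \<rho> by (simp add: indicator_def)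
 qed
 have "expectation (\<lambda>w. iexp (Y w)) - (\<Sum>j\<in>J. iexp (c j) * expectation (\<lambda>w. indicator (E j) w * iexp (Ou w))) = expectation (\<lambda>w. iexp (Y w) - S w)"
  using ii iS ij by (simp add: S_def)
 also have "cmod \<dots> \<le> expectation (\<lambda>w. cmod (iexp (Y w) - S w))" by (rule integral_norm_bound)
 also have "\<dots> \<le> expectation (\<lambda>w. \<rho> + 2 * indicator (space M - A) w)"
 proof (rule integral_mono)
  show "integrable M (\<lambda>w. cmod (iexp (Y w) - S w))" using ii iS by (intro integrable_norm Bochner_Integration.integrable_diff)
  show "integrable M (\<lambda>w. \<rho> + 2 * indicator (space M - A) w :: real)"
   using A(1) by (intro Bochner_Integration.integrable_add integrable_mult_right integrable_real_indicator) (auto simp: emeasure_eq_measure)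
 qed (rule pw)
 also have "\<dots> = \<rho> + 2 * prob (space M - A)"
  using A(1) by (subst Bochner_Integration.integral_add) (auto intro!: integrable_mult_right integrable_real_indicator simp: emeasure_eq_measure prob_space)
 also have "\<dots> \<le> \<rho> + 2 * \<epsilon>" using A prob_compl[OF A(1)] by simp
 finally show ?thesis .
qed

text \<open>\<open>Sup\<close> is a \<open>LEAST\<close> over upper bounds; when there are none, the
  defining predicate is constantly false, so the value does not depend on the set.\<close>

lemma Inf_real_unbounded: "\<not> bdd_below A \<Longrightarrow> Inf A = - (THE x::real. False)"
 unfolding Inf_real_def Sup_real_def Least_def
 by (intro arg_cong[where f=uminus] arg_cong[where f=The] ext) (auto simp: bdd_below_def, metis neg_le_iff_le minus_minus)

text \<open>
 Measurability also has to be checked where the set is empty or unbounded; there \<open>Inf\<close> is a fixed junk value.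
\<close>

lemma Inf_measurable_dense:
 fixes A :: "'a \<Rightarrow> real set"
 assumes pred: "\<And>r. r \<in> \<rat> \<Longrightarrow> {w\<in>space M. r \<in> A w} \<in> sets M"
  and dense: "\<And>w t e. w \<in> space M \<Longrightarrow> t \<in> A w \<Longrightarrow> 0 < e \<Longrightarrow> \<exists>r\<in>\<rat>. r \<in> A w \<and> \<bar>r - t\<bar> < e"
 shows "(\<lambda>w. Inf (A w)) \<in> borel_measurable M"
proof -
 have Q: "countable (\<rat>::real set)" by (rule countable_rat)
 have p: "Measurable.pred M (\<lambda>w. r \<in> A w)" if "r \<in> \<rat>" for r using pred[OF that] by (simp add: pred_def)
 have exQ: "Measurable.pred M (\<lambda>w. \<exists>r\<in>\<rat>. P r w)" if "\<And>r. r \<in> \<rat> \<Longrightarrow> Measurable.pred M (P r)" for P :: "real \<Rightarrow> 'a \<Rightarrow> bool"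
  unfolding pred_def by (rule sets.sets_Collect_countable_Ex'[OF _ Q]) (rule that[unfolded pred_def])
 have allQ: "Measurable.pred M (\<lambda>w. \<forall>r\<in>\<rat>. P r w)" if "\<And>r. r \<in> \<rat> \<Longrightarrow> Measurable.pred M (P r)" for P :: "real \<Rightarrow> 'a \<Rightarrow> bool"
  unfolding pred_def by (rule sets.sets_Collect_countable_All'[OF _ Q]) (rule that[unfolded pred_def])
 have ne_iff: "A w \<noteq> {} \<longleftrightarrow> (\<exists>r\<in>\<rat>. r \<in> A w)" if "w \<in> space M" for w
  using dense[OF that, of _ 1] by fastforce
 have bb_iff: "bdd_below (A w) \<longleftrightarrow> (\<exists>z::nat. \<forall>r\<in>\<rat>. r \<in> A w \<longrightarrow> - real z \<le> r)" if w: "w \<in> space M" for w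
 proof
  assume "bdd_below (A w)"
  then obtain c where c: "\<And>x. x \<in> A w \<Longrightarrow> c \<le> x" by (auto simp: bdd_below_def)
  obtain z :: nat where "- c \<le> z" using real_arch_simple by blast
  then show "\<exists>z::nat. \<forall>r\<in>\<rat>. r \<in> A w \<longrightarrow> - real z \<le> r" using c by (intro exI[of _ z]) (force)
 next
  assume "\<exists>z::nat. \<forall>r\<in>\<rat>. r \<in> A w \<longrightarrow> - real z \<le> r"
  then obtain z :: nat where z: "\<And>r. r \<in> \<rat> \<Longrightarrow> r \<in> A w \<Longrightarrow> - real z \<le> r" by blast
  show "bdd_below (A w)"
  proof (rule bdd_belowI)
   fix t assume "t \<in> A w"
   then obtain r where "r \<in> \<rat>" "r \<in> A w" "\<bar>r - t\<bar> < 1" using dense[OF w, of t 1] by auto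
   then show "- real z - 1 \<le> t" using z[of r] by linarith
  qed
 qed
 have Pne: "{w\<in>space M. A w \<noteq> {}} \<in> sets M"
 proof -
  have "Measurable.pred M (\<lambda>w. \<exists>r\<in>\<rat>. r \<in> A w)" by (rule exQ) (rule p)
  then show ?thesis using ne_iff by (simp add: pred_def cong: conj_cong)
 qed
 have Pbb: "{w\<in>space M. bdd_below (A w)} \<in> sets M"
 proof -
  have "Measurable.pred M (\<lambda>w. \<exists>z::nat. \<forall>r\<in>\<rat>. r \<in> A w \<longrightarrow> - real z \<le> r)"
   by (intro pred_intros_countable(2) allQ pred_intros_logic(4) p) auto
  then show ?thesis using bb_iff by (simp add: pred_def cong: conj_cong)
 qed
 show ?thesis
 proof (rule borel_measurable_iff_less[THEN iffD2], rule allI)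
  fix y :: real
  have iff: "Inf (A w) < y \<longleftrightarrow> (if A w = {} then Inf {} < y else if bdd_below (A w) then (\<exists>r\<in>\<rat>. r < y \<and> r \<in> A w) else - (THE x::real. False) < y)"
   if w: "w \<in> space M" for w
  proof -
   have "Inf (A w) < y \<longleftrightarrow> (\<exists>r\<in>\<rat>. r < y \<and> r \<in> A w)" if ne: "A w \<noteq> {}" and bb: "bdd_below (A w)"
   proof
    assume "Inf (A w) < y"
    then obtain t where t: "t \<in> A w" "t < y" using cInf_lessD[OF ne] by blast
    then obtain r where "r \<in> \<rat>" "r \<in> A w" "\<bar>r - t\<bar> < y - t" using dense[OF w t(1), of "y - t"] by auto
    then show "\<exists>r\<in>\<rat>. r < y \<and> r \<in> A w" by (intro bexI[of _ r]) auto
   next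
    assume "\<exists>r\<in>\<rat>. r < y \<and> r \<in> A w"
    then show "Inf (A w) < y" using cInf_lower[OF _ bb] by (auto intro: le_less_trans)
   qed
   then show ?thesis by (auto simp: Inf_real_unbounded)
  qed
  have eq: "{w\<in>space M. Inf (A w) < y} = {w\<in>space M. if A w = {} then Inf {} < y else if bdd_below (A w) then (\<exists>r\<in>\<rat>. r < y \<and> r \<in> A w) else - (THE x::real. False) < y}"
   by (intro Collect_cong conj_cong refl iff)
  have [measurable]: "Measurable.pred M (\<lambda>w. \<exists>r\<in>\<rat>. r < y \<and> r \<in> A w)"
   by (intro exQ pred_intros_logic(3) p) auto
  have [measurable]: "Measurable.pred M (\<lambda>w. A w = {})" "Measurable.pred M (\<lambda>w. bdd_below (A w))"
   using pred_intros_logic(2)[OF Pne[folded pred_def]] Pbb by (simp_all add: pred_def)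
  show "{w\<in>space M. Inf (A w) < y} \<in> sets M" unfolding eq by measurable
 qed
qed

lemma interval_midpoint_measurable:
 fixes A :: "'a \<Rightarrow> real set"
 assumes pred: "\<And>r. r \<in> \<rat> \<Longrightarrow> {w\<in>space M. r \<in> A w} \<in> sets M"
  and dense: "\<And>w t e. w \<in> space M \<Longrightarrow> t \<in> A w \<Longrightarrow> 0 < e \<Longrightarrow> \<exists>r\<in>\<rat>. r \<in> A w \<and> \<bar>r - t\<bar> < e"
 shows "(\<lambda>w. interval_midpoint (A w)) \<in> borel_measurable M"
proof -
 have [measurable]: "(\<lambda>w. Inf (A w)) \<in> borel_measurable M" by (rule Inf_measurable_dense[OF pred dense])
 have neg: "r \<in> uminus ` X \<longleftrightarrow> - r \<in> X" for r :: real and X by force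
 have [measurable]: "(\<lambda>w. Inf (uminus ` A w)) \<in> borel_measurable M"
 proof (rule Inf_measurable_dense)
  show "{w\<in>space M. r \<in> uminus ` A w} \<in> sets M" if "r \<in> \<rat>" for r
   unfolding neg using that by (intro pred) simp
  show "\<exists>r\<in>\<rat>. r \<in> uminus ` A w \<and> \<bar>r - t\<bar> < e" if w: "w \<in> space M" and t: "t \<in> uminus ` A w" and e: "0 < e" for w t e
  proof -
   obtain r where r: "r \<in> \<rat>" "r \<in> A w" "\<bar>r - - t\<bar> < e" using dense[OF w t[unfolded neg] e] by blast
   have "\<bar>- r - t\<bar> < e" using r(3) by linarith
   then show ?thesis using r(1,2) by (intro bexI[of _ "- r"]) auto
  qed
 qed
 have "Sup (A w) = - Inf (uminus ` A w)" for w by (simp add: Inf_real_def image_image)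
 then show ?thesis unfolding interval_midpoint_def midpoint_def by simp
qed

section \<open>The rescaled criterion\<close>

lemma cnt_eq_esum:
 assumes "S \<subseteq> T" "cnt n x S = cnt n x T"
 shows "esum n x e S = esum n x e T"
proof -
 have "{i. i < n \<and> x i \<in> S} = {i. i < n \<and> x i \<in> T}"
  using assms by (intro card_subset_eq) (auto simp: cnt_def)
 then show ?thesis by (simp add: esum_def)
qed

lemma esum_affine: "esum n x (\<lambda>i. c * e i + \<mu>) S = c * esum n x e S + \<mu> * cnt n x S"
 by (simp add: esum_def cnt_def sum.distrib sum_distrib_left mult.commute)

context regular_change_point_model
begin

text \<open>The sample counterpart of \<open>cpp_path\<close> in the scale d =
  \<open>d\<^sub>0 + t / n\<close>. \<open>jump 0\<close> and \<open>jump (-1)\<close> merely stand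
  for the signs of the right and the left side.\<close>

definition local_path :: "nat \<Rightarrow> 'a \<Rightarrow> real \<Rightarrow> real" where
 "local_path n w t = (if 0 \<le> t then esum n (\<lambda>i. Xs i w) (\<lambda>i. jump 0 (\<xi>s i w)) {d\<^sub>0<..d\<^sub>0 + t / n}
   else esum n (\<lambda>i. Xs i w) (\<lambda>i. jump (-1) (\<xi>s i w)) {d\<^sub>0 + t / n<..d\<^sub>0})"

definition local_piece :: "nat \<Rightarrow> 'a \<Rightarrow> real \<Rightarrow> int" where
 "local_piece n w t = (if 0 \<le> t then int (cnt n (\<lambda>i. Xs i w) {d\<^sub>0<..d\<^sub>0 + t / n})
   else - int (cnt n (\<lambda>i. Xs i w) {d\<^sub>0 + t / n<..d\<^sub>0}))"

lemma local_piece_mono: "s \<le> t \<Longrightarrow> local_piece n w s \<le> local_piece n w t"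
proof -
 assume st: "s \<le> t"
 then have d: "d\<^sub>0 + s / n \<le> d\<^sub>0 + t / n" by (simp add: divide_right_mono)
 have "cnt n (\<lambda>i. Xs i w) {d\<^sub>0<..d\<^sub>0 + s / n} \<le> cnt n (\<lambda>i. Xs i w) {d\<^sub>0<..d\<^sub>0 + t / n}"
  "cnt n (\<lambda>i. Xs i w) {d\<^sub>0 + t / n<..d\<^sub>0} \<le> cnt n (\<lambda>i. Xs i w) {d\<^sub>0 + s / n<..d\<^sub>0}"
  using d by (auto intro!: cnt_mono)
 then show ?thesis using st by (auto simp: local_piece_def)
qed

lemma local_path_piece:
 assumes "local_piece n w s = local_piece n w t"
 shows "local_path n w s = local_path n w t"
proof -
 have main: "local_path n w s = local_path n w t" if st: "s \<le> t" and eq: "local_piece n w s = local_piece n w t" for s t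
 proof -
  have d: "d\<^sub>0 + s / n \<le> d\<^sub>0 + t / n" using st by (simp add: divide_right_mono)
  have z: "esum n x e S = 0" if "cnt n x S = 0" for x e S
   using cnt_eq_esum[of "{}" S n x e] that by simp
  consider "0 \<le> s" "0 \<le> t" | "s < 0" "0 \<le> t" | "s < 0" "t < 0" using st by linarith
  then show ?thesis
  proof cases
   case 1
   then show ?thesis using eq d by (auto simp: local_path_def local_piece_def intro!: cnt_eq_esum)
  next
   case 2
   then have "cnt n (\<lambda>i. Xs i w) {d\<^sub>0 + s / n<..d\<^sub>0} = 0" "cnt n (\<lambda>i. Xs i w) {d\<^sub>0<..d\<^sub>0 + t / n} = 0"
    using eq by (auto simp: local_piece_def)
   then show ?thesis using 2 z by (simp add: local_path_def)
  next
   case 3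
   then show ?thesis using eq d by (auto simp: local_path_def local_piece_def intro!: cnt_eq_esum[symmetric])
  qed
 qed
 show ?thesis
 proof (cases "s \<le> t")
  case True then show ?thesis by (rule main[OF _ assms])
 next
  case False
  then have "t \<le> s" by simp
  then show ?thesis by (rule main[OF _ assms[symmetric], symmetric])
 qed
qed

lemma local_path_0: "local_path n w 0 = 0"
 by (simp add: local_path_def)

lemma jump_sides: "0 \<le> \<kappa> \<Longrightarrow> jump \<kappa> = jump 0" "\<kappa> < 0 \<Longrightarrow> jump \<kappa> = jump (-1)"
 by (auto simp: jump_def fun_eq_iff)

lemma cell_increment:
 fixes \<kappa> :: int
 assumes h: "0 < h"
 shows "local_piece n w (h * (real_of_int \<kappa> + 1)) - local_piece n w (h * real_of_int \<kappa>) = int (cnt n (\<lambda>i. Xs i w) (cell h n \<kappa>))"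
  and "path_jump h (local_path n w) \<kappa> = cell_jump h n w \<kappa>"
proof -
 let ?x = "\<lambda>i. Xs i w"
 have le: "h * real_of_int \<kappa> / n \<le> h * (real_of_int \<kappa> + 1) / n" using h by (intro divide_right_mono mult_left_mono) auto
 have "local_piece n w (h * (real_of_int \<kappa> + 1)) - local_piece n w (h * real_of_int \<kappa>) = int (cnt n ?x (cell h n \<kappa>)) \<and> path_jump h (local_path n w) \<kappa> = cell_jump h n w \<kappa>"
 proof (cases "0 \<le> \<kappa>")
  case True
  have pos: "0 \<le> h * real_of_int \<kappa>" "0 \<le> h * (real_of_int \<kappa> + 1)" using True h by auto
  have pos': "0 \<le> h * real_of_int \<kappa> / n" using pos by simp
  have S: "{d\<^sub>0<..d\<^sub>0 + h * (real_of_int \<kappa> + 1) / n} = {d\<^sub>0<..d\<^sub>0 + h * real_of_int \<kappa> / n} \<union> cell h n \<kappa>" "{d\<^sub>0<..d\<^sub>0 + h * real_of_int \<kappa> / n} \<inter> cell h n \<kappa> = {}"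
   using le pos' by (auto simp: cell_def)
  show ?thesis using pos True unfolding local_piece_def path_jump_def local_path_def cell_jump_def S(1)
   by (simp add: cnt_Un[OF S(2)] esum_Un[OF S(2)] jump_sides(1)[OF True])
 next
  case False
  then have \<kappa>: "\<kappa> + 1 \<le> 0" "\<kappa> < 0" by auto
  have neg: "h * real_of_int \<kappa> < 0" "h * (real_of_int \<kappa> + 1) \<le> 0"
  proof -
   show "h * real_of_int \<kappa> < 0" using h \<kappa> by (simp add: mult_pos_neg)
   have "real_of_int \<kappa> + 1 \<le> 0" using \<kappa>(1) by linarith
   then show "h * (real_of_int \<kappa> + 1) \<le> 0" using h by (simp add: mult_nonneg_nonpos)
  qed
  have neg': "h * (real_of_int \<kappa> + 1) / n \<le> 0" using neg(2) by (simp add: divide_nonpos_nonneg)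
  have S: "{d\<^sub>0 + h * real_of_int \<kappa> / n<..d\<^sub>0} = cell h n \<kappa> \<union> {d\<^sub>0 + h * (real_of_int \<kappa> + 1) / n<..d\<^sub>0}" "cell h n \<kappa> \<inter> {d\<^sub>0 + h * (real_of_int \<kappa> + 1) / n<..d\<^sub>0} = {}"
   using le neg' by (auto simp: cell_def)
  have p1: "local_piece n w (h * real_of_int \<kappa>) = - int (cnt n ?x (cell h n \<kappa>)) - int (cnt n ?x {d\<^sub>0 + h * (real_of_int \<kappa> + 1) / n<..d\<^sub>0})"
   using neg(1) unfolding local_piece_def S(1) by (simp add: cnt_Un[OF S(2)])
  have v1: "local_path n w (h * real_of_int \<kappa>) = esum n ?x (\<lambda>i. jump (-1) (\<xi>s i w)) (cell h n \<kappa>) + esum n ?x (\<lambda>i. jump (-1) (\<xi>s i w)) {d\<^sub>0 + h * (real_of_int \<kappa> + 1) / n<..d\<^sub>0}"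
   using neg(1) unfolding local_path_def S(1) by (simp add: esum_Un[OF S(2)])
  have p2: "local_piece n w (h * (real_of_int \<kappa> + 1)) = - int (cnt n ?x {d\<^sub>0 + h * (real_of_int \<kappa> + 1) / n<..d\<^sub>0})"
   and v2: "local_path n w (h * (real_of_int \<kappa> + 1)) = esum n ?x (\<lambda>i. jump (-1) (\<xi>s i w)) {d\<^sub>0 + h * (real_of_int \<kappa> + 1) / n<..d\<^sub>0}"
  proof -
   have "local_piece n w (h * (real_of_int \<kappa> + 1)) = - int (cnt n ?x {d\<^sub>0 + h * (real_of_int \<kappa> + 1) / n<..d\<^sub>0}) \<and>
     local_path n w (h * (real_of_int \<kappa> + 1)) = esum n ?x (\<lambda>i. jump (-1) (\<xi>s i w)) {d\<^sub>0 + h * (real_of_int \<kappa> + 1) / n<..d\<^sub>0}"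
   proof (cases "h * (real_of_int \<kappa> + 1) = 0")
    case True
    show ?thesis unfolding local_piece_def local_path_def True by simp
   next
    case F: False
    then have "\<not> 0 \<le> h * (real_of_int \<kappa> + 1)" using neg(2) by linarith
    then show ?thesis unfolding local_piece_def local_path_def by simp
   qed
   then show "local_piece n w (h * (real_of_int \<kappa> + 1)) = - int (cnt n ?x {d\<^sub>0 + h * (real_of_int \<kappa> + 1) / n<..d\<^sub>0})"
    "local_path n w (h * (real_of_int \<kappa> + 1)) = esum n ?x (\<lambda>i. jump (-1) (\<xi>s i w)) {d\<^sub>0 + h * (real_of_int \<kappa> + 1) / n<..d\<^sub>0}" by auto
  qed
  show ?thesis unfolding path_jump_def p1 p2 v1 v2 cell_jump_def using False by (simp add: jump_sides(2)[OF \<kappa>(2)])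
 qed
 then show "local_piece n w (h * (real_of_int \<kappa> + 1)) - local_piece n w (h * real_of_int \<kappa>) = int (cnt n ?x (cell h n \<kappa>))"
  "path_jump h (local_path n w) \<kappa> = cell_jump h n w \<kappa>" by auto
qed

lemma cp_data_sample: "1 \<le> n \<Longrightarrow> w \<in> space M \<Longrightarrow> cp_data n (\<lambda>i. Xs i w) (\<lambda>i. \<xi>s i w) (\<lambda>i. Ys i w) \<alpha>\<^sub>0 \<beta>\<^sub>0 d\<^sub>0"
 using \<alpha>\<^sub>0_neq_\<beta>\<^sub>0 by unfold_locales (auto simp: response)

text \<open>In the local scale the criterion is, up to a positive factor, a small perturbation of the local path.\<close>

lemma local_rss:
 assumes n: "1 \<le> n" and w: "w \<in> space M"
 shows "rss n (\<lambda>i. Xs i w) (\<lambda>i. Ys i w) (\<alpha>, \<beta>, d\<^sub>0 + t / n) = rss n (\<lambda>i. Xs i w) (\<lambda>i. Ys i w) (\<alpha>, \<beta>, d\<^sub>0) +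
  2 * (jump_sign * ((\<beta>\<^sub>0 - \<alpha>\<^sub>0) - (\<alpha> - \<alpha>\<^sub>0) + (\<beta> - \<beta>\<^sub>0))) *
   (local_path n w t - jump_sign * ((\<alpha> - \<alpha>\<^sub>0) + (\<beta> - \<beta>\<^sub>0)) / 2 * local_piece n w t)"
proof -
 interpret cp_data n "\<lambda>i. Xs i w" "\<lambda>i. \<xi>s i w" "\<lambda>i. Ys i w" \<alpha>\<^sub>0 \<beta>\<^sub>0 d\<^sub>0 by (rule cp_data_sample[OF n w])
 have s: "jump_sign * jump_sign = 1" "jump_sign * \<bar>\<alpha>\<^sub>0 - \<beta>\<^sub>0\<bar> = \<beta>\<^sub>0 - \<alpha>\<^sub>0" using \<alpha>\<^sub>0_neq_\<beta>\<^sub>0 by (auto simp: sgn_if)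
 have alg: "2 * (j * x) * (l - j * hh / 2 * p) = x * (j * (2 * l) - j * (j * (hh * p)))" for j x l hh p :: real by (simp add: field_simps)
 have s2: "jump_sign * (jump_sign * z) = z" for z using s(1) by (simp add: mult.assoc[symmetric])
 have s3: "jump_sign * (\<bar>\<alpha>\<^sub>0 - \<beta>\<^sub>0\<bar> * z) = (\<beta>\<^sub>0 - \<alpha>\<^sub>0) * z" for z using s(2) by (simp add: mult.assoc[symmetric])
 show ?thesis
 proof (cases "0 \<le> t")
  case True
  have d: "d\<^sub>0 \<le> d\<^sub>0 + t / n" using True by simp
  have path: "local_path n w t = jump_sign * E {d\<^sub>0<..d\<^sub>0 + t / n} + jump_mean * C {d\<^sub>0<..d\<^sub>0 + t / n}"
   using True by (simp add: local_path_def jump_def esum_affine)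
  have piece: "real_of_int (local_piece n w t) = C {d\<^sub>0<..d\<^sub>0 + t / n}" using True by (simp add: local_piece_def)
  have "2 * (jump_sign * (D - (\<alpha> - \<alpha>\<^sub>0) + (\<beta> - \<beta>\<^sub>0))) * (local_path n w t - jump_sign * ((\<alpha> - \<alpha>\<^sub>0) + (\<beta> - \<beta>\<^sub>0)) / 2 * local_piece n w t)
    = (D - (\<alpha> - \<alpha>\<^sub>0) + (\<beta> - \<beta>\<^sub>0)) * (jump_sign * (2 * local_path n w t) - jump_sign * (jump_sign * (((\<alpha> - \<alpha>\<^sub>0) + (\<beta> - \<beta>\<^sub>0)) * local_piece n w t)))"
   by (rule alg)
  also have "jump_sign * (2 * local_path n w t) = 2 * E {d\<^sub>0<..d\<^sub>0 + t / n} + D * C {d\<^sub>0<..d\<^sub>0 + t / n}"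
  proof -
   have "jump_sign * (2 * local_path n w t) = jump_sign * (jump_sign * (2 * E {d\<^sub>0<..d\<^sub>0 + t / n})) + jump_sign * (\<bar>\<alpha>\<^sub>0 - \<beta>\<^sub>0\<bar> * C {d\<^sub>0<..d\<^sub>0 + t / n})"
    unfolding path by (simp add: algebra_simps)
   then show ?thesis unfolding s2 s3 .
  qed
  finally show ?thesis using Q_diff_right[OF d, of \<alpha> \<beta>] unfolding s2 piece by (simp add: algebra_simps)
 next
  case False
  then have d: "d\<^sub>0 + t / n \<le> d\<^sub>0" by (simp add: divide_nonpos_nonneg)
  have path: "local_path n w t = - jump_sign * E {d\<^sub>0 + t / n<..d\<^sub>0} + jump_mean * C {d\<^sub>0 + t / n<..d\<^sub>0}"
  proof -
   have "jump (-1) e = - jump_sign * e + jump_mean" for e by (simp add: jump_def)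
   then show ?thesis using False by (simp only: local_path_def if_False esum_affine)
  qed
  have piece: "real_of_int (local_piece n w t) = - C {d\<^sub>0 + t / n<..d\<^sub>0}" using False by (simp add: local_piece_def)
  have "2 * (jump_sign * (D - (\<alpha> - \<alpha>\<^sub>0) + (\<beta> - \<beta>\<^sub>0))) * (local_path n w t - jump_sign * ((\<alpha> - \<alpha>\<^sub>0) + (\<beta> - \<beta>\<^sub>0)) / 2 * local_piece n w t)
    = (D - (\<alpha> - \<alpha>\<^sub>0) + (\<beta> - \<beta>\<^sub>0)) * (jump_sign * (2 * local_path n w t) - jump_sign * (jump_sign * (((\<alpha> - \<alpha>\<^sub>0) + (\<beta> - \<beta>\<^sub>0)) * local_piece n w t)))"
   by (rule alg)
  also have "jump_sign * (2 * local_path n w t) = - 2 * E {d\<^sub>0 + t / n<..d\<^sub>0} + D * C {d\<^sub>0 + t / n<..d\<^sub>0}"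
  proof -
   have "jump_sign * (2 * local_path n w t) = jump_sign * (jump_sign * (- 2 * E {d\<^sub>0 + t / n<..d\<^sub>0})) + jump_sign * (\<bar>\<alpha>\<^sub>0 - \<beta>\<^sub>0\<bar> * C {d\<^sub>0 + t / n<..d\<^sub>0})"
    unfolding path by (simp add: algebra_simps)
   then show ?thesis unfolding s2 s3 .
  qed
  finally show ?thesis using Q_diff_left[OF d, of \<alpha> \<beta>] unfolding s2 piece by (simp add: algebra_simps)
 qed
qed

text \<open>At the estimated coefficients the criterion is, up to a constant and a positive factor,
  the local path minus a small multiple of the piece number. With at most one point per cell that
  number is at most \<open>m\<close> in absolute value on the grid, so the perturbation stays below
  \<open>\<eta> / 2\<close> at each grid point and the strict minimum survives.\<close>

lemma midpoint_localized:
 fixes h \<eta> \<alpha> \<beta> :: real and m :: nat and a b :: int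
 assumes n: "1 \<le> n" and w: "w \<in> space M" and h: "0 < h"
  and occ: "occupied h {- int m..<int m} U n w" and pat: "(U, a, b) \<in> grid_patterns m"
  and smin: "(\<lambda>\<kappa>\<in>{- int m..<int m}. cell_jump h n w \<kappa>) \<in> strict_grid_min m \<eta> a b"
  and small: "\<bar>\<alpha> - \<alpha>\<^sub>0\<bar> + \<bar>\<beta> - \<beta>\<^sub>0\<bar> < \<bar>\<beta>\<^sub>0 - \<alpha>\<^sub>0\<bar>" "(\<bar>\<alpha> - \<alpha>\<^sub>0\<bar> + \<bar>\<beta> - \<beta>\<^sub>0\<bar>) * m < \<eta>"
  and box: "\<And>d. d \<in> {d\<^sub>0 - h * m / n..d\<^sub>0 + h * m / n} \<Longrightarrow> (\<alpha>, \<beta>, d) \<in> I"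
  and Dset: "A = {d. (\<alpha>, \<beta>, d) \<in> argmin_set (ls_criterion n (\<lambda>i. Xs i w) (\<lambda>i. Ys i w)) I}" "A \<noteq> {}" "A \<subseteq> {d\<^sub>0 - h * m / n<..<d\<^sub>0 + h * m / n}"
 shows "\<bar>n * (interval_midpoint A - d\<^sub>0) - h * (a + b) / 2\<bar> \<le> h"
proof -
 have n0: "0 < real n" using n by simp
 define g where "g t = rss n (\<lambda>i. Xs i w) (\<lambda>i. Ys i w) (\<alpha>, \<beta>, d\<^sub>0 + t / n)" for t
 define T where "T = {t. (\<alpha>, \<beta>, d\<^sub>0 + t / n) \<in> I}"
 define hh where "hh = (\<alpha> - \<alpha>\<^sub>0) + (\<beta> - \<beta>\<^sub>0)"
 \<comment> \<open>This is \<beta> - \<alpha> with the sign of the true jump removed; it is positive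
   as soon as the total error is below the size of the jump.\<close>
 define c where "c = jump_sign * ((\<beta>\<^sub>0 - \<alpha>\<^sub>0) - (\<alpha> - \<alpha>\<^sub>0) + (\<beta> - \<beta>\<^sub>0))"
 define P where "P t = local_path n w t - jump_sign * hh / 2 * local_piece n w t" for t
 have gP: "g t = g 0 + 2 * c * P t" for t
  unfolding g_def P_def c_def hh_def using local_rss[OF n w, of \<alpha> \<beta> t] by simp
 have c0: "0 < c" unfolding c_def using small(1) \<alpha>\<^sub>0_neq_\<beta>\<^sub>0 by (auto simp: sgn_if abs_if split: if_splits)
 have hh: "\<bar>hh\<bar> \<le> \<bar>\<alpha> - \<alpha>\<^sub>0\<bar> + \<bar>\<beta> - \<beta>\<^sub>0\<bar>" unfolding hh_def by (rule abs_triangle_ineq)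
 have r: "- int m < a" "a \<le> b" "b < int m" "U \<subseteq> {- int m..<int m}" using pat by (auto simp: grid_patterns_def)
 have inc: "local_piece n w (h * (real_of_int \<kappa> + 1)) - local_piece n w (h * real_of_int \<kappa>) = (if \<kappa> \<in> U then 1 else 0)" if "\<kappa> \<in> {- int m..<int m}" for \<kappa> :: int
  using occ that unfolding cell_increment(1)[OF h] occupied_def by auto
 let ?z = "\<lambda>\<kappa>\<in>{- int m..<int m}. cell_jump h n w \<kappa>"
 have zpath: "grid_path ?z k = local_path n w (h * k)" if "k \<in> {- int m..int m}" for k
 proof -
  have "grid_path ?z k = grid_path (path_jump h (local_path n w)) k"
   using that by (rule grid_path_cong) (simp add: cell_increment(2)[OF h])
  then show ?thesis using grid_path_path_jump[of "local_path n w"] local_path_0 by simp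
 qed
 have piece_bound: "\<bar>local_piece n w (h * k)\<bar> \<le> int m" if "k \<in> {- int m..int m}" for k
 proof -
  have 1: "0 \<le> local_piece n w (h * int j) \<and> local_piece n w (h * int j) \<le> int j" if "j \<le> m" for j
   using that
  proof (induction j)
   case 0 then show ?case by (simp add: local_piece_def)
  next
   case (Suc j)
   then show ?case using inc[of "int j"] by (auto simp: add.commute split: if_splits)
  qed
  have 2: "- int j \<le> local_piece n w (h * (- int j)) \<and> local_piece n w (h * (- int j)) \<le> 0" if "j \<le> m" for j
   using that
  proof (induction j)
   case 0 then show ?case by (simp add: local_piece_def)
  next
   case (Suc j)
   then show ?case using inc[of "- int (Suc j)"] by (auto simp: add.commute split: if_splits)
  qed
  show ?thesis
  proof (cases "0 \<le> k")
   case True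
   moreover have "nat k \<le> m" using that by auto
   ultimately show ?thesis using 1[of "nat k"] that by auto
  next
   case False
   moreover have "nat (- k) \<le> m" using that by auto
   ultimately show ?thesis using 2[of "nat (- k)"] that by auto
  qed
 qed
 have pert: "\<bar>jump_sign * hh / 2 * local_piece n w (h * k)\<bar> < \<eta> / 2" if "k \<in> {- int m..int m}" for k
 proof -
  have "\<bar>jump_sign\<bar> = 1" using \<alpha>\<^sub>0_neq_\<beta>\<^sub>0 by (simp add: abs_sgn_eq)
  then have "\<bar>jump_sign * hh / 2 * local_piece n w (h * k)\<bar> = \<bar>hh\<bar> * \<bar>real_of_int (local_piece n w (h * k))\<bar> / 2"
   by (simp add: abs_mult)
  also have "\<dots> \<le> (\<bar>\<alpha> - \<alpha>\<^sub>0\<bar> + \<bar>\<beta> - \<beta>\<^sub>0\<bar>) * m / 2"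
  proof -
   have "\<bar>real_of_int (local_piece n w (h * k))\<bar> \<le> real m" using piece_bound[OF that] by linarith
   then show ?thesis using hh by (intro divide_right_mono mult_mono) auto
  qed
  also have "\<dots> < \<eta> / 2" using small(2) by simp
  finally show ?thesis .
 qed
 \<comment> \<open>Some completion attains the global minimum over the box at these coefficients, so
   minimizing over \<open>d\<close> alone yields exactly the completions.\<close>
 have sub: "argmin_set g T = {t. d\<^sub>0 + t / n \<in> A}"
 proof (intro set_eqI iffI)
  fix t assume t: "t \<in> argmin_set g T"
  have "(\<alpha>, \<beta>, d\<^sub>0 + t / n) \<in> I" using t by (auto simp: argmin_set_def is_arg_min_def T_def)
  moreover obtain d where d: "(\<alpha>, \<beta>, d) \<in> argmin_set (ls_criterion n (\<lambda>i. Xs i w) (\<lambda>i. Ys i w)) I" using Dset by auto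
  then have "(\<alpha>, \<beta>, d) \<in> I" using argmin_rss(1)[OF d n] by simp
  then have "n * (d - d\<^sub>0) \<in> T" "g (n * (d - d\<^sub>0)) = rss n (\<lambda>i. Xs i w) (\<lambda>i. Ys i w) (\<alpha>, \<beta>, d)" using n0 by (auto simp: T_def g_def)
  then have "g t \<le> rss n (\<lambda>i. Xs i w) (\<lambda>i. Ys i w) (\<alpha>, \<beta>, d)" using t by (force simp: argmin_set_def is_arg_min_def not_less)
  ultimately show "t \<in> {t. d\<^sub>0 + t / n \<in> A}" unfolding Dset(1)
   using argmin_rss(2)[OF d n] by (auto intro!: argmin_rssI simp: g_def intro: order_trans)
 next
  fix t assume "t \<in> {t. d\<^sub>0 + t / n \<in> A}"
  then have d: "(\<alpha>, \<beta>, d\<^sub>0 + t / n) \<in> argmin_set (ls_criterion n (\<lambda>i. Xs i w) (\<lambda>i. Ys i w)) I" by (simp add: Dset(1))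
  show "t \<in> argmin_set g T" using argmin_rss[OF d n]
   by (force simp: argmin_set_def is_arg_min_def not_less T_def g_def)
 qed
 have key: "argmin_set g T \<subseteq> {h * a - h..h * b + h} \<and> h * a \<in> argmin_set g T \<and> h * b \<in> argmin_set g T"
 proof (rule grid_argmin[where q="local_piece n w" and m=m])
  show "0 < h" by fact
  show "local_piece n w s \<le> local_piece n w t" if "s \<le> t" for s t using that by (rule local_piece_mono)
  show "{- (h * m)..h * m} \<subseteq> T"
  proof
   fix t assume t: "t \<in> {- (h * m)..h * m}"
   have "- (h * m) / n \<le> t / n" "t / n \<le> h * m / n"
    using divide_right_mono[of "- (h * m)" t "real n"] divide_right_mono[of t "h * m" "real n"] t n0 by auto
   then show "t \<in> T" unfolding T_def by (auto intro!: box)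
  qed
  show "g s = g t" if "local_piece n w s = local_piece n w t" for s t
   using gP[of s] gP[of t] local_path_piece[OF that] that unfolding P_def by simp
  show "local_piece n w (h * (real_of_int \<kappa> + 1)) - local_piece n w (h * real_of_int \<kappa>) \<le> 1" if "\<kappa> \<in> {- int m..<int m}" for \<kappa>
   unfolding inc[OF that] by simp
  show "- int m < a" "a \<le> b" "b < int m" by (rule r)+
  show "local_piece n w (h * a) = local_piece n w (h * b)"
  proof -
   have disj: "U \<inter> {a..<b} = {}" using pat by (simp add: grid_patterns_def)
   have "local_piece n w (h * real_of_int k) = local_piece n w (h * real_of_int a)" if "a \<le> k" "k \<le> b" for k
    using that
   proof (induction k rule: int_ge_induct)
    case (step k)
    then have "k \<in> {a..<b}" "k \<in> {- int m..<int m}" using r by auto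
    moreover from this have "k \<notin> U" using disj by blast
    ultimately have "local_piece n w (h * (real_of_int k + 1)) = local_piece n w (h * real_of_int k)" using inc[of k] by simp
    then show ?case using step by simp
   qed simp
   from this[of b] show ?thesis using r by simp
  qed
  show "g (h * a) < g (h * k)" if k: "k \<in> {- int m..int m}" "k \<notin> {a..b}" for k
  proof -
   have am: "a \<in> {- int m..int m}" using r by auto
   have "local_path n w (h * a) + \<eta> \<le> local_path n w (h * k)"
   proof -
    have "grid_path ?z a + \<eta> \<le> grid_path ?z k" using smin k unfolding strict_grid_min_def by blast
    then show ?thesis unfolding zpath[OF am] zpath[OF k(1)] .
   qed
   then have "P (h * a) < P (h * k)" using pert[OF am] pert[OF k(1)] unfolding P_def by linarith
   then show ?thesis using gP[of "h * a"] gP[of "h * k"] c0 by simp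
  qed
  show "argmin_set g T \<noteq> {}"
  proof -
   obtain d where "d \<in> A" using Dset(2) by auto
   then have "n * (d - d\<^sub>0) \<in> argmin_set g T" unfolding sub using n0 by simp
   then show ?thesis by auto
  qed
  show "argmin_set g T \<subseteq> {- (h * m)<..<h * m}"
  proof
   fix t assume "t \<in> argmin_set g T"
   then have "d\<^sub>0 + t / n \<in> {d\<^sub>0 - h * m / n<..<d\<^sub>0 + h * m / n}" unfolding sub using Dset(3) by auto
   then have "- (h * m / n) < t / n" "t / n < h * m / n" by auto
   then have "n * (- (h * m / n)) < n * (t / n)" "n * (t / n) < n * (h * m / n)" using n0 by (intro mult_strict_left_mono; simp)+
   then show "t \<in> {- (h * m)<..<h * m}" using n0 by simp
  qed
 qed
 have A_iff: "d \<in> A \<longleftrightarrow> n * (d - d\<^sub>0) \<in> argmin_set g T" for d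
  unfolding sub using n0 by simp
 have "\<bar>interval_midpoint A - ((d\<^sub>0 + h * a / n) + (d\<^sub>0 + h * b / n)) / 2\<bar> \<le> h / n"
 proof (rule interval_midpoint_near)
  show "d\<^sub>0 + h * a / n \<in> A" "d\<^sub>0 + h * b / n \<in> A" unfolding A_iff using key n0 by auto
  show "A \<subseteq> {d\<^sub>0 + h * a / n - h / n..d\<^sub>0 + h * b / n + h / n}"
  proof
   fix d assume "d \<in> A"
   then have "h * a - h \<le> n * (d - d\<^sub>0)" "n * (d - d\<^sub>0) \<le> h * b + h" using key unfolding A_iff by auto
   then have "(h * a - h) / n \<le> d - d\<^sub>0" "d - d\<^sub>0 \<le> (h * b + h) / n"
    using n0 by (simp_all add: pos_divide_le_eq pos_le_divide_eq mult.commute)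
   then show "d \<in> {d\<^sub>0 + h * a / n - h / n..d\<^sub>0 + h * b / n + h / n}"
    by (auto simp: diff_divide_distrib add_divide_distrib)
  qed
 qed (use h in simp)
 then have "n * \<bar>interval_midpoint A - ((d\<^sub>0 + h * a / n) + (d\<^sub>0 + h * b / n)) / 2\<bar> \<le> n * (h / n)"
  using n0 by (intro mult_left_mono) auto
 also have "n * \<bar>interval_midpoint A - ((d\<^sub>0 + h * a / n) + (d\<^sub>0 + h * b / n)) / 2\<bar> = \<bar>n * (interval_midpoint A - ((d\<^sub>0 + h * a / n) + (d\<^sub>0 + h * b / n)) / 2)\<bar>"
  by (simp add: abs_mult)
 also have "n * (interval_midpoint A - ((d\<^sub>0 + h * a / n) + (d\<^sub>0 + h * b / n)) / 2) = n * (interval_midpoint A - d\<^sub>0) - h * (a + b) / 2"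
  using n0 by (simp add: field_simps)
 finally show ?thesis using n0 by simp
qed

end

section \<open>Consistency, rate and linearization of the estimators\<close>

locale ls_estimators = regular_change_point_model +
 fixes l u :: "real \<times> real \<times> real" and \<alpha>_hat \<beta>_hat d_hat :: "nat \<Rightarrow> 'a \<Rightarrow> real"
 assumes true_parameter: "(\<alpha>\<^sub>0, \<beta>\<^sub>0, d\<^sub>0) \<in> interior (cbox l u)"
  and hat_measurable [measurable]: "\<And>n. \<alpha>_hat n \<in> borel_measurable M" "\<And>n. \<beta>_hat n \<in> borel_measurable M" "\<And>n. d_hat n \<in> borel_measurable M"
  and hat_argmin: "\<And>n. 1 \<le> n \<Longrightarrow> AE w in M. (\<alpha>_hat n w, \<beta>_hat n w, d_hat n w)
     \<in> argmin_mid_last (ls_criterion n (\<lambda>i. Xs i w) (\<lambda>i. Ys i w)) (cbox l u)"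
begin

definition completions :: "nat \<Rightarrow> 'a \<Rightarrow> real set" where
 "completions n w = {d. (\<alpha>_hat n w, \<beta>_hat n w, d) \<in> argmin_set (ls_criterion n (\<lambda>i. Xs i w) (\<lambda>i. Ys i w)) (cbox l u)}"

text \<open>The almost sure hypothesis on the estimators enters only through this predicate and
  \<open>likely_fitted\<close>.\<close>

definition fitted :: "nat \<Rightarrow> 'a \<Rightarrow> bool" where
 "fitted n w \<longleftrightarrow> completions n w \<noteq> {} \<and> d_hat n w = interval_midpoint (completions n w)"

lemma likely_fitted: "0 \<le> \<epsilon> \<Longrightarrow> likely \<epsilon> fitted"
proof (rule likely_AE)
 show "AE w in M. fitted n w" if "1 \<le> n" for n
  using hat_argmin[OF that] by eventually_elim (auto simp: fitted_def completions_def argmin_mid_last_def)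
qed

lemma completions_argmin:
 assumes "1 \<le> n" "d \<in> completions n w"
 shows "(\<alpha>_hat n w, \<beta>_hat n w, d) \<in> cbox l u"
  and "\<And>\<theta>. \<theta> \<in> cbox l u \<Longrightarrow> rss n (\<lambda>i. Xs i w) (\<lambda>i. Ys i w) (\<alpha>_hat n w, \<beta>_hat n w, d) \<le> rss n (\<lambda>i. Xs i w) (\<lambda>i. Ys i w) \<theta>"
 using argmin_rss[of "(\<alpha>_hat n w, \<beta>_hat n w, d)" n] assms by (auto simp: completions_def)

text \<open>A distance to the boundary of the box: the coefficients must be interior for the first
  order conditions, and the local window in \<open>d\<close> must fit into the box.\<close>

definition margin :: real where
 "margin = (SOME r. 0 < r \<and> (\<forall>\<alpha> \<beta> d. \<bar>\<alpha> - \<alpha>\<^sub>0\<bar> \<le> r \<longrightarrow> \<bar>\<beta> - \<beta>\<^sub>0\<bar> \<le> r \<longrightarrow> \<bar>d - d\<^sub>0\<bar> \<le> r \<longrightarrow>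
   fst l < \<alpha> \<and> \<alpha> < fst u \<and> fst (snd l) < \<beta> \<and> \<beta> < fst (snd u) \<and> (\<alpha>, \<beta>, d) \<in> cbox l u))"

lemma margin:
 "0 < margin"
 "\<bar>\<alpha> - \<alpha>\<^sub>0\<bar> \<le> margin \<Longrightarrow> \<bar>\<beta> - \<beta>\<^sub>0\<bar> \<le> margin \<Longrightarrow> \<bar>d - d\<^sub>0\<bar> \<le> margin \<Longrightarrow>
   fst l < \<alpha> \<and> \<alpha> < fst u \<and> fst (snd l) < \<beta> \<and> \<beta> < fst (snd u) \<and> (\<alpha>, \<beta>, d) \<in> cbox l u"
proof -
 obtain l1 l2 l3 u1 u2 u3 where lu: "l = (l1, l2, l3)" "u = (u1, u2, u3)" by (metis prod.collapse)
 have b: "l1 < \<alpha>\<^sub>0" "\<alpha>\<^sub>0 < u1" "l2 < \<beta>\<^sub>0" "\<beta>\<^sub>0 < u2" "l3 < d\<^sub>0" "d\<^sub>0 < u3"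
  using true_parameter unfolding lu interior_cbox by (auto simp: mem_box Basis_prod_def)
 \<comment> \<open>Half the distance to the faces, so that even the closed cube of half-width
   \<open>r\<close> stays strictly inside.\<close>
 define r where "r = min (min (min (\<alpha>\<^sub>0 - l1) (u1 - \<alpha>\<^sub>0)) (min (\<beta>\<^sub>0 - l2) (u2 - \<beta>\<^sub>0))) (min (d\<^sub>0 - l3) (u3 - d\<^sub>0)) / 2"
 have r: "0 < r" using b by (simp add: r_def)
 have r': "2 * r \<le> \<alpha>\<^sub>0 - l1" "2 * r \<le> u1 - \<alpha>\<^sub>0" "2 * r \<le> \<beta>\<^sub>0 - l2" "2 * r \<le> u2 - \<beta>\<^sub>0" "2 * r \<le> d\<^sub>0 - l3" "2 * r \<le> u3 - d\<^sub>0"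
  by (simp_all add: r_def)
 have "0 < r \<and> (\<forall>\<alpha> \<beta> d. \<bar>\<alpha> - \<alpha>\<^sub>0\<bar> \<le> r \<longrightarrow> \<bar>\<beta> - \<beta>\<^sub>0\<bar> \<le> r \<longrightarrow> \<bar>d - d\<^sub>0\<bar> \<le> r \<longrightarrow>
   fst l < \<alpha> \<and> \<alpha> < fst u \<and> fst (snd l) < \<beta> \<and> \<beta> < fst (snd u) \<and> (\<alpha>, \<beta>, d) \<in> cbox l u)"
 proof (intro conjI allI impI r)
  fix \<alpha> \<beta> d assume "\<bar>\<alpha> - \<alpha>\<^sub>0\<bar> \<le> r" "\<bar>\<beta> - \<beta>\<^sub>0\<bar> \<le> r" "\<bar>d - d\<^sub>0\<bar> \<le> r"
  then have *: "l1 < \<alpha>" "\<alpha> < u1" "l2 < \<beta>" "\<beta> < u2" "l3 < d" "d < u3" using r r' by (auto simp: abs_le_iff)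
  then show "fst l < \<alpha>" "\<alpha> < fst u" "fst (snd l) < \<beta>" "\<beta> < fst (snd u)" "(\<alpha>, \<beta>, d) \<in> cbox l u"
   by (auto simp: lu cbox_Pair_eq)
 qed
 from someI[of "\<lambda>r. 0 < r \<and> (\<forall>\<alpha> \<beta> d. \<bar>\<alpha> - \<alpha>\<^sub>0\<bar> \<le> r \<longrightarrow> \<bar>\<beta> - \<beta>\<^sub>0\<bar> \<le> r \<longrightarrow> \<bar>d - d\<^sub>0\<bar> \<le> r \<longrightarrow>
   fst l < \<alpha> \<and> \<alpha> < fst u \<and> fst (snd l) < \<beta> \<and> \<beta> < fst (snd u) \<and> (\<alpha>, \<beta>, d) \<in> cbox l u)", OF this]
 show "0 < margin" "\<bar>\<alpha> - \<alpha>\<^sub>0\<bar> \<le> margin \<Longrightarrow> \<bar>\<beta> - \<beta>\<^sub>0\<bar> \<le> margin \<Longrightarrow> \<bar>d - d\<^sub>0\<bar> \<le> margin \<Longrightarrow>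
   fst l < \<alpha> \<and> \<alpha> < fst u \<and> fst (snd l) < \<beta> \<and> \<beta> < fst (snd u) \<and> (\<alpha>, \<beta>, d) \<in> cbox l u"
  unfolding margin_def[symmetric] by blast+
qed

lemma true_in_box: "(\<alpha>\<^sub>0, \<beta>\<^sub>0, d\<^sub>0) \<in> cbox l u"
 using margin(1) margin(2)[of \<alpha>\<^sub>0 \<beta>\<^sub>0 d\<^sub>0] by simp

lemma box_radius: "\<exists>R>0. \<bar>\<beta>\<^sub>0 - \<alpha>\<^sub>0\<bar> \<le> R \<and> (\<forall>\<alpha> \<beta> d. (\<alpha>, \<beta>, d) \<in> cbox l u \<longrightarrow> \<bar>\<alpha> - \<alpha>\<^sub>0\<bar> \<le> R \<and> \<bar>\<beta> - \<beta>\<^sub>0\<bar> \<le> R)"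
proof -
 obtain l1 l2 l3 u1 u2 u3 where lu: "l = (l1, l2, l3)" "u = (u1, u2, u3)" by (metis prod.collapse)
 have b: "l1 \<le> \<alpha>\<^sub>0" "\<alpha>\<^sub>0 \<le> u1" "l2 \<le> \<beta>\<^sub>0" "\<beta>\<^sub>0 \<le> u2" using true_in_box by (auto simp: lu cbox_Pair_eq)
 show ?thesis
 proof (intro exI conjI allI impI)
  show "0 < 1 + (u1 - l1) + (u2 - l2) + \<bar>\<beta>\<^sub>0 - \<alpha>\<^sub>0\<bar>" "\<bar>\<beta>\<^sub>0 - \<alpha>\<^sub>0\<bar> \<le> 1 + (u1 - l1) + (u2 - l2) + \<bar>\<beta>\<^sub>0 - \<alpha>\<^sub>0\<bar>" using b by auto
  fix \<alpha> \<beta> d assume "(\<alpha>, \<beta>, d) \<in> cbox l u"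
  then show "\<bar>\<alpha> - \<alpha>\<^sub>0\<bar> \<le> 1 + (u1 - l1) + (u2 - l2) + \<bar>\<beta>\<^sub>0 - \<alpha>\<^sub>0\<bar>" "\<bar>\<beta> - \<beta>\<^sub>0\<bar> \<le> 1 + (u1 - l1) + (u2 - l2) + \<bar>\<beta>\<^sub>0 - \<alpha>\<^sub>0\<bar>"
   using b by (auto simp: lu cbox_Pair_eq abs_le_iff)
 qed
qed

abbreviation xs where "xs w \<equiv> (\<lambda>i. Xs i w)"
abbreviation es where "es w \<equiv> (\<lambda>i. \<xi>s i w)"

lemma likely_sup_left: "0 < \<epsilon> \<Longrightarrow> \<exists>C>0. likely \<epsilon> (\<lambda>n w. \<forall>t. \<bar>esum n (xs w) (es w) {..t}\<bar> < C * sqrt n)"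
 using noise_sup_bound[of UNIV "\<lambda>t y. y \<le> t" 1 \<epsilon>] by (auto simp: atMost_def)

lemma likely_sup_right: "0 < \<epsilon> \<Longrightarrow> \<exists>C>0. likely \<epsilon> (\<lambda>n w. \<forall>t. \<bar>esum n (xs w) (es w) {t<..}\<bar> < C * sqrt n)"
 using noise_sup_bound[of UNIV "\<lambda>t y. t < y" "-1" \<epsilon>] by (auto simp: greaterThan_def)

lemma eventually_sqrt_small:
 fixes \<eta> C :: real
 assumes "0 < \<eta>"
 shows "\<forall>\<^sub>F n in sequentially. C * sqrt (real n) \<le> \<eta> * n"
 using eventually_ge_at_top[of "nat \<lceil>(C / \<eta>)\<^sup>2\<rceil>"]
proof eventually_elim
 case (elim n)
 then have "(C / \<eta>)\<^sup>2 \<le> n" by linarith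
 then have "C / \<eta> \<le> sqrt n" by (rule real_le_rsqrt)
 then have "C \<le> \<eta> * sqrt n" using assms by (simp add: field_simps)
 then have "C * sqrt n \<le> \<eta> * sqrt n * sqrt n" by (intro mult_right_mono) auto
 then show ?case by (simp add: mult.assoc)
qed

lemma likely_side_counts:
 assumes \<epsilon>: "0 < \<epsilon>" and \<eta>: "0 < \<eta>"
 shows "likely \<epsilon> (\<lambda>n w. \<bar>cnt n (xs w) {..d\<^sub>0} / n - p\<^sub>L\<bar> < \<eta>)" "likely \<epsilon> (\<lambda>n w. \<bar>cnt n (xs w) {d\<^sub>0<..} / n - p\<^sub>R\<bar> < \<eta>)"
 unfolding p\<^sub>L_def p\<^sub>R_def by (rule cnt_law_of_large_numbers; use assms in simp)+

text \<open>Noise sums are O(sqrt n), hence eventually below \<open>\<eta> * n\<close> for every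
  positive \<eta>; with the law of large numbers on both sides this meets the hypotheses of
  \<open>consistency\<close>.\<close>

lemma likely_consistent:
 assumes \<epsilon>: "0 < \<epsilon>" and \<delta>: "0 < \<delta>"
 shows "likely \<epsilon> (\<lambda>n w. fitted n w \<longrightarrow> \<bar>\<alpha>_hat n w - \<alpha>\<^sub>0\<bar> \<le> \<delta> \<and> \<bar>\<beta>_hat n w - \<beta>\<^sub>0\<bar> \<le> \<delta>)"
proof -
 obtain R where R: "0 < R" "\<bar>\<beta>\<^sub>0 - \<alpha>\<^sub>0\<bar> \<le> R" "\<And>\<alpha> \<beta> d. (\<alpha>, \<beta>, d) \<in> cbox l u \<Longrightarrow> \<bar>\<alpha> - \<alpha>\<^sub>0\<bar> \<le> R \<and> \<bar>\<beta> - \<beta>\<^sub>0\<bar> \<le> R"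
  using box_radius by blast
 \<comment> \<open>Half the smaller mass: proportions within \<open>c\<close> of
   \<open>p\<^sub>L\<close> and \<open>p\<^sub>R\<close> still exceed \<open>c\<close>.\<close>
 define c where "c = min p\<^sub>L p\<^sub>R / 2"
 have c: "0 < c" "c \<le> p\<^sub>L / 2" "c \<le> p\<^sub>R / 2" using p_pos by (auto simp: c_def)
 define \<eta> where "\<eta> = min (c * \<delta>\<^sup>2 / 2) (c * (\<beta>\<^sub>0 - \<alpha>\<^sub>0)\<^sup>2 / 8) / (12 * R)"
 have \<eta>: "0 < \<eta>" "12 * R * \<eta> \<le> c * \<delta>\<^sup>2 / 2" "12 * R * \<eta> \<le> c * (\<beta>\<^sub>0 - \<alpha>\<^sub>0)\<^sup>2 / 8"
  using c R \<delta> \<alpha>\<^sub>0_neq_\<beta>\<^sub>0 by (auto simp: \<eta>_def)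
 have e4: "0 < \<epsilon> / 4" using \<epsilon> by simp
 obtain C1 where C1: "likely (\<epsilon> / 4) (\<lambda>n w. \<forall>t. \<bar>esum n (xs w) (es w) {..t}\<bar> < C1 * sqrt n)" using likely_sup_left[OF e4] by blast
 obtain C2 where C2: "likely (\<epsilon> / 4) (\<lambda>n w. \<forall>t. \<bar>esum n (xs w) (es w) {t<..}\<bar> < C2 * sqrt n)" using likely_sup_right[OF e4] by blast
 note lik = likely_conj[OF likely_conj[OF C1 C2] likely_conj[OF likely_side_counts(1)[OF e4 c(1)] likely_side_counts(2)[OF e4 c(1)]]]
 have ev: "\<forall>\<^sub>F n in sequentially. C1 * sqrt (real n) \<le> \<eta> * n \<and> C2 * sqrt (real n) \<le> \<eta> * n \<and> 1 \<le> n"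
  using eventually_sqrt_small[OF \<eta>(1), of C1] eventually_sqrt_small[OF \<eta>(1), of C2] eventually_ge_at_top[of 1] by eventually_elim auto
 have "likely (\<epsilon> / 4 + \<epsilon> / 4 + (\<epsilon> / 4 + \<epsilon> / 4)) (\<lambda>n w. fitted n w \<longrightarrow> \<bar>\<alpha>_hat n w - \<alpha>\<^sub>0\<bar> \<le> \<delta> \<and> \<bar>\<beta>_hat n w - \<beta>\<^sub>0\<bar> \<le> \<delta>)"
  using lik
 proof (rule likely_mono)
  show "\<forall>\<^sub>F n in sequentially. \<forall>w\<in>space M.
   ((\<forall>t. \<bar>esum n (xs w) (es w) {..t}\<bar> < C1 * sqrt n) \<and> (\<forall>t. \<bar>esum n (xs w) (es w) {t<..}\<bar> < C2 * sqrt n)) \<and>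
   (\<bar>cnt n (xs w) {..d\<^sub>0} / n - p\<^sub>L\<bar> < c \<and> \<bar>cnt n (xs w) {d\<^sub>0<..} / n - p\<^sub>R\<bar> < c) \<longrightarrow>
   (fitted n w \<longrightarrow> \<bar>\<alpha>_hat n w - \<alpha>\<^sub>0\<bar> \<le> \<delta> \<and> \<bar>\<beta>_hat n w - \<beta>\<^sub>0\<bar> \<le> \<delta>)"
   using ev
  proof (eventually_elim, intro ballI impI, elim conjE)
   fix n w
   assume e: "C1 * sqrt (real n) \<le> \<eta> * n" "C2 * sqrt (real n) \<le> \<eta> * n" "1 \<le> n" and w: "w \<in> space M" and f: "fitted n w"
    and s: "\<forall>t. \<bar>esum n (xs w) (es w) {..t}\<bar> < C1 * sqrt n" "\<forall>t. \<bar>esum n (xs w) (es w) {t<..}\<bar> < C2 * sqrt n"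
    and k: "\<bar>cnt n (xs w) {..d\<^sub>0} / n - p\<^sub>L\<bar> < c" "\<bar>cnt n (xs w) {d\<^sub>0<..} / n - p\<^sub>R\<bar> < c"
   have n0: "0 < real n" using e by simp
   interpret cp: cp_data n "xs w" "es w" "\<lambda>i. Ys i w" \<alpha>\<^sub>0 \<beta>\<^sub>0 d\<^sub>0 by (rule cp_data_sample[OF e(3) w])
   obtain d where d: "d \<in> completions n w" using f by (auto simp: fitted_def)
   note a = completions_argmin[OF e(3) d]
   have cc: "c * n \<le> cnt n (xs w) {..d\<^sub>0}" "c * n \<le> cnt n (xs w) {d\<^sub>0<..}"
   proof -
    have "c \<le> cnt n (xs w) {..d\<^sub>0} / n" "c \<le> cnt n (xs w) {d\<^sub>0<..} / n" using k c by linarith+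
    then show "c * n \<le> cnt n (xs w) {..d\<^sub>0}" "c * n \<le> cnt n (xs w) {d\<^sub>0<..}" using n0 by (simp_all add: pos_le_divide_eq)
   qed
   have sup: "\<bar>esum n (xs w) (es w) {..t}\<bar> \<le> \<eta> * n" "\<bar>esum n (xs w) (es w) {t<..}\<bar> \<le> \<eta> * n" for t
    using s e(1,2) by (meson less_imp_le order_trans)+
   note cons = cp.consistency[OF a(2) true_in_box _ _ R(2) sup cc c(1) \<delta> \<eta>(2,3)]
   show "\<bar>\<alpha>_hat n w - \<alpha>\<^sub>0\<bar> \<le> \<delta> \<and> \<bar>\<beta>_hat n w - \<beta>\<^sub>0\<bar> \<le> \<delta>"
    using cons R(3)[OF a(1)] by blast
  qed
 qed
 then show ?thesis by simp
qed

text \<open>Noise is dominated by drift once enough points are misclassified, and a window of width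
  \<open>K / n\<close> holds that many for large \<open>K\<close>. Errors of |D| / 8 in each
  coefficient make up the |D| / 4 of \<open>rate_right\<close> and \<open>rate_left\<close>.\<close>

lemma likely_rate:
 assumes \<epsilon>: "0 < \<epsilon>"
 shows "\<exists>K0>0. \<forall>K\<ge>K0. likely \<epsilon> (\<lambda>n w. fitted n w \<longrightarrow> completions n w \<subseteq> {d\<^sub>0 - K / n<..<d\<^sub>0 + K / n})"
proof -
 let ?D = "\<bar>\<beta>\<^sub>0 - \<alpha>\<^sub>0\<bar>"
 have D: "0 < ?D" using \<alpha>\<^sub>0_neq_\<beta>\<^sub>0 by simp
 have e5: "0 < \<epsilon> / 5" and D8: "0 < ?D / 8" and D4: "0 < ?D / 4" using \<epsilon> D by auto
 note cons = likely_consistent[OF e5 D8]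
 have "\<exists>k0>0. likely (\<epsilon> / 5) (\<lambda>n w. \<forall>t. k0 \<le> cnt n (xs w) {y\<in>{d\<^sub>0<..}. y \<le> t} \<longrightarrow>
   \<bar>esum n (xs w) (es w) {y\<in>{d\<^sub>0<..}. y \<le> t}\<bar> < ?D / 4 * cnt n (xs w) {y\<in>{d\<^sub>0<..}. y \<le> t})"
  by (rule noise_strong_law[where s=1]) (use e5 D4 in auto)
 moreover have "{y\<in>{d\<^sub>0<..}. y \<le> t} = {d\<^sub>0<..t}" for t by auto
 ultimately obtain kR where kR: "0 < kR" "likely (\<epsilon> / 5) (\<lambda>n w. \<forall>t. kR \<le> cnt n (xs w) {d\<^sub>0<..t} \<longrightarrow>
   \<bar>esum n (xs w) (es w) {d\<^sub>0<..t}\<bar> < ?D / 4 * cnt n (xs w) {d\<^sub>0<..t})" by auto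
 have "\<exists>k0>0. likely (\<epsilon> / 5) (\<lambda>n w. \<forall>t. k0 \<le> cnt n (xs w) {y\<in>{..d\<^sub>0}. t < y} \<longrightarrow>
   \<bar>esum n (xs w) (es w) {y\<in>{..d\<^sub>0}. t < y}\<bar> < ?D / 4 * cnt n (xs w) {y\<in>{..d\<^sub>0}. t < y})"
  by (rule noise_strong_law[where s="-1"]) (use e5 D4 in auto)
 moreover have "{y\<in>{..d\<^sub>0}. t < y} = {t<..d\<^sub>0}" for t by auto
 ultimately obtain kL where kL: "0 < kL" "likely (\<epsilon> / 5) (\<lambda>n w. \<forall>t. kL \<le> cnt n (xs w) {t<..d\<^sub>0} \<longrightarrow>
   \<bar>esum n (xs w) (es w) {t<..d\<^sub>0}\<bar> < ?D / 4 * cnt n (xs w) {t<..d\<^sub>0})" by auto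
 \<comment> \<open>A mean number of points per half window that meets the conditions of
   \<open>cnt_large\<close> on both sides; dividing by the density gives the width.\<close>
 define c0 where "c0 = 2 * real kR + 2 * real kL + 4 / (\<epsilon> / 5) + 1"
 have c0: "0 < c0" using e5 by (simp add: c0_def add_nonneg_pos)
 show ?thesis
 proof (intro exI[of _ "c0 / f_X d\<^sub>0"] conjI allI impI)
  show "0 < c0 / f_X d\<^sub>0" using c0 density_pos by simp
  fix K assume K: "c0 / f_X d\<^sub>0 \<le> K"
  have K0: "0 < K" using K c0 density_pos by (auto intro: less_le_trans[OF divide_pos_pos])
  have fK: "c0 \<le> f_X d\<^sub>0 * K" using K density_pos by (simp add: pos_divide_le_eq mult.commute)
  have "0 \<le> 4 / (\<epsilon> / 5)" using e5 by simp
  then have big: "2 * real kR < f_X d\<^sub>0 * K" "2 * real kL < f_X d\<^sub>0 * K" "4 / (\<epsilon> / 5) < f_X d\<^sub>0 * K" using fK unfolding c0_def by linarith+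
  have limR: "(\<lambda>n. n * prob {w\<in>space M. X w \<in> {d\<^sub>0<..d\<^sub>0 + K / n}}) \<longlonglongrightarrow> f_X d\<^sub>0 * K"
   using local_mass[of 0 K] K0 by simp
  have limL: "(\<lambda>n. n * prob {w\<in>space M. X w \<in> {d\<^sub>0 - K / n<..d\<^sub>0}}) \<longlonglongrightarrow> f_X d\<^sub>0 * K"
   using local_mass[of "-K" 0] K0 by simp
  have cR: "likely (\<epsilon> / 5) (\<lambda>n w. kR \<le> cnt n (xs w) {d\<^sub>0<..d\<^sub>0 + K / n})"
   by (rule cnt_large[OF _ limR big(1) big(3) e5]) simp
  have cL: "likely (\<epsilon> / 5) (\<lambda>n w. kL \<le> cnt n (xs w) {d\<^sub>0 - K / n<..d\<^sub>0})"
   by (rule cnt_large[OF _ limL big(2) big(3) e5]) simp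
  have "likely (\<epsilon> / 5 + (\<epsilon> / 5 + \<epsilon> / 5) + (\<epsilon> / 5 + \<epsilon> / 5)) (\<lambda>n w. fitted n w \<longrightarrow> completions n w \<subseteq> {d\<^sub>0 - K / n<..<d\<^sub>0 + K / n})"
   using likely_conj[OF likely_conj[OF cons likely_conj[OF kR(2) kL(2)]] likely_conj[OF cR cL]]
  proof (rule likely_mono, intro eventually_sequentiallyI[of 1] ballI impI subsetI, elim conjE)
   fix n w d
   assume n: "1 \<le> n" and w: "w \<in> space M" and f: "fitted n w" and d: "d \<in> completions n w"
    and co: "fitted n w \<longrightarrow> \<bar>\<alpha>_hat n w - \<alpha>\<^sub>0\<bar> \<le> ?D / 8 \<and> \<bar>\<beta>_hat n w - \<beta>\<^sub>0\<bar> \<le> ?D / 8"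
    and sR: "\<forall>t. kR \<le> cnt n (xs w) {d\<^sub>0<..t} \<longrightarrow> \<bar>esum n (xs w) (es w) {d\<^sub>0<..t}\<bar> < ?D / 4 * cnt n (xs w) {d\<^sub>0<..t}"
    and sL: "\<forall>t. kL \<le> cnt n (xs w) {t<..d\<^sub>0} \<longrightarrow> \<bar>esum n (xs w) (es w) {t<..d\<^sub>0}\<bar> < ?D / 4 * cnt n (xs w) {t<..d\<^sub>0}"
    and nR: "kR \<le> cnt n (xs w) {d\<^sub>0<..d\<^sub>0 + K / n}" and nL: "kL \<le> cnt n (xs w) {d\<^sub>0 - K / n<..d\<^sub>0}"
   interpret cp: cp_data n "xs w" "es w" "\<lambda>i. Ys i w" \<alpha>\<^sub>0 \<beta>\<^sub>0 d\<^sub>0 by (rule cp_data_sample[OF n w])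
   note a = completions_argmin[OF n d]
   have ab: "\<bar>\<alpha>_hat n w - \<alpha>\<^sub>0\<bar> + \<bar>\<beta>_hat n w - \<beta>\<^sub>0\<bar> \<le> ?D / 4" using co f by auto
   \<comment> \<open>The competitor keeps the estimated coefficients and moves only
     \<open>d\<close>; it is admissible because the box is a product of intervals.\<close>
   have inbox: "(\<alpha>_hat n w, \<beta>_hat n w, d\<^sub>0) \<in> cbox l u"
   proof -
    obtain l1 l2 l3 u1 u2 u3 where lu: "l = (l1, l2, l3)" "u = (u1, u2, u3)" by (metis prod.collapse)
    show ?thesis using a(1) true_in_box by (simp add: lu cbox_Pair_eq)
   qed
   have "d < d\<^sub>0 + K / n" by (rule cp.rate_right[OF a(2)[OF inbox] ab kR(1) _ nR]) (use sR in blast)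
   moreover have "d\<^sub>0 - K / n < d" by (rule cp.rate_left[OF a(2)[OF inbox] ab kL(1) _ nL]) (use sL in blast)
   ultimately show "d \<in> {d\<^sub>0 - K / n<..<d\<^sub>0 + K / n}" by simp
  qed
  then show "likely \<epsilon> (\<lambda>n w. fitted n w \<longrightarrow> completions n w \<subseteq> {d\<^sub>0 - K / n<..<d\<^sub>0 + K / n})" by simp
 qed
qed

lemma window_mass: "0 \<le> K \<Longrightarrow> (\<lambda>n. n * prob {w\<in>space M. X w \<in> window K n}) \<longlonglongrightarrow> f_X d\<^sub>0 * (2 * K)"
 using local_mass[of "-K" K] by (simp add: window_def)

lemma eventually_inverse_sqrt_small:
 assumes "0 < \<rho>"
 shows "\<forall>\<^sub>F n in sequentially. C / sqrt (real n) \<le> \<rho>"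
 using eventually_ge_at_top[of "nat \<lceil>(C / \<rho>)\<^sup>2\<rceil>"] eventually_ge_at_top[of 1]
proof eventually_elim
 case (elim n)
 then have "(C / \<rho>)\<^sup>2 \<le> n" by linarith
 then have "C / \<rho> \<le> sqrt n" by (rule real_le_rsqrt)
 then show ?case using assms elim by (simp add: field_simps)
qed

text \<open>The misclassified points lie in a window of width O(1 / n), so the first order
  conditions express each coefficient as a ratio of noise sum to count up to a term bounded in
  probability. Dividing by sqrt n removes this term, and the law of large numbers replaces the
  counts by their means.\<close>

lemma likely_linearized:
 assumes \<epsilon>: "0 < \<epsilon>" and \<rho>: "0 < \<rho>"
 shows "likely \<epsilon> (\<lambda>n w. fitted n w \<longrightarrow>
  \<bar>sqrt n * (\<alpha>_hat n w - \<alpha>\<^sub>0) - esum n (xs w) (es w) {..d\<^sub>0} / (p\<^sub>L * sqrt n)\<bar> \<le> \<rho> \<and>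
  \<bar>sqrt n * (\<beta>_hat n w - \<beta>\<^sub>0) - esum n (xs w) (es w) {d\<^sub>0<..} / (p\<^sub>R * sqrt n)\<bar> \<le> \<rho>)"
proof -
 define e7 where "e7 = \<epsilon> / 7"
 have e7: "0 < e7" using \<epsilon> by (simp add: e7_def)
 obtain C1 where C1: "0 < C1" "likely e7 (\<lambda>n w. \<forall>t. \<bar>esum n (xs w) (es w) {..t}\<bar> < C1 * sqrt n)" using likely_sup_left[OF e7] by blast
 obtain C2 where C2: "0 < C2" "likely e7 (\<lambda>n w. \<forall>t. \<bar>esum n (xs w) (es w) {t<..}\<bar> < C2 * sqrt n)" using likely_sup_right[OF e7] by blast
 obtain K where K: "0 < K" "likely e7 (\<lambda>n w. fitted n w \<longrightarrow> completions n w \<subseteq> {d\<^sub>0 - K / n<..<d\<^sub>0 + K / n})" using likely_rate[OF e7] by blast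
 obtain B where B: "0 < B" "likely e7 (\<lambda>n w. cnt n (xs w) (window K n) + esum n (xs w) (\<lambda>i. \<bar>\<xi>s i w\<bar>) (window K n) < B)"
  using window_sum_bounded[OF sets_window window_mass e7, of K] K by auto
 \<comment> \<open>The first two bounds keep the counts above half of their means in
   \<open>ratio_linearization\<close>; the other two make its last term at most
   \<open>\<rho> / 2\<close>.\<close>
 define \<eta> where "\<eta> = min (min (p\<^sub>L / 2) (p\<^sub>R / 2)) (min (\<rho> * p\<^sub>L\<^sup>2 / (4 * C1)) (\<rho> * p\<^sub>R\<^sup>2 / (4 * C2)))"
 have \<eta>: "0 < \<eta>" "\<eta> \<le> p\<^sub>L / 2" "\<eta> \<le> p\<^sub>R / 2" using p_pos C1 C2 \<rho> by (auto simp: \<eta>_def)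
 have \<eta>L: "2 * \<eta> * C1 / p\<^sub>L\<^sup>2 \<le> \<rho> / 2"
 proof -
  have "\<eta> \<le> \<rho> * p\<^sub>L\<^sup>2 / (4 * C1)" by (simp add: \<eta>_def)
  then show ?thesis using C1 p_pos by (simp add: field_simps)
 qed
 have \<eta>R: "2 * \<eta> * C2 / p\<^sub>R\<^sup>2 \<le> \<rho> / 2"
 proof -
  have "\<eta> \<le> \<rho> * p\<^sub>R\<^sup>2 / (4 * C2)" by (simp add: \<eta>_def)
  then show ?thesis using C2 p_pos by (simp add: field_simps)
 qed
 define R where "R = 2 * margin + \<bar>\<beta>\<^sub>0 - \<alpha>\<^sub>0\<bar> + 1"
 note cons = likely_consistent[OF e7 margin(1)]
 note lik = likely_conj[OF likely_conj[OF likely_conj[OF C1(2) C2(2)] likely_conj[OF K(2) B(2)]] likely_conj[OF likely_conj[OF likely_side_counts(1)[OF e7 \<eta>(1)] likely_side_counts(2)[OF e7 \<eta>(1)]] cons]]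
 have r2: "0 < \<rho> / 2" using \<rho> by simp
 have ev: "\<forall>\<^sub>F n in sequentially. 1 \<le> n \<and> 2 * (R * B) / p\<^sub>L / sqrt (real n) \<le> \<rho> / 2 \<and> 2 * (R * B) / p\<^sub>R / sqrt (real n) \<le> \<rho> / 2"
  using eventually_ge_at_top[of 1] eventually_inverse_sqrt_small[OF r2, of "2 * (R * B) / p\<^sub>L"] eventually_inverse_sqrt_small[OF r2, of "2 * (R * B) / p\<^sub>R"]
  by eventually_elim auto
 have "likely (e7 + e7 + (e7 + e7) + (e7 + e7 + e7)) (\<lambda>n w. fitted n w \<longrightarrow>
  \<bar>sqrt n * (\<alpha>_hat n w - \<alpha>\<^sub>0) - esum n (xs w) (es w) {..d\<^sub>0} / (p\<^sub>L * sqrt n)\<bar> \<le> \<rho> \<and>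
  \<bar>sqrt n * (\<beta>_hat n w - \<beta>\<^sub>0) - esum n (xs w) (es w) {d\<^sub>0<..} / (p\<^sub>R * sqrt n)\<bar> \<le> \<rho>)"
  using lik
 proof (rule likely_mono)
  show "\<forall>\<^sub>F n in sequentially. \<forall>w\<in>space M.
   (((\<forall>t. \<bar>esum n (xs w) (es w) {..t}\<bar> < C1 * sqrt n) \<and> (\<forall>t. \<bar>esum n (xs w) (es w) {t<..}\<bar> < C2 * sqrt n)) \<and>
    (fitted n w \<longrightarrow> completions n w \<subseteq> {d\<^sub>0 - K / n<..<d\<^sub>0 + K / n}) \<and>
    cnt n (xs w) (window K n) + esum n (xs w) (\<lambda>i. \<bar>\<xi>s i w\<bar>) (window K n) < B) \<and>
   (\<bar>cnt n (xs w) {..d\<^sub>0} / n - p\<^sub>L\<bar> < \<eta> \<and> \<bar>cnt n (xs w) {d\<^sub>0<..} / n - p\<^sub>R\<bar> < \<eta>) \<and>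
   (fitted n w \<longrightarrow> \<bar>\<alpha>_hat n w - \<alpha>\<^sub>0\<bar> \<le> margin \<and> \<bar>\<beta>_hat n w - \<beta>\<^sub>0\<bar> \<le> margin) \<longrightarrow>
   (fitted n w \<longrightarrow>
    \<bar>sqrt n * (\<alpha>_hat n w - \<alpha>\<^sub>0) - esum n (xs w) (es w) {..d\<^sub>0} / (p\<^sub>L * sqrt n)\<bar> \<le> \<rho> \<and>
    \<bar>sqrt n * (\<beta>_hat n w - \<beta>\<^sub>0) - esum n (xs w) (es w) {d\<^sub>0<..} / (p\<^sub>R * sqrt n)\<bar> \<le> \<rho>)"
   using ev
  proof (eventually_elim, intro ballI impI, elim conjE)
   fix n w
   assume n: "1 \<le> n" and small: "2 * (R * B) / p\<^sub>L / sqrt (real n) \<le> \<rho> / 2" "2 * (R * B) / p\<^sub>R / sqrt (real n) \<le> \<rho> / 2"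
    and w: "w \<in> space M" and f: "fitted n w"
    and s: "\<forall>t. \<bar>esum n (xs w) (es w) {..t}\<bar> < C1 * sqrt n" "\<forall>t. \<bar>esum n (xs w) (es w) {t<..}\<bar> < C2 * sqrt n"
    and rate: "fitted n w \<longrightarrow> completions n w \<subseteq> {d\<^sub>0 - K / n<..<d\<^sub>0 + K / n}"
    and v': "cnt n (xs w) (window K n) + esum n (xs w) (\<lambda>i. \<bar>\<xi>s i w\<bar>) (window K n) < B"
    and k: "\<bar>cnt n (xs w) {..d\<^sub>0} / n - p\<^sub>L\<bar> < \<eta>" "\<bar>cnt n (xs w) {d\<^sub>0<..} / n - p\<^sub>R\<bar> < \<eta>"
    and c: "fitted n w \<longrightarrow> \<bar>\<alpha>_hat n w - \<alpha>\<^sub>0\<bar> \<le> margin \<and> \<bar>\<beta>_hat n w - \<beta>\<^sub>0\<bar> \<le> margin"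
   have n0: "0 < real n" using n by simp
   interpret cp: cp_data n "xs w" "es w" "\<lambda>i. Ys i w" \<alpha>\<^sub>0 \<beta>\<^sub>0 d\<^sub>0 by (rule cp_data_sample[OF n w])
   obtain d where d: "d \<in> completions n w" using f by (auto simp: fitted_def)
   note a = completions_argmin[OF n d]
   have ab: "\<bar>\<alpha>_hat n w - \<alpha>\<^sub>0\<bar> \<le> margin" "\<bar>\<beta>_hat n w - \<beta>\<^sub>0\<bar> \<le> margin" using c f by auto
   have int: "fst l < \<alpha>_hat n w" "\<alpha>_hat n w < fst u" "fst (snd l) < \<beta>_hat n w" "\<beta>_hat n w < fst (snd u)"
    using margin(2)[OF ab, of d\<^sub>0] margin(1) by auto
   have dW: "d \<in> {d\<^sub>0 - K / n<..<d\<^sub>0 + K / n}" using rate f d by auto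
   have w': "cnt n (xs w) {d\<^sub>0 - K / n<..d\<^sub>0 + K / n} + esum n (xs w) (\<lambda>i. \<bar>\<xi>s i w\<bar>) {d\<^sub>0 - K / n<..d\<^sub>0 + K / n} \<le> B"
    using v' by (simp add: window_def)
   have R1: "\<bar>\<alpha>_hat n w - \<alpha>\<^sub>0\<bar> + \<bar>\<beta>_hat n w - \<beta>\<^sub>0\<bar> + \<bar>\<beta>\<^sub>0 - \<alpha>\<^sub>0\<bar> \<le> R" "1 \<le> R" using ab margin(1) by (auto simp: R_def)
   note fo = cp.first_order[OF a(2,1) int dW w' R1]
   have "\<bar>sqrt n * (\<alpha>_hat n w - \<alpha>\<^sub>0) - esum n (xs w) (es w) {..d\<^sub>0} / (p\<^sub>L * sqrt n)\<bar> \<le> 2 * (R * B) / (p\<^sub>L * sqrt n) + 2 * \<eta> * C1 / p\<^sub>L\<^sup>2"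
    by (rule ratio_linearization[OF n0 p_pos(1) less_imp_le[OF k(1)] \<eta>(2) less_imp_le fo(1)]) (use s in blast)
   moreover have "\<bar>sqrt n * (\<beta>_hat n w - \<beta>\<^sub>0) - esum n (xs w) (es w) {d\<^sub>0<..} / (p\<^sub>R * sqrt n)\<bar> \<le> 2 * (R * B) / (p\<^sub>R * sqrt n) + 2 * \<eta> * C2 / p\<^sub>R\<^sup>2"
    by (rule ratio_linearization[OF n0 p_pos(2) less_imp_le[OF k(2)] \<eta>(3) less_imp_le fo(2)]) (use s in blast)
   ultimately show "\<bar>sqrt n * (\<alpha>_hat n w - \<alpha>\<^sub>0) - esum n (xs w) (es w) {..d\<^sub>0} / (p\<^sub>L * sqrt n)\<bar> \<le> \<rho> \<and>
    \<bar>sqrt n * (\<beta>_hat n w - \<beta>\<^sub>0) - esum n (xs w) (es w) {d\<^sub>0<..} / (p\<^sub>R * sqrt n)\<bar> \<le> \<rho>"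
    using small \<eta>L \<eta>R by (simp only: divide_divide_eq_left) linarith
  qed
 qed
 then show ?thesis by (simp add: e7_def)
qed

text \<open>A window of width 0 is empty, so this is the full score.\<close>

lemma outer_sum_0:
 assumes "1 \<le> n"
 shows "outer_sum v v' 0 n w = v * (esum n (xs w) (es w) {..d\<^sub>0} / (p\<^sub>L * sqrt n)) + v' * (esum n (xs w) (es w) {d\<^sub>0<..} / (p\<^sub>R * sqrt n))"
proof -
 have "(\<Sum>i | i < n \<and> Xs i w \<notin> window 0 n. \<xi>s i w * weight v v' (Xs i w)) = (\<Sum>i<n. \<xi>s i w * weight v v' (Xs i w))"
  by (intro sum.cong) (auto simp: window_def)
 also have "\<dots> = (\<Sum>i<n. (v / p\<^sub>L) * (indicator {..d\<^sub>0} (Xs i w) * \<xi>s i w) + (v' / p\<^sub>R) * (indicator {d\<^sub>0<..} (Xs i w) * \<xi>s i w))"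
  by (intro sum.cong) (auto simp: weight_def indicator_def)
 also have "\<dots> = (v / p\<^sub>L) * esum n (xs w) (es w) {..d\<^sub>0} + (v' / p\<^sub>R) * esum n (xs w) (es w) {d\<^sub>0<..}"
  by (simp only: esum_indicator sum.distrib sum_distrib_left)
 finally show ?thesis unfolding outer_sum_def by (simp add: add_divide_distrib)
qed

text \<open>The total absolute noise in the window is bounded in probability, so leaving the window
  out changes the normalized score by O(1 / sqrt n). This decouples the coefficients from the local
  process.\<close>

lemma likely_outer_sum:
 assumes \<epsilon>: "0 < \<epsilon>" and \<rho>: "0 < \<rho>" and K: "0 \<le> K"
 shows "likely \<epsilon> (\<lambda>n w. fitted n w \<longrightarrow>
  \<bar>v * (sqrt n * (\<alpha>_hat n w - \<alpha>\<^sub>0)) + v' * (sqrt n * (\<beta>_hat n w - \<beta>\<^sub>0)) - outer_sum v v' K n w\<bar> \<le> \<rho>)"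
proof -
 have e2: "0 < \<epsilon> / 2" using \<epsilon> by simp
 \<comment> \<open>The added 1 covers \<open>v = v' = 0\<close>.\<close>
 define \<rho>1 where "\<rho>1 = \<rho> / (2 * (\<bar>v\<bar> + \<bar>v'\<bar> + 1))"
 have \<rho>1: "0 < \<rho>1" "(\<bar>v\<bar> + \<bar>v'\<bar>) * \<rho>1 \<le> \<rho> / 2"
 proof -
  show "0 < \<rho>1" using \<rho> by (auto simp: \<rho>1_def intro!: divide_pos_pos add_nonneg_pos)
  have "(\<bar>v\<bar> + \<bar>v'\<bar>) * \<rho>1 \<le> (\<bar>v\<bar> + \<bar>v'\<bar> + 1) * \<rho>1" using \<open>0 < \<rho>1\<close> by (intro mult_right_mono) auto
  also have "\<dots> = \<rho> / 2"
  proof -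
   have "A * (\<rho> / (2 * A)) = \<rho> / 2" if "A \<noteq> 0" for A using that by simp
   moreover have "0 < \<bar>v\<bar> + \<bar>v'\<bar> + 1" by (simp add: add_nonneg_pos)
   ultimately show ?thesis unfolding \<rho>1_def by (metis less_irrefl)
  qed
  finally show "(\<bar>v\<bar> + \<bar>v'\<bar>) * \<rho>1 \<le> \<rho> / 2" .
 qed
 obtain B where B: "0 < B" "likely (\<epsilon> / 2) (\<lambda>n w. cnt n (xs w) (window K n) + esum n (xs w) (\<lambda>i. \<bar>\<xi>s i w\<bar>) (window K n) < B)"
  using window_sum_bounded[OF sets_window window_mass e2, of K] K by auto
 define c1 where "c1 = \<bar>v\<bar> / p\<^sub>L + \<bar>v'\<bar> / p\<^sub>R"
 have c10: "0 \<le> c1" using p_pos by (simp add: c1_def)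
 have r2: "0 < \<rho> / 2" using \<rho> by simp
 have ev: "\<forall>\<^sub>F n in sequentially. 1 \<le> n \<and> (c1 * B) / sqrt (real n) \<le> \<rho> / 2"
  using eventually_ge_at_top[of 1] eventually_inverse_sqrt_small[OF r2, of "c1 * B"] by eventually_elim auto
 have "likely (\<epsilon> / 2 + \<epsilon> / 2) (\<lambda>n w. fitted n w \<longrightarrow>
  \<bar>v * (sqrt n * (\<alpha>_hat n w - \<alpha>\<^sub>0)) + v' * (sqrt n * (\<beta>_hat n w - \<beta>\<^sub>0)) - outer_sum v v' K n w\<bar> \<le> \<rho>)"
  using likely_conj[OF likely_linearized[OF e2 \<rho>1(1)] B(2)]
 proof (rule likely_mono)
  show "\<forall>\<^sub>F n in sequentially. \<forall>w\<in>space M.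
   (fitted n w \<longrightarrow>
    \<bar>sqrt n * (\<alpha>_hat n w - \<alpha>\<^sub>0) - esum n (xs w) (es w) {..d\<^sub>0} / (p\<^sub>L * sqrt n)\<bar> \<le> \<rho>1 \<and>
    \<bar>sqrt n * (\<beta>_hat n w - \<beta>\<^sub>0) - esum n (xs w) (es w) {d\<^sub>0<..} / (p\<^sub>R * sqrt n)\<bar> \<le> \<rho>1) \<and>
   cnt n (xs w) (window K n) + esum n (xs w) (\<lambda>i. \<bar>\<xi>s i w\<bar>) (window K n) < B \<longrightarrow>
   (fitted n w \<longrightarrow>
    \<bar>v * (sqrt n * (\<alpha>_hat n w - \<alpha>\<^sub>0)) + v' * (sqrt n * (\<beta>_hat n w - \<beta>\<^sub>0)) - outer_sum v v' K n w\<bar> \<le> \<rho>)"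
   using ev
  proof (eventually_elim, intro ballI impI, elim conjE)
   fix n w
   assume n: "1 \<le> n" and small: "(c1 * B) / sqrt (real n) \<le> \<rho> / 2" and f: "fitted n w"
    and lin: "fitted n w \<longrightarrow>
    \<bar>sqrt n * (\<alpha>_hat n w - \<alpha>\<^sub>0) - esum n (xs w) (es w) {..d\<^sub>0} / (p\<^sub>L * sqrt n)\<bar> \<le> \<rho>1 \<and>
    \<bar>sqrt n * (\<beta>_hat n w - \<beta>\<^sub>0) - esum n (xs w) (es w) {d\<^sub>0<..} / (p\<^sub>R * sqrt n)\<bar> \<le> \<rho>1"
    and Bw: "cnt n (xs w) (window K n) + esum n (xs w) (\<lambda>i. \<bar>\<xi>s i w\<bar>) (window K n) < B"
   define a where "a = sqrt n * (\<alpha>_hat n w - \<alpha>\<^sub>0)"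
   define b where "b = sqrt n * (\<beta>_hat n w - \<beta>\<^sub>0)"
   define A where "A = esum n (xs w) (es w) {..d\<^sub>0} / (p\<^sub>L * sqrt n)"
   define Bb where "Bb = esum n (xs w) (es w) {d\<^sub>0<..} / (p\<^sub>R * sqrt n)"
   have l1: "\<bar>a - A\<bar> \<le> \<rho>1" "\<bar>b - Bb\<bar> \<le> \<rho>1" using lin f by (auto simp: a_def b_def A_def Bb_def)
   have "\<bar>v * a + v' * b - outer_sum v v' 0 n w\<bar> = \<bar>v * (a - A) + v' * (b - Bb)\<bar>"
    unfolding outer_sum_0[OF n] A_def[symmetric] Bb_def[symmetric] by (simp add: algebra_simps)
   also have "\<dots> \<le> \<bar>v\<bar> * \<bar>a - A\<bar> + \<bar>v'\<bar> * \<bar>b - Bb\<bar>" by (rule order_trans[OF abs_triangle_ineq]) (simp add: abs_mult)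
   also have "\<dots> \<le> \<bar>v\<bar> * \<rho>1 + \<bar>v'\<bar> * \<rho>1" using l1 by (intro add_mono mult_left_mono) auto
   also have "\<dots> \<le> \<rho> / 2" using \<rho>1(2) by (simp add: distrib_right)
   finally have p1: "\<bar>v * a + v' * b - outer_sum v v' 0 n w\<bar> \<le> \<rho> / 2" .
   have split: "(\<Sum>i<n. \<xi>s i w * weight v v' (Xs i w)) = (\<Sum>i | i < n \<and> Xs i w \<notin> window K n. \<xi>s i w * weight v v' (Xs i w)) + (\<Sum>i | i < n \<and> Xs i w \<in> window K n. \<xi>s i w * weight v v' (Xs i w))"
    by (subst sum.union_disjoint[symmetric]) (auto intro!: sum.cong)
   have z: "(\<Sum>i | i < n \<and> Xs i w \<notin> window 0 n. \<xi>s i w * weight v v' (Xs i w)) = (\<Sum>i<n. \<xi>s i w * weight v v' (Xs i w))"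
    by (intro sum.cong) (auto simp: window_def)
   have "\<bar>outer_sum v v' 0 n w - outer_sum v v' K n w\<bar> = \<bar>\<Sum>i | i < n \<and> Xs i w \<in> window K n. \<xi>s i w * weight v v' (Xs i w)\<bar> / sqrt n"
    unfolding outer_sum_def z split by (simp add: diff_divide_distrib[symmetric] abs_divide)
   also have "\<dots> \<le> (\<Sum>i | i < n \<and> Xs i w \<in> window K n. \<bar>\<xi>s i w\<bar> * c1) / sqrt n"
    using weight_bound[of v v'] by (intro divide_right_mono order_trans[OF sum_abs] sum_mono) (auto simp: abs_mult c1_def intro!: mult_left_mono)
   also have "\<dots> = c1 * esum n (xs w) (\<lambda>i. \<bar>\<xi>s i w\<bar>) (window K n) / sqrt n"
    by (simp add: esum_def sum_distrib_left mult.commute)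
   also have "\<dots> \<le> c1 * B / sqrt n"
    using Bw c10 by (intro divide_right_mono mult_left_mono) auto
   finally have "\<bar>outer_sum v v' 0 n w - outer_sum v v' K n w\<bar> \<le> \<rho> / 2" using small by linarith
   with p1 show "\<bar>v * (sqrt n * (\<alpha>_hat n w - \<alpha>\<^sub>0)) + v' * (sqrt n * (\<beta>_hat n w - \<beta>\<^sub>0)) - outer_sum v v' K n w\<bar> \<le> \<rho>"
    unfolding a_def b_def by linarith
  qed
 qed
 then show ?thesis by simp
qed

end

section \<open>The limit law of the change point\<close>

text \<open>For each accuracy the comparison sequence is built from its own window, mesh and gap, so
  its limit \<open>L'\<close> may differ slightly from \<open>L\<close>.\<close>

lemma tendsto_of_approximations:
 fixes x :: "nat \<Rightarrow> 'a::real_normed_vector"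
 assumes "\<And>r. 0 < r \<Longrightarrow> \<exists>y L'. y \<longlonglongrightarrow> L' \<and> (\<forall>\<^sub>F n in sequentially. norm (x n - y n) \<le> r) \<and> norm (L' - L) \<le> r"
 shows "x \<longlonglongrightarrow> L"
proof (rule tendstoI)
 fix e :: real assume "0 < e"
 then have e4: "0 < e / 4" by simp
 from assms[OF this] obtain y L' where y: "y \<longlonglongrightarrow> L'" "\<forall>\<^sub>F n in sequentially. norm (x n - y n) \<le> e / 4" "norm (L' - L) \<le> e / 4" by blast
 from tendstoD[OF y(1) e4] y(2) show "\<forall>\<^sub>F n in sequentially. dist (x n) L < e"
 proof eventually_elim
  case (elim n)
  have "x n - L = (x n - y n) + ((y n - L') + (L' - L))" by simp
  then have "norm (x n - L) \<le> norm (x n - y n) + (norm (y n - L') + norm (L' - L))"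
   by (metis norm_triangle_ineq norm_triangle_le add_left_mono order_trans)
  then show ?case using elim y(3) \<open>0 < e\<close> unfolding dist_norm by linarith
 qed
qed

lemma normal_law_char:
 assumes v: "0 \<le> v"
 shows "real_distribution (normal_law 0 v)" and "char (normal_law 0 v) t = of_real (exp (- (v * t\<^sup>2) / 2))"
proof -
 have "real_distribution (normal_law 0 v) \<and> char (normal_law 0 v) t = of_real (exp (- (v * t\<^sup>2) / 2))"
 proof (cases "v = 0")
  case True
  have "real_distribution (return borel (0::real))"
   unfolding real_distribution_def real_distribution_axioms_def by (simp add: prob_space_return)
  moreover have "char (return borel (0::real)) t = 1" by (simp add: char_def integral_return)
  ultimately show ?thesis using True by (simp add: normal_law_def)
 next
  case False
  with v have v0: "0 < v" by simp
  interpret s: real_distribution std_normal_distribution by (rule real_dist_normal_dist)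
  have m0: "(\<lambda>x::real. x) \<in> measurable std_normal_distribution lborel" by (rule measurable_ident_sets) simp
  have d0: "distributed std_normal_distribution lborel (\<lambda>x. x) (\<lambda>x. ennreal (normal_density 0 1 x))"
   unfolding distributed_def using m0 by (simp add: distr_id2)
  have "distributed std_normal_distribution lborel (\<lambda>x. 0 + sqrt v * x) (\<lambda>x. ennreal (normal_density (0 + sqrt v * 0) (\<bar>sqrt v\<bar> * 1) x))"
   by (rule s.normal_density_affine[OF d0]) (use v0 in auto)
  then have d: "distr std_normal_distribution lborel (\<lambda>x. sqrt v * x) = normal_law 0 v"
   using v0 by (simp add: distributed_def normal_law_def)
  have "distr std_normal_distribution lborel (\<lambda>x. sqrt v * x) = distr std_normal_distribution borel (\<lambda>x. sqrt v * x)"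
   by (rule distr_cong) auto
  with d have e: "normal_law 0 v = distr std_normal_distribution borel (\<lambda>x. sqrt v * x)" by simp
  have "char (normal_law 0 v) t = char std_normal_distribution (t * sqrt v)"
   unfolding e char_def by (subst integral_distr) (simp_all add: mult.assoc)
  also have "\<dots> = of_real (exp (- (v * t\<^sup>2) / 2))"
   using v0 by (simp add: char_std_normal_distribution power_mult_distrib mult.commute)
  finally show ?thesis unfolding e by (simp add: s.real_distribution_distr)
 qed
 then show "real_distribution (normal_law 0 v)" "char (normal_law 0 v) t = of_real (exp (- (v * t\<^sup>2) / 2))" by blast+
qed

text \<open>The number of points per cell determines the occupied cells, and the strict grid minimum the rest.\<close>

lemma grid_pattern_unique:
 fixes c :: "int \<Rightarrow> 'c::zero_neq_one"
 assumes p: "(U, a, b) \<in> grid_patterns m" "(U', a', b') \<in> grid_patterns m"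
  and c: "\<And>\<kappa>. \<kappa> \<in> {- int m..<int m} \<Longrightarrow> c \<kappa> = (if \<kappa> \<in> U then 1 else 0)" "\<And>\<kappa>. \<kappa> \<in> {- int m..<int m} \<Longrightarrow> c \<kappa> = (if \<kappa> \<in> U' then 1 else 0)"
  and z: "\<And>\<kappa>. \<kappa> \<in> {- int m..<int m} \<Longrightarrow> c \<kappa> = 0 \<Longrightarrow> z \<kappa> = 0"
  and s: "z \<in> strict_grid_min m \<eta> a b" "z \<in> strict_grid_min m \<eta>' a' b'" and \<eta>: "0 < \<eta>" "0 < \<eta>'"
 shows "(U, a, b) = (U', a', b')"
proof -
 have UU: "U = U'"
 proof -
  have "\<kappa> \<in> U \<longleftrightarrow> \<kappa> \<in> U'" if "\<kappa> \<in> {- int m..<int m}" for \<kappa>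
   using c(1)[OF that] c(2)[OF that] by (auto split: if_splits)
  moreover have "U \<subseteq> {- int m..<int m}" "U' \<subseteq> {- int m..<int m}" using p by (auto simp: grid_patterns_def)
  ultimately show ?thesis by blast
 qed
 have z0: "z \<kappa> = 0" if "\<kappa> \<in> {- int m..<int m}" "\<kappa> \<notin> U" for \<kappa> using z[OF that(1)] c(1)[OF that(1)] that(2) by simp
 \<comment> \<open>Two gaps occur when the gap of a single outcome is compared with a common one;
   both minima are weakened to the smaller gap.\<close>
 have s': "z \<in> strict_grid_min m (min \<eta> \<eta>') a b" "z \<in> strict_grid_min m (min \<eta> \<eta>') a' b'"
  using s by (force simp: strict_grid_min_def)+
 have "0 < min \<eta> \<eta>'" using \<eta> by simp
 from strict_grid_min_unique[where z=z, OF p(1) p(2)[folded UU] this z0 s'] UU show ?thesis by simp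
qed

section \<open>Measurability and grid patterns of the limit process\<close>

context two_sided_cpp
begin

text \<open>Right-continuity of the two counting processes makes the path right-continuous for t
  \<ge> 0 and left-continuous for t < 0, so its value is also taken at rationals on one side.
  Minimality can then be tested along the rationals, which gives measurability of the
  midpoint.\<close>

lemma path_rational_near:
 assumes w: "w \<in> space M" and e: "0 < e"
 shows "\<exists>r\<in>\<rat>. \<bar>r - t\<bar> < e \<and> path w r = path w t"
proof -
 have flat: "\<exists>b>t. \<forall>s>t. s < b \<longrightarrow> f s = f t" if "continuous (at_right t) f" for f :: "real \<Rightarrow> nat" and t
 proof -
  have "(f \<longlongrightarrow> f t) (at_right t)" using that by (simp add: continuous_within)
  then have "\<forall>\<^sub>F s in at_right t. f s \<in> {f t}" by (rule topological_tendstoD[OF _ discrete_topology_class.open_discrete]) simp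
  then show ?thesis by (simp add: eventually_at_right_field)
 qed
 show ?thesis
 proof (cases "0 \<le> t")
  case True
  obtain b where b: "t < b" "\<forall>s>t. s < b \<longrightarrow> N1 s w = N1 t w" using flat[OF right.N_right_cont[OF w True]] by blast
  obtain r where r: "r \<in> \<rat>" "t < r" "r < min b (t + e)" using Rats_dense_in_real[of t "min b (t + e)"] b(1) e by auto
  then have "path w r = path w t" using b(2) True by (simp add: cpp_path_def)
  then show ?thesis using r by (intro bexI[of _ r]) auto
 next
  case False
  then have t: "0 \<le> - t" by simp
  obtain b where b: "- t < b" "\<forall>s>-t. s < b \<longrightarrow> N2 s w = N2 (- t) w" using flat[OF left.N_right_cont[OF w t]] by blast
  obtain r where r: "r \<in> \<rat>" "max (- b) (t - e) < r" "r < t" using Rats_dense_in_real[of "max (- b) (t - e)" t] b(1) e by auto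
  then have "path w r = path w t" using b(2)[rule_format, of "- r"] False by (simp add: cpp_path_def)
  then show ?thesis using r by (intro bexI[of _ r]) auto
 qed
qed

lemma path_measurable [measurable]: "(\<lambda>w. path w t) \<in> borel_measurable M"
proof (cases "0 \<le> t")
 case True
 have "(\<lambda>w. \<Sum>i<N1 t w. Z1 i w) \<in> borel_measurable M"
  by (rule measurable_compose_countable[where f="\<lambda>k w. \<Sum>i<k. Z1 i w"]) (use True in measurable)
 then show ?thesis using True by (simp add: cpp_path_def)
next
 case False
 then have t: "0 \<le> - t" by simp
 have "(\<lambda>w. \<Sum>i<N2 (- t) w. Z2 i w) \<in> borel_measurable M"
  by (rule measurable_compose_countable[where f="\<lambda>k w. \<Sum>i<k. Z2 i w"]) (use t in measurable)
 then show ?thesis using False by (simp add: cpp_path_def)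
qed

lemma argmin_path_iff: "t \<in> argmin_set (path w) UNIV \<longleftrightarrow> (\<forall>s. path w t \<le> path w s)"
 by (simp add: argmin_set_def is_arg_min_def not_less)

lemma mid_argmin_measurable [measurable]: "(\<lambda>w. mid_argmin (path w)) \<in> borel_measurable M"
 unfolding mid_argmin_def
proof (rule interval_midpoint_measurable)
 fix r :: real
 have eq: "r \<in> argmin_set (path w) UNIV \<longleftrightarrow> (\<forall>s\<in>\<rat>. path w r \<le> path w s)" if w: "w \<in> space M" for w
  unfolding argmin_path_iff using path_rational_near[OF w, of 1] by (metis zero_less_one)
 have "{w\<in>space M. \<forall>s\<in>\<rat>. path w r \<le> path w s} \<in> sets M"
  by (rule sets.sets_Collect_countable_All'[OF _ countable_rat]) measurable
 then show "{w\<in>space M. r \<in> argmin_set (path w) UNIV} \<in> sets M" using eq by (simp cong: conj_cong)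
next
 fix w t and e :: real assume w: "w \<in> space M" and t: "t \<in> argmin_set (path w) UNIV" and e: "0 < e"
 obtain r where r: "r \<in> \<rat>" "\<bar>r - t\<bar> < e" "path w r = path w t" using path_rational_near[OF w e, of t] by blast
 have "r \<in> argmin_set (path w) UNIV" using t unfolding argmin_path_iff r(3) .
 with r show "\<exists>r\<in>\<rat>. r \<in> argmin_set (path w) UNIV \<and> \<bar>r - t\<bar> < e" by blast
qed

definition limit_pattern :: "real \<Rightarrow> nat \<Rightarrow> real \<Rightarrow> int set \<times> int \<times> int \<Rightarrow> 'b set" where
 "limit_pattern h m \<eta> = (\<lambda>(U, a, b). {w\<in>space M. limit_occupied h {- int m..<int m} U w \<and>
   (\<lambda>\<kappa>\<in>{- int m..<int m}. path_jump h (path w) \<kappa>) \<in> strict_grid_min m \<eta> a b})"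

lemma limit_pattern_prob:
 assumes "0 < h" "(U, a, b) \<in> grid_patterns m"
 shows "limit_pattern h m \<eta> (U, a, b) \<in> sets M"
  and "measure M (limit_pattern h m \<eta> (U, a, b)) = grid_prob \<mu> (h * rate) {- int m..<int m} U (strict_grid_min m \<eta> a b)"
proof -
 have "U \<subseteq> {- int m..<int m}" "a \<in> {- int m..int m}" using assms(2) by (auto simp: grid_patterns_def)
 note occupied_prob[OF assms(1) this(1) strict_grid_min_sets[OF this(2)]]
 then show "limit_pattern h m \<eta> (U, a, b) \<in> sets M"
  "measure M (limit_pattern h m \<eta> (U, a, b)) = grid_prob \<mu> (h * rate) {- int m..<int m} U (strict_grid_min m \<eta> a b)"
  unfolding limit_pattern_def by simp_all
qed

lemma limit_pattern_unique:
 assumes "p \<in> grid_patterns m" "p' \<in> grid_patterns m" "w \<in> limit_pattern h m \<eta> p" "w \<in> limit_pattern h m \<eta>' p'" "0 < \<eta>" "0 < \<eta>'"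
 shows "p = p'"
proof -
 obtain U a b U' a' b' where p: "p = (U, a, b)" "p' = (U', a', b')" by (metis prod.collapse)
 let ?c = "\<lambda>\<kappa>::int. piece w (h * (real_of_int \<kappa> + 1)) - piece w (h * real_of_int \<kappa>)"
 show ?thesis unfolding p
 proof (rule grid_pattern_unique[where c="?c" and \<eta>=\<eta> and \<eta>'=\<eta>' and z="\<lambda>\<kappa>\<in>{- int m..<int m}. path_jump h (path w) \<kappa>"])
  show "(\<lambda>\<kappa>\<in>{- int m..<int m}. path_jump h (path w) \<kappa>) \<kappa> = 0" if "\<kappa> \<in> {- int m..<int m}" "?c \<kappa> = 0" for \<kappa>
   using path_piece[of w "h * (real_of_int \<kappa> + 1)" "h * real_of_int \<kappa>"] that by (auto simp: path_jump_def)
 qed (use assms p in \<open>auto simp: limit_pattern_def limit_occupied_def\<close>)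
qed

text \<open>Far out the path is positive and at 0 it vanishes, so minimizers lie in the window. With
  at most one jump per cell every piece there meets the grid, so a grid minimum is a true minimum.
  All minimizers share one piece, hence the other grid points are strictly higher, and finiteness of
  the grid yields a gap.\<close>

lemma limit_pattern_exists:
 assumes w: "w \<in> space M" and h: "0 < h"
  and pos: "\<And>t. h * m \<le> \<bar>t\<bar> \<Longrightarrow> 0 < path w t"
  and U: "U \<subseteq> {- int m..<int m}" "limit_occupied h {- int m..<int m} U w"
  and uniq: "\<forall>s\<in>argmin_set (path w) UNIV. \<forall>t\<in>argmin_set (path w) UNIV. piece w s = piece w t"
 shows "\<exists>\<eta>>0. \<exists>a b. (U, a, b) \<in> grid_patterns m \<and> w \<in> limit_pattern h m \<eta> (U, a, b) \<and> \<bar>mid_argmin (path w) - h * (real_of_int a + real_of_int b) / 2\<bar> \<le> h"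
proof -
 let ?P = "\<lambda>k::int. path w (h * k)"
 let ?q = "\<lambda>k::int. piece w (h * k)"
 let ?K = "{- int m..int m}"
 have inc: "piece w (h * (real_of_int \<kappa> + 1)) - piece w (h * real_of_int \<kappa>) = (if \<kappa> \<in> U then 1 else 0)" if "\<kappa> \<in> {- int m..<int m}" for \<kappa> :: int
  using U(2) that by (simp add: limit_occupied_def)
 then have simple: "piece w (h * (real_of_int \<kappa> + 1)) - piece w (h * real_of_int \<kappa>) \<le> 1" if "\<kappa> \<in> {- int m..<int m}" for \<kappa> :: int
  using that by simp
 have mono: "piece w s \<le> piece w t" if "s \<le> t" for s t using piece_mono[OF w that] .
 have qmono: "?q k \<le> ?q k'" if "k \<le> k'" for k k' using h that by (intro mono mult_left_mono) auto
 have "Min (?P ` ?K) \<in> ?P ` ?K" by (intro Min_in) auto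
 then obtain k0 where k0: "Min (?P ` ?K) = ?P k0" "k0 \<in> ?K" by (rule imageE)
 have k0min: "?P k0 \<le> ?P k" if "k \<in> ?K" for k
  unfolding k0(1)[symmetric] using that by (intro Min_le) auto
 have "?P k0 \<le> ?P 0" by (rule k0min) simp
 then have P0: "?P k0 \<le> 0" using path_0[OF w] by simp
 have edge: "k \<noteq> - int m \<and> k \<noteq> int m" if "?P k \<le> 0" for k
  using pos[of "h * k"] that h by (auto simp: abs_mult)
 have arg: "h * k \<in> argmin_set (path w) UNIV" if "?P k \<le> ?P k0" for k :: int
  unfolding argmin_path_iff
 proof
  fix s
  show "path w (h * k) \<le> path w s"
  proof (cases "h * m \<le> \<bar>s\<bar>")
   case True then show ?thesis using pos[OF True] that P0 by linarith
  next
   case False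
   then have "s \<in> {- (h * m)<..<h * m}" by auto
   from grid_near[OF h mono simple this] obtain k' where k': "k' \<in> ?K" "piece w s = ?q k'" by auto
   then have "path w s = ?P k'" by (intro path_piece) simp
   then show ?thesis using k0min[OF k'(1)] that by simp
  qed
 qed
 define S where "S = {k\<in>?K. ?q k = ?q k0}"
 have S: "finite S" "k0 \<in> S"
 proof -
  show "finite S" by (rule finite_subset[of _ ?K]) (auto simp: S_def)
  show "k0 \<in> S" using k0(2) by (simp add: S_def)
 qed
 have SP: "?P k = ?P k0" if "k \<in> S" for k using that by (intro path_piece) (simp add: S_def)
 define a where "a = Min S"
 define b where "b = Max S"
 have ab: "a \<in> S" "b \<in> S" using Min_in[OF S(1)] Max_in[OF S(1)] S(2) unfolding a_def b_def by auto
 have le: "a \<le> k0" "k0 \<le> b" using S by (auto simp: a_def b_def)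
 have abK: "a \<in> ?K" "b \<in> ?K" "?q a = ?q k0" "?q b = ?q k0" using ab by (auto simp: S_def)
 have Sab: "k \<in> S \<longleftrightarrow> k \<in> {a..b}" for k
 proof
  assume "k \<in> S" then show "k \<in> {a..b}" using S by (auto simp: a_def b_def)
 next
  assume k: "k \<in> {a..b}"
  then have "?q a \<le> ?q k" "?q k \<le> ?q b" by (auto intro!: qmono)
  then show "k \<in> S" using k abK by (auto simp: S_def)
 qed
 have pat: "(U, a, b) \<in> grid_patterns m"
 proof -
  have "?P a \<le> 0" "?P b \<le> 0" using SP ab P0 by auto
  then have "- int m < a" "b < int m" using edge[of a] edge[of b] abK by auto
  moreover have "U \<inter> {a..<b} = {}"
  proof (rule ccontr)
   assume "U \<inter> {a..<b} \<noteq> {}"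
   then obtain \<kappa> where \<kappa>: "\<kappa> \<in> U" "a \<le> \<kappa>" "\<kappa> < b" by auto
   then have "\<kappa> \<in> S" "\<kappa> + 1 \<in> S" unfolding Sab by auto
   then have "piece w (h * real_of_int \<kappa>) = piece w (h * (real_of_int \<kappa> + 1))" by (simp add: S_def)
   then show False using inc[of \<kappa>] \<kappa> U(1) by auto
  qed
  ultimately show ?thesis using U(1) le by (simp add: grid_patterns_def)
 qed
 have gap: "?P a < ?P k" if "k \<in> ?K" "k \<notin> {a..b}" for k
 proof (rule ccontr)
  assume "\<not> ?P a < ?P k"
  then have "?P k \<le> ?P k0" using SP[OF ab(1)] by simp
  then have "?q k = ?q k0" using uniq arg[of k] arg[of k0] by blast
  then show False using that Sab by (auto simp: S_def)
 qed
 \<comment> \<open>The inserted 1 keeps the set nonempty.\<close>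
 define \<eta> where "\<eta> = Min (insert 1 ((\<lambda>k. ?P k - ?P a) ` (?K - {a..b})))"
 have \<eta>: "0 < \<eta>" unfolding \<eta>_def using gap by (subst Min_gr_iff) auto
 have \<eta>le: "?P a + \<eta> \<le> ?P k" if "k \<in> ?K - {a..b}" for k
 proof -
  have "\<eta> \<le> ?P k - ?P a" unfolding \<eta>_def using that by (intro Min_le) auto
  then show ?thesis by simp
 qed
 have gp: "grid_path (\<lambda>\<kappa>\<in>{- int m..<int m}. path_jump h (path w) \<kappa>) k = ?P k" if "k \<in> ?K" for k
 proof -
  have "grid_path (\<lambda>\<kappa>\<in>{- int m..<int m}. path_jump h (path w) \<kappa>) k = grid_path (path_jump h (path w)) k"
   using that by (rule grid_path_cong) simp
  then show ?thesis using grid_path_path_jump[of "path w"] path_0[OF w] by simp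
 qed
 have lp: "w \<in> limit_pattern h m \<eta> (U, a, b)"
  unfolding limit_pattern_def strict_grid_min_def using w U(2) \<eta>le gp abK(1) by (auto simp: space_PiM)
 have mid: "\<bar>mid_argmin (path w) - h * (real_of_int a + real_of_int b) / 2\<bar> \<le> h"
 proof -
  have in_window: "argmin_set (path w) UNIV \<subseteq> {- (h * m)<..<h * m}"
  proof
   fix t assume "t \<in> argmin_set (path w) UNIV"
   then have "path w t \<le> path w 0" by (simp add: argmin_path_iff)
   then have "\<not> h * m \<le> \<bar>t\<bar>" using pos[of t] path_0[OF w] by force
   then show "t \<in> {- (h * m)<..<h * m}" by auto
  qed
  have r: "- int m < a" "a \<le> b" "b < int m" using pat by (auto simp: grid_patterns_def)
  have ne: "argmin_set (path w) UNIV \<noteq> {}" using arg[of k0] by auto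
  have qab: "?q a = ?q b" using abK by simp
  note ga = grid_argmin[OF h mono subset_UNIV path_piece simple r qab gap ne in_window]
  have "\<bar>interval_midpoint (argmin_set (path w) UNIV) - (h * a + h * b) / 2\<bar> \<le> h"
   by (rule interval_midpoint_near) (use ga h in auto)
  then show ?thesis by (simp add: mid_argmin_def distrib_left)
 qed
 show ?thesis
  by (rule exI[of _ \<eta>], rule conjI[OF \<eta>], rule exI[of _ a], rule exI[of _ b], intro conjI pat lp mid)
qed

text \<open>The gap found for an outcome depends on the outcome. The events with gap
  \<open>1 / Suc j\<close> increase to the good event, so a single \<open>j\<close> serves most of
  it. The budget of 6 \<epsilon> consists of 4 for positivity far out, 1 for two points in a cell
  and 1 for the common gap.\<close>

lemma limit_pattern_likely:
 assumes int: "integrable \<mu> (\<lambda>x. x)" "integrable \<mu> (\<lambda>x. x\<^sup>2)" and c: "0 < integral\<^sup>L \<mu> (\<lambda>x. x)"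
  and uniq: "unique_minimizing_interval M N1 N2 Z1 Z2" and \<epsilon>: "0 < \<epsilon>"
 shows "\<exists>K0>0. \<forall>K\<ge>K0. \<forall>m\<ge>1. 2 * real m * (K / m * rate)\<^sup>2 \<le> \<epsilon> \<longrightarrow>
  (\<exists>\<eta>>0. \<exists>A\<in>sets M. 1 - 6 * \<epsilon> \<le> measure M A \<and>
   (\<forall>w\<in>A. \<exists>(U, a, b)\<in>grid_patterns m. w \<in> limit_pattern (K / m) m \<eta> (U, a, b) \<and> \<bar>mid_argmin (path w) - K / m * (real_of_int a + real_of_int b) / 2\<bar> \<le> K / m))"
proof -
 obtain K0 where K0: "0 < K0" "\<And>K. K0 \<le> K \<Longrightarrow> \<exists>A\<in>sets M. 1 - 4 * \<epsilon> \<le> measure M A \<and> (\<forall>w\<in>A. \<forall>t. K \<le> \<bar>t\<bar> \<longrightarrow> 0 < path w t)"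
  using path_positive_far_out[OF int c \<epsilon>] by blast
 show ?thesis
 proof (rule exI[of _ K0], intro conjI allI impI)
  fix K :: real and m :: nat assume K: "K0 \<le> K" and m: "1 \<le> m" and small: "2 * real m * (K / m * rate)\<^sup>2 \<le> \<epsilon>"
  define h where "h = K / m"
  have h: "0 < h" "h * m = K" using K K0(1) m by (auto simp: h_def)
  obtain A1 where A1: "A1 \<in> sets M" "1 - 4 * \<epsilon> \<le> measure M A1" "\<And>w t. w \<in> A1 \<Longrightarrow> K \<le> \<bar>t\<bar> \<Longrightarrow> 0 < path w t" using K0(2)[OF K] by blast
  obtain A2 where A2: "A2 \<in> sets M" "1 - 2 * real m * (h * rate)\<^sup>2 \<le> measure M A2" "\<And>w. w \<in> A2 \<Longrightarrow> \<exists>U\<subseteq>{- int m..<int m}. limit_occupied h {- int m..<int m} U w"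
   using not_simple_prob[OF h(1), of m] by blast
  obtain N where N: "N \<in> null_sets M" "\<And>w. w \<in> space M - N \<Longrightarrow> \<forall>s\<in>argmin_set (path w) UNIV. \<forall>t\<in>argmin_set (path w) UNIV. piece w s = piece w t"
   using AE_E3[OF uniq[unfolded unique_minimizing_interval_def]] by blast
  define G where "G = A1 \<inter> A2 - N"
  have Nm: "N \<in> sets M" using N(1) by blast
  have Gm: "G \<in> sets M" using A1(1) A2(1) Nm by (auto simp: G_def)
  have Gs: "w \<in> space M" if "w \<in> G" for w using that sets.sets_into_space[OF A1(1)] by (auto simp: G_def)
  have GP: "1 - 5 * \<epsilon> \<le> measure M G"
  proof -
   have "measure M (A1 \<union> A2) = measure M A1 + measure M A2 - measure M (A1 \<inter> A2)"
    using A1 A2 by (intro measure_Un3) (auto simp: right.fmeasurable_eq_sets)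
   moreover have "measure M (A1 \<union> A2) \<le> 1" by (rule right.prob_le_1)
   moreover have "measure M G = measure M (A1 \<inter> A2)" unfolding G_def using A1 A2 by (intro measure_Diff_null_set N) auto
   moreover have "1 - \<epsilon> \<le> measure M A2" using A2(2) small unfolding h_def by linarith
   ultimately show ?thesis using A1(2) by linarith
  qed
  have ex: "\<exists>\<eta>>0. \<exists>U a b. (U, a, b) \<in> grid_patterns m \<and> w \<in> limit_pattern h m \<eta> (U, a, b) \<and> \<bar>mid_argmin (path w) - h * (real_of_int a + real_of_int b) / 2\<bar> \<le> h" if w: "w \<in> G" for w
  proof -
   obtain U where U: "U \<subseteq> {- int m..<int m}" "limit_occupied h {- int m..<int m} U w" using A2(3) w by (auto simp: G_def)
   have "w \<in> A1" "w \<in> space M - N" using w Gs[OF w] by (auto simp: G_def)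
   have pos: "0 < path w t" if "h * m \<le> \<bar>t\<bar>" for t using A1(3)[OF \<open>w \<in> A1\<close>] that unfolding h(2) .
   have "\<exists>\<eta>>0. \<exists>a b. (U, a, b) \<in> grid_patterns m \<and> w \<in> limit_pattern h m \<eta> (U, a, b) \<and> \<bar>mid_argmin (path w) - h * (real_of_int a + real_of_int b) / 2\<bar> \<le> h"
    by (rule limit_pattern_exists[OF Gs[OF w] h(1) _ U N(2)[OF \<open>w \<in> space M - N\<close>]]) (rule pos)
   then show ?thesis by blast
  qed
  define E where "E j = (\<Union>p\<in>grid_patterns m. limit_pattern h m (1 / Suc j) p)" for j :: nat
  have Em: "E j \<in> sets M" for j
   unfolding E_def using finite_grid_patterns limit_pattern_prob(1)[OF h(1)] by (intro sets.finite_UN) auto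
  have shrink: "w \<in> limit_pattern h m \<eta>' p" if "w \<in> limit_pattern h m \<eta> p" "\<eta>' \<le> \<eta>" for w \<eta> \<eta>' p
   using that by (force simp: limit_pattern_def strict_grid_min_def split: prod.splits)
  have Einc: "incseq (\<lambda>j. G \<inter> E j)"
  proof (rule incseq_SucI)
   fix j
   have "1 / real (Suc (Suc j)) \<le> 1 / real (Suc j)" by (intro divide_left_mono) auto
   then show "G \<inter> E j \<subseteq> G \<inter> E (Suc j)" unfolding E_def using shrink by blast
  qed
  have "(\<Union>j. G \<inter> E j) = G"
  proof
   show "G \<subseteq> (\<Union>j. G \<inter> E j)"
   proof
    fix w assume w: "w \<in> G"
    from ex[OF w] obtain \<eta> p where p: "0 < \<eta>" "p \<in> grid_patterns m" "w \<in> limit_pattern h m \<eta> p" by blast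
    obtain j where "1 / real (Suc j) < \<eta>" using reals_Archimedean[OF p(1)] by (auto simp: inverse_eq_divide)
    then have "w \<in> E j" unfolding E_def using p shrink[OF p(3)] less_imp_le by blast
    then show "w \<in> (\<Union>j. G \<inter> E j)" using w by blast
   qed
  qed auto
  moreover have "(\<lambda>j. measure M (G \<inter> E j)) \<longlonglongrightarrow> measure M (\<Union>j. G \<inter> E j)"
   using Gm Em by (intro right.finite_Lim_measure_incseq Einc) auto
  ultimately have "(\<lambda>j. measure M (G \<inter> E j)) \<longlonglongrightarrow> measure M G" by simp
  then have "\<forall>\<^sub>F j in sequentially. 1 - 6 * \<epsilon> < measure M (G \<inter> E j)"
   using GP \<epsilon> by (intro order_tendstoD(1)) auto
  then obtain j where j: "1 - 6 * \<epsilon> < measure M (G \<inter> E j)" by (auto dest: eventually_happens)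
  have j0: "0 < 1 / real (Suc j)" by simp
  show "\<exists>\<eta>>0. \<exists>A\<in>sets M. 1 - 6 * \<epsilon> \<le> measure M A \<and>
   (\<forall>w\<in>A. \<exists>(U, a, b)\<in>grid_patterns m. w \<in> limit_pattern (K / m) m \<eta> (U, a, b) \<and> \<bar>mid_argmin (path w) - K / m * (real_of_int a + real_of_int b) / 2\<bar> \<le> K / m)"
  proof (rule exI[of _ "1 / real (Suc j)"], intro conjI j0 bexI[of _ "G \<inter> E j"] ballI)
   show "1 - 6 * \<epsilon> \<le> measure M (G \<inter> E j)" using j by simp
   show "G \<inter> E j \<in> sets M" using Gm Em by blast
   fix w assume w: "w \<in> G \<inter> E j"
   then obtain p where p: "p \<in> grid_patterns m" "w \<in> limit_pattern h m (1 / Suc j) p" by (auto simp: E_def)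
   obtain \<eta> U a b where e: "0 < \<eta>" "(U, a, b) \<in> grid_patterns m" "w \<in> limit_pattern h m \<eta> (U, a, b)" "\<bar>mid_argmin (path w) - h * (real_of_int a + real_of_int b) / 2\<bar> \<le> h"
    using ex w by blast
   \<comment> \<open>The midpoint estimate is attached to the pattern with the outcome's own gap;
     uniqueness across gaps transfers it to the pattern with the common one.\<close>
   have "p = (U, a, b)" by (rule limit_pattern_unique[OF p(1) e(2) p(2) e(3) j0 e(1)])
   then show "\<exists>(U, a, b)\<in>grid_patterns m. w \<in> limit_pattern (K / m) m (1 / real (Suc j)) (U, a, b) \<and> \<bar>mid_argmin (path w) - K / m * (real_of_int a + real_of_int b) / 2\<bar> \<le> K / m"
    using p e unfolding h_def by (intro bexI[of _ "(U, a, b)"]) auto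
  qed
 qed (rule K0(1))
qed

text \<open>\<open>char_discretize\<close> without an outer sum: the midpoint of the path is
  replaced by that of its pattern, at most one mesh width away. The total mass of the patterns is
  recorded because the sample patterns inherit it in the limit.\<close>

lemma limit_char_approx:
 assumes int: "integrable \<mu> (\<lambda>x. x)" "integrable \<mu> (\<lambda>x. x\<^sup>2)" and c: "0 < integral\<^sup>L \<mu> (\<lambda>x. x)"
  and uniq: "unique_minimizing_interval M N1 N2 Z1 Z2" and \<epsilon>: "0 < \<epsilon>"
 obtains K0 where "0 < K0" "\<forall>K m. K0 \<le> K \<longrightarrow> 1 \<le> (m::nat) \<longrightarrow> 2 * real m * (K / m * rate)\<^sup>2 \<le> \<epsilon> \<longrightarrow>
  (\<exists>\<eta>>0. 1 - 6 * \<epsilon> \<le> (\<Sum>p\<in>grid_patterns m. pattern_prob \<mu> rate (K / m) m \<eta> p) \<and>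
   (\<forall>t. cmod (char (distr M borel (\<lambda>w. mid_argmin (path w))) t -
     (\<Sum>p\<in>grid_patterns m. iexp (t * (K / m * pattern_mid p)) * of_real (pattern_prob \<mu> rate (K / m) m \<eta> p))) \<le> \<bar>t\<bar> * (K / m) + 12 * \<epsilon>))"
proof -
 obtain K0 where K0: "0 < K0" "\<And>K m. K0 \<le> K \<Longrightarrow> 1 \<le> m \<Longrightarrow> 2 * real m * (K / m * rate)\<^sup>2 \<le> \<epsilon> \<Longrightarrow>
  \<exists>\<eta>>0. \<exists>A\<in>sets M. 1 - 6 * \<epsilon> \<le> measure M A \<and>
   (\<forall>w\<in>A. \<exists>(U, a, b)\<in>grid_patterns m. w \<in> limit_pattern (K / m) m \<eta> (U, a, b) \<and> \<bar>mid_argmin (path w) - K / m * (real_of_int a + real_of_int b) / 2\<bar> \<le> K / m)"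
  using limit_pattern_likely[OF int c uniq \<epsilon>] by blast
 show thesis
 proof (rule that[OF K0(1)], intro allI impI)
  fix K :: real and m :: nat assume K: "K0 \<le> K" and m: "1 \<le> m" and small: "2 * real m * (K / m * rate)\<^sup>2 \<le> \<epsilon>"
  define h where "h = K / m"
  have h: "0 < h" using K K0(1) m by (auto simp: h_def)
  from K0(2)[OF K m small] obtain \<eta> A where \<eta>: "0 < \<eta>" and A: "A \<in> sets M" "1 - 6 * \<epsilon> \<le> measure M A" and
   near: "\<And>w. w \<in> A \<Longrightarrow> \<exists>(U, a, b)\<in>grid_patterns m. w \<in> limit_pattern h m \<eta> (U, a, b) \<and> \<bar>mid_argmin (path w) - h * (real_of_int a + real_of_int b) / 2\<bar> \<le> h"
   unfolding h_def by blast
  let ?E = "limit_pattern h m \<eta>"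
  have Em: "?E p \<in> sets M" and Ep: "measure M (?E p) = pattern_prob \<mu> rate h m \<eta> p" if "p \<in> grid_patterns m" for p
  proof -
   obtain U a b where p: "p = (U, a, b)" by (cases p)
   show "?E p \<in> sets M" "measure M (?E p) = pattern_prob \<mu> rate h m \<eta> p"
    unfolding p pattern_prob_def using limit_pattern_prob[OF h that[unfolded p]] by simp_all
  qed
  have disj: "disjoint_family_on ?E (grid_patterns m)"
   unfolding disjoint_family_on_def using limit_pattern_unique[OF _ _ _ _ \<eta> \<eta>] by blast
  have "1 - 6 * \<epsilon> \<le> measure M (\<Union>p\<in>grid_patterns m. ?E p)"
  proof (rule order_trans[OF A(2)], rule right.finite_measure_mono)
   show "A \<subseteq> (\<Union>p\<in>grid_patterns m. ?E p)" using near by blast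
   show "(\<Union>p\<in>grid_patterns m. ?E p) \<in> sets M" using finite_grid_patterns Em by (intro sets.finite_UN) auto
  qed
  also have "\<dots> = (\<Sum>p\<in>grid_patterns m. measure M (?E p))"
   using finite_grid_patterns Em disj by (intro right.finite_measure_finite_Union) auto
  also have "\<dots> = (\<Sum>p\<in>grid_patterns m. pattern_prob \<mu> rate h m \<eta> p)" by (rule sum.cong) (auto simp: Ep)
  finally have sum: "1 - 6 * \<epsilon> \<le> (\<Sum>p\<in>grid_patterns m. pattern_prob \<mu> rate h m \<eta> p)" .
  have ch: "cmod (char (distr M borel (\<lambda>w. mid_argmin (path w))) t -
     (\<Sum>p\<in>grid_patterns m. iexp (t * (h * pattern_mid p)) * of_real (pattern_prob \<mu> rate h m \<eta> p))) \<le> \<bar>t\<bar> * h + 12 * \<epsilon>" for t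
  proof -
   have "cmod (right.expectation (\<lambda>w. iexp (t * mid_argmin (path w))) -
    (\<Sum>p\<in>grid_patterns m. iexp (t * (h * pattern_mid p)) * right.expectation (\<lambda>w. indicator (?E p) w * iexp ((\<lambda>_. 0) w)))) \<le> \<bar>t\<bar> * h + 2 * (6 * \<epsilon>)"
   proof (rule right.char_discretize[OF _ _ finite_grid_patterns Em disj A])
    fix w assume "w \<in> A"
    from near[OF this] obtain U a b where p: "(U, a, b) \<in> grid_patterns m" "w \<in> ?E (U, a, b)" "\<bar>mid_argmin (path w) - h * (real_of_int a + real_of_int b) / 2\<bar> \<le> h" by blast
    have "\<bar>t * mid_argmin (path w) - 0 - t * (h * (real_of_int a + real_of_int b) / 2)\<bar> = \<bar>t\<bar> * \<bar>mid_argmin (path w) - h * (real_of_int a + real_of_int b) / 2\<bar>"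
     by (simp add: abs_mult[symmetric] right_diff_distrib)
    also have "\<dots> \<le> \<bar>t\<bar> * h" using p(3) by (intro mult_left_mono) auto
    finally show "\<exists>p\<in>grid_patterns m. w \<in> ?E p \<and> \<bar>t * mid_argmin (path w) - 0 - t * (h * pattern_mid p)\<bar> \<le> \<bar>t\<bar> * h"
     using p by (intro bexI[of _ "(U, a, b)"]) (auto simp: pattern_mid_def)
   qed (use h in auto)
   moreover have "right.expectation (\<lambda>w. indicator (?E p) w * iexp ((\<lambda>_. 0) w)) = of_real (pattern_prob \<mu> rate h m \<eta> p)" if "p \<in> grid_patterns m" for p
   proof -
    have "right.expectation (\<lambda>w. indicator (?E p) w * iexp ((\<lambda>_. 0) w)) = right.expectation (\<lambda>w. complex_of_real (indicator (?E p) w))"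
     by (intro Bochner_Integration.integral_cong) (auto simp: indicator_def)
    also have "\<dots> = of_real (measure M (?E p))" using Em[OF that] by (simp add: integral_complex_of_real)
    finally show ?thesis unfolding Ep[OF that] .
   qed
   moreover have "char (distr M borel (\<lambda>w. mid_argmin (path w))) t = right.expectation (\<lambda>w. iexp (t * mid_argmin (path w)))"
    unfolding char_def by (subst integral_distr) auto
   ultimately show ?thesis by (simp cong: sum.cong)
  qed
  show "\<exists>\<eta>>0. 1 - 6 * \<epsilon> \<le> (\<Sum>p\<in>grid_patterns m. pattern_prob \<mu> rate (K / m) m \<eta> p) \<and>
   (\<forall>t. cmod (char (distr M borel (\<lambda>w. mid_argmin (path w))) t -
     (\<Sum>p\<in>grid_patterns m. iexp (t * (K / m * pattern_mid p)) * of_real (pattern_prob \<mu> rate (K / m) m \<eta> p))) \<le> \<bar>t\<bar> * (K / m) + 12 * \<epsilon>)"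
   using \<eta> sum ch unfolding h_def by blast
 qed
qed

end

section \<open>The joint limit\<close>

context regular_change_point_model
begin

lemma outer_sum_measurable [measurable]: "outer_sum u v K n \<in> borel_measurable M"
proof -
 have eq: "outer_sum u v K n = (\<lambda>w. (\<Sum>i<n. indicator (- window K n) (Xs i w) * (\<xi>s i w * weight u v (Xs i w))) / sqrt n)"
  unfolding outer_sum_def by (intro ext arg_cong2[where f="(/)"] refl sum.mono_neutral_cong_left) (auto simp: indicator_def)
 show ?thesis unfolding eq by measurable
qed

lemma jump_law_moments: "integrable jump_law (\<lambda>x. x)" "integrable jump_law (\<lambda>x. x\<^sup>2)" "0 < integral\<^sup>L jump_law (\<lambda>x. x)"
proof -
 have m: "(\<lambda>w. \<xi> w + jump_mean) \<in> borel_measurable M" by simp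
 have i1: "integrable M (\<lambda>w. \<xi> w + jump_mean)" using \<xi>_integrable by simp
 have "integrable M (\<lambda>w. (\<xi> w)\<^sup>2 + 2 * jump_mean * \<xi> w + jump_mean\<^sup>2)"
  by (intro Bochner_Integration.integrable_add integrable_mult_right \<xi>_square_integrable \<xi>_integrable) simp
 then have i2: "integrable M (\<lambda>w. (\<xi> w + jump_mean)\<^sup>2)" by (simp add: power2_sum algebra_simps)
 show "integrable jump_law (\<lambda>x. x)" unfolding jump_law_def using i1 by (simp add: integrable_distr_eq[OF m])
 show "integrable jump_law (\<lambda>x. x\<^sup>2)" unfolding jump_law_def using i2 by (simp add: integrable_distr_eq[OF m])
 have "integral\<^sup>L jump_law (\<lambda>x. x) = expectation (\<lambda>w. \<xi> w + jump_mean)"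
  unfolding jump_law_def by (rule integral_distr[OF m]) simp
 also have "\<dots> = jump_mean" using \<xi>_integrable expectation_\<xi> by (simp add: prob_space)
 finally show "0 < integral\<^sup>L jump_law (\<lambda>x. x)" using \<alpha>\<^sub>0_neq_\<beta>\<^sub>0 by simp
qed

definition sample_pattern :: "real \<Rightarrow> nat \<Rightarrow> real \<Rightarrow> nat \<Rightarrow> int set \<times> int \<times> int \<Rightarrow> 'a set" where
 "sample_pattern h m \<eta> n = (\<lambda>(U, a, b). {w\<in>space M. occupied h {- int m..<int m} U n w \<and>
   (\<lambda>\<kappa>\<in>{- int m..<int m}. cell_jump h n w \<kappa>) \<in> strict_grid_min m \<eta> a b})"

lemma sample_pattern_sets:
 assumes "(U, a, b) \<in> grid_patterns m"
 shows "sample_pattern h m \<eta> n (U, a, b) \<in> events"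
proof -
 have a: "a \<in> {- int m..int m}" using assms by (auto simp: grid_patterns_def)
 have c: "(\<lambda>w. real (cnt n (\<lambda>i. Xs i w) (cell h n \<kappa>))) \<in> borel_measurable M" for \<kappa>
  unfolding cnt_indicator by measurable
 have j: "(\<lambda>w. cell_jump h n w \<kappa>) \<in> borel_measurable M" for \<kappa>
  unfolding cell_jump_def esum_indicator by measurable
 have o: "{w\<in>space M. occupied h {- int m..<int m} U n w} \<in> events"
 proof -
  have "{w\<in>space M. \<forall>\<kappa>\<in>{- int m..<int m}. real (cnt n (\<lambda>i. Xs i w) (cell h n \<kappa>)) = (if \<kappa> \<in> U then 1 else 0)} \<in> events"
   using borel_measurable_eq[OF c borel_measurable_const] by (intro sets.sets_Collect_finite_All) auto
  moreover have "(real k = (if \<kappa> \<in> U then 1 else 0)) = (k = (if \<kappa> \<in> U then 1 else 0))" for k and \<kappa> :: int by auto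
  ultimately show ?thesis unfolding occupied_def by (simp only:)
 qed
 have "(\<lambda>w. \<lambda>\<kappa>\<in>{- int m..<int m}. cell_jump h n w \<kappa>) \<in> measurable M (PiM {- int m..<int m} (\<lambda>_. borel))"
  by (intro measurable_restrict j)
 from measurable_sets[OF this strict_grid_min_sets[OF a, of \<eta> b]]
 have "{w\<in>space M. (\<lambda>\<kappa>\<in>{- int m..<int m}. cell_jump h n w \<kappa>) \<in> strict_grid_min m \<eta> a b} \<in> events"
  by (simp add: vimage_def Int_def conj_commute)
 with o show ?thesis unfolding sample_pattern_def by (simp add: sets.sets_Collect_conj)
qed

lemma sample_pattern_unique:
 assumes "p \<in> grid_patterns m" "p' \<in> grid_patterns m" "w \<in> sample_pattern h m \<eta> n p" "w \<in> sample_pattern h m \<eta> n p'" "0 < \<eta>"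
 shows "p = p'"
proof -
 obtain U a b U' a' b' where p: "p = (U, a, b)" "p' = (U', a', b')" by (metis prod.collapse)
 let ?c = "\<lambda>\<kappa>. cnt n (\<lambda>i. Xs i w) (cell h n \<kappa>)"
 show ?thesis unfolding p
 proof (rule grid_pattern_unique[where c="?c" and \<eta>=\<eta> and \<eta>'=\<eta> and z="\<lambda>\<kappa>\<in>{- int m..<int m}. cell_jump h n w \<kappa>"])
  show "(\<lambda>\<kappa>\<in>{- int m..<int m}. cell_jump h n w \<kappa>) \<kappa> = 0" if "\<kappa> \<in> {- int m..<int m}" "?c \<kappa> = 0" for \<kappa>
   using cnt_eq_esum[of "{}" "cell h n \<kappa>" n "\<lambda>i. Xs i w"] that by (auto simp: cell_jump_def)
 qed (use assms p in \<open>auto simp: sample_pattern_def occupied_def\<close>)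
qed

lemma sample_pattern_limit:
 assumes h: "0 < h" and p: "(U, a, b) \<in> grid_patterns m"
 shows "(\<lambda>n. expectation (\<lambda>w. indicator (sample_pattern h m \<eta> n (U, a, b)) w * iexp (outer_sum u v (h * m) n w)))
  \<longlonglongrightarrow> of_real (exp (- limit_variance u v / 2) * grid_prob jump_law (h * f_X d\<^sub>0) {- int m..<int m} U (strict_grid_min m \<eta> a b))"
proof -
 have U: "U \<subseteq> {- int m..<int m}" "a \<in> {- int m..int m}" using p by (auto simp: grid_patterns_def)
 have "expectation (\<lambda>w. indicator (sample_pattern h m \<eta> n (U, a, b)) w * iexp (outer_sum u v (h * m) n w)) =
  expectation (\<lambda>w. of_bool (occupied h {- int m..<int m} U n w \<and> (\<lambda>\<kappa>\<in>{- int m..<int m}. cell_jump h n w \<kappa>) \<in> strict_grid_min m \<eta> a b) *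
   iexp (outer_sum u v (h * m) n w))" for n
  by (intro Bochner_Integration.integral_cong refl) (auto simp: sample_pattern_def indicator_def)
 then show ?thesis using grid_limit[OF h U(1) strict_grid_min_sets[OF U(2), where \<eta>=\<eta> and b=b], where u=u and v=v] by simp
qed

text \<open>Frequencies 0 turn \<open>grid_limit\<close> into convergence of the pattern
  probabilities. The patterns are disjoint and finite in number, so their total mass in the sample
  converges to the total mass in the limit; at most \<epsilon> more is lost to crowded cells or near
  ties.\<close>

lemma likely_sample_pattern:
 assumes h: "0 < h" and \<eta>: "0 < \<eta>" and \<epsilon>: "0 < \<epsilon>"
  and sum: "1 - \<epsilon>1 \<le> (\<Sum>p\<in>grid_patterns m. pattern_prob jump_law (f_X d\<^sub>0) h m \<eta> p)"
 shows "likely (\<epsilon>1 + \<epsilon>) (\<lambda>n w. \<exists>p\<in>grid_patterns m. w \<in> sample_pattern h m \<eta> n p)"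
proof -
 let ?\<pi> = "pattern_prob jump_law (f_X d\<^sub>0) h m \<eta>"
 have "weight 0 0 x = 0" for x by (simp add: weight_def)
 then have outer0: "outer_sum 0 0 K n w = 0" for K n w by (simp add: outer_sum_def)
 have Em: "sample_pattern h m \<eta> n p \<in> events" if "p \<in> grid_patterns m" for n p
  using sample_pattern_sets that by (cases p) auto
 have "(\<lambda>n. prob (sample_pattern h m \<eta> n p)) \<longlonglongrightarrow> ?\<pi> p" if p: "p \<in> grid_patterns m" for p
 proof -
  obtain U a b where pe: "p = (U, a, b)" by (cases p)
  have "expectation (\<lambda>w. indicator (sample_pattern h m \<eta> n p) w * iexp (outer_sum 0 0 (h * m) n w)) = of_real (prob (sample_pattern h m \<eta> n p))" for n
  proof -
   have "expectation (\<lambda>w. indicator (sample_pattern h m \<eta> n p) w * iexp (outer_sum 0 0 (h * m) n w)) =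
     expectation (\<lambda>w. complex_of_real (indicator (sample_pattern h m \<eta> n p) w))"
    by (intro Bochner_Integration.integral_cong) (auto simp: indicator_def outer0)
   then show ?thesis using Em[OF p] by (simp add: integral_complex_of_real)
  qed
  then have "(\<lambda>n. complex_of_real (prob (sample_pattern h m \<eta> n p))) \<longlonglongrightarrow> complex_of_real (?\<pi> p)"
   using sample_pattern_limit[OF h p[unfolded pe], of \<eta> 0 0] unfolding pe by (simp add: limit_variance_def pattern_prob_def)
  then show ?thesis by (simp only: tendsto_of_real_iff)
 qed
 then have "(\<lambda>n. \<Sum>p\<in>grid_patterns m. prob (sample_pattern h m \<eta> n p)) \<longlonglongrightarrow> (\<Sum>p\<in>grid_patterns m. ?\<pi> p)"
  by (intro tendsto_sum)
 then have "\<forall>\<^sub>F n in sequentially. 1 - (\<epsilon>1 + \<epsilon>) < (\<Sum>p\<in>grid_patterns m. prob (sample_pattern h m \<eta> n p))"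
  using sum \<epsilon> by (intro order_tendstoD(1)) auto
 then show ?thesis unfolding likely_def
 proof eventually_elim
  case (elim n)
  have "disjoint_family_on (sample_pattern h m \<eta> n) (grid_patterns m)"
   unfolding disjoint_family_on_def using sample_pattern_unique[OF _ _ _ _ \<eta>] by blast
  then have "prob (\<Union>p\<in>grid_patterns m. sample_pattern h m \<eta> n p) = (\<Sum>p\<in>grid_patterns m. prob (sample_pattern h m \<eta> n p))"
   using finite_grid_patterns Em by (intro finite_measure_finite_Union) auto
  moreover have "(\<Union>p\<in>grid_patterns m. sample_pattern h m \<eta> n p) \<in> events"
   using finite_grid_patterns Em by (intro sets.finite_UN) auto
  ultimately show ?case using elim by (intro bexI[of _ "\<Union>p\<in>grid_patterns m. sample_pattern h m \<eta> n p"]) auto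
 qed
qed

lemma normal_chars:
 assumes "law\<^sub>\<alpha> = normal_law 0 (\<sigma>2 / p\<^sub>L)" "law\<^sub>\<beta> = normal_law 0 (\<sigma>2 / p\<^sub>R)"
 shows "real_distribution law\<^sub>\<alpha>" "real_distribution law\<^sub>\<beta>" "char law\<^sub>\<alpha> v * char law\<^sub>\<beta> v' = of_real (exp (- limit_variance v v' / 2))"
proof -
 have v: "0 \<le> \<sigma>2 / p\<^sub>L" "0 \<le> \<sigma>2 / p\<^sub>R" using \<sigma>2_nonneg p_pos by auto
 show "real_distribution law\<^sub>\<alpha>" "real_distribution law\<^sub>\<beta>" unfolding assms using v by (auto intro: normal_law_char(1))
 have "- (\<sigma>2 / p\<^sub>L * v\<^sup>2) / 2 + - (\<sigma>2 / p\<^sub>R * v'\<^sup>2) / 2 = - limit_variance v v' / 2"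
  by (simp add: limit_variance_def field_simps)
 then show "char law\<^sub>\<alpha> v * char law\<^sub>\<beta> v' = of_real (exp (- limit_variance v v' / 2))"
  unfolding assms normal_law_char(2)[OF v(1)] normal_law_char(2)[OF v(2)] of_real_mult[symmetric] exp_add[symmetric] by simp
qed

end

section \<open>Characteristic functions of the estimators\<close>

context ls_estimators
begin

abbreviation \<alpha>_err where "\<alpha>_err n w \<equiv> sqrt (real n) * (\<alpha>_hat n w - \<alpha>\<^sub>0)"
abbreviation \<beta>_err where "\<beta>_err n w \<equiv> sqrt (real n) * (\<beta>_hat n w - \<beta>\<^sub>0)"
abbreviation d_err where "d_err n w \<equiv> real n * (d_hat n w - d\<^sub>0)"

text \<open>On the empty grid, \<open>m = 0\<close>, the window is empty and the only pattern has
  probability 1, so \<open>grid_limit\<close> reduces to the central limit theorem for the full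
  score.\<close>

lemma coefficient_char_limit:
 "(\<lambda>n. expectation (\<lambda>w. iexp (v * \<alpha>_err n w + v' * \<beta>_err n w))) \<longlonglongrightarrow> of_real (exp (- limit_variance v v' / 2))"
proof (rule tendsto_of_approximations)
 fix r :: real assume r: "0 < r"
 then have r4: "0 < r / 4" by simp
 let ?Y = "\<lambda>n w. v * \<alpha>_err n w + v' * \<beta>_err n w"
 have "(\<lambda>n. expectation (\<lambda>w. iexp (outer_sum v v' 0 n w))) \<longlonglongrightarrow> of_real (exp (- limit_variance v v' / 2))"
 proof -
  have "prob_space (PiM {} (\<lambda>_. jump_law :: real measure) :: (int \<Rightarrow> real) measure)" by (rule prob_space_PiM) simp
  then have "measure (PiM {} (\<lambda>_. jump_law)) (space (PiM {} (\<lambda>_. jump_law)) :: (int \<Rightarrow> real) set) = 1" by (rule prob_space.prob_space)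
  moreover have re: "restrict f {} = (\<lambda>_. undefined)" for f :: "int \<Rightarrow> real" by auto
  ultimately have "grid_prob jump_law (1 * f_X d\<^sub>0) {- int 0..<int 0} {} (space (PiM {- int 0..<int 0} (\<lambda>_. borel))) = 1"
   by (simp add: grid_prob_def zero_extend_def space_PiM re)
  moreover have "occupied 1 {- int 0..<int 0} {} n w \<and> (\<lambda>\<kappa>\<in>{- int 0..<int 0}. cell_jump 1 n w \<kappa>) \<in> space (PiM {- int 0..<int 0} (\<lambda>_. borel))" for n w
   by (simp add: occupied_def space_PiM re)
  ultimately show ?thesis
   using grid_limit[of 1 "{}" 0 "space (PiM {- int 0..<int 0} (\<lambda>_. borel))" v v'] by (simp add: sets.top)
 qed
 moreover have "\<forall>\<^sub>F n in sequentially. cmod (expectation (\<lambda>w. iexp (?Y n w)) - expectation (\<lambda>w. iexp (outer_sum v v' 0 n w))) \<le> r"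
  using likely_conj[OF likely_fitted[OF order_refl] likely_outer_sum[OF r4 r4 order_refl, of v v']] unfolding likely_def
 proof (rule eventually_mono)
  fix n assume "\<exists>A\<in>events. 1 - (0 + r / 4) \<le> prob A \<and> (\<forall>w\<in>A. fitted n w \<and> (fitted n w \<longrightarrow> \<bar>?Y n w - outer_sum v v' 0 n w\<bar> \<le> r / 4))"
  then obtain A where A: "A \<in> events" "1 - r / 4 \<le> prob A" "\<And>w. w \<in> A \<Longrightarrow> \<bar>?Y n w - outer_sum v v' 0 n w\<bar> \<le> r / 4" by auto
  have "cmod (expectation (\<lambda>w. iexp (?Y n w)) - (\<Sum>j\<in>{()}. iexp ((\<lambda>_. 0) j) * expectation (\<lambda>w. indicator ((\<lambda>_. space M) j) w * iexp (outer_sum v v' 0 n w)))) \<le> r / 4 + 2 * (r / 4)"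
  proof (rule char_discretize[OF _ _ _ _ _ A(1,2)])
   show "\<exists>j\<in>{()}. w \<in> space M \<and> \<bar>?Y n w - outer_sum v v' 0 n w - 0\<bar> \<le> r / 4" if "w \<in> A" for w
    using A(3)[OF that] that sets.sets_into_space[OF A(1)] by auto
  qed (use r in \<open>auto simp: disjoint_family_on_def\<close>)
  moreover have "expectation (\<lambda>w. indicator (space M) w * iexp (outer_sum v v' 0 n w)) = expectation (\<lambda>w. iexp (outer_sum v v' 0 n w))"
   by (intro Bochner_Integration.integral_cong) auto
  ultimately show "cmod (expectation (\<lambda>w. iexp (?Y n w)) - expectation (\<lambda>w. iexp (outer_sum v v' 0 n w))) \<le> r"
   using r by simp
 qed
 ultimately show "\<exists>y L'. y \<longlonglongrightarrow> L' \<and>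
   (\<forall>\<^sub>F n in sequentially. cmod (expectation (\<lambda>w. iexp (?Y n w)) - y n) \<le> r) \<and> cmod (L' - of_real (exp (- limit_variance v v' / 2))) \<le> r"
  using r by (intro exI[of _ "\<lambda>n. expectation (\<lambda>w. iexp (outer_sum v v' 0 n w))"] exI[of _ "of_real (exp (- limit_variance v v' / 2))"]) auto
qed

text \<open>\<open>char_discretize\<close> on the event where the estimators are fitted, some
  pattern occurs, all completions lie in the window, the coefficients are accurate and the
  linearization holds. The excluded probability is 10 \<epsilon>: 7 for the patterns and 1 for each
  of the last three.\<close>

lemma estimator_char_approx:
 assumes \<epsilon>: "0 < \<epsilon>"
 obtains K0 where "0 < K0" "\<forall>K m \<eta> v v' t. K0 \<le> K \<longrightarrow> 1 \<le> (m::nat) \<longrightarrow> 0 < \<eta> \<longrightarrow>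
  1 - 6 * \<epsilon> \<le> (\<Sum>p\<in>grid_patterns m. pattern_prob jump_law (f_X d\<^sub>0) (K / m) m \<eta> p) \<longrightarrow>
  (\<forall>\<^sub>F n in sequentially. cmod (expectation (\<lambda>w. iexp (v * \<alpha>_err n w + v' * \<beta>_err n w + t * d_err n w)) -
   (\<Sum>p\<in>grid_patterns m. iexp (t * (K / m * pattern_mid p)) *
     expectation (\<lambda>w. indicator (sample_pattern (K / m) m \<eta> n p) w * iexp (outer_sum v v' K n w)))) \<le> \<epsilon> + \<bar>t\<bar> * (K / m) + 20 * \<epsilon>)"
proof -
 obtain K0 where K0: "0 < K0" "\<And>K. K0 \<le> K \<Longrightarrow> likely \<epsilon> (\<lambda>n w. fitted n w \<longrightarrow> completions n w \<subseteq> {d\<^sub>0 - K / n<..<d\<^sub>0 + K / n})"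
  using likely_rate[OF \<epsilon>] by blast
 show thesis
 proof (rule that[OF K0(1)], intro allI impI)
  fix K :: real and m :: nat and \<eta> v v' t :: real
  assume K: "K0 \<le> K" and m: "1 \<le> m" and \<eta>: "0 < \<eta>"
   and sum: "1 - 6 * \<epsilon> \<le> (\<Sum>p\<in>grid_patterns m. pattern_prob jump_law (f_X d\<^sub>0) (K / m) m \<eta> p)"
  define h where "h = K / m"
  have h: "0 < h" "h * m = K" using K K0(1) m by (auto simp: h_def)
  have K': "0 \<le> K" using K K0(1) by simp
  define D where "D = \<bar>\<beta>\<^sub>0 - \<alpha>\<^sub>0\<bar>"
  have D: "0 < D" using \<alpha>\<^sub>0_neq_\<beta>\<^sub>0 by (simp add: D_def)
  \<comment> \<open>Three demands on the coefficients: their total error stays below the jump,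
    \<open>m\<close> times it stays below \<open>\<eta>\<close>, and they stay in the box together
    with the window in \<open>d\<close>. The factor 3 makes the first two strict, the total error
    being at most \<open>2 * \<rho>\<close>.\<close>
  define \<rho> where "\<rho> = min (min (D / 3) (\<eta> / (3 * m))) margin"
  have \<rho>: "0 < \<rho>" "3 * \<rho> \<le> D" "3 * \<rho> * m \<le> \<eta>" "\<rho> \<le> margin"
  proof -
   show "0 < \<rho>" using D \<eta> m margin(1) by (auto simp: \<rho>_def)
   show "3 * \<rho> \<le> D" "\<rho> \<le> margin" by (auto simp: \<rho>_def)
   have "\<rho> \<le> \<eta> / (3 * m)" by (simp add: \<rho>_def)
   then show "3 * \<rho> * m \<le> \<eta>" using m by (simp add: field_simps)
  qed
  note pat = likely_sample_pattern[OF h(1) \<eta> \<epsilon> sum[folded h_def]]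
  note lik = likely_conj[OF likely_conj[OF likely_fitted[OF order_refl] pat] likely_conj[OF K0(2)[OF K] likely_conj[OF likely_consistent[OF \<epsilon> \<rho>(1)] likely_outer_sum[OF \<epsilon> \<epsilon> K', of v v']]]]
  have ev: "\<forall>\<^sub>F n in sequentially. 1 \<le> n \<and> K / real n \<le> margin"
   using eventually_ge_at_top[of "nat \<lceil>K / margin\<rceil>"] eventually_ge_at_top[of 1]
  proof eventually_elim
   case (elim n)
   then have "K / margin \<le> n" by linarith
   then show ?case using elim margin(1) by (simp add: field_simps)
  qed
  let ?Y = "\<lambda>n w. v * \<alpha>_err n w + v' * \<beta>_err n w"
  show "\<forall>\<^sub>F n in sequentially. cmod (expectation (\<lambda>w. iexp (?Y n w + t * d_err n w)) -
   (\<Sum>p\<in>grid_patterns m. iexp (t * (K / m * pattern_mid p)) *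
     expectation (\<lambda>w. indicator (sample_pattern (K / m) m \<eta> n p) w * iexp (outer_sum v v' K n w)))) \<le> \<epsilon> + \<bar>t\<bar> * (K / m) + 20 * \<epsilon>"
   using lik[unfolded likely_def] ev
  proof eventually_elim
   case (elim n)
   then have n: "1 \<le> n" "K / real n \<le> margin" by auto
   from elim(1) obtain A where A: "A \<in> events" "1 - (0 + (6 * \<epsilon> + \<epsilon>) + (\<epsilon> + (\<epsilon> + \<epsilon>))) \<le> prob A" and
    Aw: "\<And>w. w \<in> A \<Longrightarrow> fitted n w" "\<And>w. w \<in> A \<Longrightarrow> \<exists>p\<in>grid_patterns m. w \<in> sample_pattern h m \<eta> n p"
     "\<And>w. w \<in> A \<Longrightarrow> completions n w \<subseteq> {d\<^sub>0 - K / n<..<d\<^sub>0 + K / n}"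
     "\<And>w. w \<in> A \<Longrightarrow> \<bar>\<alpha>_hat n w - \<alpha>\<^sub>0\<bar> \<le> \<rho> \<and> \<bar>\<beta>_hat n w - \<beta>\<^sub>0\<bar> \<le> \<rho>"
     "\<And>w. w \<in> A \<Longrightarrow> \<bar>?Y n w - outer_sum v v' K n w\<bar> \<le> \<epsilon>"
    by blast
   have A10: "1 - 10 * \<epsilon> \<le> prob A" using A(2) by simp
   have "cmod (expectation (\<lambda>w. iexp (?Y n w + t * d_err n w)) -
    (\<Sum>p\<in>grid_patterns m. iexp (t * (h * pattern_mid p)) *
     expectation (\<lambda>w. indicator (sample_pattern h m \<eta> n p) w * iexp (outer_sum v v' K n w)))) \<le> (\<epsilon> + \<bar>t\<bar> * h) + 2 * (10 * \<epsilon>)"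
   proof (rule char_discretize[OF _ _ finite_grid_patterns _ _ A(1) A10])
    show "sample_pattern h m \<eta> n p \<in> events" if "p \<in> grid_patterns m" for p
     using sample_pattern_sets that by (cases p) auto
    show "disjoint_family_on (sample_pattern h m \<eta> n) (grid_patterns m)"
     unfolding disjoint_family_on_def using sample_pattern_unique[OF _ _ _ _ \<eta>] by blast
    fix w assume v': "w \<in> A"
    obtain U a b where p: "(U, a, b) \<in> grid_patterns m" "w \<in> sample_pattern h m \<eta> n (U, a, b)" using Aw(2)[OF v'] by auto
    note hats = Aw(4)[OF v']
    have mid: "\<bar>n * (interval_midpoint (completions n w) - d\<^sub>0) - h * (a + b) / 2\<bar> \<le> h"
    proof (rule midpoint_localized[OF n(1) _ h(1) _ p(1), where \<eta>=\<eta> and \<alpha>="\<alpha>_hat n w" and \<beta>="\<beta>_hat n w" and I="cbox l u"])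
     show "w \<in> space M" "occupied h {- int m..<int m} U n w" "(\<lambda>\<kappa>\<in>{- int m..<int m}. cell_jump h n w \<kappa>) \<in> strict_grid_min m \<eta> a b"
      using p(2) by (auto simp: sample_pattern_def)
     have s: "\<bar>\<alpha>_hat n w - \<alpha>\<^sub>0\<bar> + \<bar>\<beta>_hat n w - \<beta>\<^sub>0\<bar> \<le> 2 * \<rho>" using hats by linarith
     then show "\<bar>\<alpha>_hat n w - \<alpha>\<^sub>0\<bar> + \<bar>\<beta>_hat n w - \<beta>\<^sub>0\<bar> < \<bar>\<beta>\<^sub>0 - \<alpha>\<^sub>0\<bar>" using \<rho>(1,2) unfolding D_def by linarith
     have "(\<bar>\<alpha>_hat n w - \<alpha>\<^sub>0\<bar> + \<bar>\<beta>_hat n w - \<beta>\<^sub>0\<bar>) * m \<le> 2 * \<rho> * m" using s by (intro mult_right_mono) auto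
     also have "\<dots> < 3 * \<rho> * m" using \<rho>(1) m by simp
     finally show "(\<bar>\<alpha>_hat n w - \<alpha>\<^sub>0\<bar> + \<bar>\<beta>_hat n w - \<beta>\<^sub>0\<bar>) * m < \<eta>" using \<rho>(3) by linarith
     show "(\<alpha>_hat n w, \<beta>_hat n w, d) \<in> cbox l u" if "d \<in> {d\<^sub>0 - h * m / n..d\<^sub>0 + h * m / n}" for d
     proof -
      have "\<bar>d - d\<^sub>0\<bar> \<le> K / n" using that unfolding h(2) by auto
      then have "\<bar>d - d\<^sub>0\<bar> \<le> margin" using n(2) by linarith
      then show ?thesis using margin(2)[of "\<alpha>_hat n w" "\<beta>_hat n w" d] hats \<rho>(4) by linarith
     qed
     show "completions n w = {d. (\<alpha>_hat n w, \<beta>_hat n w, d) \<in> argmin_set (ls_criterion n (\<lambda>i. Xs i w) (\<lambda>i. Ys i w)) (cbox l u)}"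
      by (simp add: completions_def)
     show "completions n w \<noteq> {}" using Aw(1)[OF v'] by (simp add: fitted_def)
     show "completions n w \<subseteq> {d\<^sub>0 - h * m / n<..<d\<^sub>0 + h * m / n}" using Aw(3)[OF v'] unfolding h(2) .
    qed
    have "d_hat n w = interval_midpoint (completions n w)" using Aw(1)[OF v'] by (simp add: fitted_def)
    with mid have mid': "\<bar>d_err n w - h * (a + b) / 2\<bar> \<le> h" by simp
    have "\<bar>(?Y n w + t * d_err n w) - outer_sum v v' K n w - t * (h * (a + b) / 2)\<bar> =
     \<bar>(?Y n w - outer_sum v v' K n w) + t * (d_err n w - h * (a + b) / 2)\<bar>" by (simp add: right_diff_distrib)
    also have "\<dots> \<le> \<bar>?Y n w - outer_sum v v' K n w\<bar> + \<bar>t\<bar> * \<bar>d_err n w - h * (a + b) / 2\<bar>"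
     by (rule order_trans[OF abs_triangle_ineq]) (simp only: abs_mult order_refl)
    also have "\<dots> \<le> \<epsilon> + \<bar>t\<bar> * h" using Aw(5)[OF v'] mid' by (intro add_mono mult_left_mono) auto
    finally show "\<exists>p\<in>grid_patterns m. w \<in> sample_pattern h m \<eta> n p \<and>
      \<bar>(?Y n w + t * d_err n w) - outer_sum v v' K n w - t * (h * pattern_mid p)\<bar> \<le> \<epsilon> + \<bar>t\<bar> * h"
     using p by (intro bexI[of _ "(U, a, b)"]) (auto simp: pattern_mid_def)
   qed (use \<epsilon> h in auto)
   then show ?case unfolding h_def by simp
  qed
 qed
qed

text \<open>One width \<open>K\<close> serves sample and limit; then come the mesh through
  \<open>m\<close>, the gap from the limit process, and only then \<open>n\<close>. On each pattern
  the weighted expectation tends to the Gaussian factor times the probability that the limit process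
  gives to the same pattern, so the Gaussian factor comes out of the sum.\<close>

theorem joint_char_limit:
 assumes cpp: "two_sided_cpp M' N1 N2 (f_X d\<^sub>0) Z1 Z2 jump_law" and uniq: "unique_minimizing_interval M' N1 N2 Z1 Z2"
 defines "law\<^sub>d \<equiv> distr M' borel (\<lambda>w. mid_argmin (cpp_path N1 N2 Z1 Z2 w))"
 shows "(\<lambda>n. expectation (\<lambda>w. iexp (v * \<alpha>_err n w + v' * \<beta>_err n w + t * d_err n w)))
  \<longlonglongrightarrow> of_real (exp (- limit_variance v v' / 2)) * char law\<^sub>d t"
proof (rule tendsto_of_approximations)
 fix r :: real assume r: "0 < r"
 interpret cpp: two_sided_cpp M' N1 N2 "f_X d\<^sub>0" Z1 Z2 jump_law by (rule cpp)
 \<comment> \<open>The budget is at most 22 \<epsilon> for the sample and 13 \<epsilon> for the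
   limit.\<close>
 define \<epsilon> where "\<epsilon> = r / 50"
 have \<epsilon>: "0 < \<epsilon>" using r by (simp add: \<epsilon>_def)
 obtain K1 where K1: "0 < K1" "\<forall>K m. K1 \<le> K \<longrightarrow> 1 \<le> (m::nat) \<longrightarrow> 2 * real m * (K / m * f_X d\<^sub>0)\<^sup>2 \<le> \<epsilon> \<longrightarrow>
  (\<exists>\<eta>>0. 1 - 6 * \<epsilon> \<le> (\<Sum>p\<in>grid_patterns m. pattern_prob jump_law (f_X d\<^sub>0) (K / m) m \<eta> p) \<and>
   (\<forall>t. cmod (char law\<^sub>d t - (\<Sum>p\<in>grid_patterns m. iexp (t * (K / m * pattern_mid p)) * of_real (pattern_prob jump_law (f_X d\<^sub>0) (K / m) m \<eta> p))) \<le> \<bar>t\<bar> * (K / m) + 12 * \<epsilon>))"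
  by (rule cpp.limit_char_approx[OF jump_law_moments uniq \<epsilon>, folded law\<^sub>d_def]) (rule that; assumption)
 obtain K2 where K2: "0 < K2" "\<forall>K m \<eta> v v' t. K2 \<le> K \<longrightarrow> 1 \<le> (m::nat) \<longrightarrow> 0 < \<eta> \<longrightarrow> 1 - 6 * \<epsilon> \<le> (\<Sum>p\<in>grid_patterns m. pattern_prob jump_law (f_X d\<^sub>0) (K / m) m \<eta> p) \<longrightarrow>
  (\<forall>\<^sub>F n in sequentially. cmod (expectation (\<lambda>w. iexp (v * \<alpha>_err n w + v' * \<beta>_err n w + t * d_err n w)) -
   (\<Sum>p\<in>grid_patterns m. iexp (t * (K / m * pattern_mid p)) *
     expectation (\<lambda>w. indicator (sample_pattern (K / m) m \<eta> n p) w * iexp (outer_sum v v' K n w)))) \<le> \<epsilon> + \<bar>t\<bar> * (K / m) + 20 * \<epsilon>)"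
  by (rule estimator_char_approx[OF \<epsilon>]) (rule that; assumption)
 define K where "K = max K1 K2"
 obtain m :: nat where m: "max 1 (max (2 * (K * f_X d\<^sub>0)\<^sup>2 / \<epsilon>) (\<bar>t\<bar> * K / \<epsilon>)) \<le> m" using real_arch_simple by blast
 have m1: "1 \<le> m" using m by simp
 have K0: "0 < K" "K1 \<le> K" "K2 \<le> K" using K1(1) by (auto simp: K_def)
 define h where "h = K / m"
 have h: "0 < h" "h * m = K" using K0 m1 by (auto simp: h_def)
 have "2 * (K * f_X d\<^sub>0)\<^sup>2 / \<epsilon> \<le> m" "\<bar>t\<bar> * K / \<epsilon> \<le> m" using m by auto
 then have m2: "2 * (K * f_X d\<^sub>0)\<^sup>2 \<le> \<epsilon> * m" "\<bar>t\<bar> * K \<le> \<epsilon> * m" using \<epsilon> by (simp_all add: pos_divide_le_eq mult.commute)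
 have "2 * real m * (K / m * f_X d\<^sub>0)\<^sup>2 = 2 * (K * f_X d\<^sub>0)\<^sup>2 / m" using m1 by (simp add: power2_eq_square field_simps)
 also have "\<dots> \<le> \<epsilon>" using m2(1) m1 by (simp add: pos_divide_le_eq)
 finally have small: "2 * real m * (K / m * f_X d\<^sub>0)\<^sup>2 \<le> \<epsilon>" .
 have th: "\<bar>t\<bar> * h \<le> \<epsilon>" using m2(2) m1 by (simp add: h_def pos_divide_le_eq)
 from K1(2)[rule_format, OF K0(2) m1 small, folded h_def] obtain \<eta> where \<eta>: "0 < \<eta>" "1 - 6 * \<epsilon> \<le> (\<Sum>p\<in>grid_patterns m. pattern_prob jump_law (f_X d\<^sub>0) h m \<eta> p)"
  and lim: "cmod (char law\<^sub>d t - (\<Sum>p\<in>grid_patterns m. iexp (t * (h * pattern_mid p)) * of_real (pattern_prob jump_law (f_X d\<^sub>0) h m \<eta> p))) \<le> \<bar>t\<bar> * h + 12 * \<epsilon>"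
  by blast
 note approx = K2(2)[rule_format, OF K0(3) m1 \<eta>(1), folded h_def, OF \<eta>(2), of v v' t]
 let ?c = "\<lambda>p :: int set \<times> int \<times> int. iexp (t * (h * pattern_mid p))"
 let ?y = "\<lambda>n. \<Sum>p\<in>grid_patterns m. ?c p * expectation (\<lambda>w. indicator (sample_pattern h m \<eta> n p) w * iexp (outer_sum v v' K n w))"
 let ?\<pi> = "pattern_prob jump_law (f_X d\<^sub>0) h m \<eta>"
 let ?g = "exp (- limit_variance v v' / 2)"
 let ?L = "\<Sum>p\<in>grid_patterns m. ?c p * of_real (?g * ?\<pi> p)"
 have "(\<lambda>n. expectation (\<lambda>w. indicator (sample_pattern h m \<eta> n p) w * iexp (outer_sum v v' K n w))) \<longlonglongrightarrow> of_real (?g * ?\<pi> p)"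
  if "p \<in> grid_patterns m" for p
  using sample_pattern_limit[OF h(1), of _ _ _ m \<eta> v v'] that unfolding h(2) by (cases p) (auto simp: pattern_prob_def)
 then have "?y \<longlonglongrightarrow> ?L" by (intro tendsto_sum tendsto_mult tendsto_const)
 moreover have "\<forall>\<^sub>F n in sequentially. cmod (expectation (\<lambda>w. iexp (v * \<alpha>_err n w + v' * \<beta>_err n w + t * d_err n w)) - ?y n) \<le> r"
  using approx
 proof eventually_elim
  case (elim n)
  moreover have "\<epsilon> + \<bar>t\<bar> * h + 20 * \<epsilon> \<le> r" using th r unfolding \<epsilon>_def by linarith
  ultimately show ?case by (rule order_trans)
 qed
 moreover have "cmod (?L - of_real ?g * char law\<^sub>d t) \<le> r"
 proof -
  let ?S = "\<Sum>p\<in>grid_patterns m. ?c p * of_real (?\<pi> p)"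
  have "?L = of_real ?g * ?S" by (simp add: sum_distrib_left mult.left_commute)
  then have "?L - of_real ?g * char law\<^sub>d t = of_real ?g * (?S - char law\<^sub>d t)" by (simp only: right_diff_distrib)
  then have "cmod (?L - of_real ?g * char law\<^sub>d t) = ?g * cmod (char law\<^sub>d t - ?S)" by (simp only: norm_mult norm_of_real norm_minus_commute) simp
  also have "\<dots> \<le> 1 * cmod (char law\<^sub>d t - ?S)"
  proof (intro mult_right_mono)
   show "?g \<le> 1" using \<sigma>2_nonneg p_pos by (simp add: limit_variance_def)
  qed simp
  also have "\<dots> \<le> r" using lim th r unfolding \<epsilon>_def by linarith
  finally show ?thesis .
 qed
 ultimately show "\<exists>y L'. y \<longlonglongrightarrow> L' \<and>
   (\<forall>\<^sub>F n in sequentially. cmod (expectation (\<lambda>w. iexp (v * \<alpha>_err n w + v' * \<beta>_err n w + t * d_err n w)) - y n) \<le> r) \<and>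
   cmod (L' - of_real ?g * char law\<^sub>d t) \<le> r" by blast
qed

end

section \<open>Marginal and joint convergence in distribution\<close>

theorem theorem2p3:
  fixes M :: "'a measure" and M' :: "'b measure"
    and X \<xi> :: "'a \<Rightarrow> real" and Xs \<xi>s Ys :: "nat \<Rightarrow> 'a \<Rightarrow> real"
    and f_X :: "real \<Rightarrow> real"
    and \<alpha>\<^sub>0 \<beta>\<^sub>0 d\<^sub>0 :: real
    and I :: "(real \<times> real \<times> real) set" and l u :: "real \<times> real \<times> real"
    and \<alpha>_hat \<beta>_hat d_hat :: "nat \<Rightarrow> 'a \<Rightarrow> real"
    and N1 N2 :: "real \<Rightarrow> 'b \<Rightarrow> nat" and Z1 Z2 :: "nat \<Rightarrow> 'b \<Rightarrow> real"
  defines "\<sigma>2 \<equiv> (\<integral>\<omega>. (\<xi> \<omega>)\<^sup>2 \<partial>M)"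
    and "F_X \<equiv> cdf (distr M borel X)"
  defines "law_\<alpha> \<equiv> normal_law 0 (\<sigma>2 / F_X d\<^sub>0)"
    and "law_\<beta> \<equiv> normal_law 0 (\<sigma>2 / (1 - F_X d\<^sub>0))"
    and "law_d \<equiv> distr M' borel (\<lambda>\<omega>. mid_argmin (cpp_path N1 N2 Z1 Z2 \<omega>))"
  assumes model: "change_point_model M X \<xi> Xs \<xi>s Ys f_X \<alpha>\<^sub>0 \<beta>\<^sub>0 d\<^sub>0"
    and compact_interval: "I = cbox l u"
    and true_parameter: "(\<alpha>\<^sub>0, \<beta>\<^sub>0, d\<^sub>0) \<in> interior I"
    and density_cont: "isCont f_X d\<^sub>0"
    and density_pos: "0 < f_X d\<^sub>0"
    and estimators_measurable:
      "\<And>n. \<alpha>_hat n \<in> borel_measurable M"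
      "\<And>n. \<beta>_hat n \<in> borel_measurable M"
      "\<And>n. d_hat n \<in> borel_measurable M"
    and estimators:
      "\<And>n. 1 \<le> n \<Longrightarrow> AE \<omega> in M. (\<alpha>_hat n \<omega>, \<beta>_hat n \<omega>, d_hat n \<omega>)
          \<in> argmin_mid_last (ls_criterion n (\<lambda>i. Xs i \<omega>) (\<lambda>i. Ys i \<omega>)) I"
    and limit_process:
      "two_sided_cpp M' N1 N2 (f_X d\<^sub>0) Z1 Z2 (distr M borel (\<lambda>\<omega>. \<xi> \<omega> + \<bar>\<alpha>\<^sub>0 - \<beta>\<^sub>0\<bar> / 2))"
  shows "weak_conv_m (\<lambda>n. distr M borel (\<lambda>\<omega>. sqrt (real n) * (\<alpha>_hat n \<omega> - \<alpha>\<^sub>0))) law_\<alpha>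
       \<and> weak_conv_m (\<lambda>n. distr M borel (\<lambda>\<omega>. sqrt (real n) * (\<beta>_hat n \<omega> - \<beta>\<^sub>0))) law_\<beta>
       \<and> (unique_minimizing_interval M' N1 N2 Z1 Z2 \<longrightarrow>
            weak_conv_m (\<lambda>n. distr M borel (\<lambda>\<omega>. real n * (d_hat n \<omega> - d\<^sub>0))) law_d
          \<and> weak_conv_borel
              (\<lambda>n. distr M borel (\<lambda>\<omega>. (sqrt (real n) * (\<alpha>_hat n \<omega> - \<alpha>\<^sub>0),
                                        sqrt (real n) * (\<beta>_hat n \<omega> - \<beta>\<^sub>0),
                                        real n * (d_hat n \<omega> - d\<^sub>0))))
              (law_\<alpha> \<Otimes>\<^sub>M (law_\<beta> \<Otimes>\<^sub>M law_d)))"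
proof -
 interpret model: change_point_model M X \<xi> Xs \<xi>s Ys f_X \<alpha>\<^sub>0 \<beta>\<^sub>0 d\<^sub>0 by (rule model)
 interpret ls_estimators M X \<xi> Xs \<xi>s Ys f_X \<alpha>\<^sub>0 \<beta>\<^sub>0 d\<^sub>0 l u \<alpha>_hat \<beta>_hat d_hat
  using density_cont density_pos true_parameter estimators_measurable estimators unfolding compact_interval by unfold_locales auto
 have laws: "law_\<alpha> = normal_law 0 (model.\<sigma>2 / p\<^sub>L)" "law_\<beta> = normal_law 0 (model.\<sigma>2 / p\<^sub>R)"
  unfolding law_\<alpha>_def law_\<beta>_def F_X_def p\<^sub>L_cdf p\<^sub>R_eq \<sigma>2_def model.\<sigma>2_def by simp_all
 note rd = normal_chars(1,2)[OF laws] and ch = normal_chars(3)[OF laws]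
 have m: "\<alpha>_err n \<in> borel_measurable M" "\<beta>_err n \<in> borel_measurable M" "d_err n \<in> borel_measurable M" for n by measurable
 have rdd: "real_distribution (distr M borel (\<alpha>_err n))" "real_distribution (distr M borel (\<beta>_err n))" "real_distribution (distr M borel (d_err n))" for n
  using m[of n] by (auto intro!: model.real_distribution_distr)
 have chd: "char (distr M borel Y) t = model.expectation (\<lambda>w. iexp (t * Y w))" if "Y \<in> borel_measurable M" for Y :: "'a \<Rightarrow> real" and t
  unfolding char_def using that by (subst integral_distr) auto
 have c0: "char law_\<alpha> 0 = 1" "char law_\<beta> 0 = 1"
  using real_distribution.char_zero[OF rd(1)] real_distribution.char_zero[OF rd(2)] by auto
 \<comment> \<open>A frequency 0 in the other coordinate isolates the marginal, and Levy's
   continuity theorem applies on the line.\<close>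
 have "weak_conv_m (\<lambda>n. distr M borel (\<alpha>_err n)) law_\<alpha>"
 proof (rule levy_continuity[OF rdd(1) rd(1)])
  show "(\<lambda>n. char (distr M borel (\<alpha>_err n)) t) \<longlonglongrightarrow> char law_\<alpha> t" for t
   using coefficient_char_limit[of t 0] unfolding chd[OF m(1)] ch[of t 0, symmetric] c0 by simp
 qed
 moreover have "weak_conv_m (\<lambda>n. distr M borel (\<beta>_err n)) law_\<beta>"
 proof (rule levy_continuity[OF rdd(2) rd(2)])
  show "(\<lambda>n. char (distr M borel (\<beta>_err n)) t) \<longlonglongrightarrow> char law_\<beta> t" for t
   using coefficient_char_limit[of 0 t] unfolding chd[OF m(2)] ch[of 0 t, symmetric] c0 by simp
 qed
 moreover have "weak_conv_m (\<lambda>n. distr M borel (d_err n)) law_d \<and>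
   weak_conv_borel (\<lambda>n. distr M borel (\<lambda>w. (\<alpha>_err n w, \<beta>_err n w, d_err n w))) (law_\<alpha> \<Otimes>\<^sub>M (law_\<beta> \<Otimes>\<^sub>M law_d))"
  if uniq: "unique_minimizing_interval M' N1 N2 Z1 Z2"
 proof -
  have cpp: "two_sided_cpp M' N1 N2 (f_X d\<^sub>0) Z1 Z2 jump_law" using limit_process unfolding jump_law_def .
  interpret cpp: two_sided_cpp M' N1 N2 "f_X d\<^sub>0" Z1 Z2 jump_law by (rule cpp)
  have rd3: "real_distribution law_d" unfolding law_d_def by (rule cpp.right.real_distribution_distr) simp
  have joint: "(\<lambda>n. model.expectation (\<lambda>w. iexp (v * \<alpha>_err n w + v' * \<beta>_err n w + t * d_err n w))) \<longlonglongrightarrow> char law_\<alpha> v * char law_\<beta> v' * char law_d t" for v v' t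
   using joint_char_limit[OF cpp uniq, of v v' t] unfolding law_d_def[symmetric] ch .
  have "weak_conv_m (\<lambda>n. distr M borel (d_err n)) law_d"
  proof (rule levy_continuity[OF rdd(3) rd3])
   show "(\<lambda>n. char (distr M borel (d_err n)) t) \<longlonglongrightarrow> char law_d t" for t
    using joint[of 0 0 t] unfolding chd[OF m(3)] c0 by simp
  qed
  moreover have "weak_conv_borel (\<lambda>n. distr M borel (\<lambda>w. (\<alpha>_err n w, \<beta>_err n w, d_err n w))) (law_\<alpha> \<Otimes>\<^sub>M (law_\<beta> \<Otimes>\<^sub>M law_d))"
   by (rule model.weak_conv_borel_product3[OF m rd rd3 joint])
  ultimately show ?thesis by blast
 qed
 ultimately show ?thesis by blast
qed

end
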